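(* Let $d\ge 3$, $\epsilon>0$, $T>0$, $\bar\theta\in C^\infty([0,T]\times\mathbb T^d)$ with $\fint_{\mathbb T^d}\bar\theta(t,x)dx=0$ for all $t$, and $\bar u\in C^\infty([0,T]\times\mathbb T^d)$ with $\nabla\cdot\bar u=0$. Set $E=\{t\in[0,T]:\partial_t\bar\theta+\mathrm{div}(\bar u\bar\theta)+\frac12\bar\theta-\Delta\bar\theta=0 \text{ at time } t\}$. Let $p\in(1,\infty)$, $\tilde p\in(1,\infty)$ with $\frac1p+\frac1{\tilde p}>1+\frac1d$ and $p'<d$. Then there exist deterministic $\theta:[0,T]\times\mathbb T^d\to\mathbb R$ and $u:[0,T]\times\mathbb T^d\to\mathbb R^d$ such that (1) $\theta\in C([0,T];L^p(\mathbb T^d))$ and $u\in C([0,T];L^{p'}(\mathbb T^d))\cap C([0,T];W^{1,\tilde p}(\mathbb T^d))$; (2) $(\theta,u)$ satisfies $\partial_t\theta+\mathrm{div}(u\theta)+\frac12\theta=\Delta\theta$, $\nabla\cdot u=0$, in the analytically weak sense; (3) $(\theta,u)(t,x)=(\bar\theta,\bar u)(t,x)$ for all $(t,x)\in E\times\mathbb T^d$; (4) one may in addition ensure $\|(\theta-\bar\theta)(t)\|_{L^p}<\epsilon$ for all $t\in[0,T]$, or alternatively $\|(u-\bar u)(t)\|_{L^{p'}}<\epsilon$ for all $t\in[0,T]$.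
   Context: $\mathbb T^d=\mathbb R^d/\mathbb Z^d$; $p'$ is the Hölder dual of $p$. *)

theory Defs
  imports "HOL-Analysis.Analysis"
begin

fun Ck :: "nat \<Rightarrow> ('a::euclidean_space \<Rightarrow> 'b::euclidean_space) \<Rightarrow> bool" where
  "Ck 0 f = continuous_on UNIV f"
| "Ck (Suc n) f = (f differentiable_on UNIV \<and>
      (\<forall>v\<in>Basis. Ck n (\<lambda>x. frechet_derivative f (at x) v)))"

definition smooth :: "('a::euclidean_space \<Rightarrow> 'b::euclidean_space) \<Rightarrow> bool" where
  "smooth f \<longleftrightarrow> (\<forall>n. Ck n f)"

section \<open>The torus T^d = R^d / Z^d: Z^d-periodic functions on real^'d\<close>

definition periodic :: "(real^'d \<Rightarrow> 'b) \<Rightarrow> bool" where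
  "periodic f \<longleftrightarrow> (\<forall>x i. f (x + axis i 1) = f x)"

text \<open>Fundamental cell [0,1]^d (of volume 1, so integral = average).\<close>
definition cell :: "(real^'d) set" where
  "cell = cbox 0 One"

definition tint :: "(real^'d \<Rightarrow> 'b::{banach,second_countable_topology}) \<Rightarrow> 'b" where
  "tint f = integral\<^sup>L (lebesgue_on cell) f"

definition pd :: "(real^'d \<Rightarrow> 'b::real_normed_vector) \<Rightarrow> 'd \<Rightarrow> real^'d \<Rightarrow> 'b" where
  "pd f i x = frechet_derivative f (at x) (axis i 1)"

definition grad :: "(real^'d \<Rightarrow> real) \<Rightarrow> real^'d \<Rightarrow> real^'d" where
  "grad f x = (\<chi> i. pd f i x)"

definition divg :: "(real^'d \<Rightarrow> real^'d) \<Rightarrow> real^'d \<Rightarrow> real" where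
  "divg F x = (\<Sum>i\<in>UNIV. pd F i x $ i)"

definition lap :: "(real^'d \<Rightarrow> real) \<Rightarrow> real^'d \<Rightarrow> real" where
  "lap f x = (\<Sum>i\<in>UNIV. pd (pd f i) i x)"

definition hconj :: "real \<Rightarrow> real" where
  "hconj p = p / (p - 1)"

definition Lp_mem :: "real \<Rightarrow> (real^'d \<Rightarrow> 'b::euclidean_space) \<Rightarrow> bool" where
  "Lp_mem p f \<longleftrightarrow> f \<in> borel_measurable (lebesgue_on cell) \<and>
     integrable (lebesgue_on cell) (\<lambda>x. norm (f x) powr p)"

definition Lp_norm :: "real \<Rightarrow> (real^'d \<Rightarrow> 'b::euclidean_space) \<Rightarrow> real" where
  "Lp_norm p f = (tint (\<lambda>x. norm (f x) powr p)) powr (1 / p)"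

definition test_fun :: "(real^'d \<Rightarrow> real) \<Rightarrow> bool" where
  "test_fun \<phi> \<longleftrightarrow> smooth \<phi> \<and> periodic \<phi>"

definition weak_pd :: "'d \<Rightarrow> (real^'d \<Rightarrow> real) \<Rightarrow> (real^'d \<Rightarrow> real) \<Rightarrow> bool" where
  "weak_pd i f g \<longleftrightarrow>
     (\<forall>\<phi>. test_fun \<phi> \<longrightarrow> tint (\<lambda>x. f x * pd \<phi> i x) = - tint (\<lambda>x. g x * \<phi> x))"

definition C_Lp :: "real \<Rightarrow> real \<Rightarrow> (real \<Rightarrow> real^'d \<Rightarrow> 'b::euclidean_space) \<Rightarrow> bool" where
  "C_Lp T p f \<longleftrightarrow> (\<forall>t\<in>{0..T}. Lp_mem p (f t)) \<and>
     (\<forall>t\<in>{0..T}. ((\<lambda>s. Lp_norm p (\<lambda>x. f s x - f t x)) \<longlongrightarrow> 0) (at t within {0..T}))"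

definition C_W1p :: "real \<Rightarrow> real \<Rightarrow> (real \<Rightarrow> real^'d \<Rightarrow> real^'d) \<Rightarrow> bool" where
  "C_W1p T p u \<longleftrightarrow> (\<exists>Du :: real \<Rightarrow> real^'d \<Rightarrow> real^'d^'d.
     C_Lp T p u \<and> C_Lp T p Du \<and>
     (\<forall>t\<in>{0..T}. \<forall>i j. weak_pd j (\<lambda>x. u t x $ i) (\<lambda>x. Du t x $ i $ j)))"

text \<open>Analytically weak solution on [0,T] of
  d_t theta + div(u theta) + theta/2 = Laplace theta,  div u = 0.\<close>
definition weak_solution :: "real \<Rightarrow> (real \<Rightarrow> real^'d \<Rightarrow> real) \<Rightarrow> (real \<Rightarrow> real^'d \<Rightarrow> real^'d) \<Rightarrow> bool" where
  "weak_solution T \<theta> u \<longleftrightarrow>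
    (\<forall>\<phi>. test_fun \<phi> \<longrightarrow> (\<forall>t\<in>{0..T}.
       tint (\<lambda>x. \<theta> t x * \<phi> x) - tint (\<lambda>x. \<theta> 0 x * \<phi> x) =
         integral\<^sup>L (lebesgue_on {0..t})
           (\<lambda>s. tint (\<lambda>x. \<theta> s x * (u s x \<bullet> grad \<phi> x) - \<theta> s x * \<phi> x / 2
                          + \<theta> s x * lap \<phi> x))
       \<and> tint (\<lambda>x. u t x \<bullet> grad \<phi> x) = 0))"

definition Eset :: "real \<Rightarrow> (real \<Rightarrow> real^'d \<Rightarrow> real) \<Rightarrow> (real \<Rightarrow> real^'d \<Rightarrow> real^'d) \<Rightarrow> real set" where
  "Eset T \<theta>b ub = {t\<in>{0..T}. \<forall>x.
     deriv (\<lambda>s. \<theta>b s x) t + divg (\<lambda>y. \<theta>b t y *\<^sub>R ub t y) x + \<theta>b t x / 2 - lap (\<theta>b t) x = 0}"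

definition good_pair :: "real \<Rightarrow> real \<Rightarrow> real \<Rightarrow> (real \<Rightarrow> real^'d \<Rightarrow> real) \<Rightarrow> (real \<Rightarrow> real^'d \<Rightarrow> real^'d)
    \<Rightarrow> (real \<Rightarrow> real^'d \<Rightarrow> real) \<Rightarrow> (real \<Rightarrow> real^'d \<Rightarrow> real^'d) \<Rightarrow> bool" where
  "good_pair T p pt \<theta>b ub \<theta> u \<longleftrightarrow>
     (\<forall>t\<in>{0..T}. periodic (\<theta> t) \<and> periodic (u t)) \<and>
     C_Lp T p \<theta> \<and> C_Lp T (hconj p) u \<and> C_W1p T pt u \<and>
     weak_solution T \<theta> u \<and>
     (\<forall>t\<in>Eset T \<theta>b ub. \<forall>x. \<theta> t x = \<theta>b t x \<and> u t x = ub t x)"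

end

theory Submission
  imports Defs
begin

text \<open>Convex integration: starting from the given pair, the error in the equation is written as the divergence
  of a smooth defect field, which is then removed in the limit by infinitely many small perturbations.

  A perturbation cancels one coordinate \<open>R\<^sub>j\<close> of the defect at a time. Fix another coordinate \<open>k\<close> and let
  \<open>\<phi>\<close> be a periodised Gaussian of width about \<open>1 / \<mu>\<close>, repeated with period \<open>1 / \<lambda>\<close>, travelling with
  velocity \<open>\<omega>\<close> in direction \<open>j\<close> and modulated by an oscillation of frequency \<open>N\<close> in direction \<open>k\<close>.
  The density is perturbed by a \<open>k\<close>-derivative, and the velocity by a curl in the \<open>(j, k)\<close>-plane, of slow
  amplitudes times this blob. The product of the two perturbations is, to leading order, \<open>-R\<^sub>j\<close> times a
  nonnegative periodic density \<open>H\<close> of mean one. The remaining oscillation \<open>R\<^sub>j (H - 1)\<close> contributes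
  the \<open>j\<close>-derivative of a travelling profile, which is up to small errors \<open>1 / \<omega>\<close> times a time derivative, and
  it is absorbed by a corrector of the density. All other contributions are small
  in \<open>L\<^sup>1\<close>, and the velocity perturbation is small in \<open>W\<^bsup>1,pt\<^esup>\<close>, when \<open>\<mu>\<close>, \<open>\<omega>\<close> are suitable powers
  of a large \<open>N\<close>; the admissible exponents exist exactly because of the two hypotheses on \<open>p\<close>, \<open>pt\<close> and \<open>d\<close>.

  The amplitudes are of size \<open>\<eta> |R\<^sub>j|\<^bsup>1/p\<^esup>\<close> for the density and \<open>\<eta>\<^bsup>-1\<^esup> |R\<^sub>j|\<^bsup>1/p'\<^esup>\<close> for the
  velocity, so a small or a large \<open>\<eta>\<close> gives the first or the second closeness
  statement. They vanish at the times at which the defect vanishes, so nothing changes on the set \<open>E\<close>.\<close>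

subsection \<open>Smooth scalar functions\<close>

text \<open>Concentration and oscillation compete. With \<open>\<mu>\<close> = N^s in d dimensions,
  the normalisation gives the density and the velocity amplitudes mu^(d/p) and mu^(d/p'), while an
  integral of the blob gains mu^(-d). Smallness of the diffusion of the density requires s d/p' > 1,
  and one derivative of the velocity in L^pt requires s d/p' + 1 < s d/pt; p' < d and the inequality
  between p and pt say exactly that both hold for s close to 1. Keeping s < 1 leaves the gap mu/N by
  which a derivative of the Gaussian is weaker than one of the oscillation. The speed must exceed
  N^(s d/p') for the corrector to be small in L^p, and stay below N^(s d/p' + 1 - s) for the time
  derivative of the density to be small in L^1, so s < 1 also opens this window. Treating the
  coordinates of the defect one after another avoids interactions between different blobs. The
  frequency lambda is fixed before N: it only separates fast from slow functions. The divergence is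
  inverted by averages along coordinate segments, which act boundedly on L^1, the space in which the
  defect is measured.\<close>

definition ddir :: "'a::euclidean_space \<Rightarrow> ('a \<Rightarrow> real) \<Rightarrow> 'a \<Rightarrow> real" where
  "ddir v f z = frechet_derivative f (at z) v"

lemma ddir_eqI: "(f has_derivative f') (at z) \<Longrightarrow> ddir v f z = f' v"
  unfolding ddir_def by (metis frechet_derivative_at)

lemma Ck_SucI:
  fixes f :: "'a::euclidean_space \<Rightarrow> real"
  assumes "\<And>z. (f has_derivative f' z) (at z)" "\<And>b. b \<in> Basis \<Longrightarrow> Ck n (\<lambda>z. f' z b)"
  shows "Ck (Suc n) f"
proof -
  have "frechet_derivative f (at z) = f' z" for z
    using assms(1) by (metis frechet_derivative_at)
  then show ?thesis using assms
    by (auto simp: differentiable_on_def intro!: differentiableI)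
qed

lemma Ck_Suc_has_derivative:
  fixes f :: "'a::euclidean_space \<Rightarrow> real"
  assumes "Ck (Suc n) f"
  shows "(f has_derivative (\<lambda>v. ddir v f z)) (at z)"
  using assms frechet_derivative_works[of f "at z"]
  by (auto simp: differentiable_on_def ddir_def[abs_def])

lemma Ck_Suc_ddir: "Ck (Suc n) f \<Longrightarrow> b \<in> Basis \<Longrightarrow> Ck n (ddir b f)"
  by (auto simp: ddir_def[abs_def])

lemma Ck_Suc_imp_Ck:
  fixes f :: "'a::euclidean_space \<Rightarrow> real"
  shows "Ck (Suc n) f \<Longrightarrow> Ck n f"
proof (induction n arbitrary: f)
  case 0
  then show ?case by (simp add: differentiable_imp_continuous_on)
next
  case (Suc n)
  then show ?case by (metis Ck.simps(2))
qed

lemma smooth_has_derivative: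
  fixes f :: "'a::euclidean_space \<Rightarrow> real"
  shows "smooth f \<Longrightarrow> (f has_derivative (\<lambda>v. ddir v f z)) (at z)"
  using Ck_Suc_has_derivative[of 0 f z] unfolding smooth_def by blast

text \<open>\<open>Ck\<close> speaks of basis directions only, which is why iterated derivatives are
  taken along them; multiples of a direction are reached by linearity, as in
  \<open>ddir_scaleR\<close>.\<close>

lemma smooth_ddir: "smooth f \<Longrightarrow> b \<in> Basis \<Longrightarrow> smooth (ddir b f)"
  unfolding smooth_def using Ck_Suc_ddir by blast

lemma smooth_continuous_on: "smooth f \<Longrightarrow> continuous_on S f"
  unfolding smooth_def using continuous_on_subset[of UNIV f S]
  by (metis Ck.simps(1) subset_UNIV)

lemma smooth_cont_compose:
  "smooth f \<Longrightarrow> continuous_on S g \<Longrightarrow> continuous_on S (\<lambda>x. f (g x))"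
  using continuous_on_compose2[OF smooth_continuous_on[of f UNIV]] by blast

lemma Ck_const [simp]: "Ck n (\<lambda>z::'a::euclidean_space. c::real)"
proof (induction n arbitrary: c)
  case (Suc n)
  show ?case by (rule Ck_SucI[where f'="\<lambda>z v. 0"]) (auto simp: Suc)
qed auto

lemma Ck_add:
  fixes f g :: "'a::euclidean_space \<Rightarrow> real"
  shows "Ck n f \<Longrightarrow> Ck n g \<Longrightarrow> Ck n (\<lambda>z. f z + g z)"
proof (induction n arbitrary: f g)
  case 0 then show ?case by (auto intro: continuous_intros)
next
  case (Suc n)
  show ?case
    by (rule Ck_SucI[where f'="\<lambda>z v. ddir v f z + ddir v g z"])
       (auto intro!: derivative_intros Ck_Suc_has_derivative[OF Suc.prems(1)]
         Ck_Suc_has_derivative[OF Suc.prems(2)] Suc.IH Ck_Suc_ddir[OF Suc.prems(1)] Ck_Suc_ddir[OF Suc.prems(2)])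
qed

lemma Ck_mult:
  fixes f g :: "'a::euclidean_space \<Rightarrow> real"
  shows "Ck n f \<Longrightarrow> Ck n g \<Longrightarrow> Ck n (\<lambda>z. f z * g z)"
proof (induction n arbitrary: f g)
  case 0 then show ?case by (auto intro: continuous_intros)
next
  case (Suc n)
  show ?case
    by (rule Ck_SucI[where f'="\<lambda>z v. f z * ddir v g z + ddir v f z * g z"])
       (auto intro!: has_derivative_mult Ck_Suc_has_derivative[OF Suc.prems(1)]
         Ck_Suc_has_derivative[OF Suc.prems(2)] Ck_add Suc.IH Ck_Suc_ddir[OF Suc.prems(1)]
         Ck_Suc_ddir[OF Suc.prems(2)] Ck_Suc_imp_Ck[OF Suc.prems(1)] Ck_Suc_imp_Ck[OF Suc.prems(2)])
qed

lemma Ck_linear: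
  fixes f :: "'a::euclidean_space \<Rightarrow> real"
  assumes "bounded_linear f" shows "Ck n f"
proof (cases n)
  case 0
  then show ?thesis using linear_continuous_on[OF assms] by simp
next
  case (Suc m)
  then show ?thesis
    by (simp del: Ck.simps, intro Ck_SucI[where f'="\<lambda>z v. f v"] bounded_linear_imp_has_derivative[OF assms]) simp
qed

lemma Ck_exp:
  fixes f :: "'a::euclidean_space \<Rightarrow> real"
  shows "Ck n f \<Longrightarrow> Ck n (\<lambda>z. exp (f z))"
proof (induction n)
  case 0 then show ?case by (auto intro: continuous_intros)
next
  case (Suc n)
  show ?case
    by (rule Ck_SucI[where f'="\<lambda>z v. exp (f z) * ddir v f z"])
       (auto intro!: derivative_eq_intros Ck_Suc_has_derivative[OF Suc.prems] Ck_mult Suc.IH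
          Ck_Suc_ddir[OF Suc.prems] Ck_Suc_imp_Ck[OF Suc.prems])
qed

lemma Ck_sin_cos:
  fixes f :: "'a::euclidean_space \<Rightarrow> real"
  shows "Ck n f \<Longrightarrow> Ck n (\<lambda>z. sin (f z)) \<and> Ck n (\<lambda>z. cos (f z))"
proof (induction n)
  case 0 then show ?case by (auto intro: continuous_intros)
next
  case (Suc n)
  note IH = Suc.IH[OF Ck_Suc_imp_Ck[OF Suc.prems]]
  have "Ck (Suc n) (\<lambda>z. sin (f z))"
    by (rule Ck_SucI[where f'="\<lambda>z v. cos (f z) * ddir v f z"])
       (auto intro!: derivative_eq_intros Ck_Suc_has_derivative[OF Suc.prems] Ck_mult
          Ck_Suc_ddir[OF Suc.prems] simp: IH)
  moreover have "Ck (Suc n) (\<lambda>z. cos (f z))"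
  proof (rule Ck_SucI)
    show "((\<lambda>z. cos (f z)) has_derivative (\<lambda>v. (- 1) * (sin (f z) * ddir v f z))) (at z)" for z
      by (auto intro!: derivative_eq_intros Ck_Suc_has_derivative[OF Suc.prems])
    show "Ck n (\<lambda>z. (- 1) * (sin (f z) * ddir b f z))" if "b \<in> Basis" for b
      using that IH by (intro Ck_mult Ck_const Ck_Suc_ddir[OF Suc.prems]) auto
  qed
  ultimately show ?case by blast
qed

text \<open>The exponent is generalised in the induction, since differentiation replaces
  \<open>r\<close> by \<open>r - 1\<close>; positivity keeps \<open>powr\<close> away from its
  singularity at 0.\<close>

lemma Ck_powr:
  fixes f :: "'a::euclidean_space \<Rightarrow> real"
  assumes "\<And>z. f z > 0"
  shows "Ck n f \<Longrightarrow> Ck n (\<lambda>z. f z powr r)"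
proof (induction n arbitrary: r)
  case 0
  have "f z \<noteq> 0" for z using assms[of z] by simp
  then show ?case using 0 by (auto intro!: continuous_on_powr)
next
  case (Suc n)
  have "((\<lambda>z. f z powr r) has_derivative (\<lambda>v. r * f z powr (r - 1) * ddir v f z)) (at z)" for z
    using has_derivative_compose[OF Ck_Suc_has_derivative[OF Suc.prems(1), of z],
        of "\<lambda>y. y powr r" "\<lambda>y. (r * f z powr (r - 1)) * y"] has_real_derivative_powr[OF assms[of z], of r]
    by (simp add: has_field_derivative_def)
  then show ?case
    by (rule Ck_SucI) (auto intro!: Ck_mult Suc.IH Ck_Suc_ddir[OF Suc.prems] Ck_Suc_imp_Ck[OF Suc.prems])
qed

lemma smooth_const [simp]: "smooth (\<lambda>z::'a::euclidean_space. c::real)"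
  by (simp add: smooth_def)

context
  fixes f g :: "'a::euclidean_space \<Rightarrow> real"
  assumes f: "smooth f" and g: "smooth g"
begin

lemma smooth_add: "smooth (\<lambda>z. f z + g z)" and smooth_mult: "smooth (\<lambda>z. f z * g z)"
  using f g by (auto simp: smooth_def Ck_add Ck_mult)

lemma ddir_add: "ddir v (\<lambda>z. f z + g z) z = ddir v f z + ddir v g z"
  by (rule ddir_eqI) (auto intro!: derivative_intros smooth_has_derivative f g)

lemma ddir_diff: "ddir v (\<lambda>z. f z - g z) z = ddir v f z - ddir v g z"
  by (rule ddir_eqI) (auto intro!: derivative_intros smooth_has_derivative f g)

lemma ddir_mult: "ddir v (\<lambda>z. f z * g z) z = ddir v f z * g z + f z * ddir v g z"
  using ddir_eqI[OF has_derivative_mult[OF smooth_has_derivative[OF f] smooth_has_derivative[OF g]]]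
  by (simp add: add.commute)

end

context
  fixes f :: "'a::euclidean_space \<Rightarrow> real"
  assumes f: "smooth f"
begin

lemma smooth_cmult: "smooth (\<lambda>z. c * f z)" by (rule smooth_mult[OF smooth_const f])

lemma smooth_minus: "smooth (\<lambda>z. - f z)" using smooth_cmult[of "-1"] by simp

lemma smooth_divide: "smooth (\<lambda>z. f z / c)" using smooth_cmult[of "inverse c"] by (simp add: divide_inverse mult.commute)

lemma smooth_power: "smooth (\<lambda>z. f z ^ n)"
  by (induction n) (auto intro: smooth_mult f)

lemma smooth_exp: "smooth (\<lambda>z. exp (f z))"
  and smooth_sin: "smooth (\<lambda>z. sin (f z))"
  and smooth_cos: "smooth (\<lambda>z. cos (f z))"
  using f by (auto simp: smooth_def Ck_exp Ck_sin_cos)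

lemma smooth_powr: "(\<And>z. f z > 0) \<Longrightarrow> smooth (\<lambda>z. f z powr r)"
  using f by (auto simp: smooth_def Ck_powr)

lemma ddir_cmult: "ddir v (\<lambda>z. c * f z) z = c * ddir v f z"
  by (rule ddir_eqI) (auto intro!: derivative_eq_intros smooth_has_derivative f)

lemma ddir_minus: "ddir v (\<lambda>z. - f z) z = - ddir v f z"
  by (rule ddir_eqI) (auto intro!: derivative_eq_intros smooth_has_derivative f)

lemma ddir_divide: "ddir v (\<lambda>z. f z / c) z = ddir v f z / c"
  using ddir_cmult[of v "inverse c" z] by (simp add: divide_inverse mult.commute)

lemma ddir_exp: "ddir v (\<lambda>z. exp (f z)) z = exp (f z) * ddir v f z"
  by (rule ddir_eqI) (auto intro!: derivative_eq_intros smooth_has_derivative f)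

lemma ddir_sin: "ddir v (\<lambda>z. sin (f z)) z = cos (f z) * ddir v f z"
  by (rule ddir_eqI) (auto intro!: derivative_eq_intros smooth_has_derivative f)

lemma ddir_cos: "ddir v (\<lambda>z. cos (f z)) z = - (sin (f z) * ddir v f z)"
  by (rule ddir_eqI) (auto intro!: derivative_eq_intros smooth_has_derivative f)

lemma ddir_scaleR: "ddir (c *\<^sub>R v) f z = c * ddir v f z"
  using linear_scale[OF has_derivative_linear[OF smooth_has_derivative[OF f, of z]]] by simp

end

lemma ddir_const [simp]: "ddir v (\<lambda>z. c) z = 0"
  by (rule ddir_eqI) auto

lemma smooth_diff:
  fixes f g :: "'a::euclidean_space \<Rightarrow> real"
  shows "smooth f \<Longrightarrow> smooth g \<Longrightarrow> smooth (\<lambda>z. f z - g z)"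
  using smooth_add[of f "\<lambda>z. - g z"] smooth_minus[of g] by simp

lemma smooth_linear:
  fixes f :: "'a::euclidean_space \<Rightarrow> real"
  shows "bounded_linear f \<Longrightarrow> smooth f"
  by (simp add: smooth_def Ck_linear)

lemma ddir_linear: "bounded_linear f \<Longrightarrow> ddir v f z = f v"
  by (rule ddir_eqI) (rule bounded_linear_imp_has_derivative)

lemma smooth_sum:
  fixes f :: "'i \<Rightarrow> 'a::euclidean_space \<Rightarrow> real"
  assumes "\<And>i. i \<in> S \<Longrightarrow> smooth (f i)"
  shows "smooth (\<lambda>z. \<Sum>i\<in>S. f i z)"
proof (cases "finite S")
  case True then show ?thesis using assms by (induction S) (auto intro: smooth_add)
qed auto

lemma ddir_sum:
  fixes f :: "'i \<Rightarrow> 'a::euclidean_space \<Rightarrow> real"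
  assumes "\<And>i. i \<in> S \<Longrightarrow> smooth (f i)"
  shows "ddir v (\<lambda>z. \<Sum>i\<in>S. f i z) z = (\<Sum>i\<in>S. ddir v (f i) z)"
  by (rule ddir_eqI) (auto intro!: derivative_intros smooth_has_derivative assms)

lemmas smooth_intros = smooth_const smooth_add smooth_diff smooth_minus smooth_mult smooth_sum
  smooth_divide smooth_power smooth_exp smooth_sin smooth_cos

subsection \<open>Averages along a segment\<close>

text \<open>Two weights will occur: \<open>k s = 1\<close> gives the mean over the segment, and
  \<open>k s = s\<close> a first moment that serves as a primitive in direction \<open>v\<close>.
  The parameter runs over [0,1], so the length of the segment sits in \<open>v\<close>.\<close>

definition seg_avg :: "(real \<Rightarrow> real) \<Rightarrow> 'a::euclidean_space \<Rightarrow> ('a \<Rightarrow> real) \<Rightarrow> 'a \<Rightarrow> real" where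
  "seg_avg k v f z = integral {0..1} (\<lambda>s. k s * f (z + s *\<^sub>R v))"

context
  fixes f :: "'a::euclidean_space \<Rightarrow> real" and k :: "real \<Rightarrow> real"
  assumes f: "smooth f" and k: "continuous_on UNIV k"
begin

lemma k_cont: "continuous_on S g \<Longrightarrow> continuous_on S (\<lambda>x. k (g x))"
  using continuous_on_compose2[OF k] by blast

lemmas f_cont = smooth_cont_compose[OF f] and df_cont = smooth_cont_compose[OF smooth_ddir[OF f]]

lemma seg_avg_has_derivative:
  "(seg_avg k v f has_derivative (\<lambda>w. seg_avg k v (ddir w f) z)) (at z)"
proof -
  \<comment> \<open>\<open>leibniz_rule\<close> asks for the derivative as a continuous family of
    bounded linear maps; expanding it over the basis reduces this continuity to that of the partial
    derivatives.\<close>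
  define fx where "fx z s = (\<Sum>b\<in>Basis. (k s * ddir b f (z + s *\<^sub>R v)) *\<^sub>R blinfun_inner_left b)" for z s
  have ddirB: "ddir w f y = (\<Sum>b\<in>Basis. (w \<bullet> b) * ddir b f y)" for w y
  proof -
    note L = has_derivative_linear[OF smooth_has_derivative[OF f, of y]]
    have "ddir w f y = ddir (\<Sum>b\<in>Basis. (w \<bullet> b) *\<^sub>R b) f y" by (simp add: euclidean_representation)
    also have "\<dots> = (\<Sum>b\<in>Basis. (w \<bullet> b) * ddir b f y)"
      using linear_sum[OF L, of "\<lambda>b. (w \<bullet> b) *\<^sub>R b" Basis] linear_scale[OF L] by simp
    finally show ?thesis .
  qed
  have app: "blinfun_apply (fx z s) w = k s * ddir w f (z + s *\<^sub>R v)" for z s w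
    unfolding fx_def by (subst ddirB) (simp add: blinfun.sum_left blinfun.scaleR_left sum_distrib_left inner_commute algebra_simps)
  have "((\<lambda>z. integral (cbox 0 1) (\<lambda>s. k s * f (z + s *\<^sub>R v))) has_derivative
      blinfun_apply (integral (cbox 0 1) (fx z))) (at z within UNIV)"
  proof (rule leibniz_rule)
    fix y :: 'a and t :: real
    have *: "((\<lambda>x. f (x + t *\<^sub>R v)) has_derivative (\<lambda>w. ddir w f (y + t *\<^sub>R v))) (at y)"
      by (rule has_derivative_compose[of "\<lambda>x. x + t *\<^sub>R v" "\<lambda>x. x" y UNIV f, simplified])
         (auto intro!: derivative_eq_intros smooth_has_derivative f)
    show "((\<lambda>x. k t * f (x + t *\<^sub>R v)) has_derivative blinfun_apply (fx y t)) (at y within UNIV)"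
      unfolding app by (rule has_derivative_mult_right[OF *, THEN has_derivative_eq_rhs]) auto
  next
    show "continuous_on (UNIV \<times> cbox 0 1) (\<lambda>(x, t). fx x t)"
      unfolding fx_def split_beta
      by (intro continuous_intros k_cont df_cont) auto
  qed (auto intro!: integrable_continuous_interval continuous_intros k_cont f_cont)
  moreover have "blinfun_apply (integral (cbox 0 1) (fx z)) w = seg_avg k v (ddir w f) z" for w
  proof -
    have "fx z integrable_on {0..1}" unfolding fx_def
      by (intro integrable_continuous_interval continuous_intros k_cont df_cont) auto
    then show ?thesis unfolding seg_avg_def
      by (subst blinfun_apply_integral) (auto simp: app)
  qed
  then have "blinfun_apply (integral (cbox 0 1) (fx z)) = (\<lambda>w. seg_avg k v (ddir w f) z)" by blast
  ultimately show ?thesis unfolding seg_avg_def[of k v f, abs_def] by simp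
qed

lemma ddir_seg_avg: "ddir w (seg_avg k v f) z = seg_avg k v (ddir w f) z"
  by (rule ddir_eqI) (rule seg_avg_has_derivative)

end

text \<open>Differentiation passes under the integral and lands on \<open>f\<close>, so each order
  of smoothness follows from the previous one applied to the derivatives of
  \<open>f\<close>.\<close>

lemma smooth_seg_avg:
  fixes f :: "'a::euclidean_space \<Rightarrow> real"
  assumes "smooth f" and k: "continuous_on UNIV k"
  shows "smooth (seg_avg k v f)"
proof -
  have "smooth f \<Longrightarrow> Ck n (seg_avg k v f)" for n f
  proof (induction n arbitrary: f)
    case 0
    then show ?case
      using seg_avg_has_derivative[OF 0 k] by (auto intro!: has_derivative_continuous_on[of UNIV] simp: has_derivative_at_withinI)
  next
    case (Suc n)
    show ?case
      by (rule Ck_SucI[OF seg_avg_has_derivative[OF Suc.prems k]]) (auto intro: Suc smooth_ddir)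
  qed
  then show ?thesis using assms by (auto simp: smooth_def)
qed

lemma seg_has_field_derivative:
  fixes f :: "'a::euclidean_space \<Rightarrow> real"
  assumes "smooth f"
  shows "((\<lambda>s. f (z + s *\<^sub>R v)) has_real_derivative ddir v f (z + s *\<^sub>R v)) (at s within S)"
proof -
  have "((\<lambda>s. f (z + s *\<^sub>R v)) has_derivative (\<lambda>r. ddir (r *\<^sub>R v) f (z + s *\<^sub>R v))) (at s within S)"
    by (rule has_derivative_compose[OF _ smooth_has_derivative[OF assms]])
       (auto intro!: derivative_eq_intros)
  then show ?thesis using assms by (simp add: ddir_scaleR has_field_derivative_def mult_commute_abs)
qed

lemma seg_avg_one_ddir:
  fixes f :: "'a::euclidean_space \<Rightarrow> real"
  assumes "smooth f"
  shows "seg_avg (\<lambda>s. 1) v (ddir v f) z = f (z + v) - f z"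
  unfolding seg_avg_def using fundamental_theorem_of_calculus[of 0 1 "\<lambda>s. f (z + s *\<^sub>R v)" "\<lambda>s. ddir v f (z + s *\<^sub>R v)"]
    seg_has_field_derivative[OF assms]
  by (auto simp: has_real_derivative_iff_has_vector_derivative[symmetric] dest: integral_unique)

text \<open>Integration by parts of \<open>s\<close> against d/ds f(z + s v). If \<open>f\<close> is
  periodic along \<open>v\<close>, the right-hand side is \<open>f\<close> minus its mean over a
  period, so the first moment inverts the derivative up to that mean.\<close>

lemma seg_avg_id_ddir:
  fixes f :: "'a::euclidean_space \<Rightarrow> real"
  assumes "smooth f"
  shows "seg_avg (\<lambda>s. s) v (ddir v f) z = f (z + v) - seg_avg (\<lambda>s. 1) v f z"
proof -
  have 1: "((\<lambda>s. s * ddir v f (z + s *\<^sub>R v) + f (z + s *\<^sub>R v)) has_integral (1 * f (z + 1 *\<^sub>R v) - 0 * f (z + 0 *\<^sub>R v))) {0..1}"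
  proof (rule fundamental_theorem_of_calculus)
    fix s :: real
    show "((\<lambda>s. s * f (z + s *\<^sub>R v)) has_vector_derivative s * ddir v f (z + s *\<^sub>R v) + f (z + s *\<^sub>R v)) (at s within {0..1})"
      using DERIV_mult[OF DERIV_ident seg_has_field_derivative[OF assms, of z v s "{0..1}"]]
      by (simp add: has_real_derivative_iff_has_vector_derivative[symmetric] mult.commute add.commute)
  qed simp
  have 2: "((\<lambda>s. f (z + s *\<^sub>R v)) has_integral seg_avg (\<lambda>s. 1) v f z) {0..1}"
    unfolding seg_avg_def by (auto intro!: integrable_integral integrable_continuous_interval continuous_intros smooth_cont_compose[OF assms])
  show ?thesis using integral_unique[OF has_integral_diff[OF 1 2]] by (simp add: seg_avg_def)
qed

text \<open>A difference of \<open>f\<close> in direction \<open>w\<close>, differentiated along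
  \<open>v\<close>, is computed in two ways. This shows that the commutator \<open>G\<close> has
  mean zero over every nondegenerate segment along \<open>w\<close>. The mean \<open>F h\<close> is
  continuous in the length \<open>h\<close>, and \<open>F 0\<close> is the commutator at
  \<open>z\<close> itself.\<close>

lemma ddir_commute:
  fixes f :: "'a::euclidean_space \<Rightarrow> real"
  assumes f: "smooth f" and v: "v \<in> Basis" and w: "w \<in> Basis"
  shows "ddir v (ddir w f) z = ddir w (ddir v f) z"
proof -
  define G where "G z = ddir v (ddir w f) z - ddir w (ddir v f) z" for z
  have sG: "smooth G" unfolding G_def[abs_def] by (intro smooth_diff smooth_ddir f v w)
  define F where "F h = integral (cbox 0 1) (\<lambda>s. G (z + (s * h) *\<^sub>R w))" for h
  have cF: "continuous_on UNIV F" unfolding F_def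
    by (rule integral_continuous_on_param) (auto simp: split_beta intro!: continuous_intros smooth_cont_compose[OF sG])
  have F0: "F h = 0" if "h \<noteq> 0" for h
  proof -
    have "(\<lambda>y. f (y + h *\<^sub>R w) - f y) = (\<lambda>y. h * seg_avg (\<lambda>s. 1) (h *\<^sub>R w) (ddir w f) y)"
      using seg_avg_one_ddir[OF f, of "h *\<^sub>R w"] by (auto simp: fun_eq_iff ddir_scaleR[OF f] seg_avg_def)
    then have "ddir v (\<lambda>y. f (y + h *\<^sub>R w) - f y) z = ddir v (\<lambda>y. h * seg_avg (\<lambda>s. 1) (h *\<^sub>R w) (ddir w f) y) z"
      by simp
    also have "\<dots> = h * seg_avg (\<lambda>s. 1) (h *\<^sub>R w) (ddir v (ddir w f)) z"
      by (simp add: ddir_cmult smooth_seg_avg smooth_ddir f w ddir_seg_avg)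
    finally have 1: "ddir v (\<lambda>y. f (y + h *\<^sub>R w) - f y) z = h * seg_avg (\<lambda>s. 1) (h *\<^sub>R w) (ddir v (ddir w f)) z" .
    have d: "((\<lambda>y. f (y + h *\<^sub>R w)) has_derivative (\<lambda>u. ddir u f (z + h *\<^sub>R w))) (at z)"
      by (rule has_derivative_compose[of "\<lambda>x. x + h *\<^sub>R w" "\<lambda>x. x" z UNIV f, simplified])
         (auto intro!: derivative_eq_intros smooth_has_derivative f)
    have "ddir v (\<lambda>y. f (y + h *\<^sub>R w) - f y) z = ddir v f (z + h *\<^sub>R w) - ddir v f z"
      by (rule ddir_eqI) (intro derivative_intros d smooth_has_derivative f)
    also have "\<dots> = h * seg_avg (\<lambda>s. 1) (h *\<^sub>R w) (ddir w (ddir v f)) z"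
      using seg_avg_one_ddir[OF smooth_ddir[OF f v], of "h *\<^sub>R w" z]
      by (simp add: ddir_scaleR[OF smooth_ddir[OF f v]] seg_avg_def)
    finally have "seg_avg (\<lambda>s. 1) (h *\<^sub>R w) (ddir w (ddir v f)) z = seg_avg (\<lambda>s. 1) (h *\<^sub>R w) (ddir v (ddir w f)) z"
      using 1 that by simp
    moreover have "F h = seg_avg (\<lambda>s. 1) (h *\<^sub>R w) (ddir v (ddir w f)) z - seg_avg (\<lambda>s. 1) (h *\<^sub>R w) (ddir w (ddir v f)) z"
      unfolding F_def G_def seg_avg_def
      by (simp, subst integral_diff) (auto intro!: integrable_continuous_interval continuous_intros smooth_cont_compose[OF smooth_ddir[OF smooth_ddir]] f v w)
    ultimately show ?thesis by simp
  qed
  have "F \<midarrow>0\<rightarrow> F 0" using cF by (simp add: continuous_on_def)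
  moreover have "F \<midarrow>0\<rightarrow> 0"
    using F0 by (intro tendsto_eventually) (auto simp: eventually_at_filter)
  ultimately have "F 0 = 0" by (rule LIM_unique)
  then show ?thesis by (simp add: F_def G_def)
qed

subsection \<open>Integration over the torus\<close>

lemma One_nth [simp]: "(One :: real^'d) $ i = 1"
  by (simp add: cart_eq_inner_axis)

text \<open>Bridge between two integrals: the theorem is stated with the Lebesgue integral
  \<open>tint\<close>, while the smooth part of the argument runs in the gauge integral.\<close>

lemma tint_eq_integral:
  fixes f :: "real^'d \<Rightarrow> 'b::euclidean_space"
  assumes "continuous_on cell f"
  shows "tint f = integral cell f" "integrable (lebesgue_on cell) f"
proof -
  show 1: "integrable (lebesgue_on cell) f"
    using continuous_imp_integrable[of 0 One f] assms by (simp add: cell_def)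
  show "tint f = integral cell f"
    unfolding tint_def by (rule lebesgue_integral_eq_integral[OF 1]) (simp add: cell_def)
qed

lemma integrable_cell:
  fixes f :: "real^'d \<Rightarrow> 'b::euclidean_space"
  shows "continuous_on UNIV f \<Longrightarrow> f integrable_on cell"
  unfolding cell_def by (rule integrable_continuous) (rule continuous_on_subset, auto)

lemma integral_cell_const [simp]: "integral (cell :: (real^'d) set) (\<lambda>x. c :: real) = c"
  unfolding cell_def by (subst integral_const) (simp add: content_cbox_if box_ne_empty)

text \<open>The shifted cell is cut at coordinate 1 in direction \<open>i\<close>; the overhanging
  slab is moved back by one period and fills the slab that the shift has left free.\<close>

lemma integral_cell_translate:
  fixes f :: "real^'d \<Rightarrow> real"
  assumes per: "periodic f" and cont: "continuous_on UNIV f" and r: "0 \<le> r" "r \<le> 1"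
  shows "integral cell (\<lambda>x. f (x + r *\<^sub>R axis i 1)) = integral cell f"
proof -
  let ?e = "axis i 1 :: real^'d"
  have eB: "?e \<in> Basis" by simp
  have ax: "?e $ l = (if l = i then 1 else 0)" for l by (simp add: axis_def)
  have mem: "x \<in> cbox a b \<longleftrightarrow> (a $ i \<le> x $ i \<and> x $ i \<le> b $ i) \<and> (\<forall>l. l \<noteq> i \<longrightarrow> a $ l \<le> x $ l \<and> x $ l \<le> b $ l)"
    for x a b :: "real^'d" by (metis mem_box_cart)
  have ion: "f integrable_on cbox a b" for a b
    by (rule integrable_continuous) (rule continuous_on_subset[OF cont], simp)
  have "integral cell (\<lambda>x. f (x + r *\<^sub>R ?e)) = integral (cbox (r *\<^sub>R ?e) (One + r *\<^sub>R ?e)) f"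
    using integral_shift_cbox[of "r *\<^sub>R ?e" "r *\<^sub>R ?e" "One + r *\<^sub>R ?e" f] by (simp add: cell_def)
  also have "\<dots> = integral (cbox (r *\<^sub>R ?e) (One + r *\<^sub>R ?e) \<inter> {x. x \<bullet> ?e \<le> 1}) f
      + integral (cbox (r *\<^sub>R ?e) (One + r *\<^sub>R ?e) \<inter> {x. x \<bullet> ?e \<ge> 1}) f"
    by (rule integral_split[OF ion eB])
  also have "cbox (r *\<^sub>R ?e) (One + r *\<^sub>R ?e) \<inter> {x. x \<bullet> ?e \<le> 1} = cell \<inter> {x. x \<bullet> ?e \<ge> r}"
    unfolding cell_def using r by (auto simp: mem ax inner_axis simp del: sum_component)
  also have "cbox (r *\<^sub>R ?e) (One + r *\<^sub>R ?e) \<inter> {x. x \<bullet> ?e \<ge> 1} = cbox ?e (One - (1 - r) *\<^sub>R ?e + ?e)"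
    using r by (auto simp: mem ax inner_axis simp del: sum_component)
  also have "integral (cbox ?e (One - (1 - r) *\<^sub>R ?e + ?e)) f = integral (cbox 0 (One - (1 - r) *\<^sub>R ?e)) (\<lambda>x. f (x + ?e))"
    using integral_shift_cbox[of ?e ?e "One - (1 - r) *\<^sub>R ?e + ?e" f] by simp
  also have "\<dots> = integral (cbox 0 (One - (1 - r) *\<^sub>R ?e)) f"
    using per by (simp add: periodic_def)
  also have "cbox 0 (One - (1 - r) *\<^sub>R ?e) = cell \<inter> {x. x \<bullet> ?e \<le> r}"
    unfolding cell_def using r by (auto simp: mem ax inner_axis simp del: sum_component)
  also have "integral (cell \<inter> {x. r \<le> x \<bullet> ?e}) f + integral (cell \<inter> {x. x \<bullet> ?e \<le> r}) f = integral cell f"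
    unfolding cell_def using integral_split[OF ion eB, of 0 One r] by simp
  finally show ?thesis .
qed

lemma continuous_on_seg_avg:
  fixes f :: "'a::euclidean_space \<Rightarrow> real"
  assumes "continuous_on UNIV f" "continuous_on UNIV k"
  shows "continuous_on UNIV (seg_avg k v f)"
proof -
  have "continuous_on UNIV (\<lambda>z. integral (cbox 0 1) (\<lambda>s. k s * f (z + s *\<^sub>R v)))"
    by (rule integral_continuous_on_param)
       (auto simp: split_beta intro!: continuous_intros continuous_on_compose2[OF assms(1)] continuous_on_compose2[OF assms(2)])
  then show ?thesis by (simp add: seg_avg_def[abs_def])
qed

text \<open>Exchange of the two integrals: for each \<open>s\<close> the shift by
  \<open>s * r\<close> along the axis leaves the integral over the cell unchanged, so only the mass
  of the weight remains.\<close>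

lemma integral_cell_seg_avg:
  fixes f :: "real^'d \<Rightarrow> real"
  assumes per: "periodic f" and cont: "continuous_on UNIV f" and k: "continuous_on UNIV k" and r: "0 \<le> r" "r \<le> 1"
  shows "integral cell (seg_avg k (r *\<^sub>R axis i 1) f) = integral {0..1} k * integral cell f"
proof -
  have "integral cell (seg_avg k (r *\<^sub>R axis i 1) f)
      = integral (cbox 0 One) (\<lambda>x. integral (cbox 0 1) (\<lambda>s. k s * f (x + s *\<^sub>R r *\<^sub>R axis i 1)))"
    by (simp add: cell_def seg_avg_def[abs_def])
  also have "\<dots> = integral (cbox 0 1) (\<lambda>s. integral (cbox 0 One) (\<lambda>x. k s * f (x + s *\<^sub>R r *\<^sub>R axis i 1)))"
    by (rule integral_swap_continuous)
       (auto simp: split_beta intro!: continuous_intros continuous_on_compose2[OF cont] continuous_on_compose2[OF k])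
  also have "\<dots> = integral (cbox 0 1) (\<lambda>s. k s * integral cell f)"
  proof (rule integral_cong)
    fix s :: real assume s: "s \<in> cbox 0 1"
    then have "0 \<le> s * r" "s * r \<le> 1" using r by (auto simp: mult_le_one)
    then show "integral (cbox 0 One) (\<lambda>x. k s * f (x + s *\<^sub>R r *\<^sub>R axis i 1)) = k s * integral cell f"
      using integral_cell_translate[OF per cont, of "s * r" i] by (simp add: cell_def)
  qed
  finally show ?thesis by simp
qed

text \<open>Averaging over a full period keeps the integral over the cell and turns a derivative
  into the increment of \<open>f\<close> over that period, which is zero.\<close>

lemma integral_cell_ddir:
  fixes f :: "real^'d \<Rightarrow> real"
  assumes f: "smooth f" and per: "periodic f" and perd: "periodic (ddir (axis i 1) f)"
  shows "integral cell (ddir (axis i 1) f) = 0"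
proof -
  have "integral cell (ddir (axis i 1) f) = integral cell (seg_avg (\<lambda>s. 1) (1 *\<^sub>R axis i 1) (ddir (axis i 1) f))"
    by (subst integral_cell_seg_avg[OF perd smooth_continuous_on[OF smooth_ddir[OF f]]]) auto
  also have "seg_avg (\<lambda>s. 1) (1 *\<^sub>R axis i 1) (ddir (axis i 1) f) = (\<lambda>x. 0)"
    using seg_avg_one_ddir[OF f, of "axis i 1"] per by (auto simp: periodic_def)
  finally show ?thesis by simp
qed

lemma abs_seg_avg_le:
  assumes f: "continuous_on UNIV f" and k: "continuous_on UNIV k" and k1: "\<And>s. s \<in> {0..1} \<Longrightarrow> \<bar>k s\<bar> \<le> 1"
  shows "\<bar>seg_avg k v f z\<bar> \<le> seg_avg (\<lambda>s. 1) v (\<lambda>z. \<bar>f z\<bar>) z"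
proof -
  have "norm (integral {0..1} (\<lambda>s. k s * f (z + s *\<^sub>R v))) \<le> integral {0..1} (\<lambda>s. \<bar>f (z + s *\<^sub>R v)\<bar>)"
    by (rule integral_norm_bound_integral)
       (auto intro!: integrable_continuous_interval continuous_intros continuous_on_compose2[OF f] continuous_on_compose2[OF k]
         mult_left_le_one_le simp: abs_mult k1)
  then show ?thesis by (simp add: seg_avg_def)
qed

lemma integral_abs_seg_avg_le:
  fixes f :: "real^'d \<Rightarrow> real"
  assumes per: "periodic f" and f: "continuous_on UNIV f" and k: "continuous_on UNIV k"
    and k1: "\<And>s. s \<in> {0..1} \<Longrightarrow> \<bar>k s\<bar> \<le> 1" and r: "0 \<le> r" "r \<le> 1"
  shows "integral cell (\<lambda>x. \<bar>seg_avg k (r *\<^sub>R axis i 1) f x\<bar>) \<le> integral cell (\<lambda>x. \<bar>f x\<bar>)"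
proof -
  have c: "continuous_on UNIV (\<lambda>x. \<bar>f x\<bar>)" by (intro continuous_intros f)
  have "integral cell (\<lambda>x. \<bar>seg_avg k (r *\<^sub>R axis i 1) f x\<bar>) \<le> integral cell (seg_avg (\<lambda>s. 1) (r *\<^sub>R axis i 1) (\<lambda>x. \<bar>f x\<bar>))"
    by (rule integral_le)
       (auto intro!: integrable_cell continuous_intros continuous_on_seg_avg c f k abs_seg_avg_le k1)
  also have "\<dots> = integral cell (\<lambda>x. \<bar>f x\<bar>)"
    using per by (subst integral_cell_seg_avg[OF _ c _ r]) (auto simp: periodic_def)
  finally show ?thesis .
qed

subsection \<open>Space-time functions and the antidivergence\<close>

abbreviation et :: "real \<times> (real^'d)" where "et \<equiv> (1, 0)"
abbreviation ex :: "'d \<Rightarrow> real \<times> (real^'d)" where "ex i \<equiv> (0, axis i 1)"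
abbreviation Dt :: "(real \<times> (real^'d) \<Rightarrow> real) \<Rightarrow> real \<times> (real^'d) \<Rightarrow> real" where "Dt \<equiv> ddir et"
abbreviation Dx :: "'d \<Rightarrow> (real \<times> (real^'d) \<Rightarrow> real) \<Rightarrow> real \<times> (real^'d) \<Rightarrow> real" where "Dx i \<equiv> ddir (ex i)"

lemma et_Basis [simp]: "(et :: real \<times> (real^'d)) \<in> Basis" and ex_Basis [simp]: "ex i \<in> Basis"
  by (auto simp: Basis_prod_def)

lemma slice_has_derivative:
  fixes f :: "real \<times> (real^'d) \<Rightarrow> real"
  assumes "smooth f"
  shows "((\<lambda>x. f (t, x)) has_derivative (\<lambda>h. ddir (0, h) f (t, x))) (at x)"
  by (rule has_derivative_compose[OF _ smooth_has_derivative[OF assms]])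
     (auto intro!: derivative_eq_intros)

lemma ddir_slice:
  fixes f :: "real \<times> (real^'d) \<Rightarrow> real"
  shows "smooth f \<Longrightarrow> ddir h (\<lambda>x. f (t, x)) x = ddir (0, h) f (t, x)"
  by (rule ddir_eqI) (rule slice_has_derivative)

lemma smooth_slice:
  fixes f :: "real \<times> (real^'d) \<Rightarrow> real"
  assumes "smooth f"
  shows "smooth (\<lambda>x. f (t, x))"
proof -
  have "smooth f \<Longrightarrow> Ck n (\<lambda>x. f (t, x))" for n and f :: "real \<times> (real^'d) \<Rightarrow> real"
  proof (induction n arbitrary: f)
    case 0
    then show ?case by (auto intro!: smooth_cont_compose[of f] continuous_intros)
  next
    case (Suc n)
    have "Ck n (\<lambda>x. ddir (0, b) f (t, x))" if "b \<in> Basis" for b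
      using that by (intro Suc.IH smooth_ddir Suc.prems) (auto simp: Basis_prod_def)
    then show ?case by (rule Ck_SucI[OF slice_has_derivative[OF Suc.prems]])
  qed
  then show ?thesis using assms by (auto simp: smooth_def)
qed

text \<open>Periodicity is recorded time by time, because the data are periodic only for times in
  [0,T]. The period \<open>\<rho>\<close> will be 1 or the fine period \<open>1 / lam\<close> of the
  blobs.\<close>

definition per_at :: "real \<Rightarrow> real \<Rightarrow> (real \<times> (real^'d) \<Rightarrow> real) \<Rightarrow> bool" where
  "per_at \<rho> t f \<longleftrightarrow> (\<forall>x i. f (t, x + \<rho> *\<^sub>R axis i 1) = f (t, x))"

lemma per_at_1: "per_at 1 t f \<longleftrightarrow> periodic (\<lambda>x. f (t, x))"
  by (auto simp: per_at_def periodic_def)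

lemma per_at_ddir:
  fixes f :: "real \<times> (real^'d) \<Rightarrow> real"
  assumes f: "smooth f" and p: "per_at \<rho> t f"
  shows "per_at \<rho> t (Dx i f)"
proof -
  have "ddir (axis i 1) (\<lambda>x. f (t, x)) (x + \<rho> *\<^sub>R axis l 1) = ddir (axis i 1) (\<lambda>x. f (t, x)) x" for x l
  proof -
    have "((\<lambda>x. f (t, x + \<rho> *\<^sub>R axis l 1)) has_derivative (\<lambda>h. ddir (0, h) f (t, x + \<rho> *\<^sub>R axis l 1))) (at x)"
      by (rule has_derivative_compose[of "\<lambda>x. x + \<rho> *\<^sub>R axis l 1" "\<lambda>x. x" x UNIV "\<lambda>x. f (t, x)", simplified])
         (auto intro!: derivative_eq_intros slice_has_derivative f)
    then have "((\<lambda>x. f (t, x)) has_derivative (\<lambda>h. ddir (0, h) f (t, x + \<rho> *\<^sub>R axis l 1))) (at x)"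
      using p by (simp add: per_at_def)
    then show ?thesis by (simp add: ddir_eqI ddir_slice f)
  qed
  then show ?thesis by (simp add: per_at_def ddir_slice f)
qed

lemma Dx_zero_slice:
  fixes f :: "real \<times> (real^'d) \<Rightarrow> real"
  assumes f: "smooth f" and z: "\<And>x. f (t, x) = 0"
  shows "Dx i f (t, x) = 0"
proof -
  have "Dx i f (t, x) = ddir (axis i 1) (\<lambda>x. f (t, x)) x" by (simp add: ddir_slice f)
  then show ?thesis by (simp add: z)
qed

lemma seg_avg_slice: "seg_avg k (0, v) f (t, x) = seg_avg k v (\<lambda>x. f (t, x)) x"
  by (simp add: seg_avg_def)

lemma per_at_seg_avg: "per_at \<rho> t f \<Longrightarrow> per_at \<rho> t (seg_avg k (0, v) f)"
proof -
  assume p: "per_at \<rho> t f"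
  have "f (t, x + \<rho> *\<^sub>R axis i 1 + s *\<^sub>R v) = f (t, x + s *\<^sub>R v)" for x i s
  proof -
    have "x + \<rho> *\<^sub>R axis i 1 + s *\<^sub>R v = (x + s *\<^sub>R v) + \<rho> *\<^sub>R axis i 1" by simp
    then show ?thesis using p unfolding per_at_def by metis
  qed
  then show ?thesis by (simp add: per_at_def seg_avg_def)
qed

abbreviation savg :: "real \<Rightarrow> 'd \<Rightarrow> (real \<times> (real^'d) \<Rightarrow> real) \<Rightarrow> real \<times> (real^'d) \<Rightarrow> real" where
  "savg \<rho> i \<equiv> seg_avg (\<lambda>s. 1) (0, \<rho> *\<^sub>R axis i 1)"

primrec avg_list :: "real \<Rightarrow> 'd list \<Rightarrow> (real \<times> (real^'d) \<Rightarrow> real) \<Rightarrow> real \<times> (real^'d) \<Rightarrow> real" where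
  "avg_list \<rho> [] f = f"
| "avg_list \<rho> (i # is) f = avg_list \<rho> is (savg \<rho> i f)"

text \<open>Averaging the coordinates one by one writes \<open>f\<close> minus its full average as a
  telescoping sum. Each summand, a function minus its mean along one axis, is the derivative along
  that axis of \<open>\<rho>\<close> times a first moment, by \<open>seg_avg_id_ddir\<close>; these
  moments are collected as the components of a vector field.\<close>

primrec adiv :: "real \<Rightarrow> 'd list \<Rightarrow> (real \<times> (real^'d) \<Rightarrow> real) \<Rightarrow> 'd \<Rightarrow> real \<times> (real^'d) \<Rightarrow> real" where
  "adiv \<rho> [] f = (\<lambda>l z. 0)"
| "adiv \<rho> (i # is) f = (\<lambda>l z. (if l = i then \<rho> else 0) * seg_avg (\<lambda>s. s) (0, \<rho> *\<^sub>R axis i 1) f z + adiv \<rho> is (savg \<rho> i f) l z)"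

lemma smooth_avg_list: "smooth f \<Longrightarrow> smooth (avg_list \<rho> xs f)"
proof (induction xs arbitrary: f)
  case (Cons i xs)
  show ?case using Cons.IH[of "savg \<rho> i f"] Cons.prems by (simp add: smooth_seg_avg)
qed simp

lemma smooth_adiv: "smooth f \<Longrightarrow> smooth (adiv \<rho> xs f l)"
  by (induction xs arbitrary: f) (auto intro!: smooth_add smooth_mult smooth_const smooth_seg_avg continuous_intros)

lemma per_at_adiv: "per_at m t f \<Longrightarrow> per_at m t (adiv \<rho> xs f l)"
proof (induction xs arbitrary: f)
  case (Cons i xs)
  show ?case using Cons.IH[OF per_at_seg_avg[OF Cons.prems]] per_at_seg_avg[OF Cons.prems, of "\<lambda>s. s"]
    by (simp add: per_at_def)
qed (simp add: per_at_def)

lemma ddir_avg_list: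
  "smooth f \<Longrightarrow> w \<in> Basis \<Longrightarrow> ddir w (avg_list \<rho> xs f) = avg_list \<rho> xs (ddir w f)"
proof (induction xs arbitrary: f)
  case (Cons i xs)
  have "ddir w (savg \<rho> i f) = savg \<rho> i (ddir w f)"
    by (rule ext, rule ddir_seg_avg) (auto simp: Cons.prems)
  then show ?case using Cons by (simp add: smooth_seg_avg)
qed simp

lemma ddir_adiv:
  "smooth f \<Longrightarrow> w \<in> Basis \<Longrightarrow> ddir w (adiv \<rho> xs f l) = adiv \<rho> xs (ddir w f) l"
proof (induction xs arbitrary: f)
  case (Cons i xs)
  have 1: "ddir w (savg \<rho> i f) = savg \<rho> i (ddir w f)"
    by (rule ext, rule ddir_seg_avg) (auto simp: Cons.prems)
  have 2: "ddir w (seg_avg (\<lambda>s. s) (0, \<rho> *\<^sub>R axis i 1) f) z = seg_avg (\<lambda>s. s) (0, \<rho> *\<^sub>R axis i 1) (ddir w f) z" for z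
    by (rule ddir_seg_avg) (auto simp: Cons.prems continuous_intros)
  have s: "smooth (savg \<rho> i f)" by (simp add: smooth_seg_avg Cons.prems)
  have s2: "smooth (seg_avg (\<lambda>s. s) (0, \<rho> *\<^sub>R axis i 1) f)" by (simp add: smooth_seg_avg Cons.prems continuous_on_id)
  show ?case
    by (rule ext) (simp add: ddir_add smooth_cmult s2 smooth_adiv s ddir_cmult 2 Cons.IH[OF s Cons.prems(2)] 1)
qed (simp add: fun_eq_iff)

lemma seg_avg_cmult: "seg_avg k v (\<lambda>z. c * f z) z = c * seg_avg k v f z"
proof -
  have "(\<lambda>s. k s * (c * f (z + s *\<^sub>R v))) = (\<lambda>s. c * (k s * f (z + s *\<^sub>R v)))" by (simp add: fun_eq_iff)
  then show ?thesis by (simp add: seg_avg_def)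
qed

lemma adiv_cmult: "adiv \<rho> xs (\<lambda>z. c * f z) l = (\<lambda>z. c * adiv \<rho> xs f l z)"
  by (induction xs arbitrary: f) (auto simp: fun_eq_iff seg_avg_cmult[abs_def] algebra_simps)

lemma div_adiv:
  fixes f :: "real \<times> (real^'d) \<Rightarrow> real"
  assumes "\<rho> \<noteq> 0"
  shows "smooth f \<Longrightarrow> per_at \<rho> t f \<Longrightarrow> (\<Sum>l\<in>UNIV. Dx l (adiv \<rho> xs f l) (t, x)) = f (t, x) - avg_list \<rho> xs f (t, x)"
proof (induction xs arbitrary: f)
  case (Cons i xs)
  note f = Cons.prems(1)
  let ?v = "(0, \<rho> *\<^sub>R axis i 1) :: real \<times> (real^'d)"
  have s: "smooth (savg \<rho> i f)" by (simp add: smooth_seg_avg f)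
  have s2: "smooth (seg_avg (\<lambda>s. s) ?v f)" by (simp add: smooth_seg_avg f continuous_on_id)
  have v: "?v = \<rho> *\<^sub>R ex i" by simp
  have "\<rho> * Dx i (seg_avg (\<lambda>s. s) ?v f) (t, x) = \<rho> * seg_avg (\<lambda>s. s) ?v (Dx i f) (t, x)"
    by (subst ddir_seg_avg) (auto simp: f continuous_on_id)
  also have "\<dots> = seg_avg (\<lambda>s. s) ?v (ddir ?v f) (t, x)"
    unfolding v using seg_avg_cmult[of "\<lambda>s. s" "\<rho> *\<^sub>R ex i" \<rho> "Dx i f" "(t, x)"] ddir_scaleR[OF f, of \<rho> "ex i"] by presburger
  also have "\<dots> = f ((t, x) + ?v) - savg \<rho> i f (t, x)" by (rule seg_avg_id_ddir[OF f])
  also have "f ((t, x) + ?v) = f (t, x)" using Cons.prems(2) by (simp add: per_at_def)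
  finally have 1: "\<rho> * Dx i (seg_avg (\<lambda>s. s) ?v f) (t, x) = f (t, x) - savg \<rho> i f (t, x)" .
  have "Dx l (adiv \<rho> (i # xs) f l) (t, x) = (if l = i then \<rho> * Dx i (seg_avg (\<lambda>s. s) ?v f) (t, x) else 0) + Dx l (adiv \<rho> xs (savg \<rho> i f) l) (t, x)" for l
    by (simp add: ddir_add smooth_cmult s2 smooth_adiv s ddir_cmult)
  then have "(\<Sum>l\<in>UNIV. Dx l (adiv \<rho> (i # xs) f l) (t, x)) = \<rho> * Dx i (seg_avg (\<lambda>s. s) ?v f) (t, x) + (\<Sum>l\<in>UNIV. Dx l (adiv \<rho> xs (savg \<rho> i f) l) (t, x))"
    by (simp add: sum.distrib)
  also have "\<dots> = f (t, x) - savg \<rho> i f (t, x) + (savg \<rho> i f (t, x) - avg_list \<rho> xs (savg \<rho> i f) (t, x))"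
    using 1 Cons.IH[OF s per_at_seg_avg[OF Cons.prems(2)]] by simp
  finally show ?case by simp
qed simp

lemma slice_cont: "smooth f \<Longrightarrow> continuous_on S (\<lambda>x. f (t, x))"
  by (auto intro!: smooth_cont_compose[of f] continuous_intros)

lemma integral_avg_list:
  fixes f :: "real \<times> (real^'d) \<Rightarrow> real"
  assumes "0 \<le> \<rho>" "\<rho> \<le> 1"
  shows "smooth f \<Longrightarrow> per_at 1 t f \<Longrightarrow> integral cell (\<lambda>x. avg_list \<rho> xs f (t, x)) = integral cell (\<lambda>x. f (t, x))"
proof (induction xs arbitrary: f)
  case (Cons i xs)
  have "integral cell (\<lambda>x. avg_list \<rho> xs (savg \<rho> i f) (t, x)) = integral cell (\<lambda>x. savg \<rho> i f (t, x))"
    by (rule Cons.IH) (auto intro: smooth_seg_avg per_at_seg_avg Cons.prems)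
  also have "\<dots> = integral cell (\<lambda>x. f (t, x))"
    unfolding seg_avg_slice using Cons.prems assms
    by (subst integral_cell_seg_avg) (auto simp: per_at_1 slice_cont)
  finally show ?case by simp
qed simp

lemma avg_list_zero: "(\<And>x. f (t, x) = 0) \<Longrightarrow> avg_list \<rho> xs f (t, x) = 0"
proof (induction xs arbitrary: f x)
  case (Cons i xs)
  have "savg \<rho> i f (t, x) = 0" for x by (simp add: seg_avg_def Cons.prems)
  then show ?case using Cons.IH by simp
qed simp

text \<open>Derivatives commute with averages, so \<open>Dx i\<close> can be carried to the average
  along \<open>i\<close> itself, which annihilates it by periodicity; the averages that follow
  preserve zero.\<close>

lemma avg_list_Dx:
  fixes f :: "real \<times> (real^'d) \<Rightarrow> real"
  assumes l: "\<rho> \<noteq> 0"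
  shows "smooth f \<Longrightarrow> per_at \<rho> t f \<Longrightarrow> i \<in> set xs \<Longrightarrow> avg_list \<rho> xs (Dx i f) (t, x) = 0"
proof (induction xs arbitrary: f)
  case (Cons j xs)
  note f = Cons.prems(1)
  have s: "smooth (savg \<rho> j f)" by (simp add: smooth_seg_avg f)
  have c: "savg \<rho> j (Dx i f) = Dx i (savg \<rho> j f)"
    by (rule ext, subst ddir_seg_avg) (auto simp: f)
  show ?case
  proof (cases "i \<in> set xs")
    case True
    then show ?thesis using Cons.IH[OF s per_at_seg_avg[OF Cons.prems(2)]] c by simp
  next
    case False
    then have ij: "j = i" using Cons.prems by auto
    have "savg \<rho> i (Dx i f) (t, x) = 0" for x
    proof -
      have "\<rho> * savg \<rho> i (Dx i f) (t, x) = savg \<rho> i (ddir (\<rho> *\<^sub>R ex i) f) (t, x)"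
        using seg_avg_cmult[of "\<lambda>s. 1" "(0, \<rho> *\<^sub>R axis i 1)" \<rho> "Dx i f" "(t, x)"] ddir_scaleR[OF f, of \<rho> "ex i"] by presburger
      also have "\<dots> = f ((t, x) + \<rho> *\<^sub>R ex i) - f (t, x)"
        using seg_avg_one_ddir[OF f, of "\<rho> *\<^sub>R ex i"] by simp
      also have "\<dots> = 0" using Cons.prems(2) by (simp add: per_at_def)
      finally show ?thesis using l by simp
    qed
    then show ?thesis using avg_list_zero[of "savg \<rho> i (Dx i f)" t] ij by simp
  qed
qed simp

text \<open>After averaging in every coordinate all spatial derivatives vanish, so the average is
  constant in \<open>x\<close>; its value is read off by integrating over the cell, which the
  averages respect.\<close>

lemma avg_list_eq_integral:
  fixes f :: "real \<times> (real^'d) \<Rightarrow> real"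
  assumes l: "0 < \<rho>" "\<rho> \<le> 1" and f: "smooth f" and p: "per_at \<rho> t f" "per_at 1 t f" and xs: "set xs = UNIV"
  shows "avg_list \<rho> xs f (t, x) = integral cell (\<lambda>x. f (t, x))"
proof -
  let ?F = "avg_list \<rho> xs f"
  have s: "smooth ?F" by (rule smooth_avg_list[OF f])
  have 0: "Dx i ?F (t, x) = 0" for i x
    using avg_list_Dx[OF _ f p(1), of i xs] l xs by (simp add: ddir_avg_list f)
  have "((\<lambda>x. ?F (t, x)) has_derivative (\<lambda>h. 0)) (at x within UNIV)" for x
  proof -
    note L = has_derivative_linear[OF slice_has_derivative[OF s, of t x]]
    have "ddir (0, h) ?F (t, x) = 0" for h
    proof -
      have "ddir (0, h) ?F (t, x) = ddir (0, \<Sum>i\<in>UNIV. h $ i *\<^sub>R axis i 1) ?F (t, x)"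
        using basis_expansion[of h] by (simp add: scalar_mult_eq_scaleR)
      also have "\<dots> = (\<Sum>i\<in>UNIV. h $ i * Dx i ?F (t, x))"
        using linear_sum[OF L, of "\<lambda>i. h $ i *\<^sub>R axis i 1" UNIV] linear_scale[OF L] by simp
      finally show ?thesis by (simp add: 0)
    qed
    then show ?thesis using slice_has_derivative[OF s, of t x] by simp
  qed
  then obtain c where c: "\<And>x. ?F (t, x) = c"
    using has_derivative_zero_constant[of UNIV "\<lambda>x. ?F (t, x)"] by auto
  have "integral cell (\<lambda>x. ?F (t, x)) = integral cell (\<lambda>x. f (t, x))"
    by (rule integral_avg_list) (use l f p in auto)
  then show ?thesis using c by simp
qed

text \<open>Every segment average contracts L^1, also with the weight \<open>s\<close>, so each
  coordinate contributes one factor \<open>\<rho>\<close>. This gain is the reason for averaging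
  over the fine period of a function rather than over the whole cell.\<close>

lemma integral_abs_adiv_le:
  fixes f :: "real \<times> (real^'d) \<Rightarrow> real"
  assumes l: "0 \<le> \<rho>" "\<rho> \<le> 1"
  shows "smooth f \<Longrightarrow> per_at 1 t f \<Longrightarrow>
    integral cell (\<lambda>x. \<bar>adiv \<rho> xs f l (t, x)\<bar>) \<le> real (length xs) * \<rho> * integral cell (\<lambda>x. \<bar>f (t, x)\<bar>)"
proof (induction xs arbitrary: f)
  case (Cons i xs)
  note f = Cons.prems(1)
  let ?v = "(0, \<rho> *\<^sub>R axis i 1) :: real \<times> (real^'d)"
  let ?I = "integral cell :: (real^'d \<Rightarrow> real) \<Rightarrow> real"
  have s: "smooth (savg \<rho> i f)" by (simp add: smooth_seg_avg f)
  have s2: "smooth (seg_avg (\<lambda>s. s) ?v f)" by (simp add: smooth_seg_avg f continuous_on_id)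
  have c1: "continuous_on UNIV (\<lambda>x. seg_avg (\<lambda>s. s) ?v f (t, x))" by (rule slice_cont[OF s2])
  have c2: "continuous_on UNIV (\<lambda>x. adiv \<rho> xs (savg \<rho> i f) m (t, x))" for m by (rule slice_cont[OF smooth_adiv[OF s]])
  have p: "periodic (\<lambda>x. f (t, x))" using Cons.prems by (simp add: per_at_1)
  have "?I (\<lambda>x. \<bar>adiv \<rho> (i # xs) f l (t, x)\<bar>) \<le> ?I (\<lambda>x. \<rho> * \<bar>seg_avg (\<lambda>s. s) ?v f (t, x)\<bar> + \<bar>adiv \<rho> xs (savg \<rho> i f) l (t, x)\<bar>)"
    by (rule integral_le)
       (use l in \<open>auto intro!: integrable_cell continuous_intros c1 c2 abs_triangle_ineq[THEN order_trans] simp: abs_mult\<close>)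
  also have "\<dots> = \<rho> * ?I (\<lambda>x. \<bar>seg_avg (\<lambda>s. s) ?v f (t, x)\<bar>) + ?I (\<lambda>x. \<bar>adiv \<rho> xs (savg \<rho> i f) l (t, x)\<bar>)"
    by (subst integral_add) (auto intro!: integrable_cell continuous_intros c1 c2)
  also have "\<dots> \<le> \<rho> * ?I (\<lambda>x. \<bar>f (t, x)\<bar>) + real (length xs) * \<rho> * ?I (\<lambda>x. \<bar>savg \<rho> i f (t, x)\<bar>)"
    unfolding seg_avg_slice[of "\<lambda>s. s"]
    by (intro add_mono mult_left_mono integral_abs_seg_avg_le Cons.IH s per_at_seg_avg Cons.prems p slice_cont f)
       (use l in auto)
  also have "\<dots> \<le> \<rho> * ?I (\<lambda>x. \<bar>f (t, x)\<bar>) + real (length xs) * \<rho> * ?I (\<lambda>x. \<bar>f (t, x)\<bar>)"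
    unfolding seg_avg_slice
    by (intro add_mono mult_left_mono integral_abs_seg_avg_le p slice_cont f) (use l in auto)
  finally show ?case by (simp add: algebra_simps)
qed simp

lemma abs_seg_avg_bound:
  fixes f :: "'a::euclidean_space \<Rightarrow> real"
  assumes f: "continuous_on UNIV f" and k: "continuous_on UNIV k" and k1: "\<And>s. s \<in> {0..1} \<Longrightarrow> \<bar>k s\<bar> \<le> 1"
    and b: "\<And>s. \<bar>f (z + s *\<^sub>R v)\<bar> \<le> C"
  shows "\<bar>seg_avg k v f z\<bar> \<le> C"
proof -
  have "seg_avg (\<lambda>s. 1) v (\<lambda>z. \<bar>f z\<bar>) z \<le> integral {0..1} (\<lambda>s::real. C)"
    unfolding seg_avg_def
    by (rule integral_le) (auto intro!: integrable_continuous_interval continuous_intros continuous_on_compose2[OF f] b)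
  then show ?thesis using abs_seg_avg_le[OF f k k1, of v z] by simp
qed

lemma abs_adiv_le:
  fixes f :: "real \<times> (real^'d) \<Rightarrow> real"
  assumes l: "0 \<le> \<rho>"
  shows "smooth f \<Longrightarrow> (\<And>x. \<bar>f (t, x)\<bar> \<le> C) \<Longrightarrow> \<bar>adiv \<rho> xs f l (t, x)\<bar> \<le> real (length xs) * \<rho> * C"
proof (induction xs arbitrary: f)
  case (Cons i xs)
  note f = Cons.prems(1)
  have s: "smooth (savg \<rho> i f)" by (simp add: smooth_seg_avg f)
  have 1: "\<bar>seg_avg (\<lambda>s. s) (0, \<rho> *\<^sub>R axis i 1) f (t, x)\<bar> \<le> C"
    by (rule abs_seg_avg_bound) (auto intro!: smooth_continuous_on f continuous_intros Cons.prems)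
  have "\<bar>savg \<rho> i f (t, x)\<bar> \<le> C" for x
    by (rule abs_seg_avg_bound) (auto intro!: smooth_continuous_on f continuous_intros Cons.prems)
  from Cons.IH[OF s this] have 2: "\<bar>adiv \<rho> xs (savg \<rho> i f) l (t, x)\<bar> \<le> real (length xs) * \<rho> * C" .
  have "0 \<le> C" using 1 by linarith
  then have "\<bar>(if l = i then \<rho> else 0) * seg_avg (\<lambda>s. s) (0, \<rho> *\<^sub>R axis i 1) f (t, x)\<bar> \<le> \<rho> * C"
    using 1 l by (auto simp: abs_mult mult_left_mono)
  then show ?case using 2 abs_triangle_ineq[of "(if l = i then \<rho> else 0) * seg_avg (\<lambda>s. s) (0, \<rho> *\<^sub>R axis i 1) f (t, x)"
      "adiv \<rho> xs (savg \<rho> i f) l (t, x)"] by (simp only: adiv.simps) (simp add: algebra_simps)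
qed simp

lemma adiv_zero: "(\<And>x. f (t, x) = 0) \<Longrightarrow> adiv \<rho> xs f l (t, x) = 0"
proof (induction xs arbitrary: f)
  case (Cons i xs)
  have "savg \<rho> i f (t, x) = 0" for x by (simp add: seg_avg_def Cons.prems)
  then show ?case using Cons.IH by (simp add: seg_avg_def Cons.prems)
qed simp

text \<open>Averaging along \<open>i\<close> acts on the \<open>i\<close>-th factor alone. The
  factors \<open>h\<close> are generalised in the induction since each step replaces one of them by
  its mean. In this way means of blobs reduce to one-dimensional integrals.\<close>

lemma avg_list_prod:
  fixes f :: "real \<times> (real^'d) \<Rightarrow> real"
  shows "distinct xs \<Longrightarrow> (\<And>x. f (t, x) = (\<Prod>i\<in>UNIV. h i (x $ i))) \<Longrightarrow>
    avg_list \<rho> xs f (t, x) = (\<Prod>i\<in>UNIV. if i \<in> set xs then integral {0..1} (\<lambda>s. h i (x $ i + s * \<rho>)) else h i (x $ i))"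
proof (induction xs arbitrary: f h)
  case (Cons i xs)
  let ?h = "h(i := \<lambda>y. integral {0..1} (\<lambda>s. h i (y + s * \<rho>)))"
  have "savg \<rho> i f (t, x) = (\<Prod>l\<in>UNIV. ?h l (x $ l))" for x
  proof -
    have 1: "(\<Prod>l\<in>UNIV. g l) = g i * (\<Prod>l\<in>UNIV - {i}. g l)" for g :: "'d \<Rightarrow> real"
      by (simp add: prod.remove)
    have "(\<Prod>l\<in>UNIV. h l ((x + s *\<^sub>R \<rho> *\<^sub>R axis i 1) $ l)) = h i (x $ i + s * \<rho>) * (\<Prod>l\<in>UNIV - {i}. h l (x $ l))" for s
      by (subst 1) (auto intro!: prod.cong simp: axis_def)
    then have "savg \<rho> i f (t, x) = integral {0..1} (\<lambda>s. h i (x $ i + s * \<rho>)) * (\<Prod>l\<in>UNIV - {i}. h l (x $ l))"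
      by (simp add: seg_avg_def Cons.prems(2))
    also have "\<dots> = (\<Prod>l\<in>UNIV. ?h l (x $ l))"
      by (subst 1) (auto intro!: prod.cong)
    finally show ?thesis .
  qed
  then have "avg_list \<rho> xs (savg \<rho> i f) (t, x) = (\<Prod>l\<in>UNIV. if l \<in> set xs then integral {0..1} (\<lambda>s. ?h l (x $ l + s * \<rho>)) else ?h l (x $ l))"
    by (intro Cons.IH) (use Cons.prems in auto)
  then show ?case using Cons.prems(1)
    by (auto intro!: prod.cong)
qed simp

subsection \<open>One-dimensional profile integrals\<close>

text \<open>Up to pi/3 the derivative cos - 1/2 is nonnegative; beyond it sin is at least sqrt 3 /
  2, while u/2 is at most pi/4, and 17/20 lies between these two numbers.\<close>

lemma sin_ge_half: assumes "0 \<le> u" "u \<le> pi / 2" shows "u / 2 \<le> sin u"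
proof (cases "u \<le> pi / 3")
  case True
  have "sin 0 - 0 / 2 \<le> sin u - u / 2"
  proof (rule DERIV_nonneg_imp_nondecreasing[OF assms(1)])
    fix x assume x: "0 \<le> x" "x \<le> u"
    have "cos (pi / 3) \<le> cos x" using x True by (intro cos_monotone_0_pi_le) auto
    then have "0 \<le> cos x - 1 / 2" by (simp add: cos_60)
    moreover have "((\<lambda>u. sin u - u / 2) has_real_derivative cos x - 1 / 2) (at x)"
      by (auto intro!: derivative_eq_intros)
    ultimately show "\<exists>y. ((\<lambda>u. sin u - u / 2) has_real_derivative y) (at x) \<and> 0 \<le> y" by blast
  qed
  then show ?thesis by simp
next
  case False
  have "sin (pi / 3) \<le> sin u" using assms False by (intro sin_monotone_2pi_le) auto
  moreover have "u / 2 \<le> 17 / 20" using assms pi_less_4 pi_approx by simp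
  moreover have "17 / 20 \<le> sqrt 3 / 2"
    using real_le_rsqrt[of "17/10" 3] by (simp add: power2_eq_square)
  ultimately show ?thesis by (simp add: sin_60)
qed

text \<open>In closed form this is exp(-c/2) I_0(c/2) with the modified Bessel function I_0; what
  matters is its decay like c^(-1/2).\<close>

definition gint :: "real \<Rightarrow> real" where
  "gint c = integral {0..1} (\<lambda>s. exp (- c * (sin (pi * s))\<^sup>2))"

lemma exp_minus_le: "0 \<le> x \<Longrightarrow> exp (- x) \<le> 1 / (1 + x)" for x :: real
  using exp_ge_add_one_self[of x] by (simp add: exp_minus field_simps)

text \<open>On [0,1], sin (pi s) is at least the distance of \<open>s\<close> to the nearer
  endpoint, and exp(-x) is at most 1/(1+x). The resulting majorant has an arctangent as primitive;
  one summand is attached to each endpoint, since the integrand peaks at both.\<close>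

lemma gint_le: assumes c: "0 < c" shows "gint c \<le> pi / sqrt c"
proof -
  have sq: "sqrt c * sqrt c = c" "sqrt c > 0" using c by auto
  have d: "((\<lambda>s. arctan (sqrt c * s) / sqrt c) has_real_derivative 1 / (1 + c * x\<^sup>2)) (at x)" for x
  proof -
    have "((\<lambda>s. arctan (sqrt c * s) / sqrt c) has_real_derivative (inverse (1 + (sqrt c * x)\<^sup>2) * sqrt c) / sqrt c) (at x)"
      by (rule DERIV_cdivide[OF DERIV_chain2[OF DERIV_arctan DERIV_cmult_Id]])
    then show ?thesis using sq c by (simp add: power_mult_distrib inverse_eq_divide)
  qed
  have 1: "((\<lambda>s. 1 / (1 + c * s\<^sup>2)) has_integral (arctan (sqrt c * 1) / sqrt c - arctan (sqrt c * 0) / sqrt c)) {0..1}"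
    by (rule fundamental_theorem_of_calculus)
       (auto simp: has_real_derivative_iff_has_vector_derivative[symmetric] intro: DERIV_subset[OF d])
  have 2: "((\<lambda>s. 1 / (1 + c * (1 - s)\<^sup>2)) has_integral (- (arctan (sqrt c * (1 - 1)) / sqrt c) - (- (arctan (sqrt c * (1 - 0)) / sqrt c)))) {0..1}"
  proof (rule fundamental_theorem_of_calculus)
    fix x :: real
    have "((\<lambda>s. 1 - s) has_real_derivative (-1)) (at x)" by (auto intro!: derivative_eq_intros)
    from DERIV_minus[OF DERIV_chain2[OF d this]]
    have "((\<lambda>s. - (arctan (sqrt c * (1 - s)) / sqrt c)) has_real_derivative 1 / (1 + c * (1 - x)\<^sup>2)) (at x)" by simp
    then show "((\<lambda>s. - (arctan (sqrt c * (1 - s)) / sqrt c)) has_vector_derivative 1 / (1 + c * (1 - x)\<^sup>2)) (at x within {0..1})"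
      by (simp add: has_real_derivative_iff_has_vector_derivative[symmetric] has_field_derivative_at_within)
  qed simp
  have 3: "((\<lambda>s. 1 / (1 + c * s\<^sup>2) + 1 / (1 + c * (1 - s)\<^sup>2)) has_integral 2 * arctan (sqrt c) / sqrt c) {0..1}"
    using has_integral_add[OF 1 2] by (simp add: field_simps)
  have le: "exp (- c * (sin (pi * s))\<^sup>2) \<le> 1 / (1 + c * s\<^sup>2) + 1 / (1 + c * (1 - s)\<^sup>2)" if s: "s \<in> {0..1}" for s
  proof -
    define m where "m = min s (1 - s)"
    have m0: "0 \<le> m" "m \<le> 1 / 2" using s by (auto simp: m_def min_def)
    have "sin (pi * s) = sin (pi * m)"
    proof (cases "s \<le> 1 - s")
      case False
      then have "pi * m = pi - pi * s" by (simp add: m_def algebra_simps)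
      then show ?thesis by simp
    qed (simp add: m_def)
    moreover have "pi * m / 2 \<le> sin (pi * m)" using m0 by (intro sin_ge_half) auto
    moreover have "m \<le> pi * m / 2" using m0 pi_gt3 mult_right_mono[of 2 pi m] by linarith
    ultimately have "m \<le> sin (pi * s)" by linarith
    then have "m\<^sup>2 \<le> (sin (pi * s))\<^sup>2" using m0 by (intro power_mono) auto
    then have "c * m\<^sup>2 \<le> c * (sin (pi * s))\<^sup>2" using c by (intro mult_left_mono) auto
    then have "exp (- c * (sin (pi * s))\<^sup>2) \<le> exp (- (c * m\<^sup>2))" by simp
    also have "\<dots> \<le> 1 / (1 + c * m\<^sup>2)" using c by (intro exp_minus_le) auto
    also have "\<dots> \<le> 1 / (1 + c * s\<^sup>2) + 1 / (1 + c * (1 - s)\<^sup>2)"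
      using c by (auto simp: m_def min_def add_pos_nonneg)
    finally show ?thesis .
  qed
  have "gint c \<le> 2 * arctan (sqrt c) / sqrt c"
    unfolding gint_def
    by (rule has_integral_le[OF integrable_integral 3]) (use le in \<open>auto intro!: integrable_continuous_interval continuous_intros\<close>)
  also have "\<dots> \<le> pi / sqrt c" using arctan_ubound[of "sqrt c"] sq by (intro divide_right_mono) auto
  finally show ?thesis .
qed

definition gsint :: "real \<Rightarrow> real \<Rightarrow> real" where
  "gsint c n = integral {0..1} (\<lambda>s. exp (- c * (sin (pi * s))\<^sup>2) * (sin (2 * pi * n * s))\<^sup>2)"

lemma gsint_le_gint: "gsint c n \<le> gint c"
  unfolding gsint_def gint_def
  by (rule integral_le) (auto intro!: integrable_continuous_interval continuous_intros mult_left_le power_le_one abs_sin_le_one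
      simp: power2_le_iff_abs_le abs_square_le_1)

text \<open>Only the interval [0, 1/mu] is kept. There the Gaussian stays above exp(-2 pi^2), and
  since \<open>n\<close> is at least \<open>\<mu>\<close>, the squared sine runs through full
  periods: the boundary term costs at most half of 1/(2 mu). This bound is the source of the
  constant \<open>c0\<close> in \<open>substep\<close>.\<close>

lemma gsint_ge:
  assumes mu: "1 \<le> \<mu>" "\<mu> \<le> n"
  shows "exp (- 2 * pi\<^sup>2) / 4 / \<mu> \<le> gsint (2 * \<mu>\<^sup>2) n"
proof -
  let ?f = "\<lambda>s. exp (- (2 * \<mu>\<^sup>2) * (sin (pi * s))\<^sup>2) * (sin (2 * pi * n * s))\<^sup>2"
  let ?g = "\<lambda>s. exp (- 2 * pi\<^sup>2) * (sin (2 * pi * n * s))\<^sup>2"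
  have n0: "n > 0" using mu by linarith
  have io: "?f integrable_on {a..b}" "?g integrable_on {a..b}" for a b
    by (intro integrable_continuous_interval continuous_intros)+
  have "((\<lambda>s. (sin (2 * pi * n * s))\<^sup>2) has_integral
     ((1 / \<mu>) / 2 - sin (4 * pi * n * (1 / \<mu>)) / (8 * pi * n) - (0 / 2 - sin (4 * pi * n * 0) / (8 * pi * n)))) {0..1 / \<mu>}"
  proof (rule fundamental_theorem_of_calculus)
    show "0 \<le> 1 / \<mu>" using mu by simp
    fix s :: real
    have "cos (4 * pi * n * s) = 1 - 2 * (sin (2 * pi * n * s))\<^sup>2"
      using cos_double_sin[of "2 * pi * n * s"] by (simp add: algebra_simps)
    then have *: "1 / 2 - cos (4 * pi * n * s) * (4 * pi * n) / (8 * pi * n) = (sin (2 * pi * n * s))\<^sup>2"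
      using n0 by (simp add: field_simps)
    have "((\<lambda>s. s / 2 - sin (4 * pi * n * s) / (8 * pi * n)) has_real_derivative 1 / 2 - cos (4 * pi * n * s) * (4 * pi * n) / (8 * pi * n)) (at s within {0..1 / \<mu>})"
      by (auto intro!: derivative_eq_intros)
    then show "((\<lambda>s. s / 2 - sin (4 * pi * n * s) / (8 * pi * n)) has_vector_derivative (sin (2 * pi * n * s))\<^sup>2) (at s within {0..1 / \<mu>})"
      unfolding * by (simp add: has_real_derivative_iff_has_vector_derivative[symmetric])
  qed
  then have I: "integral {0..1 / \<mu>} ?g = exp (- 2 * pi\<^sup>2) * (1 / \<mu> / 2 - sin (4 * pi * n * (1 / \<mu>)) / (8 * pi * n))"
    by (simp add: integral_unique)
  have "sin (4 * pi * n * (1 / \<mu>)) / (8 * pi * n) \<le> 1 / (8 * pi * n)"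
    using n0 by (intro divide_right_mono) auto
  also have "\<dots> \<le> 1 / (4 * \<mu>)"
  proof (intro divide_left_mono)
    have "4 * \<mu> \<le> 4 * n" using mu by simp
    also have "4 * n \<le> 8 * pi * n" using n0 pi_gt3 by simp
    finally show "4 * \<mu> \<le> 8 * pi * n" .
  qed (use mu n0 in auto)
  finally have "1 / (4 * \<mu>) \<le> 1 / \<mu> / 2 - sin (4 * pi * n * (1 / \<mu>)) / (8 * pi * n)"
    using mu by (simp add: field_simps)
  then have "exp (- 2 * pi\<^sup>2) * (1 / (4 * \<mu>)) \<le> exp (- 2 * pi\<^sup>2) * (1 / \<mu> / 2 - sin (4 * pi * n * (1 / \<mu>)) / (8 * pi * n))"
    by (intro mult_left_mono) auto
  also have "\<dots> = integral {0..1 / \<mu>} ?g" by (rule I[symmetric])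
  also have "\<dots> \<le> integral {0..1 / \<mu>} ?f"
  proof (rule integral_le[OF io(2) io(1)])
    fix s assume s: "s \<in> {0..1 / \<mu>}"
    have "\<bar>\<mu> * sin (pi * s)\<bar> \<le> \<bar>\<mu> * (pi * s)\<bar>"
      using abs_sin_x_le_abs_x[of "pi * s"] by (simp add: abs_mult mult_left_mono)
    also have "\<dots> \<le> pi" using s mu mult_left_mono[of "\<mu> * s" 1 pi] by (simp add: abs_mult field_simps)
    finally have "(\<mu> * sin (pi * s))\<^sup>2 \<le> pi\<^sup>2" using power_mono[of "\<bar>\<mu> * sin (pi * s)\<bar>" pi 2] by simp
    then show "?g s \<le> ?f s" by (intro mult_right_mono) (auto simp: power_mult_distrib)
  qed
  also have "\<dots> \<le> integral {0..1} ?f"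
    by (rule integral_subset_le[OF _ io(1) io(1)]) (use mu in auto)
  finally show ?thesis by (simp add: gsint_def)
qed

subsection \<open>The travelling oscillating blob\<close>

text \<open>Together with \<open>xx_exp_le\<close> this trades the polynomial factors produced by
  differentiating a Gaussian against half of its exponent.\<close>

lemma x_exp_le: "0 \<le> x \<Longrightarrow> x * exp (- (x\<^sup>2 / 2)) \<le> 1" for x :: real
proof -
  assume x: "0 \<le> x"
  have "x \<le> 1 + x\<^sup>2 / 2" using zero_le_power2[of "x - 1"] by (simp add: power2_eq_square algebra_simps)
  also have "\<dots> \<le> exp (x\<^sup>2 / 2)" by (rule exp_ge_add_one_self)
  finally show ?thesis by (simp add: exp_minus field_simps)
qed

lemma xx_exp_le: "x * exp (- (x / 2)) \<le> 1" for x :: real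
proof -
  have "x / 2 \<le> exp (x / 2 - 1)" using exp_ge_add_one_self[of "x / 2 - 1"] by simp
  also have "\<dots> = exp (x / 2) / exp 1" by (rule exp_diff)
  finally have "x \<le> exp (x / 2) * (2 / exp 1)" by (simp add: field_simps)
  also have "\<dots> \<le> exp (x / 2) * 1"
    using exp_ge_add_one_self[of "1::real"] by (intro mult_left_mono) auto
  finally show ?thesis by (simp add: exp_minus field_simps)
qed

text \<open>\<open>lam\<close> and \<open>N\<close> are natural numbers so that the pattern closes
  up on the torus, \<open>j \<noteq> k\<close> makes the oscillation constant along the motion, and
  \<open>\<mu> \<le> N\<close> keeps derivatives of the Gaussian from exceeding those of the
  oscillation.\<close>

locale blob =
  fixes j k :: "'d::finite" and lam N om \<mu> :: real
  assumes jk: "j \<noteq> k" and lam: "lam \<ge> 1" "lam \<in> \<nat>" and N: "N \<in> \<nat>" and mu: "1 \<le> \<mu>" "\<mu> \<le> N" and om: "om > 0"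
begin

definition yy :: "'d \<Rightarrow> real \<times> (real^'d) \<Rightarrow> real" where
  "yy i z = lam * (snd z $ i - (if i = j then om * fst z else 0))"

text \<open>A smooth periodic stand-in for the squared distance to the nearest blob centre, in
  rescaled moving coordinates. As a sum over coordinates it makes the Gaussian a product.\<close>

definition QQ :: "real \<times> (real^'d) \<Rightarrow> real" where
  "QQ z = (\<Sum>i\<in>UNIV. (sin (pi * yy i z))\<^sup>2)"

definition gauss :: "real \<Rightarrow> real \<times> (real^'d) \<Rightarrow> real" where
  "gauss c z = exp (- c * QQ z)"

text \<open>The Gaussian \<open>phi\<close> is the square of \<open>EE\<close>. In the estimates one
  factor \<open>EE\<close> absorbs the polynomial terms created by derivatives, and the other
  remains as a profile with integral of order mu^(-d).\<close>

definition phi :: "real \<times> (real^'d) \<Rightarrow> real" where "phi = gauss (\<mu>\<^sup>2)"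
definition EE :: "real \<times> (real^'d) \<Rightarrow> real" where "EE = gauss (\<mu>\<^sup>2 / 2)"
definition q :: real where "q = 2 * pi * N * lam"
definition sn :: "real \<times> (real^'d) \<Rightarrow> real" where "sn z = sin (q * snd z $ k)"
definition cs :: "real \<times> (real^'d) \<Rightarrow> real" where "cs z = cos (q * snd z $ k)"
text \<open>To leading order a \<open>k\<close>-primitive of \<open>phi * sn\<close>:
  differentiating the cosine cancels \<open>q\<close>, and the part that falls on \<open>phi\<close>
  is smaller by \<open>\<mu> / N\<close>.\<close>

definition Phi :: "real \<times> (real^'d) \<Rightarrow> real" where "Phi z = - (phi z * cs z) / q"
text \<open>The mean of phi^2 sn^2, written as the product of its one-dimensional means; direction
  \<open>k\<close> carries the squared sine.\<close>

definition MM :: real where "MM = gint (2 * \<mu>\<^sup>2) ^ (CARD('d) - 1) * gsint (2 * \<mu>\<^sup>2) N"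
definition HH :: "real \<times> (real^'d) \<Rightarrow> real" where "HH z = (phi z)\<^sup>2 * (sn z)\<^sup>2 / MM"

lemma N1: "N \<ge> 1" using mu by linarith
lemma q_pos: "q > 0" using lam N1 by (simp add: q_def)

lemma bl_yy: "bounded_linear (yy i)"
proof -
  have "bounded_linear (\<lambda>z :: real \<times> (real^'d). snd z $ i)"
    by (rule bounded_linear_compose[OF bounded_linear_vec_nth bounded_linear_snd])
  moreover have "bounded_linear (\<lambda>z :: real \<times> (real^'d). if i = j then om * fst z else 0)"
    by (cases "i = j") (auto intro: bounded_linear_const_mult bounded_linear_fst)
  ultimately show ?thesis unfolding yy_def[abs_def]
    by (intro bounded_linear_const_mult bounded_linear_sub)
qed

lemma bl_k: "bounded_linear (\<lambda>z :: real \<times> (real^'d). q * snd z $ k)"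
  by (intro bounded_linear_const_mult bounded_linear_compose[OF bounded_linear_vec_nth bounded_linear_snd])

lemma smooth_yy: "smooth (yy i)" by (rule smooth_linear[OF bl_yy])

lemma smooth_QQ: "smooth QQ" unfolding QQ_def[abs_def]
  by (intro smooth_intros smooth_yy)

lemma smooth_gauss: "smooth (gauss c)" unfolding gauss_def[abs_def]
  by (intro smooth_intros smooth_QQ)

lemma smooth_phi: "smooth phi" unfolding phi_def by (rule smooth_gauss)
lemma smooth_sn: "smooth sn" and smooth_cs: "smooth cs"
  unfolding sn_def[abs_def] cs_def[abs_def] by (auto intro: smooth_sin smooth_cos smooth_linear[OF bl_k])
lemma smooth_Phi: "smooth Phi" unfolding Phi_def[abs_def]
  by (intro smooth_intros smooth_phi smooth_cs)
lemma smooth_HH: "smooth HH" unfolding HH_def[abs_def]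
  by (intro smooth_intros smooth_phi smooth_sn)

lemma ddir_yy: "ddir v (yy i) z = yy i v" by (rule ddir_linear[OF bl_yy])

lemma yy_ex: "yy i (ex l) = (if i = l then lam else 0)" by (auto simp: yy_def axis_def)
lemma yy_et: "yy i et = (if i = j then - lam * om else 0)" by (auto simp: yy_def)

lemma ddir_QQ: "ddir v QQ z = (\<Sum>i\<in>UNIV. pi * sin (2 * pi * yy i z) * yy i v)"
proof -
  have "ddir v (\<lambda>z. (sin (pi * yy i z))\<^sup>2) z = pi * sin (2 * pi * yy i z) * yy i v" for i
    unfolding power2_eq_square
    by (simp add: ddir_mult smooth_sin smooth_cmult smooth_yy ddir_sin ddir_cmult ddir_yy sin_double[of "pi * yy i z"] mult.assoc)
  moreover have "ddir v QQ z = (\<Sum>i\<in>UNIV. ddir v (\<lambda>z. (sin (pi * yy i z))\<^sup>2) z)"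
    unfolding QQ_def[abs_def] by (rule ddir_sum) (intro smooth_intros smooth_yy)
  ultimately show ?thesis by simp
qed

lemma Dx_QQ: "Dx i QQ z = pi * lam * sin (2 * pi * yy i z)"
  by (simp add: ddir_QQ yy_ex if_distrib mult_ac cong: if_cong)

lemma Dt_QQ: "Dt QQ z = - om * Dx j QQ z"
  by (simp add: ddir_QQ yy_ex yy_et if_distrib cong: if_cong)

lemma Dxx_QQ: "Dx l (Dx i QQ) z = (if l = i then 2 * pi\<^sup>2 * lam\<^sup>2 * cos (2 * pi * yy i z) else 0)"
proof -
  have "Dx i QQ = (\<lambda>z. (pi * lam) * sin ((2 * pi) * yy i z))" by (simp add: fun_eq_iff Dx_QQ)
  then show ?thesis
    by (simp add: ddir_cmult smooth_sin smooth_cmult smooth_yy ddir_sin ddir_yy yy_ex power2_eq_square)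
qed

lemma QQ_nonneg: "0 \<le> QQ z" by (simp add: QQ_def sum_nonneg)

text \<open>By sin 2x = 2 sin x cos x the gradient of \<open>QQ\<close> vanishes at the blob centres
  like the square root of \<open>QQ\<close>, which is the kind of factor that the Gaussian can
  absorb.\<close>

lemma abs_Dx_QQ: "\<bar>Dx i QQ z\<bar> \<le> 2 * pi * lam * sqrt (QQ z)"
proof -
  have "(sin (pi * yy i z))\<^sup>2 \<le> QQ z" unfolding QQ_def by (rule member_le_sum) auto
  then have 1: "\<bar>sin (pi * yy i z)\<bar> \<le> sqrt (QQ z)" by (simp add: real_le_rsqrt)
  have "\<bar>sin (2 * pi * yy i z)\<bar> = 2 * \<bar>sin (pi * yy i z)\<bar> * \<bar>cos (pi * yy i z)\<bar>"
    using sin_double[of "pi * yy i z"] by (simp add: abs_mult mult.assoc)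
  also have "\<dots> \<le> 2 * sqrt (QQ z) * 1"
    by (intro mult_mono) (use 1 in \<open>auto simp: QQ_nonneg\<close>)
  finally show ?thesis using lam by (simp add: Dx_QQ abs_mult mult_left_mono mult.assoc mult.left_commute)
qed

lemma ddir_gauss: "ddir v (gauss c) z = - c * gauss c z * ddir v QQ z"
proof -
  have "gauss c = (\<lambda>z. exp ((- c) * QQ z))" by (simp add: fun_eq_iff gauss_def)
  then show ?thesis by (simp only: ddir_exp smooth_cmult smooth_QQ ddir_cmult) simp
qed

lemma gauss_pos: "0 < gauss c z" by (simp add: gauss_def)

lemma EE_pos: "0 < EE z" by (simp add: EE_def gauss_pos)
lemma phi_pos: "0 < phi z" by (simp add: phi_def gauss_pos)

lemma phi_eq: "phi z = EE z * EE z"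
  by (simp add: phi_def EE_def gauss_def flip: exp_add)

lemma EE_le_1: "EE z \<le> 1" by (simp add: EE_def gauss_def QQ_nonneg)

lemma phi_le_EE: "phi z \<le> EE z"
  unfolding phi_eq using EE_pos[of z] EE_le_1[of z] by (simp add: mult_left_le)

lemma sqrt_QQ_EE: "\<mu> * sqrt (QQ z) * EE z \<le> 1"
  using x_exp_le[of "\<mu> * sqrt (QQ z)"] mu QQ_nonneg[of z]
  by (simp add: EE_def gauss_def power_mult_distrib)

lemma QQ_EE: "\<mu>\<^sup>2 * QQ z * EE z \<le> 1"
  using xx_exp_le[of "\<mu>\<^sup>2 * QQ z"] by (simp add: EE_def gauss_def)

lemma abs_Dx_phi: "\<bar>Dx i phi z\<bar> \<le> 2 * pi * lam * \<mu> * EE z"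
proof -
  have "\<bar>Dx i phi z\<bar> = \<mu>\<^sup>2 * phi z * \<bar>Dx i QQ z\<bar>"
    using phi_pos[of z] by (simp add: phi_def ddir_gauss abs_mult)
  also have "\<dots> \<le> \<mu>\<^sup>2 * phi z * (2 * pi * lam * sqrt (QQ z))"
    using phi_pos[of z] by (intro mult_left_mono abs_Dx_QQ) auto
  also have "\<dots> = 2 * pi * lam * \<mu> * EE z * (\<mu> * sqrt (QQ z) * EE z)"
    by (simp add: phi_eq power2_eq_square)
  also have "\<dots> \<le> 2 * pi * lam * \<mu> * EE z * 1"
    using sqrt_QQ_EE[of z] EE_pos[of z] lam mu by (intro mult_left_mono) auto
  finally show ?thesis by simp
qed

text \<open>Of the constant 6, the part 4 comes from the product of two first derivatives, where
  \<open>QQ_EE\<close> absorbs the factor mu^2 \<open>QQ\<close>, and the part 2 from the second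
  derivative of \<open>QQ\<close>.\<close>

lemma abs_Dxx_phi: "\<bar>Dx l (Dx i phi) z\<bar> \<le> 6 * pi\<^sup>2 * lam\<^sup>2 * \<mu>\<^sup>2 * EE z"
proof -
  have "Dx i phi = (\<lambda>z. (- \<mu>\<^sup>2) * (phi z * Dx i QQ z))"
    by (simp add: fun_eq_iff phi_def ddir_gauss)
  then have "Dx l (Dx i phi) z = (- \<mu>\<^sup>2) * (Dx l phi z * Dx i QQ z + phi z * Dx l (Dx i QQ) z)"
    by (simp only: ddir_cmult smooth_mult smooth_phi smooth_ddir ex_Basis smooth_QQ ddir_mult)
  also have "Dx l phi z = - \<mu>\<^sup>2 * phi z * Dx l QQ z" by (simp add: phi_def ddir_gauss)
  finally have "Dx l (Dx i phi) z = (- \<mu>\<^sup>2) * (phi z * (- \<mu>\<^sup>2 * (Dx l QQ z * Dx i QQ z) + Dx l (Dx i QQ) z))"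
    by (simp add: algebra_simps)
  then have "\<bar>Dx l (Dx i phi) z\<bar> = \<mu>\<^sup>2 * (phi z * \<bar>- \<mu>\<^sup>2 * (Dx l QQ z * Dx i QQ z) + Dx l (Dx i QQ) z\<bar>)"
    using phi_pos[of z] by (simp only: abs_mult abs_minus_cancel) simp
  also have "\<dots> \<le> \<mu>\<^sup>2 * (phi z * (\<mu>\<^sup>2 * ((2 * pi * lam * sqrt (QQ z)) * (2 * pi * lam * sqrt (QQ z))) + 2 * pi\<^sup>2 * lam\<^sup>2))"
  proof (intro mult_left_mono order_trans[OF abs_triangle_ineq] add_mono)
    show "\<bar>- \<mu>\<^sup>2 * (Dx l QQ z * Dx i QQ z)\<bar> \<le> \<mu>\<^sup>2 * ((2 * pi * lam * sqrt (QQ z)) * (2 * pi * lam * sqrt (QQ z)))"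
      unfolding abs_mult abs_minus_cancel abs_power2 using lam QQ_nonneg[of z] by (intro mult_left_mono mult_mono abs_Dx_QQ) auto
    show "\<bar>Dx l (Dx i QQ) z\<bar> \<le> 2 * pi\<^sup>2 * lam\<^sup>2"
      by (auto simp: Dxx_QQ abs_mult mult_left_le)
  qed (use phi_pos[of z] in auto)
  also have "\<dots> = 4 * pi\<^sup>2 * lam\<^sup>2 * \<mu>\<^sup>2 * EE z * (\<mu>\<^sup>2 * QQ z * EE z) + 2 * pi\<^sup>2 * lam\<^sup>2 * \<mu>\<^sup>2 * phi z"
    using QQ_nonneg[of z] by (simp add: phi_eq power2_eq_square algebra_simps)
  also have "\<dots> \<le> 4 * pi\<^sup>2 * lam\<^sup>2 * \<mu>\<^sup>2 * EE z * 1 + 2 * pi\<^sup>2 * lam\<^sup>2 * \<mu>\<^sup>2 * EE z"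
    using EE_pos[of z] by (intro add_mono mult_left_mono QQ_EE phi_le_EE) auto
  finally show ?thesis by (simp add: algebra_simps)
qed

lemma Dt_phi: "Dt phi z = - om * Dx j phi z"
  by (simp add: phi_def ddir_gauss Dt_QQ)

lemma ddir_sn: "ddir v sn z = q * cs z * snd v $ k" and ddir_cs: "ddir v cs z = - (q * sn z * snd v $ k)"
  by (simp_all add: sn_def[abs_def] cs_def[abs_def] ddir_sin ddir_cos smooth_linear[OF bl_k] ddir_linear[OF bl_k])

lemma abs_sn: "\<bar>sn z\<bar> \<le> 1" and abs_cs: "\<bar>cs z\<bar> \<le> 1" by (auto simp: sn_def cs_def)

lemma ddir_Phi: "ddir v Phi z = - (ddir v phi z * cs z) / q + phi z * sn z * snd v $ k"
proof -
  have "Phi = (\<lambda>z. (- (1 / q)) * (phi z * cs z))" by (simp add: Phi_def fun_eq_iff)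
  then have "ddir v Phi z = (- (1 / q)) * (ddir v phi z * cs z + phi z * ddir v cs z)"
    by (simp only: ddir_cmult smooth_mult smooth_phi smooth_cs ddir_mult)
  then show ?thesis using q_pos by (simp add: ddir_cs field_simps)
qed

lemma Dxx_Phi: "Dx l (Dx i Phi) z = - (Dx l (Dx i phi) z * cs z) / q + Dx i phi z * sn z * axis l 1 $ k
   + (Dx l phi z * sn z + phi z * q * cs z * axis l 1 $ k) * axis i 1 $ k"
proof -
  have "Dx i Phi = (\<lambda>z. (- (1 / q)) * (Dx i phi z * cs z) + (axis i 1 $ k) * (phi z * sn z))"
    by (simp add: fun_eq_iff ddir_Phi)
  then have "Dx l (Dx i Phi) z = (- (1 / q)) * (Dx l (Dx i phi) z * cs z + Dx i phi z * Dx l cs z) + (axis i 1 $ k) * (Dx l phi z * sn z + phi z * Dx l sn z)"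
    by (simp only: ddir_add ddir_cmult ddir_mult smooth_cmult smooth_mult smooth_ddir ex_Basis smooth_phi smooth_cs smooth_sn)
  then show ?thesis using q_pos by (simp add: ddir_sn ddir_cs field_simps)
qed

lemma abs_Phi: "\<bar>Phi z\<bar> \<le> EE z / N"
proof -
  have "\<bar>Phi z\<bar> = phi z * \<bar>cs z\<bar> / q" using phi_pos[of z] q_pos by (simp add: Phi_def abs_mult)
  also have "\<dots> \<le> EE z * 1 / N"
  proof (intro frac_le mult_mono phi_le_EE abs_cs)
    have "1 * N \<le> (2 * pi * lam) * N" using pi_gt3 lam N1 by (intro mult_right_mono) (auto intro: order_trans[of 1 lam])
    then show "N \<le> q" by (simp add: q_def mult_ac)
  qed (use EE_pos[of z] N1 in auto)
  finally show ?thesis by simp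
qed

lemma abs_Dx_phi_q: "\<bar>Dx i phi z * cs z / q\<bar> \<le> \<mu> / N * EE z"
proof -
  have "\<bar>Dx i phi z * cs z / q\<bar> = \<bar>Dx i phi z\<bar> * \<bar>cs z\<bar> / q" using q_pos by (simp add: abs_mult)
  also have "\<dots> \<le> (2 * pi * lam * \<mu> * EE z) * 1 / q"
    using q_pos EE_pos[of z] lam mu by (intro divide_right_mono mult_mono abs_Dx_phi abs_cs) auto
  also have "\<dots> = \<mu> / N * EE z" using N1 lam by (simp add: q_def)
  finally show ?thesis .
qed

lemma Dx_k_Phi: "\<bar>Dx k Phi z - phi z * sn z\<bar> \<le> \<mu> / N * EE z"
  using abs_Dx_phi_q[of k z] by (simp add: ddir_Phi axis_def)

lemma Dx_ne_Phi: "i \<noteq> k \<Longrightarrow> \<bar>Dx i Phi z\<bar> \<le> \<mu> / N * EE z"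
  using abs_Dx_phi_q[of i z] by (simp add: ddir_Phi axis_def)

lemma abs_phi_sn: "\<bar>phi z * sn z\<bar> \<le> EE z"
  using mult_mono[OF phi_le_EE[of z] abs_sn[of z]] phi_pos[of z] EE_pos[of z] by (simp add: abs_mult)

lemma abs_Dx_Phi: "\<bar>Dx i Phi z\<bar> \<le> 2 * EE z"
proof -
  have 1: "\<mu> / N * EE z \<le> EE z" using mu N1 EE_pos[of z] by (simp add: field_simps)
  show ?thesis
  proof (cases "i = k")
    case True then show ?thesis using Dx_k_Phi[of z] abs_phi_sn[of z] 1 by simp
  next
    case False then show ?thesis using Dx_ne_Phi[of i z] 1 EE_pos[of z] by simp
  qed
qed

text \<open>The oscillation depends on coordinate \<open>k\<close> alone and the blob travels along
  \<open>j\<close>, so the time derivative falls only on the Gaussian. The cost is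
  \<open>om * \<mu> / N\<close> instead of \<open>om\<close>.\<close>

lemma abs_Dt_Phi: "\<bar>Dt Phi z\<bar> \<le> om * \<mu> / N * EE z"
proof -
  have "Dt Phi z = om * (Dx j phi z * cs z / q)" by (simp add: ddir_Phi Dt_phi)
  then have "\<bar>Dt Phi z\<bar> = om * \<bar>Dx j phi z * cs z / q\<bar>" using om by (simp add: abs_mult)
  also have "\<dots> \<le> om * (\<mu> / N * EE z)" using om by (intro mult_left_mono abs_Dx_phi_q) auto
  finally show ?thesis by simp
qed

text \<open>The worst term hits the oscillation twice and has size \<open>q\<close>; the others are
  brought to the same size by \<open>\<mu> \<le> N\<close>. The constant is 9 = 3 + 2 + 2 + 2, one
  summand for each term of the product rule.\<close>

lemma abs_Dxx_Phi: "\<bar>Dx l (Dx i Phi) z\<bar> \<le> 9 * pi * lam * N * EE z"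
proof -
  have ax: "\<bar>axis l 1 $ k\<bar> \<le> (1::real)" for l :: 'd by (auto simp: axis_def)
  have E0: "0 \<le> EE z" using EE_pos[of z] by simp
  have "\<mu>\<^sup>2 \<le> N\<^sup>2" using mu by (intro power_mono) auto
  then have "3 * pi * lam * \<mu>\<^sup>2 / N * EE z \<le> 3 * pi * lam * N\<^sup>2 / N * EE z"
    using lam N1 E0 by (intro mult_right_mono divide_right_mono mult_left_mono) auto
  moreover have "\<bar>Dx l (Dx i phi) z * cs z / q\<bar> \<le> (6 * pi\<^sup>2 * lam\<^sup>2 * \<mu>\<^sup>2 * EE z) * 1 / q"
    unfolding abs_divide abs_mult abs_of_pos[OF q_pos] using q_pos E0 by (intro divide_right_mono mult_mono abs_Dxx_phi abs_cs) auto
  moreover have "(6 * pi\<^sup>2 * lam\<^sup>2 * \<mu>\<^sup>2 * EE z) * 1 / q = 3 * pi * lam * \<mu>\<^sup>2 / N * EE z"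
    using N1 lam by (simp add: q_def power2_eq_square field_simps)
  ultimately have 1: "\<bar>Dx l (Dx i phi) z * cs z / q\<bar> \<le> 3 * pi * lam * N * EE z"
    using N1 by (simp add: power2_eq_square)
  have P: "\<bar>Dx m phi z\<bar> \<le> 2 * pi * lam * N * EE z" for m
  proof -
    have "2 * pi * lam * \<mu> * EE z \<le> 2 * pi * lam * N * EE z" using lam mu E0 by (intro mult_right_mono mult_left_mono) auto
    then show ?thesis using abs_Dx_phi[of m z] by linarith
  qed
  have 2: "\<bar>Dx m phi z * sn z * axis n 1 $ k\<bar> \<le> 2 * pi * lam * N * EE z" for m n
    unfolding abs_mult
    using mult_mono[OF mult_mono[OF P[of m] abs_sn[of z]] ax[of n]] lam N1 E0 by simp
  have "\<bar>phi z * q * cs z * axis l 1 $ k * axis i 1 $ k\<bar> \<le> EE z * q * 1 * 1 * 1"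
    unfolding abs_mult using phi_pos[of z] q_pos E0 by (intro mult_mono phi_le_EE abs_cs ax) (auto simp: phi_le_EE)
  then have 3: "\<bar>phi z * q * cs z * axis l 1 $ k * axis i 1 $ k\<bar> \<le> 2 * pi * lam * N * EE z"
    by (simp add: q_def mult_ac)
  have "Dx l (Dx i Phi) z = - (Dx l (Dx i phi) z * cs z / q) + Dx i phi z * sn z * axis l 1 $ k
     + Dx l phi z * sn z * axis i 1 $ k + phi z * q * cs z * axis l 1 $ k * axis i 1 $ k"
    by (simp add: Dxx_Phi algebra_simps)
  then show ?thesis using 1 2[of i l] 2[of l i] 3 by linarith
qed

text \<open>Each one-dimensional factor is at least of order 1/mu, because dropping the squared sine
  only increases the integral. The velocity amplitude is divided by \<open>MM\<close> and is
  controlled through this bound.\<close>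

lemma MM_ge: "(exp (- 2 * pi\<^sup>2) / 4 / \<mu>) ^ CARD('d) \<le> MM"
proof -
  have g: "exp (- 2 * pi\<^sup>2) / 4 / \<mu> \<le> gsint (2 * \<mu>\<^sup>2) N" by (rule gsint_ge[OF mu])
  then have gg: "exp (- 2 * pi\<^sup>2) / 4 / \<mu> \<le> gint (2 * \<mu>\<^sup>2)" using gsint_le_gint[of "2 * \<mu>\<^sup>2" N] by linarith
  moreover have "0 \<le> exp (- 2 * pi\<^sup>2) / 4 / \<mu>" using mu by simp
  ultimately have g0: "0 \<le> gint (2 * \<mu>\<^sup>2)" by linarith
  have "(exp (- 2 * pi\<^sup>2) / 4 / \<mu>) ^ (CARD('d) - 1) * (exp (- 2 * pi\<^sup>2) / 4 / \<mu>) \<le> MM"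
    unfolding MM_def using g mu gg
    by (intro mult_mono power_mono zero_le_power) (auto simp: g0)
  moreover have "CARD('d) = Suc (CARD('d) - 1)" using card_gt_0_iff[of "UNIV :: 'd set"] by simp
  ultimately show ?thesis by (metis power_Suc2)
qed

lemma MM_pos: "0 < MM"
  by (rule less_le_trans[OF _ MM_ge]) (use mu in auto)

text \<open>Since \<open>sn\<close> is constant along \<open>j\<close>, the whole density is
  transported rigidly with speed \<open>om\<close>, and not only its Gaussian envelope.\<close>

lemma Dt_HH: "Dt HH z = - om * Dx j HH z"
proof -
  have "Dt (\<lambda>z. phi z * phi z * (sn z * sn z)) z = - om * Dx j (\<lambda>z. phi z * phi z * (sn z * sn z)) z"
    using jk by (simp add: ddir_mult smooth_mult smooth_phi smooth_sn ddir_sn Dt_phi axis_def algebra_simps)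
  then show ?thesis
    by (simp add: HH_def[abs_def] power2_eq_square ddir_divide smooth_mult smooth_phi smooth_sn)
qed

lemma HH_nonneg: "0 \<le> HH z" using MM_pos by (simp add: HH_def)

lemma HH_le: "HH z \<le> EE z / MM"
proof -
  have "(phi z * sn z)\<^sup>2 \<le> (EE z)\<^sup>2" using abs_phi_sn[of z] EE_pos[of z] by (simp add: abs_le_square_iff[symmetric])
  also have "\<dots> \<le> EE z" using EE_pos[of z] EE_le_1[of z] by (simp add: power2_eq_square mult_left_le)
  finally show ?thesis using MM_pos by (simp add: HH_def power_mult_distrib divide_right_mono)
qed

lemma abs_Dx_HH: "\<bar>Dx i HH z\<bar> \<le> 8 * pi * lam * N * EE z / MM"
proof -
  have E0: "0 \<le> EE z" using EE_pos[of z] by simp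
  have "Dx i HH z = 2 * (phi z * sn z) * (Dx i phi z * sn z + phi z * q * cs z * axis i 1 $ k) / MM"
    by (simp add: HH_def[abs_def] power2_eq_square ddir_divide smooth_mult smooth_phi smooth_sn ddir_mult ddir_sn algebra_simps)
  then have "\<bar>Dx i HH z\<bar> = 2 * \<bar>phi z * sn z\<bar> * \<bar>Dx i phi z * sn z + phi z * q * cs z * axis i 1 $ k\<bar> / MM"
    using MM_pos by (simp add: abs_mult)
  also have "\<dots> \<le> 2 * EE z * (4 * pi * lam * N * 1) / MM"
  proof (intro divide_right_mono mult_mono order_trans[OF abs_triangle_ineq] abs_phi_sn)
    have "2 * pi * lam * \<mu> * EE z \<le> 2 * pi * lam * N * 1"
      using lam mu E0 EE_le_1[of z] by (intro mult_mono) auto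
    then have P: "\<bar>Dx i phi z\<bar> \<le> 2 * pi * lam * N" using abs_Dx_phi[of i z] by linarith
    have "\<bar>Dx i phi z * sn z\<bar> \<le> 2 * pi * lam * N * 1"
      unfolding abs_mult by (intro mult_mono P abs_sn) (use lam N1 in auto)
    moreover have "\<bar>phi z * q * cs z * axis i 1 $ k\<bar> \<le> 1 * q * 1 * 1"
      unfolding abs_mult using phi_pos[of z] phi_le_EE[of z] EE_le_1[of z] q_pos by (intro mult_mono abs_cs) (auto simp: axis_def)
    ultimately show "\<bar>Dx i phi z * sn z\<bar> + \<bar>phi z * q * cs z * axis i 1 $ k\<bar> \<le> 4 * pi * lam * N * 1"
      by (simp add: q_def mult_ac)
  qed (use E0 MM_pos in auto)
  finally show ?thesis by (simp add: mult_ac)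
qed

end

section \<open>Enumeration of the coordinates and integration by parts on the torus\<close>

definition coords :: "'d::finite list" where
  "coords = (SOME xs. set xs = UNIV \<and> distinct xs)"

lemma coords: "set (coords :: 'd list) = UNIV" "distinct (coords :: 'd list)" "length (coords :: 'd::finite list) = CARD('d)"
proof -
  have "\<exists>xs :: 'd list. set xs = UNIV \<and> distinct xs" using finite_distinct_list[of "UNIV :: 'd set"] by simp
  then have "set (coords :: 'd list) = UNIV \<and> distinct (coords :: 'd list)"
    unfolding coords_def by (rule someI_ex)
  then show "set (coords :: 'd list) = UNIV" "distinct (coords :: 'd list)" "length (coords :: 'd::finite list) = CARD('d)"
    using distinct_card[of "coords :: 'd list"] by auto
qed

lemma integral_cell_le:
  fixes f g :: "real^'d \<Rightarrow> real"
  assumes "continuous_on UNIV f" "continuous_on UNIV g" "\<And>x. x \<in> cell \<Longrightarrow> f x \<le> g x"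
  shows "integral cell f \<le> integral cell g"
  using assms by (intro integral_le integrable_cell) auto

lemma integral_by_parts:
  fixes f g :: "real \<times> (real^'d) \<Rightarrow> real"
  assumes f: "smooth f" "per_at 1 t f" and g: "smooth g" "per_at 1 t g"
  shows "integral cell (\<lambda>x. f (t, x) * Dx i g (t, x)) = - integral cell (\<lambda>x. Dx i f (t, x) * g (t, x))"
proof -
  have s: "smooth (\<lambda>z. f z * g z)" by (rule smooth_mult[OF f(1) g(1)])
  have p: "per_at 1 t (\<lambda>z. f z * g z)" using f g by (simp add: per_at_def)
  have "integral cell (ddir (axis i 1) (\<lambda>x. f (t, x) * g (t, x))) = 0"
  proof (rule integral_cell_ddir)
    show "smooth (\<lambda>x. f (t, x) * g (t, x))" using smooth_slice[OF s] by simp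
    show "periodic (\<lambda>x. f (t, x) * g (t, x))" using p by (simp add: per_at_1)
    have "ddir (axis i 1) (\<lambda>x. f (t, x) * g (t, x)) = (\<lambda>x. Dx i (\<lambda>z. f z * g z) (t, x))"
      using ddir_slice[OF s] by (simp add: fun_eq_iff)
    then show "periodic (ddir (axis i 1) (\<lambda>x. f (t, x) * g (t, x)))"
      using per_at_ddir[OF s p, of i] by (simp add: per_at_1)
  qed
  moreover have "ddir (axis i 1) (\<lambda>x. f (t, x) * g (t, x)) = (\<lambda>x. Dx i f (t, x) * g (t, x) + f (t, x) * Dx i g (t, x))"
    using ddir_slice[OF s] by (simp add: fun_eq_iff ddir_mult f g)
  moreover have "integral cell (\<lambda>x. Dx i f (t, x) * g (t, x) + f (t, x) * Dx i g (t, x))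
     = integral cell (\<lambda>x. Dx i f (t, x) * g (t, x)) + integral cell (\<lambda>x. f (t, x) * Dx i g (t, x))"
    using f g by (intro integral_add integrable_cell continuous_intros slice_cont smooth_ddir) auto
  ultimately show ?thesis by simp
qed

text \<open>A rapidly oscillating density acts on slow functions like its mean: it differs from the mean by the
  divergence of a field whose size is proportional to the period.\<close>

lemma integral_mult_oscillating_le:
  fixes G h :: "real \<times> (real^'d) \<Rightarrow> real"
  assumes G: "smooth G" "per_at \<rho> t G" "per_at 1 t G" "\<And>z. 0 \<le> G z" and h: "smooth h" "per_at 1 t h"
    and r: "0 < \<rho>" "\<rho> \<le> 1" and K: "\<And>x i. x \<in> cell \<Longrightarrow> \<bar>Dx i h (t, x)\<bar> \<le> K"
  shows "integral cell (\<lambda>x. h (t, x) * G (t, x))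
    \<le> integral cell (\<lambda>x. G (t, x)) * (integral cell (\<lambda>x. h (t, x)) + (real CARD('d))\<^sup>2 * \<rho> * K)"
proof -
  let ?I = "integral cell :: (real^'d \<Rightarrow> real) \<Rightarrow> real"
  define V where "V = adiv \<rho> coords G"
  let ?m = "?I (\<lambda>x. G (t, x))"
  have sV: "smooth (V l)" for l unfolding V_def by (rule smooth_adiv[OF G(1)])
  have pV: "per_at 1 t (V l)" for l unfolding V_def by (rule per_at_adiv[OF G(3)])
  have div: "(\<Sum>l\<in>UNIV. Dx l (V l) (t, x)) = G (t, x) - ?m" for x
    unfolding V_def using r by (subst div_adiv[OF _ G(1,2)]) (auto simp: avg_list_eq_integral G coords)
  have cont: "continuous_on UNIV (\<lambda>x. h (t, x))" "continuous_on UNIV (\<lambda>x. V l (t, x))"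
     "continuous_on UNIV (\<lambda>x. Dx l h (t, x))" "continuous_on UNIV (\<lambda>x. Dx l (V l) (t, x))" "continuous_on UNIV (\<lambda>x. G (t, x))" for l
    by (intro slice_cont smooth_ddir sV h G ex_Basis)+
  have "?I (\<lambda>x. h (t, x) * G (t, x)) = ?I (\<lambda>x. ?m * h (t, x) + (\<Sum>l\<in>UNIV. h (t, x) * Dx l (V l) (t, x)))"
    by (simp add: div algebra_simps flip: sum_distrib_left)
  also have "\<dots> = ?I (\<lambda>x. ?m * h (t, x)) + ?I (\<lambda>x. \<Sum>l\<in>UNIV. h (t, x) * Dx l (V l) (t, x))"
    by (rule integral_add) (intro integrable_cell continuous_intros cont)+
  also have "?I (\<lambda>x. \<Sum>l\<in>UNIV. h (t, x) * Dx l (V l) (t, x)) = (\<Sum>l\<in>UNIV. ?I (\<lambda>x. h (t, x) * Dx l (V l) (t, x)))"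
    by (rule integral_sum) (auto intro!: integrable_cell continuous_intros cont)
  also have "\<dots> \<le> (\<Sum>l\<in>(UNIV :: 'd set). K * (real CARD('d) * \<rho> * ?m))"
  proof (rule sum_mono)
    fix l :: 'd
    have K0: "0 \<le> K" using K[of 0 l] abs_ge_zero[of "Dx l h (t, 0)"]
      by (simp add: cell_def mem_box_cart del: sum_component)
    have "?I (\<lambda>x. h (t, x) * Dx l (V l) (t, x)) = - ?I (\<lambda>x. Dx l h (t, x) * V l (t, x))"
      by (rule integral_by_parts[OF h sV pV])
    also have "\<dots> = ?I (\<lambda>x. - (Dx l h (t, x) * V l (t, x)))" by simp
    also have "\<dots> \<le> ?I (\<lambda>x. K * \<bar>V l (t, x)\<bar>)"
    proof (rule integral_cell_le)
      fix x :: "real^'d" assume x: "x \<in> cell"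
      have "- (Dx l h (t, x) * V l (t, x)) \<le> \<bar>Dx l h (t, x)\<bar> * \<bar>V l (t, x)\<bar>"
        by (metis abs_ge_minus_self abs_mult)
      also have "\<dots> \<le> K * \<bar>V l (t, x)\<bar>" by (intro mult_right_mono K x) auto
      finally show "- (Dx l h (t, x) * V l (t, x)) \<le> K * \<bar>V l (t, x)\<bar>" .
    qed (intro continuous_intros cont)+
    also have "\<dots> = K * ?I (\<lambda>x. \<bar>V l (t, x)\<bar>)" by simp
    also have "\<dots> \<le> K * (real (length (coords :: 'd list)) * \<rho> * ?I (\<lambda>x. \<bar>G (t, x)\<bar>))"
      unfolding V_def using r by (intro mult_left_mono integral_abs_adiv_le G K0) auto
    finally show "?I (\<lambda>x. h (t, x) * Dx l (V l) (t, x)) \<le> K * (real CARD('d) * \<rho> * ?m)"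
      using G(4) by (simp add: coords)
  qed
  finally show ?thesis by (simp add: algebra_simps power2_eq_square)
qed

section \<open>Periods, means and antidivergence of the blob\<close>

context blob begin

lemma sin_shift_nat: assumes "m \<in> \<nat>" shows "(sin (pi * (y + m)))\<^sup>2 = (sin (pi * y))\<^sup>2"
proof -
  obtain n where m: "m = real n" using assms by (elim Nats_cases)
  have "sin (pi * m) = 0" unfolding m by (metis mult.commute sin_npi)
  moreover from this have "(cos (pi * m))\<^sup>2 = 1" using sin_cos_squared_add[of "pi * m"] by simp
  ultimately show ?thesis by (simp add: distrib_left sin_add power_mult_distrib)
qed

lemma yy_shift: "yy i (t, x + (m / lam) *\<^sub>R axis l 1) = yy i (t, x) + (if i = l then m else 0)"
  using lam by (auto simp: yy_def axis_def field_simps)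

text \<open>A shift by \<open>m / lam\<close> covers both periods in use: \<open>m = 1\<close> is
  the fine period of the blobs, and \<open>m = lam\<close> the period of the torus, which is where
  \<open>lam\<close> has to be a natural number.\<close>

lemma per_QQ: assumes "m \<in> \<nat>" shows "per_at (m / lam) t QQ"
proof -
  have "(sin (pi * yy i (t, x + (m / lam) *\<^sub>R axis l 1)))\<^sup>2 = (sin (pi * yy i (t, x)))\<^sup>2" for x i l
    by (simp add: yy_shift sin_shift_nat[OF assms])
  then show ?thesis by (simp add: per_at_def QQ_def)
qed

lemma per_gauss: "m \<in> \<nat> \<Longrightarrow> per_at (m / lam) t (gauss c)"
  using per_QQ[of m t] by (simp add: per_at_def gauss_def)

lemma sn_cs_shift: assumes "m \<in> \<nat>"
  shows "sn (t, x + (m / lam) *\<^sub>R axis l 1) = sn (t, x)" "cs (t, x + (m / lam) *\<^sub>R axis l 1) = cs (t, x)"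
proof -
  obtain n where n: "N * m = real n" using Nats_mult[OF N assms] by (elim Nats_cases)
  have "sn (t, x + (m / lam) *\<^sub>R axis l 1) = sn (t, x) \<and> cs (t, x + (m / lam) *\<^sub>R axis l 1) = cs (t, x)"
  proof (cases "l = k")
    case True
    have "q * (x + (m / lam) *\<^sub>R axis k 1) $ k = q * x $ k + q * m / lam"
      by (simp add: axis_def distrib_left)
    also have "q * m / lam = 2 * pi * real n" using lam n by (simp add: q_def)
    finally have *: "q * (x + (m / lam) *\<^sub>R axis k 1) $ k = q * x $ k + 2 * pi * real n" .
    have s: "sin (2 * pi * real n) = 0" "cos (2 * pi * real n) = 1"
      using sin_2npi[of n] cos_2npi[of n] by (simp_all add: mult_ac)
    show ?thesis unfolding True sn_def cs_def snd_conv * sin_add cos_add s by simp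
  qed (auto simp: sn_def cs_def axis_def)
  then show "sn (t, x + (m / lam) *\<^sub>R axis l 1) = sn (t, x)" "cs (t, x + (m / lam) *\<^sub>R axis l 1) = cs (t, x)" by auto
qed

lemma per_Phi: "m \<in> \<nat> \<Longrightarrow> per_at (m / lam) t Phi" and per_HH: "m \<in> \<nat> \<Longrightarrow> per_at (m / lam) t HH"
  using per_gauss[of m t] sn_cs_shift[of m t] by (auto simp: per_at_def Phi_def HH_def phi_def)

lemma lam_1: "lam / lam = 1" using lam by simp

lemma per1: "per_at 1 t (gauss c)" "per_at 1 t Phi" "per_at 1 t HH"
  using per_gauss[OF lam(2)] per_Phi[OF lam(2)] per_HH[OF lam(2)] unfolding lam_1 by auto

lemma per_lam: "per_at (1 / lam) t (gauss c)" "per_at (1 / lam) t HH"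
  using per_gauss[of 1] per_HH[of 1] by auto

lemma rho: "0 < 1 / lam" "1 / lam \<le> 1" using lam by auto

lemma exp_QQ_prod: "exp (- c * QQ z) = (\<Prod>i\<in>UNIV. exp (- c * (sin (pi * yy i z))\<^sup>2))"
proof -
  have "- c * QQ z = (\<Sum>i\<in>UNIV. - c * (sin (pi * yy i z))\<^sup>2)" unfolding QQ_def by (rule sum_distrib_left)
  then show ?thesis by (simp only: exp_sum finite)
qed

lemma yy_pair: "yy i (t, x) = lam * (x $ i - (if i = j then om * t else 0))"
  by (simp add: yy_def)

text \<open>The full average over one fine period is the same at all points, so it may be evaluated
  at the centre of the moving blob, where the time drops out of the Gaussian factors.\<close>

lemma blob_mean:
  assumes f: "smooth f" "per_at (1 / lam) t f" "per_at 1 t f" and h: "\<And>x. f (t, x) = (\<Prod>i\<in>UNIV. h i (x $ i))"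
    and m: "\<And>i. integral {0..1} (\<lambda>s. h i ((if i = j then om * t else 0) + s / lam)) = m i"
  shows "integral cell (\<lambda>x. f (t, x)) = (\<Prod>i\<in>UNIV. m i)"
proof -
  let ?x = "(\<chi> i. if i = j then om * t else 0) :: real^'d"
  have "integral cell (\<lambda>x. f (t, x)) = avg_list (1 / lam) coords f (t, ?x)"
    using avg_list_eq_integral[OF rho f coords(1)] by simp
  also have "\<dots> = (\<Prod>i\<in>UNIV. m i)"
    using avg_list_prod[of coords f t h "1 / lam" ?x, OF coords(2) h] m by (simp add: coords)
  finally show ?thesis .
qed

lemma integral_gauss: "integral cell (\<lambda>x. gauss c (t, x)) = gint c ^ CARD('d)"
proof -
  have "integral cell (\<lambda>x. gauss c (t, x)) = (\<Prod>i\<in>(UNIV::'d set). gint c)"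
    by (rule blob_mean[OF smooth_gauss per_lam(1) per1(1), where h="\<lambda>i y. exp (- c * (sin (pi * (lam * (y - (if i = j then om * t else 0)))))\<^sup>2)"])
       (use lam in \<open>auto simp: gint_def gauss_def exp_QQ_prod[unfolded mult_minus_left] yy_pair\<close>)
  then show ?thesis by simp
qed

text \<open>The square of \<open>phi\<close> is again a Gaussian of the same family, with doubled
  parameter; this explains the argument 2 mu^2 in \<open>MM\<close>.\<close>

lemma integral_HH: "integral cell (\<lambda>x. HH (t, x)) = 1"
proof -
  have phi2: "(phi z)\<^sup>2 = gauss (2 * \<mu>\<^sup>2) z" for z
    by (simp add: phi_def gauss_def power2_eq_square flip: exp_add)
  have s: "smooth (\<lambda>z. (phi z)\<^sup>2 * (sn z)\<^sup>2)" by (intro smooth_intros smooth_phi smooth_sn)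
  have p: "per_at r t (\<lambda>z. (phi z)\<^sup>2 * (sn z)\<^sup>2)" if "per_at r t HH" for r
    using that MM_pos by (simp add: per_at_def HH_def)
  let ?h = "\<lambda>i y. exp (- (2 * \<mu>\<^sup>2) * (sin (pi * (lam * (y - (if i = j then om * t else 0)))))\<^sup>2) * (if i = k then (sin (q * y))\<^sup>2 else 1)"
  have "integral cell (\<lambda>x. (phi (t, x))\<^sup>2 * (sn (t, x))\<^sup>2) = (\<Prod>i\<in>(UNIV::'d set). if i = k then gsint (2 * \<mu>\<^sup>2) N else gint (2 * \<mu>\<^sup>2))"
  proof (rule blob_mean[OF s p[OF per_lam(2)] p[OF per1(3)], where h="?h"])
    fix x show "(phi (t, x))\<^sup>2 * (sn (t, x))\<^sup>2 = (\<Prod>i\<in>UNIV. ?h i (x $ i))"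
      unfolding prod.distrib phi2 gauss_def exp_QQ_prod by (simp add: yy_pair sn_def)
  next
    fix i
    show "integral {0..1} (\<lambda>s. ?h i ((if i = j then om * t else 0) + s / lam)) = (if i = k then gsint (2 * \<mu>\<^sup>2) N else gint (2 * \<mu>\<^sup>2))"
      using jk lam by (auto simp: gsint_def gint_def q_def mult_ac)
  qed
  also have "\<dots> = MM"
    by (subst prod.remove[of _ k]) (auto simp: MM_def card_Diff_singleton mult.commute)
  finally show ?thesis using MM_pos by (simp add: HH_def)
qed

lemma gint_nonneg: "0 \<le> gint c"
  unfolding gint_def by (rule integral_nonneg) (auto intro!: integrable_continuous_interval continuous_intros)

lemma integral_gauss_le:
  assumes c: "c > 0" shows "integral cell (\<lambda>x. gauss (c * \<mu>\<^sup>2) (t, x)) \<le> (pi / sqrt c / \<mu>) ^ CARD('d)"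
proof -
  have "gint (c * \<mu>\<^sup>2) \<le> pi / sqrt (c * \<mu>\<^sup>2)" using c mu by (intro gint_le) auto
  also have "\<dots> = pi / sqrt c / \<mu>" using mu by (simp add: real_sqrt_mult)
  finally show ?thesis unfolding integral_gauss by (intro power_mono gint_nonneg)
qed

lemma MM_le_1: "MM \<le> 1"
proof -
  have g: "gint (2 * \<mu>\<^sup>2) \<le> 1"
  proof -
    have "gint (2 * \<mu>\<^sup>2) \<le> integral {0..1::real} (\<lambda>s. 1)"
      unfolding gint_def by (rule integral_le) (auto intro!: integrable_continuous_interval continuous_intros)
    then show ?thesis by simp
  qed
  have "MM \<le> 1 ^ (CARD('d) - 1) * 1"
    unfolding MM_def
  proof (intro mult_mono power_mono g gint_nonneg)
    show "gsint (2 * \<mu>\<^sup>2) N \<le> 1" using gsint_le_gint[of "2 * \<mu>\<^sup>2" N] g by linarith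
    have "0 \<le> exp (- 2 * pi\<^sup>2) / 4 / \<mu>" using mu by simp
    then show "0 \<le> gsint (2 * \<mu>\<^sup>2) N" using gsint_ge[OF mu] by linarith
  qed auto
  then show ?thesis by simp
qed

text \<open>A field with divergence \<open>HH - 1\<close>: the antidivergence subtracts the mean by
  itself, and the mean of \<open>HH\<close> is one.\<close>

definition VV :: "'d \<Rightarrow> real \<times> (real^'d) \<Rightarrow> real" where "VV = adiv (1 / lam) coords HH"

lemma smooth_VV: "smooth (VV l)" unfolding VV_def by (rule smooth_adiv[OF smooth_HH])
lemma per_VV: "per_at 1 t (VV l)" unfolding VV_def by (rule per_at_adiv[OF per1(3)])

lemma div_VV: "(\<Sum>l\<in>UNIV. Dx l (VV l) (t, x)) = HH (t, x) - 1"
  unfolding VV_def using rho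
  by (subst div_adiv[OF _ smooth_HH per_lam(2)]) (auto simp: avg_list_eq_integral smooth_HH per_lam per1 coords integral_HH)

text \<open>The antidivergence commutes with derivatives, so this field travels with the
  blob.\<close>

lemma Dt_VV: "Dt (VV l) z = - om * Dx j (VV l) z"
proof -
  have "Dt HH = (\<lambda>z. (- om) * Dx j HH z)" by (simp add: fun_eq_iff Dt_HH)
  then show ?thesis unfolding VV_def by (simp only: ddir_adiv[OF smooth_HH] et_Basis ex_Basis adiv_cmult)
qed

text \<open>The size is governed by the fine period times the mass of \<open>HH\<close>, which is
  one however concentrated the blob is. Smallness can therefore be arranged through
  \<open>lam\<close> before the concentration is chosen.\<close>

lemma integral_abs_VV: "integral cell (\<lambda>x. \<bar>VV l (t, x)\<bar>) \<le> real CARD('d) / lam"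
  using integral_abs_adiv_le[of "1 / lam" HH t coords l] rho integral_HH[of t] HH_nonneg
  by (simp add: VV_def smooth_HH per1 coords)

lemma abs_VV: "\<bar>VV l (t, x)\<bar> \<le> real CARD('d) / MM"
proof -
  have "\<bar>HH (t, x)\<bar> \<le> 1 / MM" for x
    using HH_le[of "(t, x)"] HH_nonneg[of "(t, x)"] divide_right_mono[OF EE_le_1[of "(t, x)"], of MM] MM_pos by simp
  then have "\<bar>VV l (t, x)\<bar> \<le> real CARD('d) * (1 / lam) * (1 / MM)"
    using abs_adiv_le[of "1 / lam" HH t "1 / MM" coords l x] rho by (simp add: VV_def smooth_HH coords)
  also have "\<dots> \<le> real CARD('d) * 1 * (1 / MM)" using rho MM_pos by (intro mult_mono) auto
  finally show ?thesis by simp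
qed

lemma smooth_EE: "smooth EE" unfolding EE_def by (rule smooth_gauss)

lemma integral_EE: "integral cell (\<lambda>x. EE (t, x)) \<le> (pi * sqrt 2 / \<mu>) ^ CARD('d)"
  using integral_gauss_le[of "1 / 2" t] by (simp add: EE_def real_sqrt_divide)

lemma integral_abs_Dx_HH:
  "integral cell (\<lambda>x. \<bar>Dx i HH (t, x)\<bar>) \<le> 8 * pi * lam * N / MM * integral cell (\<lambda>x. EE (t, x))"
proof -
  have "integral cell (\<lambda>x. \<bar>Dx i HH (t, x)\<bar>) \<le> integral cell (\<lambda>x. (8 * pi * lam * N / MM) * EE (t, x))"
    using abs_Dx_HH[of i] by (intro integral_cell_le continuous_intros slice_cont smooth_ddir smooth_HH smooth_EE) auto
  then show ?thesis by simp
qed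

text \<open>A derivative of \<open>HH\<close> costs a factor \<open>lam\<close>, which the fine
  period in the antidivergence gives back.\<close>

lemma integral_abs_Dx_VV:
  "integral cell (\<lambda>x. \<bar>Dx i (VV l) (t, x)\<bar>) \<le> 8 * pi * real CARD('d) * N / MM * integral cell (\<lambda>x. EE (t, x))"
proof -
  have "integral cell (\<lambda>x. \<bar>Dx i (VV l) (t, x)\<bar>) \<le> real CARD('d) * (1 / lam) * integral cell (\<lambda>x. \<bar>Dx i HH (t, x)\<bar>)"
    using integral_abs_adiv_le[of "1 / lam" "Dx i HH" t coords l] rho
    by (simp add: VV_def ddir_adiv smooth_HH smooth_ddir per_at_ddir per1 coords)
  also have "\<dots> \<le> real CARD('d) * (1 / lam) * (8 * pi * lam * N / MM * integral cell (\<lambda>x. EE (t, x)))"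
    using rho by (intro mult_left_mono integral_abs_Dx_HH) auto
  finally show ?thesis using lam by (simp add: mult_ac)
qed

end

subsection \<open>The perturbation and the new defect field\<close>

text \<open>An approximate solution with defect \<open>R\<close>. The error is kept as a divergence,
  because in the weak formulation the derivative moves to the test function and only the L^1 size of
  \<open>R\<close> counts. Smoothness is global, whereas equation and periodicity refer to times in
  [0,T].\<close>

definition solves :: "real \<Rightarrow> (real \<times> (real^'d) \<Rightarrow> real) \<Rightarrow> ('d \<Rightarrow> real \<times> (real^'d) \<Rightarrow> real) \<Rightarrow> ('d \<Rightarrow> real \<times> (real^'d) \<Rightarrow> real) \<Rightarrow> bool" where
  "solves T \<theta> u R \<longleftrightarrow> smooth \<theta> \<and> (\<forall>i. smooth (u i)) \<and> (\<forall>i. smooth (R i)) \<and>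
     (\<forall>t\<in>{0..T}. per_at 1 t \<theta> \<and> (\<forall>i. per_at 1 t (u i)) \<and> (\<forall>i. per_at 1 t (R i)) \<and>
       (\<forall>x. (\<Sum>i\<in>UNIV. Dx i (u i) (t, x)) = 0 \<and>
          Dt \<theta> (t, x) + (\<Sum>i\<in>UNIV. Dx i (\<lambda>z. u i z * \<theta> z) (t, x)) + \<theta> (t, x) / 2 - (\<Sum>i\<in>UNIV. Dx i (Dx i \<theta>) (t, x))
            = (\<Sum>i\<in>UNIV. Dx i (R i) (t, x))))"

text \<open>Periodicity is known only inside [0,T], so at an endpoint the two time derivatives are
  compared as one-sided ones; these are unique because [0,T] is nondegenerate.\<close>

lemma per_at_Dt:
  fixes s :: "real \<times> (real^'d) \<Rightarrow> real"
  assumes s: "smooth s" and p: "\<And>t. t \<in> {0..T} \<Longrightarrow> per_at 1 t s" and T: "0 < T" and t: "t \<in> {0..T}"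
  shows "per_at 1 t (Dt s)"
  unfolding per_at_def
proof (intro allI)
  fix x i
  have d: "((\<lambda>r. s (r, y)) has_real_derivative Dt s (t, y)) (at t within {0..T})" for y
  proof -
    have "((\<lambda>r. s ((0, y) + r *\<^sub>R et)) has_real_derivative Dt s ((0, y) + t *\<^sub>R et)) (at t within {0..T})"
      by (rule seg_has_field_derivative[OF s])
    then show ?thesis by simp
  qed
  have "((\<lambda>r. s (r, x)) has_real_derivative Dt s (t, x + 1 *\<^sub>R axis i 1)) (at t within {0..T})"
    by (rule has_field_derivative_transform_within[OF d[of "x + 1 *\<^sub>R axis i 1"] zero_less_one t]) (use p in \<open>auto simp: per_at_def\<close>)
  moreover have "at t within {0..T} \<noteq> bot" using t T by (simp add: trivial_limit_within islimpt_Icc)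
  ultimately show "Dt s (t, x + 1 *\<^sub>R axis i 1) = Dt s (t, x)"
    using d[of x] vector_derivative_unique_within
    unfolding has_real_derivative_iff_has_vector_derivative by blast
qed

locale perturbation = blob j k lam N om \<mu> for j k :: "'d::finite" and lam N om \<mu> :: real +
  fixes A B T :: real and a b f \<theta> :: "real \<times> (real^'d) \<Rightarrow> real" and u R :: "'d \<Rightarrow> real \<times> (real^'d) \<Rightarrow> real"
  assumes sa: "smooth a" and sb: "smooth b" and sf: "smooth f" and sol: "solves T \<theta> u R"
    and pa: "\<And>t. t \<in> {0..T} \<Longrightarrow> per_at 1 t a" and pb: "\<And>t. t \<in> {0..T} \<Longrightarrow> per_at 1 t b" and pf: "\<And>t. t \<in> {0..T} \<Longrightarrow> per_at 1 t f"
begin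

text \<open>The density perturbation is a \<open>k\<close>-derivative of this potential, so its time
  derivative and its damping are \<open>k\<close>-derivatives too and go directly into coordinate
  \<open>k\<close> of the defect. \<open>Xi\<close> is the stream function of the velocity
  perturbation.\<close>

definition ZZ :: "real \<times> (real^'d) \<Rightarrow> real" where "ZZ z = A * (a z * Phi z)"
definition Xi :: "real \<times> (real^'d) \<Rightarrow> real" where "Xi z = B * (b z * Phi z)"
definition th1 :: "real \<times> (real^'d) \<Rightarrow> real" where "th1 = Dx k ZZ"
definition ww :: "'d \<Rightarrow> real \<times> (real^'d) \<Rightarrow> real" where
  "ww i z = (if i = j then Dx k Xi z else if i = k then - Dx j Xi z else 0)"
definition divV :: "(real \<times> (real^'d) \<Rightarrow> real) \<Rightarrow> real \<times> (real^'d) \<Rightarrow> real" where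
  "divV s z = (\<Sum>i\<in>UNIV. Dx i (\<lambda>z. s z * VV i z) z)"
text \<open>\<open>divV f\<close> is \<open>f * (HH - 1)\<close> up to terms with derivatives of
  \<open>f\<close>, so this is the oscillation divided by the speed. Writing it as a divergence
  keeps its time derivative and damping in divergence form.\<close>

definition Qc :: "real \<times> (real^'d) \<Rightarrow> real" where "Qc z = (- (1 / om)) * divV f z"
definition th :: "real \<times> (real^'d) \<Rightarrow> real" where "th z = th1 z + Qc z"
definition GG :: "real \<times> (real^'d) \<Rightarrow> real" where "GG z = (\<Sum>l\<in>UNIV. Dx l f z * VV l z)"
text \<open>In coordinate \<open>j\<close> the product \<open>ww j * th1\<close> is close to
  \<open>- f * HH\<close>, so \<open>R j + f * (HH - 1) + ww j * th1\<close> leaves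
  \<open>R j - f\<close>. The terms with \<open>Dx j f * VV i\<close> and with \<open>1 / om\<close>
  are left over from the time derivative and the damping of \<open>Qc\<close>; the terms with
  \<open>ZZ\<close> are those of \<open>th1\<close>.\<close>

definition RR :: "'d \<Rightarrow> real \<times> (real^'d) \<Rightarrow> real" where
  "RR i z = R i z + (if i = j then GG z + f z * (HH z - 1) else 0) - Dx j f z * VV i z - (1 / om) * (Dt f z * VV i z)
     + (if i = k then Dt ZZ z + (1 / 2) * ZZ z else 0) - (1 / (2 * om)) * (f z * VV i z) - Dx i th z
     + u i z * th z + ww i z * \<theta> z + ww i z * th z"

lemma s\<theta>: "smooth \<theta>" and su: "smooth (u i)" and sR: "smooth (R i)"
  using sol by (auto simp: solves_def)
lemma sZ: "smooth ZZ" and sXi: "smooth Xi"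
  unfolding ZZ_def[abs_def] Xi_def[abs_def] by (intro smooth_intros sa sb smooth_Phi)+
lemma sth1: "smooth th1" unfolding th1_def by (simp add: smooth_ddir sZ)
lemma sww: "smooth (ww i)"
  unfolding ww_def[abs_def] using jk by (cases "i = j"; cases "i = k") (auto intro!: smooth_intros smooth_ddir sXi)
lemma sdivV: "smooth s \<Longrightarrow> smooth (divV s)"
  unfolding divV_def[abs_def] by (intro smooth_sum smooth_ddir smooth_mult smooth_VV ex_Basis)
lemma sQc: "smooth Qc" unfolding Qc_def[abs_def] by (intro smooth_mult smooth_const sdivV sf)
lemma sth: "smooth th" unfolding th_def[abs_def] by (intro smooth_add sth1 sQc)
lemma sGG: "smooth GG" unfolding GG_def[abs_def] by (intro smooth_intros smooth_ddir smooth_VV sf ex_Basis)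

lemma sif: "smooth (P :: real \<times> (real^'d) \<Rightarrow> real) \<Longrightarrow> smooth (\<lambda>z. if c then P z else 0)" by (cases c) auto

lemmas smooths = s\<theta> su sR sZ sXi sth1 sww sdivV sQc sth sGG sf sa sb smooth_VV smooth_HH smooth_Phi

lemma sRR: "smooth (RR i)"
  unfolding RR_def[abs_def] by (intro smooth_add smooth_diff smooth_mult smooth_const sif smooth_ddir smooths et_Basis ex_Basis)

lemma divV_eq: "smooth s \<Longrightarrow> divV s z = (\<Sum>i\<in>UNIV. Dx i s z * VV i z) + s z * (HH z - 1)"
proof -
  assume s: "smooth s"
  have "divV s z = (\<Sum>i\<in>UNIV. Dx i s z * VV i z + s z * Dx i (VV i) z)"
    unfolding divV_def by (simp add: ddir_mult s smooth_VV)
  also have "\<dots> = (\<Sum>i\<in>UNIV. Dx i s z * VV i z) + s z * (\<Sum>i\<in>UNIV. Dx i (VV i) z)"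
    by (simp add: sum.distrib sum_distrib_left)
  also have "(\<Sum>i\<in>UNIV. Dx i (VV i) z) = HH z - 1" using div_VV[of "fst z" "snd z"] by simp
  finally show ?thesis .
qed

lemma divV_f: "divV f z = GG z + f z * (HH z - 1)"
  by (simp add: divV_eq sf GG_def)

text \<open>The travelling blob turns the divergence of its own flux into a time derivative.\<close>

lemma Dt_Qc: "Dt Qc z = - (1 / om) * divV (Dt f) z + Dx j (\<lambda>z. GG z + f z * (HH z - 1)) z - divV (Dx j f) z"
proof -
  have sfV: "smooth (\<lambda>z. f z * VV i z)" for i by (intro smooth_mult smooths)
  have "Dt Qc z = (- (1 / om)) * (\<Sum>i\<in>UNIV. Dt (Dx i (\<lambda>z. f z * VV i z)) z)"
    unfolding Qc_def[abs_def] divV_def[abs_def]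
    by (subst ddir_cmult, intro smooth_sum smooth_ddir sfV ex_Basis, subst ddir_sum) (auto intro!: smooth_ddir sfV)
  also have "(\<Sum>i\<in>UNIV. Dt (Dx i (\<lambda>z. f z * VV i z)) z) = (\<Sum>i\<in>UNIV. Dx i (\<lambda>z. Dt f z * VV i z) z - om * (Dx j (Dx i (\<lambda>z. f z * VV i z)) z - Dx i (\<lambda>z. Dx j f z * VV i z) z))"
  proof (rule sum.cong[OF refl])
    fix i
    have "Dt (Dx i (\<lambda>z. f z * VV i z)) z = Dx i (Dt (\<lambda>z. f z * VV i z)) z"
      by (rule ddir_commute) (auto intro: sfV)
    also have "Dt (\<lambda>z. f z * VV i z) = (\<lambda>z. Dt f z * VV i z - om * (Dx j (\<lambda>z. f z * VV i z) z - Dx j f z * VV i z))"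
      by (simp add: fun_eq_iff ddir_mult smooths Dt_VV)
    also have "Dx i (\<lambda>z. Dt f z * VV i z - om * (Dx j (\<lambda>z. f z * VV i z) z - Dx j f z * VV i z)) z
       = Dx i (\<lambda>z. Dt f z * VV i z) z - om * (Dx i (Dx j (\<lambda>z. f z * VV i z)) z - Dx i (\<lambda>z. Dx j f z * VV i z) z)"
      by (subst ddir_diff, (intro smooth_intros smooth_ddir smooths ex_Basis et_Basis)+,
          subst ddir_cmult, (intro smooth_intros smooth_ddir smooths ex_Basis et_Basis)+,
          subst ddir_diff, (intro smooth_intros smooth_ddir smooths ex_Basis et_Basis)+) simp
    also have "Dx i (Dx j (\<lambda>z. f z * VV i z)) z = Dx j (Dx i (\<lambda>z. f z * VV i z)) z"
      by (rule ddir_commute) (auto intro: sfV)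
    finally show "Dt (Dx i (\<lambda>z. f z * VV i z)) z = Dx i (\<lambda>z. Dt f z * VV i z) z - om * (Dx j (Dx i (\<lambda>z. f z * VV i z)) z - Dx i (\<lambda>z. Dx j f z * VV i z) z)" .
  qed
  also have "\<dots> = divV (Dt f) z - om * ((\<Sum>i\<in>UNIV. Dx j (Dx i (\<lambda>z. f z * VV i z)) z) - divV (Dx j f) z)"
    by (simp add: sum_subtractf divV_def sum_distrib_left right_diff_distrib)
  also have "(\<Sum>i\<in>UNIV. Dx j (Dx i (\<lambda>z. f z * VV i z)) z) = Dx j (divV f) z"
    unfolding divV_def[abs_def] by (subst ddir_sum) (auto intro!: smooth_ddir sfV)
  also have "divV f = (\<lambda>z. GG z + f z * (HH z - 1))" by (simp add: fun_eq_iff divV_f)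
  finally show ?thesis using om by (simp add: field_simps)
qed

lemma div_ww: "(\<Sum>i\<in>UNIV. Dx i (ww i) z) = 0"
proof -
  have "Dx i (ww i) z = (if i = j then Dx j (Dx k Xi) z else 0) - (if i = k then Dx k (Dx j Xi) z else 0)" for i
    using jk by (cases "i = j"; cases "i = k") (auto simp: ww_def[abs_def] ddir_minus smooth_ddir sXi)
  then show ?thesis using ddir_commute[OF sXi, of "ex j" "ex k" z]
    by (simp add: sum_subtractf)
qed

lemma div_RR: "(\<Sum>i\<in>UNIV. Dx i (RR i) z) = (\<Sum>i\<in>UNIV. Dx i (R i) z) + Dt th z + (1 / 2) * th z - (\<Sum>i\<in>UNIV. Dx i (Dx i th) z)
   + (\<Sum>i\<in>UNIV. Dx i (\<lambda>z. u i z * th z) z) + (\<Sum>i\<in>UNIV. Dx i (\<lambda>z. ww i z * \<theta> z) z) + (\<Sum>i\<in>UNIV. Dx i (\<lambda>z. ww i z * th z) z)"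
proof -
  define P where "P z = GG z + f z * (HH z - 1)" for z
  define P' where "P' z = Dt ZZ z + (1 / 2) * ZZ z" for z
  have sP: "smooth P" "smooth P'" unfolding P_def[abs_def] P'_def[abs_def]
    by (intro smooth_add smooth_diff smooth_mult smooth_const smooth_ddir smooths et_Basis)+
  have "Dx i (RR i) z = Dx i (R i) z + (if i = j then Dx j P z else 0) - Dx i (\<lambda>z. Dx j f z * VV i z) z - (1 / om) * Dx i (\<lambda>z. Dt f z * VV i z) z
     + (if i = k then Dx k P' z else 0) - (1 / (2 * om)) * Dx i (\<lambda>z. f z * VV i z) z - Dx i (Dx i th) z
     + Dx i (\<lambda>z. u i z * th z) z + Dx i (\<lambda>z. ww i z * \<theta> z) z + Dx i (\<lambda>z. ww i z * th z) z" for i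
  proof -
    have if1: "Dx i (\<lambda>z. if i = j then P z else 0) z = (if i = j then Dx j P z else 0)" by auto
    have if2: "Dx i (\<lambda>z. if i = k then P' z else 0) z = (if i = k then Dx k P' z else 0)" by auto
    note sm = smooth_add smooth_diff smooth_mult smooth_const sif smooth_ddir smooths et_Basis ex_Basis sP
    have s1: "smooth (\<lambda>z. Dx j f z * VV i z)" "smooth (\<lambda>z. (1 / om) * (Dt f z * VV i z))" "smooth (\<lambda>z. (1 / (2 * om)) * (f z * VV i z))"
      "smooth (Dx i th)" "smooth (\<lambda>z. u i z * th z)" "smooth (\<lambda>z. ww i z * \<theta> z)" "smooth (\<lambda>z. ww i z * th z)"
      "smooth (\<lambda>z. if i = j then P z else 0)" "smooth (\<lambda>z. if i = k then P' z else 0)" "smooth (R i)"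
      "smooth (\<lambda>z. Dt f z * VV i z)" "smooth (\<lambda>z. f z * VV i z)"
      by (intro sm)+
    show ?thesis
      unfolding RR_def[abs_def] P_def[symmetric] P'_def[symmetric]
      by (simp only: ddir_add ddir_diff smooth_add smooth_diff s1 if1 if2 ddir_cmult)
  qed
  then have 1: "(\<Sum>i\<in>UNIV. Dx i (RR i) z) = (\<Sum>i\<in>UNIV. Dx i (R i) z) + Dx j P z - divV (Dx j f) z - (1 / om) * divV (Dt f) z
     + Dx k P' z - (1 / (2 * om)) * divV f z - (\<Sum>i\<in>UNIV. Dx i (Dx i th) z)
   + (\<Sum>i\<in>UNIV. Dx i (\<lambda>z. u i z * th z) z) + (\<Sum>i\<in>UNIV. Dx i (\<lambda>z. ww i z * \<theta> z) z) + (\<Sum>i\<in>UNIV. Dx i (\<lambda>z. ww i z * th z) z)"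
    by (simp add: sum.distrib sum_subtractf divV_def sum_distrib_left)
  \<comment> \<open>Commuting the \<open>k\<close>-derivative with the time derivative identifies
    the potential terms as the time derivative and the damping of \<open>th1\<close>.\<close>
  have "Dx k P' z = Dx k (Dt ZZ) z + (1 / 2) * Dx k ZZ z"
    unfolding P'_def[abs_def] by (subst ddir_add) (auto intro!: smooth_intros smooth_ddir smooths simp: ddir_cmult ddir_divide sZ)
  also have "Dx k (Dt ZZ) z = Dt th1 z"
    unfolding th1_def using ddir_commute[OF sZ, of "ex k" et z] by simp
  finally have 2: "Dx k P' z = Dt th1 z + (1 / 2) * th1 z" by (simp add: th1_def)
  have 3: "Dt Qc z = - (1 / om) * divV (Dt f) z + Dx j P z - divV (Dx j f) z"
    using Dt_Qc[of z] unfolding P_def[abs_def] .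
  have 4: "Dt th z = Dt th1 z + Dt Qc z" unfolding th_def[abs_def] by (rule ddir_add[OF sth1 sQc])
  have 5: "(1 / (2 * om)) * divV f z = - (1 / 2) * Qc z" by (simp add: Qc_def)
  show ?thesis unfolding 1 2 5 4 3 th_def by (simp add: algebra_simps)
qed

lemma pers:
  assumes t: "t \<in> {0..T}"
  shows "per_at 1 t ZZ" "per_at 1 t Xi" "per_at 1 t (ww i)" "per_at 1 t Qc" "per_at 1 t th" "per_at 1 t (Dx i f)" "per_at 1 t GG"
proof -
  have ZX: "per_at 1 t ZZ" "per_at 1 t Xi" using pa[OF t] pb[OF t] per1(2)[of t] by (simp_all add: per_at_def ZZ_def Xi_def)
  then show "per_at 1 t ZZ" "per_at 1 t Xi" by auto
  show "per_at 1 t (ww i)" using per_at_ddir[OF sXi ZX(2)] by (simp add: per_at_def ww_def)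
  show pDf: "per_at 1 t (Dx i f)" for i by (rule per_at_ddir[OF sf pf[OF t]])
  show G: "per_at 1 t GG" using pDf per_VV[of t] by (simp add: per_at_def GG_def)
  show Q: "per_at 1 t Qc" using G pf[OF t] per1(3)[of t] by (simp add: per_at_def Qc_def divV_f)
  have "per_at 1 t th1" unfolding th1_def by (rule per_at_ddir[OF sZ ZX(1)])
  with Q show "per_at 1 t th" by (simp add: per_at_def th_def)
qed

lemma new_solves: assumes T: "0 < T" shows "solves T (\<lambda>z. \<theta> z + th z) (\<lambda>i z. u i z + ww i z) RR"
  unfolding solves_def
proof (intro conjI allI ballI)
  show "smooth (\<lambda>z. \<theta> z + th z)" "smooth (\<lambda>z. u i z + ww i z)" "smooth (RR i)" for i
    by (intro smooth_add smooths sRR)+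
  fix t assume t: "t \<in> {0..T}"
  have po: "per_at 1 t \<theta>" "per_at 1 t (u i)" "per_at 1 t (R i)" for i using sol t by (auto simp: solves_def)
  note pe = pers[OF t]
  show "per_at 1 t (\<lambda>z. \<theta> z + th z)" using po pe by (simp add: per_at_def)
  show "per_at 1 t (\<lambda>z. u i z + ww i z)" for i using po pe by (simp add: per_at_def)
  show "per_at 1 t (RR i)" for i
    using po pe(1,3,7) pe(5) pf[OF t] per1(3)[of t] per_VV[of t] per_at_Dt[OF sf pf T t] per_at_Dt[OF sZ pers(1) T t]
      per_at_ddir[OF sth pe(5), of i] per_at_ddir[OF sf pf[OF t], of j]
    by (simp add: per_at_def RR_def cong: if_cong)
  fix x
  have eq: "(\<Sum>i\<in>UNIV. Dx i (u i) (t, x)) = 0"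
     "Dt \<theta> (t, x) + (\<Sum>i\<in>UNIV. Dx i (\<lambda>z. u i z * \<theta> z) (t, x)) + \<theta> (t, x) / 2 - (\<Sum>i\<in>UNIV. Dx i (Dx i \<theta>) (t, x))
            = (\<Sum>i\<in>UNIV. Dx i (R i) (t, x))"
    using sol t by (auto simp: solves_def)
  show "(\<Sum>i\<in>UNIV. Dx i (\<lambda>z. u i z + ww i z) (t, x)) = 0"
    using eq(1) div_ww[of "(t, x)"] by (simp add: ddir_add smooths sum.distrib)
  have 1: "Dx i (\<lambda>z. (u i z + ww i z) * (\<theta> z + th z)) (t, x) = Dx i (\<lambda>z. u i z * \<theta> z) (t, x) + Dx i (\<lambda>z. u i z * th z) (t, x)
     + Dx i (\<lambda>z. ww i z * \<theta> z) (t, x) + Dx i (\<lambda>z. ww i z * th z) (t, x)" for i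
    by (simp only: ddir_mult ddir_add smooth_add smooths) (simp add: algebra_simps)
  have 2: "Dx i (Dx i (\<lambda>z. \<theta> z + th z)) (t, x) = Dx i (Dx i \<theta>) (t, x) + Dx i (Dx i th) (t, x)" for i
  proof -
    have "Dx i (\<lambda>z. \<theta> z + th z) = (\<lambda>z. Dx i \<theta> z + Dx i th z)" by (simp add: fun_eq_iff ddir_add smooths)
    then show ?thesis by (simp add: ddir_add smooth_ddir smooths)
  qed
  have 3: "Dt (\<lambda>z. \<theta> z + th z) (t, x) = Dt \<theta> (t, x) + Dt th (t, x)" by (simp add: ddir_add smooths)
  show "Dt (\<lambda>z. \<theta> z + th z) (t, x) + (\<Sum>i\<in>UNIV. Dx i (\<lambda>z. (u i z + ww i z) * (\<theta> z + th z)) (t, x)) + (\<theta> (t, x) + th (t, x)) / 2 -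
    (\<Sum>i\<in>UNIV. Dx i (Dx i (\<lambda>z. \<theta> z + th z)) (t, x)) = (\<Sum>i\<in>UNIV. Dx i (RR i) (t, x))"
    unfolding div_RR 1 2 3 sum.distrib eq(2)[symmetric] by (simp add: algebra_simps add_divide_distrib)
qed

text \<open>The time derivatives occurring in \<open>RR\<close> are those of \<open>ZZ\<close> and
  \<open>f\<close>, which is why \<open>a\<close> and \<open>f\<close> have to vanish together with
  their first time derivatives. Spatial derivatives vanish by themselves, as the functions are zero
  on the whole slice.\<close>

lemma vanish:
  assumes g: "\<And>x. a (t, x) = 0" "\<And>x. b (t, x) = 0" "\<And>x. f (t, x) = 0" "\<And>x. Dt a (t, x) = 0" "\<And>x. Dt f (t, x) = 0"
    and R0: "\<And>x. R i (t, x) = 0"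
  shows "th (t, x) = 0" "ww l (t, x) = 0" "RR i (t, x) = 0"
proof -
  have Z0: "ZZ (t, x) = 0" "Xi (t, x) = 0" for x by (simp_all add: ZZ_def Xi_def g)
  note D = Dx_zero_slice[OF sZ Z0(1)] Dx_zero_slice[OF sXi Z0(2)] Dx_zero_slice[OF sf g(3)]
  have G0: "GG (t, x) = 0" for x by (simp add: GG_def D)
  have th0: "th (t, x) = 0" for x by (simp add: th_def th1_def D Qc_def divV_f G0 g)
  have w0: "ww l (t, x) = 0" for l x by (simp add: ww_def D)
  have DtZ: "Dt ZZ (t, x) = 0"
    unfolding ZZ_def[abs_def] by (simp add: ddir_cmult smooth_mult smooths ddir_mult g)
  show "th (t, x) = 0" "ww l (t, x) = 0" by (rule th0 w0)+
  show "RR i (t, x) = 0" using jk by (simp add: RR_def R0 G0 g D DtZ Z0 th0 w0 Dx_zero_slice[OF sth th0])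
qed

end

subsection \<open>Estimates for one perturbation step\<close>

text \<open>\<open>A * B * MM = 1\<close> normalises the product of the amplitudes against the mean
  of the squared blob, and \<open>a z * b z = - f z\<close> puts the defect into it. The common
  bound \<open>K\<close> concerns slow functions, so it can be fixed before the fast
  parameters.\<close>

locale estimates = perturbation j k lam N om \<mu> A B T a b f \<theta> u R
  for j k :: "'d::finite" and lam N om \<mu> A B T :: real and a b f \<theta> :: "real \<times> (real^'d) \<Rightarrow> real"
    and u R :: "'d \<Rightarrow> real \<times> (real^'d) \<Rightarrow> real" +
  fixes K :: real
  assumes T: "0 < T" and om1: "1 \<le> om" and AB: "0 < A" "0 < B" "A * B * MM = 1" and ab: "\<And>z. a z * b z = - f z"
    and ba: "\<And>t x. t \<in> {0..T} \<Longrightarrow> x \<in> cell \<Longrightarrow> \<bar>a (t, x)\<bar> \<le> K \<and> (\<forall>i. \<bar>Dx i a (t, x)\<bar> \<le> K) \<and> (\<forall>l i. \<bar>Dx l (Dx i a) (t, x)\<bar> \<le> K) \<and> \<bar>Dt a (t, x)\<bar> \<le> K"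
    and bb: "\<And>t x. t \<in> {0..T} \<Longrightarrow> x \<in> cell \<Longrightarrow> \<bar>b (t, x)\<bar> \<le> K \<and> (\<forall>i. \<bar>Dx i b (t, x)\<bar> \<le> K) \<and> (\<forall>l i. \<bar>Dx l (Dx i b) (t, x)\<bar> \<le> K)"
    and bf: "\<And>t x. t \<in> {0..T} \<Longrightarrow> x \<in> cell \<Longrightarrow> \<bar>f (t, x)\<bar> \<le> K \<and> (\<forall>i. \<bar>Dx i f (t, x)\<bar> \<le> K) \<and> (\<forall>l i. \<bar>Dx l (Dx i f) (t, x)\<bar> \<le> K) \<and> \<bar>Dt f (t, x)\<bar> \<le> K"
    and bu: "\<And>t x. t \<in> {0..T} \<Longrightarrow> x \<in> cell \<Longrightarrow> \<bar>\<theta> (t, x)\<bar> \<le> K \<and> (\<forall>i. \<bar>u i (t, x)\<bar> \<le> K)"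
begin

lemma abs_mult_le: "\<bar>x\<bar> \<le> p \<Longrightarrow> \<bar>y\<bar> \<le> q \<Longrightarrow> \<bar>x * y\<bar> \<le> p * q" for x y p q :: real
  unfolding abs_mult by (intro mult_mono) auto

lemma abs_add_le: "\<bar>x\<bar> \<le> p \<Longrightarrow> \<bar>y\<bar> \<le> p \<Longrightarrow> \<bar>x + y\<bar> \<le> 2 * p" for x y p :: real
  by linarith

lemma K0: "0 \<le> K"
proof -
  have "(0::real^'d) \<in> cell" by (simp add: cell_def mem_box_cart del: sum_component)
  then show ?thesis using ba[of 0 0] T abs_ge_zero[of "a (0, 0)"] by fastforce
qed

context
  fixes s :: "real \<times> (real^'d) \<Rightarrow> real" and z
  assumes s: "smooth s" and b0: "\<bar>s z\<bar> \<le> K" and b1: "\<And>i. \<bar>Dx i s z\<bar> \<le> K"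
begin

lemma Dx_sPhi: "Dx i (\<lambda>z. s z * Phi z) z = Dx i s z * Phi z + s z * Dx i Phi z"
  by (rule ddir_mult[OF s smooth_Phi])

text \<open>A derivative on the slow factor leaves \<open>Phi\<close>, which is already smaller by
  1/N; by \<open>\<mu> \<ge> 1\<close> this is relaxed to the common form with
  \<open>\<mu> / N\<close>.\<close>

lemma sPhi_lower: "\<bar>Dx i s z * Phi z\<bar> \<le> K * (\<mu> / N * EE z)"
proof -
  have "EE z / N \<le> \<mu> / N * EE z" using mu N1 EE_pos[of z] by (simp add: divide_right_mono)
  then show ?thesis using abs_mult_le[OF b1[of i] abs_Phi[of z]] mult_left_mono[OF _ K0] by fastforce
qed

lemma Dx_k_sPhi: "\<bar>Dx k (\<lambda>z. s z * Phi z) z - s z * (phi z * sn z)\<bar> \<le> 2 * K * (\<mu> / N) * EE z"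
proof -
  have "Dx k (\<lambda>z. s z * Phi z) z - s z * (phi z * sn z) = Dx k s z * Phi z + s z * (Dx k Phi z - phi z * sn z)"
    by (simp add: Dx_sPhi algebra_simps)
  then show ?thesis using abs_add_le[OF sPhi_lower[of k] abs_mult_le[OF b0 Dx_k_Phi[of z]]] by simp
qed

lemma Dx_ne_sPhi: "i \<noteq> k \<Longrightarrow> \<bar>Dx i (\<lambda>z. s z * Phi z) z\<bar> \<le> 2 * K * (\<mu> / N) * EE z"
  using abs_add_le[OF sPhi_lower[of i] abs_mult_le[OF b0 Dx_ne_Phi[of i z]]] by (simp add: Dx_sPhi)

lemma muN: "\<mu> / N \<le> 1" using mu N1 by simp

lemma abs_Dx_sPhi: "\<bar>Dx i (\<lambda>z. s z * Phi z) z\<bar> \<le> 3 * K * EE z"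
proof -
  have "K * (\<mu> / N * EE z) \<le> K * (1 * EE z)" using K0 muN EE_pos[of z] by (intro mult_left_mono mult_right_mono) auto
  then show ?thesis using sPhi_lower[of i] abs_mult_le[OF b0 abs_Dx_Phi[of i z]] by (simp add: Dx_sPhi algebra_simps)
qed

text \<open>The part with the derivative on \<open>s\<close> is of order 1/N and is relaxed to the
  size of the other part, using that \<open>om * \<mu>\<close> is at least 1.\<close>

lemma abs_Dt_sPhi: assumes "\<bar>Dt s z\<bar> \<le> K" shows "\<bar>Dt (\<lambda>z. s z * Phi z) z\<bar> \<le> 2 * K * (om * \<mu> / N) * EE z"
proof -
  have "1 \<le> om * \<mu>" using om1 mu mult_mono[of 1 om 1 \<mu>] by simp
  then have "EE z / N \<le> om * \<mu> / N * EE z" using N1 EE_pos[of z] by (simp add: divide_right_mono)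
  then have "\<bar>Dt s z * Phi z\<bar> \<le> K * (om * \<mu> / N * EE z)"
    using abs_mult_le[OF assms abs_Phi[of z]] mult_left_mono[OF _ K0] by fastforce
  then show ?thesis using abs_add_le[OF _ abs_mult_le[OF b0 abs_Dt_Phi[of z]]] by (simp add: ddir_mult[OF s smooth_Phi] mult.assoc)
qed

text \<open>5 = 1 + 2 + 2 collects the terms with at least one derivative on \<open>s\<close>;
  \<open>9 * pi * lam\<close> is the second derivative of \<open>Phi\<close>.\<close>

lemma abs_Dxx_sPhi: assumes b2: "\<bar>Dx l (Dx i s) z\<bar> \<le> K"
  shows "\<bar>Dx l (Dx i (\<lambda>z. s z * Phi z)) z\<bar> \<le> (5 + 9 * pi * lam) * K * N * EE z"
proof -
  have "Dx i (\<lambda>z. s z * Phi z) = (\<lambda>z. Dx i s z * Phi z + s z * Dx i Phi z)"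
    by (simp add: fun_eq_iff ddir_mult[OF s smooth_Phi])
  then have eq: "Dx l (Dx i (\<lambda>z. s z * Phi z)) z = Dx l (Dx i s) z * Phi z + Dx i s z * Dx l Phi z + Dx l s z * Dx i Phi z + s z * Dx l (Dx i Phi) z"
    by (simp add: ddir_add ddir_mult smooth_mult smooth_ddir s smooth_Phi)
  have E0: "0 \<le> K * EE z" using K0 EE_pos[of z] by simp
  have "K * EE z / N \<le> K * EE z * N"
  proof -
    have "K * EE z / N \<le> K * EE z / 1" using E0 N1 by (intro divide_left_mono) auto
    also have "\<dots> \<le> K * EE z * N" using E0 N1 mult_left_mono[OF N1 E0] by simp
    finally show ?thesis .
  qed
  then have 1: "\<bar>Dx l (Dx i s) z * Phi z\<bar> \<le> K * EE z * N" using abs_mult_le[OF b2 abs_Phi[of z]] by simp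
  have 2: "\<bar>Dx m s z * Dx n Phi z\<bar> \<le> 2 * (K * EE z * N)" for m n
    using abs_mult_le[OF b1[of m] abs_Dx_Phi[of n z]] mult_left_mono[OF N1 E0] by simp
  have 3: "\<bar>s z * Dx l (Dx i Phi) z\<bar> \<le> 9 * pi * lam * (K * EE z * N)"
    using abs_mult_le[OF b0 abs_Dxx_Phi[of l i z]] by (simp add: mult_ac)
  have "(5 + 9 * pi * lam) * K * N * EE z = K * EE z * N + 2 * (K * EE z * N) + 2 * (K * EE z * N) + 9 * pi * lam * (K * EE z * N)"
    by (simp add: algebra_simps)
  then show ?thesis unfolding eq using 1 2[of i l] 2[of l i] 3 by linarith
qed

end

text \<open>The part of the new defect that must become small: \<open>RR\<close> is \<open>R\<close>
  with \<open>f\<close> subtracted in coordinate \<open>j\<close>, plus \<open>SS\<close>.\<close>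

definition SS :: "'d \<Rightarrow> real \<times> (real^'d) \<Rightarrow> real" where
  "SS i z = RR i z - R i z + (if i = j then f z else 0)"

definition C1 :: real where "C1 = 5 + 9 * pi * lam"

context
  fixes t :: real and x :: "real^'d" assumes t: "t \<in> {0..T}" and x: "x \<in> cell"
begin

lemma ba': "\<bar>a (t, x)\<bar> \<le> K" "\<bar>Dx i a (t, x)\<bar> \<le> K" "\<bar>Dx l (Dx i a) (t, x)\<bar> \<le> K" "\<bar>Dt a (t, x)\<bar> \<le> K"
  and bb': "\<bar>b (t, x)\<bar> \<le> K" "\<bar>Dx i b (t, x)\<bar> \<le> K" "\<bar>Dx l (Dx i b) (t, x)\<bar> \<le> K"
  and bf': "\<bar>f (t, x)\<bar> \<le> K" "\<bar>Dx i f (t, x)\<bar> \<le> K" "\<bar>Dx l (Dx i f) (t, x)\<bar> \<le> K" "\<bar>Dt f (t, x)\<bar> \<le> K"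
  and bu': "\<bar>\<theta> (t, x)\<bar> \<le> K" "\<bar>u i (t, x)\<bar> \<le> K"
  using ba[OF t x] bb[OF t x] bf[OF t x] bu[OF t x] by auto

lemma saP: "smooth (\<lambda>z. a z * Phi z)" and sbP: "smooth (\<lambda>z. b z * Phi z)"
  by (intro smooth_mult sa sb smooth_Phi)+

lemma Dx_ZZ: "ddir v ZZ z = A * ddir v (\<lambda>z. a z * Phi z) z" and Dx_Xi: "ddir v Xi z = B * ddir v (\<lambda>z. b z * Phi z) z"
  unfolding ZZ_def[abs_def] Xi_def[abs_def] by (rule ddir_cmult saP sbP)+

lemma Dxx_ZZ: "Dx l (Dx i ZZ) z = A * Dx l (Dx i (\<lambda>z. a z * Phi z)) z" and Dxx_Xi: "Dx l (Dx i Xi) z = B * Dx l (Dx i (\<lambda>z. b z * Phi z)) z"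
proof -
  have "Dx i ZZ = (\<lambda>z. A * Dx i (\<lambda>z. a z * Phi z) z)" "Dx i Xi = (\<lambda>z. B * Dx i (\<lambda>z. b z * Phi z) z)" by (simp_all add: fun_eq_iff Dx_ZZ Dx_Xi)
  then show "Dx l (Dx i ZZ) z = A * Dx l (Dx i (\<lambda>z. a z * Phi z)) z" "Dx l (Dx i Xi) z = B * Dx l (Dx i (\<lambda>z. b z * Phi z)) z"
    by (simp_all add: ddir_cmult smooth_ddir saP sbP)
qed

text \<open>The natural bound of order 1/N is relaxed to the size of \<open>Dt ZZ\<close>, so that
  both can share one term in \<open>abs_SS\<close>.\<close>

lemma abs_ZZ: "\<bar>ZZ (t, x)\<bar> \<le> A * (K * (om * \<mu> / N) * EE (t, x))"
proof -
  have "1 \<le> om * \<mu>" using om1 mu mult_mono[of 1 om 1 \<mu>] by simp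
  then have "EE (t, x) / N \<le> om * \<mu> / N * EE (t, x)" using N1 EE_pos[of "(t, x)"] by (simp add: divide_right_mono)
  then have "\<bar>a (t, x) * Phi (t, x)\<bar> \<le> K * (om * \<mu> / N * EE (t, x))"
    using abs_mult_le[OF ba'(1) abs_Phi[of "(t, x)"]] mult_left_mono[OF _ K0] by fastforce
  from abs_mult_le[of A A, OF _ this] show ?thesis using AB by (simp add: ZZ_def mult.assoc)
qed

lemma abs_Dt_ZZ: "\<bar>Dt ZZ (t, x)\<bar> \<le> A * (2 * K * (om * \<mu> / N) * EE (t, x))"
  using abs_mult_le[of A A, OF _ abs_Dt_sPhi[OF sa ba'(1) ba'(2) ba'(4)]] AB by (simp add: Dx_ZZ)

lemma abs_th1: "\<bar>th1 (t, x)\<bar> \<le> A * (3 * K * EE (t, x))"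
  using abs_Dx_sPhi[OF sa ba'(1) ba'(2), of k] AB by (simp add: th1_def Dx_ZZ abs_mult mult_left_mono)

lemma th1_main: "\<bar>th1 (t, x) - A * (a (t, x) * (phi (t, x) * sn (t, x)))\<bar> \<le> A * (2 * K * (\<mu> / N) * EE (t, x))"
  using mult_left_mono[OF Dx_k_sPhi[OF sa ba'(1) ba'(2)], of A] AB
  by (simp add: th1_def Dx_ZZ abs_mult right_diff_distrib[symmetric])

lemma abs_Dx_th1: "\<bar>Dx i th1 (t, x)\<bar> \<le> A * (C1 * K * N * EE (t, x))"
  using abs_Dxx_sPhi[OF sa ba'(1) ba'(2) ba'(3), of i k] AB by (simp add: th1_def Dxx_ZZ abs_mult mult_left_mono C1_def)

lemma abs_ww: "\<bar>ww i (t, x)\<bar> \<le> B * (3 * K * EE (t, x))"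
  using abs_Dx_sPhi[OF sb bb'(1) bb'(2), of k] abs_Dx_sPhi[OF sb bb'(1) bb'(2), of j] AB K0 EE_pos[of "(t, x)"]
  by (auto simp: ww_def Dx_Xi abs_mult mult_left_mono)

lemma ww_main: "\<bar>ww j (t, x) - B * (b (t, x) * (phi (t, x) * sn (t, x)))\<bar> \<le> B * (2 * K * (\<mu> / N) * EE (t, x))"
  using mult_left_mono[OF Dx_k_sPhi[OF sb bb'(1) bb'(2)], of B] AB
  by (simp add: ww_def Dx_Xi abs_mult right_diff_distrib[symmetric])

lemma ww_ne: assumes "i \<noteq> j" shows "\<bar>ww i (t, x)\<bar> \<le> B * (2 * K * (\<mu> / N) * EE (t, x))"
proof -
  have "0 \<le> B * (2 * K * (\<mu> / N) * EE (t, x))" using AB K0 EE_pos[of "(t, x)"] mu N1 by simp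
  then show ?thesis using assms mult_left_mono[OF Dx_ne_sPhi[OF sb bb'(1) bb'(2) jk], of B] AB
    by (auto simp: ww_def Dx_Xi abs_mult)
qed

lemma Dx_ww: "Dx l (ww i) (t, x) = (if i = j then Dx l (Dx k Xi) (t, x) else if i = k then - Dx l (Dx j Xi) (t, x) else 0)"
  using jk by (cases "i = j"; cases "i = k") (auto simp: ww_def[abs_def] ddir_minus smooth_ddir sXi)

lemma abs_Dx_ww: "\<bar>Dx l (ww i) (t, x)\<bar> \<le> B * (C1 * K * N * EE (t, x))"
proof -
  have "0 \<le> C1" using lam by (simp add: C1_def)
  then show ?thesis
    using abs_Dxx_sPhi[OF sb bb'(1) bb'(2) bb'(3), of l k] abs_Dxx_sPhi[OF sb bb'(1) bb'(2) bb'(3), of l j] AB K0 EE_pos[of "(t, x)"] N1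
    by (auto simp: Dx_ww Dxx_Xi abs_mult mult_left_mono C1_def)
qed

lemma EE_sq: "EE (t, x) * EE (t, x) \<le> EE (t, x)"
  using EE_le_1[of "(t, x)"] EE_pos[of "(t, x)"] by (simp add: mult_left_le)

text \<open>The leading part of the product of the two perturbations is exactly the blob-modulated defect.\<close>

lemma th1_ww: "\<bar>ww i (t, x) * th1 (t, x) + (if i = j then f (t, x) * HH (t, x) else 0)\<bar> \<le> 12 * A * B * K\<^sup>2 * (\<mu> / N) * EE (t, x)"
proof -
  let ?z = "(t, x)"
  let ?m = "phi ?z * sn ?z"
  let ?E = "EE ?z"
  have E2: "c * (?E * ?E) \<le> c * ?E" if "0 \<le> c" for c using EE_sq that by (rule mult_left_mono)
  have lin: "c * y \<le> c' * w" if "y \<le> w" "0 \<le> w" "0 \<le> c" "c \<le> c'" for y w c c' :: real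
    using mult_left_mono[OF that(1,3)] mult_right_mono[OF that(4,2)] by linarith
  have c0: "0 \<le> A * B * K\<^sup>2 * (\<mu> / N)" using AB mu N1 by simp
  show ?thesis
  proof (cases "i = j")
    case True
    have HHm: "f ?z * HH ?z = - (A * (a ?z * ?m)) * (B * (b ?z * ?m))"
    proof -
      have "1 / MM = A * B" using AB MM_pos by (simp add: field_simps)
      moreover have "HH ?z = (1 / MM) * (?m * ?m)" by (simp add: HH_def power2_eq_square)
      ultimately have "HH ?z = A * B * (?m * ?m)" by simp
      moreover have "f ?z = - (a ?z * b ?z)" by (simp add: ab)
      ultimately show ?thesis by simp
    qed
    \<comment> \<open>The difference of products is split as x0 (y - y0) + (x - x0) y, with x0 and
      y0 the leading parts of \<open>ww j\<close> and \<open>th1\<close>.\<close>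
    have "ww i ?z * th1 ?z + f ?z * HH ?z = (B * (b ?z * ?m)) * (th1 ?z - A * (a ?z * ?m)) + (ww j ?z - B * (b ?z * ?m)) * th1 ?z"
      unfolding HHm True by (simp add: algebra_simps)
    moreover have "\<bar>(B * (b ?z * ?m)) * (th1 ?z - A * (a ?z * ?m))\<bar> \<le> (B * (K * ?E)) * (A * (2 * K * (\<mu> / N) * ?E))"
      by (rule abs_mult_le[OF abs_mult_le[OF _ abs_mult_le[OF bb'(1) abs_phi_sn]] th1_main]) (use AB in auto)
    moreover have "\<bar>(ww j ?z - B * (b ?z * ?m)) * th1 ?z\<bar> \<le> (B * (2 * K * (\<mu> / N) * ?E)) * (A * (3 * K * ?E))"
      by (rule abs_mult_le[OF ww_main abs_th1])
    moreover have "(B * (K * ?E)) * (A * (2 * K * (\<mu> / N) * ?E)) + (B * (2 * K * (\<mu> / N) * ?E)) * (A * (3 * K * ?E)) = 8 * ((A * B * K\<^sup>2 * (\<mu> / N)) * (?E * ?E))"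
      by (simp add: power2_eq_square algebra_simps)
    ultimately have "\<bar>ww i ?z * th1 ?z + f ?z * HH ?z\<bar> \<le> 8 * ((A * B * K\<^sup>2 * (\<mu> / N)) * (?E * ?E))" by linarith
    \<comment> \<open>One factor \<open>EE\<close> is dropped and 8 is enlarged to 12, which gives
      both cases the same bound.\<close>
    also have "\<dots> \<le> 12 * ((A * B * K\<^sup>2 * (\<mu> / N)) * ?E)"
      by (rule lin[OF E2[OF c0] mult_nonneg_nonneg[OF c0 less_imp_le[OF EE_pos[of ?z]]]]) simp_all
    finally show ?thesis using True by (simp add: mult_ac)
  next
    case False
    have "\<bar>ww i ?z * th1 ?z\<bar> \<le> (B * (2 * K * (\<mu> / N) * ?E)) * (A * (3 * K * ?E))"
      by (rule abs_mult_le[OF ww_ne[OF False] abs_th1])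
    also have "\<dots> = 6 * ((A * B * K\<^sup>2 * (\<mu> / N)) * (?E * ?E))" by (simp add: power2_eq_square)
    also have "\<dots> \<le> 12 * ((A * B * K\<^sup>2 * (\<mu> / N)) * ?E)"
      by (rule lin[OF E2[OF c0] mult_nonneg_nonneg[OF c0 less_imp_le[OF EE_pos[of ?z]]]]) simp_all
    finally show ?thesis using False by (simp add: mult_ac)
  qed
qed

lemma abs_Qc: "\<bar>Qc (t, x)\<bar> \<le> K / om * ((\<Sum>l\<in>UNIV. \<bar>VV l (t, x)\<bar>) + HH (t, x) + 1)"
proof -
  have 1: "\<bar>GG (t, x)\<bar> \<le> K * (\<Sum>l\<in>UNIV. \<bar>VV l (t, x)\<bar>)"
    unfolding GG_def sum_distrib_left
    by (rule order_trans[OF sum_abs sum_mono]) (auto intro!: abs_mult_le[OF bf'(2) order_refl])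
  have "\<bar>HH (t, x) - 1\<bar> \<le> HH (t, x) + 1" using HH_nonneg[of "(t, x)"] by auto
  then have 2: "\<bar>f (t, x) * (HH (t, x) - 1)\<bar> \<le> K * (HH (t, x) + 1)" by (rule abs_mult_le[OF bf'(1)])
  have "\<bar>divV f (t, x)\<bar> \<le> K * ((\<Sum>l\<in>UNIV. \<bar>VV l (t, x)\<bar>) + HH (t, x) + 1)"
    unfolding divV_f using 1 2 abs_triangle_ineq[of "GG (t, x)" "f (t, x) * (HH (t, x) - 1)"] by (simp add: algebra_simps)
  then show ?thesis using om by (simp add: Qc_def abs_mult divide_right_mono)
qed

lemma abs_Dx_Qc: "\<bar>Dx i Qc (t, x)\<bar> \<le> K / om * ((\<Sum>l\<in>UNIV. \<bar>VV l (t, x)\<bar>) + (\<Sum>l\<in>UNIV. \<bar>Dx i (VV l) (t, x)\<bar>) + HH (t, x) + 1 + \<bar>Dx i HH (t, x)\<bar>)"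
proof -
  let ?z = "(t, x)"
  have "Dx i GG ?z = (\<Sum>l\<in>UNIV. Dx i (Dx l f) ?z * VV l ?z + Dx l f ?z * Dx i (VV l) ?z)"
    unfolding GG_def[abs_def] by (subst ddir_sum) (auto intro!: smooth_mult smooth_ddir smooths sum.cong simp: ddir_mult smooth_ddir smooths)
  moreover have "\<bar>\<dots>\<bar> \<le> (\<Sum>l\<in>UNIV. K * \<bar>VV l ?z\<bar> + K * \<bar>Dx i (VV l) ?z\<bar>)"
    by (rule order_trans[OF sum_abs sum_mono], rule order_trans[OF abs_triangle_ineq])
       (auto intro!: add_mono abs_mult_le bf')
  ultimately have 1: "\<bar>Dx i GG ?z\<bar> \<le> K * (\<Sum>l\<in>UNIV. \<bar>VV l ?z\<bar>) + K * (\<Sum>l\<in>UNIV. \<bar>Dx i (VV l) ?z\<bar>)"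
    by (simp add: sum.distrib sum_distrib_left)
  have h: "\<bar>HH ?z - 1\<bar> \<le> HH ?z + 1" using HH_nonneg[of ?z] by auto
  have 2: "Dx i (\<lambda>z. f z * (HH z - 1)) ?z = Dx i f ?z * (HH ?z - 1) + f ?z * Dx i HH ?z"
    by (simp add: ddir_mult ddir_diff smooth_diff smooths)
  have 3: "\<bar>Dx i f ?z * (HH ?z - 1)\<bar> \<le> K * (HH ?z + 1)" by (rule abs_mult_le[OF bf'(2) h])
  have 4: "\<bar>f ?z * Dx i HH ?z\<bar> \<le> K * \<bar>Dx i HH ?z\<bar>" by (rule abs_mult_le[OF bf'(1) order_refl])
  have "divV f = (\<lambda>z. GG z + f z * (HH z - 1))" by (simp add: fun_eq_iff divV_f)
  then have "Dx i (divV f) ?z = Dx i GG ?z + Dx i (\<lambda>z. f z * (HH z - 1)) ?z"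
    by (simp add: ddir_add smooth_mult smooth_diff smooths)
  then have "\<bar>Dx i (divV f) ?z\<bar> \<le> K * ((\<Sum>l\<in>UNIV. \<bar>VV l ?z\<bar>) + (\<Sum>l\<in>UNIV. \<bar>Dx i (VV l) ?z\<bar>) + HH ?z + 1 + \<bar>Dx i HH ?z\<bar>)"
    using 1 3 4 unfolding 2 by (simp add: algebra_simps)
  moreover have "Dx i Qc ?z = (- (1 / om)) * Dx i (divV f) ?z"
    unfolding Qc_def[abs_def] by (rule ddir_cmult[OF sdivV[OF sf]])
  ultimately show ?thesis using om by (simp add: abs_mult divide_right_mono)
qed

text \<open>Three sources of smallness are kept apart: \<open>VV\<close> is small through
  \<open>lam\<close>, \<open>EE\<close> through the concentration, and \<open>Qc\<close> through the
  speed \<open>om\<close>.\<close>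

lemma abs_SS: "\<bar>SS i (t, x)\<bar> \<le> 4 * K * (\<Sum>l\<in>UNIV. \<bar>VV l (t, x)\<bar>)
   + (12 * A * B * K\<^sup>2 * (\<mu> / N) + 3 * A * K * (om * \<mu> / N) + A * C1 * K * N + 3 * A * K\<^sup>2 + 3 * B * K\<^sup>2) * EE (t, x)
   + (3 * B * K + K) * \<bar>Qc (t, x)\<bar> + \<bar>Dx i Qc (t, x)\<bar>"
proof -
  let ?z = "(t, x)"
  let ?SV = "\<Sum>l\<in>UNIV. \<bar>VV l ?z\<bar>"
  have V: "\<bar>VV i ?z\<bar> \<le> ?SV" by (rule member_le_sum) auto
  have V0: "0 \<le> ?SV" by (rule sum_nonneg) auto
  have E0: "0 \<le> EE ?z" "EE ?z \<le> 1" using EE_pos[of ?z] EE_le_1[of ?z] by auto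
  have eq: "SS i ?z = (if i = j then GG ?z else 0) + (ww i ?z * th1 ?z + (if i = j then f ?z * HH ?z else 0))
     - Dx j f ?z * VV i ?z - (1 / om) * (Dt f ?z * VV i ?z)
     + (if i = k then Dt ZZ ?z + (1 / 2) * ZZ ?z else 0) - (1 / (2 * om)) * (f ?z * VV i ?z) - Dx i th1 ?z - Dx i Qc ?z
     + u i ?z * th1 ?z + u i ?z * Qc ?z + ww i ?z * \<theta> ?z + ww i ?z * Qc ?z"
    unfolding SS_def RR_def th_def[abs_def] by (simp add: ddir_add smooths algebra_simps)
  have 1: "\<bar>if i = j then GG ?z else 0\<bar> \<le> K * ?SV"
  proof -
    have "\<bar>GG ?z\<bar> \<le> K * ?SV" unfolding GG_def sum_distrib_left
      by (rule order_trans[OF sum_abs sum_mono]) (auto intro!: abs_mult_le[OF bf'(2) order_refl])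
    then show ?thesis using K0 V0 by auto
  qed
  have 2: "\<bar>Dx j f ?z * VV i ?z\<bar> \<le> K * ?SV" by (rule abs_mult_le[OF bf'(2) V])
  have 3: "\<bar>(1 / om) * (Dt f ?z * VV i ?z)\<bar> \<le> 1 * (K * ?SV)"
    by (rule abs_mult_le[OF _ abs_mult_le[OF bf'(4) V]]) (use om1 in auto)
  have 4: "\<bar>(1 / (2 * om)) * (f ?z * VV i ?z)\<bar> \<le> 1 * (K * ?SV)"
    by (rule abs_mult_le[OF _ abs_mult_le[OF bf'(1) V]]) (use om1 in auto)
  have 5: "\<bar>if i = k then Dt ZZ ?z + (1 / 2) * ZZ ?z else 0\<bar> \<le> 3 * (A * K * (om * \<mu> / N) * EE ?z)"
  proof -
    have z0: "0 \<le> A * K * (om * \<mu> / N) * EE ?z" using AB K0 om mu N1 E0 by simp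
    have "\<bar>Dt ZZ ?z\<bar> \<le> 2 * (A * K * (om * \<mu> / N) * EE ?z)" using abs_Dt_ZZ by (simp add: mult_ac)
    moreover have "\<bar>ZZ ?z\<bar> \<le> A * K * (om * \<mu> / N) * EE ?z" using abs_ZZ by (simp add: mult_ac)
    ultimately show ?thesis using z0 by auto
  qed
  have 6: "\<bar>u i ?z * th1 ?z\<bar> \<le> K * (A * (3 * K * EE ?z))" by (rule abs_mult_le[OF bu'(2) abs_th1])
  have 7: "\<bar>u i ?z * Qc ?z\<bar> \<le> K * \<bar>Qc ?z\<bar>" by (rule abs_mult_le[OF bu'(2) order_refl])
  have 8: "\<bar>ww i ?z * \<theta> ?z\<bar> \<le> B * (3 * K * EE ?z) * K" by (rule abs_mult_le[OF abs_ww bu'(1)])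
  have "B * (3 * K * EE ?z) \<le> B * (3 * K * 1)" using AB K0 E0 by (intro mult_left_mono) auto
  then have "\<bar>ww i ?z\<bar> \<le> B * (3 * K * 1)" using abs_ww[of i] by linarith
  from abs_mult_le[OF this order_refl[of "\<bar>Qc ?z\<bar>"]] have 9: "\<bar>ww i ?z * Qc ?z\<bar> \<le> B * (3 * K * 1) * \<bar>Qc ?z\<bar>" .
  \<comment> \<open>Stated for arbitrary reals, so that the rearrangement treats the long terms as
    atoms.\<close>
  have gen: "K * S + 12 * A * B * K\<^sup>2 * m * E + K * S + 1 * (K * S) + 3 * (A * K * m' * E) + 1 * (K * S)
     + A * (C * K * n * E) + D + K * (A * (3 * K * E)) + K * Q + B * (3 * K * E) * K + B * (3 * K * 1) * Q
     = 4 * K * S + (12 * A * B * K\<^sup>2 * m + 3 * A * K * m' + A * C * K * n + 3 * A * K\<^sup>2 + 3 * B * K\<^sup>2) * E + (3 * B * K + K) * Q + D"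
    for A B K m m' C n S E D Q :: real by (simp add: algebra_simps power2_eq_square)
  have tp: "\<bar>y + w\<bar> \<le> c + \<bar>w\<bar>" and tm: "\<bar>y - w\<bar> \<le> c + \<bar>w\<bar>" if "\<bar>y\<bar> \<le> c" for y w c :: real using that by linarith+
  have tri: "\<bar>x1 + x2 - x3 - x4 + x5 - x6 - x7 - x8 + x9 + x10 + x11 + x12\<bar> \<le> \<bar>x1\<bar> + \<bar>x2\<bar> + \<bar>x3\<bar> + \<bar>x4\<bar> + \<bar>x5\<bar> + \<bar>x6\<bar> + \<bar>x7\<bar> + \<bar>x8\<bar> + \<bar>x9\<bar> + \<bar>x10\<bar> + \<bar>x11\<bar> + \<bar>x12\<bar>"
    for x1 x2 x3 x4 x5 x6 x7 x8 x9 x10 x11 x12 :: real by (intro tp tm order_refl)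
  have "\<bar>SS i ?z\<bar> \<le> K * ?SV + 12 * A * B * K\<^sup>2 * (\<mu> / N) * EE ?z + K * ?SV + 1 * (K * ?SV) + 3 * (A * K * (om * \<mu> / N) * EE ?z) + 1 * (K * ?SV)
     + A * (C1 * K * N * EE ?z) + \<bar>Dx i Qc ?z\<bar> + K * (A * (3 * K * EE ?z)) + K * \<bar>Qc ?z\<bar> + B * (3 * K * EE ?z) * K + B * (3 * K * 1) * \<bar>Qc ?z\<bar>"
    unfolding eq by (rule order_trans[OF tri]) (intro add_mono 1 2 3 4 5 6 7 8 9 th1_ww abs_Dx_th1 order_refl)
  also have "\<dots> = 4 * K * ?SV + (12 * A * B * K\<^sup>2 * (\<mu> / N) + 3 * A * K * (om * \<mu> / N) + A * C1 * K * N + 3 * A * K\<^sup>2 + 3 * B * K\<^sup>2) * EE ?z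
   + (3 * B * K + K) * \<bar>Qc ?z\<bar> + \<bar>Dx i Qc ?z\<bar>"
    by (rule gen)
  finally show ?thesis .
qed

end

end

section \<open>Power inequalities and the integrated form of the pointwise bounds\<close>

lemma powr_add_le2:
  fixes x y r :: real assumes "0 \<le> x" "0 \<le> y" "0 \<le> r"
  shows "(x + y) powr r \<le> 2 powr r * (x powr r + y powr r)"
proof -
  have "(x + y) powr r \<le> (2 * max x y) powr r" using assms by (intro powr_mono2) auto
  also have "\<dots> = 2 powr r * max x y powr r" using assms by (simp add: powr_mult)
  also have "max x y powr r \<le> x powr r + y powr r" by (simp add: max_def)
  finally show ?thesis by simp
qed

lemma powr_add_le3:
  fixes x y w r :: real assumes "0 \<le> x" "0 \<le> y" "0 \<le> w" "0 \<le> r"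
  shows "(x + y + w) powr r \<le> 3 powr r * (x powr r + y powr r + w powr r)"
proof -
  have "(x + y + w) powr r \<le> (3 * max x (max y w)) powr r" using assms by (intro powr_mono2) auto
  also have "\<dots> = 3 powr r * max x (max y w) powr r" using assms by (simp add: powr_mult)
  also have "max x (max y w) powr r \<le> x powr r + y powr r + w powr r" by (simp add: max_def)
  finally show ?thesis by simp
qed

lemma continuous_on_abs_powr:
  fixes F :: "'a::topological_space \<Rightarrow> real"
  shows "0 < r \<Longrightarrow> continuous_on S F \<Longrightarrow> continuous_on S (\<lambda>x. \<bar>F x\<bar> powr r)"
  by (rule continuous_on_powr') (auto intro!: continuous_intros)

context estimates begin

lemma conts: "continuous_on UNIV (\<lambda>x. VV l (t, x))" "continuous_on UNIV (\<lambda>x. Dx i (VV l) (t, x))"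
  "continuous_on UNIV (\<lambda>x. HH (t, x))" "continuous_on UNIV (\<lambda>x. Dx i HH (t, x))"
  "continuous_on UNIV (\<lambda>x. EE (t, x))" "continuous_on UNIV (\<lambda>x. Qc (t, x))" "continuous_on UNIV (\<lambda>x. Dx i Qc (t, x))"
  "continuous_on UNIV (\<lambda>x. th (t, x))" "continuous_on UNIV (\<lambda>x. th1 (t, x))" "continuous_on UNIV (\<lambda>x. ww i (t, x))"
  "continuous_on UNIV (\<lambda>x. Dx l (ww i) (t, x))" "continuous_on UNIV (\<lambda>x. a (t, x))" "continuous_on UNIV (\<lambda>x. b (t, x))"
  "continuous_on UNIV (\<lambda>x. phi (t, x))" "continuous_on UNIV (\<lambda>x. sn (t, x))" "continuous_on UNIV (\<lambda>x. gauss c (t, x))"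
  by (intro slice_cont smooth_ddir smooths smooth_EE smooth_phi smooth_sn smooth_gauss ex_Basis)+


lemma integral_sum_VV: "integral cell (\<lambda>x. \<Sum>l\<in>UNIV. \<bar>VV l (t, x)\<bar>) \<le> (real CARD('d))\<^sup>2 / lam"
proof -
  have "integral cell (\<lambda>x. \<Sum>l\<in>UNIV. \<bar>VV l (t, x)\<bar>) = (\<Sum>l\<in>UNIV. integral cell (\<lambda>x. \<bar>VV l (t, x)\<bar>))"
    by (rule integral_sum) (auto intro!: integrable_cell continuous_intros conts)
  also have "\<dots> \<le> (\<Sum>l\<in>(UNIV::'d set). real CARD('d) / lam)" by (intro sum_mono integral_abs_VV)
  finally show ?thesis by (simp add: power2_eq_square)
qed

lemma dlam: "(real CARD('d))\<^sup>2 / lam \<le> (real CARD('d))\<^sup>2"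
  using lam by (simp add: divide_le_eq mult_le_cancel_left1)

definition Ed :: real where "Ed = (pi * sqrt 2 / \<mu>) ^ CARD('d)"

lemma Ed0: "0 \<le> Ed" using mu by (simp add: Ed_def)

lemma integral_EE_Ed: "integral cell (\<lambda>x. EE (t, x)) \<le> Ed" unfolding Ed_def by (rule integral_EE)

definition cQ :: real where "cQ = K * ((real CARD('d))\<^sup>2 + 2)"

definition cD :: real where "cD = 8 * pi * (real CARD('d))\<^sup>2 + 8 * pi * lam"

definition cE :: real where
  "cE = 12 * A * B * K\<^sup>2 * (\<mu> / N) + 3 * A * K * (om * \<mu> / N) + A * C1 * K * N + 3 * A * K\<^sup>2 + 3 * B * K\<^sup>2"

context fixes t assumes t: "t \<in> {0..T}" begin

lemma integral_Qc: "integral cell (\<lambda>x. \<bar>Qc (t, x)\<bar>) \<le> cQ / om"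
proof -
  let ?I = "integral cell :: (real^'d \<Rightarrow> real) \<Rightarrow> real"
  have "?I (\<lambda>x. \<bar>Qc (t, x)\<bar>) \<le> ?I (\<lambda>x. K / om * ((\<Sum>l\<in>UNIV. \<bar>VV l (t, x)\<bar>) + HH (t, x) + 1))"
    by (rule integral_cell_le[OF _ _ abs_Qc[OF t]]) (use om in \<open>auto intro!: continuous_intros conts\<close>)
  also have "\<dots> = K / om * (?I (\<lambda>x. \<Sum>l\<in>UNIV. \<bar>VV l (t, x)\<bar>) + 1 + 1)"
    by (simp, subst integral_add, (intro integrable_cell continuous_intros conts)+, subst integral_add)
       (auto intro!: integrable_cell continuous_intros conts simp: integral_HH)
  also have "\<dots> \<le> K / om * ((real CARD('d))\<^sup>2 + 1 + 1)"
    using integral_sum_VV[of t] dlam K0 om by (intro mult_left_mono) auto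
  finally show ?thesis by (simp add: cQ_def add.commute)
qed

text \<open>This bound grows like 1/\<open>MM\<close>. It is one endpoint of the interpolation in
  \<open>integral_Qc_powr\<close>, the other being \<open>integral_Qc\<close>.\<close>

lemma sup_Qc: assumes x: "x \<in> cell" shows "\<bar>Qc (t, x)\<bar> \<le> cQ / om / MM"
proof -
  have "(\<Sum>l\<in>UNIV. \<bar>VV l (t, x)\<bar>) \<le> (\<Sum>l\<in>(UNIV::'d set). real CARD('d) / MM)" by (intro sum_mono abs_VV)
  moreover have "HH (t, x) \<le> 1 / MM"
    using HH_le[of "(t, x)"] divide_right_mono[OF EE_le_1[of "(t, x)"], of MM] MM_pos by simp
  moreover have "1 \<le> 1 / MM" using MM_pos MM_le_1 by simp
  ultimately have "(\<Sum>l\<in>UNIV. \<bar>VV l (t, x)\<bar>) + HH (t, x) + 1 \<le> ((real CARD('d))\<^sup>2 + 2) / MM"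
    by (simp add: power2_eq_square add_divide_distrib)
  then have "K / om * ((\<Sum>l\<in>UNIV. \<bar>VV l (t, x)\<bar>) + HH (t, x) + 1) \<le> K / om * (((real CARD('d))\<^sup>2 + 2) / MM)"
    using K0 om by (intro mult_left_mono) auto
  then show ?thesis using abs_Qc[OF t x] by (simp add: cQ_def)
qed

text \<open>A derivative of the corrector reaches the fast profile and costs \<open>N\<close>. The
  quotient of \<open>Ed\<close> and \<open>MM\<close> stays bounded by \<open>MM_ge\<close>, so the
  speed \<open>om\<close> has to beat \<open>N\<close>.\<close>

lemma integral_Dx_Qc: "integral cell (\<lambda>x. \<bar>Dx i Qc (t, x)\<bar>) \<le> cQ / om + K / om * (cD * N / MM * Ed)"
proof -
  let ?I = "integral cell :: (real^'d \<Rightarrow> real) \<Rightarrow> real"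
  let ?V = "\<lambda>x. \<Sum>l\<in>UNIV. \<bar>VV l (t, x)\<bar>" and ?DV = "\<lambda>x. \<Sum>l\<in>UNIV. \<bar>Dx i (VV l) (t, x)\<bar>"
  have "?I ?DV = (\<Sum>l\<in>UNIV. ?I (\<lambda>x. \<bar>Dx i (VV l) (t, x)\<bar>))"
    by (rule integral_sum) (auto intro!: integrable_cell continuous_intros conts)
  also have "\<dots> \<le> (\<Sum>l\<in>(UNIV::'d set). 8 * pi * real CARD('d) * N / MM * Ed)"
    by (intro sum_mono order_trans[OF integral_abs_Dx_VV] mult_left_mono integral_EE_Ed) (use N1 MM_pos in auto)
  also have "\<dots> = 8 * pi * (real CARD('d))\<^sup>2 * N / MM * Ed" by (simp add: power2_eq_square)
  finally have 1: "?I ?DV \<le> 8 * pi * (real CARD('d))\<^sup>2 * N / MM * Ed" .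
  have 2: "?I (\<lambda>x. \<bar>Dx i HH (t, x)\<bar>) \<le> 8 * pi * lam * N / MM * Ed"
    by (rule order_trans[OF integral_abs_Dx_HH]) (intro mult_left_mono integral_EE_Ed, use N1 lam MM_pos in auto)
  have "?I (\<lambda>x. \<bar>Dx i Qc (t, x)\<bar>) \<le> ?I (\<lambda>x. K / om * (?V x + ?DV x + HH (t, x) + 1 + \<bar>Dx i HH (t, x)\<bar>))"
    by (rule integral_cell_le[OF _ _ abs_Dx_Qc[OF t]]) (use om in \<open>auto intro!: continuous_intros conts\<close>)
  also have "\<dots> = K / om * ?I (\<lambda>x. ?V x + ?DV x + HH (t, x) + 1 + \<bar>Dx i HH (t, x)\<bar>)" by simp
  also have "?I (\<lambda>x. ?V x + ?DV x + HH (t, x) + 1 + \<bar>Dx i HH (t, x)\<bar>) = ?I ?V + ?I ?DV + 1 + 1 + ?I (\<lambda>x. \<bar>Dx i HH (t, x)\<bar>)"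
    by (subst integral_add, (intro integrable_cell continuous_intros conts)+)+ (simp add: integral_HH)
  also have "K / om * (?I ?V + ?I ?DV + 1 + 1 + ?I (\<lambda>x. \<bar>Dx i HH (t, x)\<bar>)) \<le> K / om * (((real CARD('d))\<^sup>2 + 2) + cD * N / MM * Ed)"
  proof (intro mult_left_mono)
    have "cD * N / MM * Ed = 8 * pi * (real CARD('d))\<^sup>2 * N / MM * Ed + 8 * pi * lam * N / MM * Ed"
      by (simp add: cD_def distrib_right add_divide_distrib)
    then show "?I ?V + ?I ?DV + 1 + 1 + ?I (\<lambda>x. \<bar>Dx i HH (t, x)\<bar>) \<le> ((real CARD('d))\<^sup>2 + 2) + cD * N / MM * Ed"
      using integral_sum_VV[of t] dlam 1 2 by linarith
  qed (use K0 om in auto)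
  finally show ?thesis by (simp add: cQ_def distrib_left add_divide_distrib)
qed

lemma cE0: "0 \<le> cE" unfolding cE_def C1_def using AB K0 mu N1 om lam by (intro add_nonneg_nonneg) auto

lemma sSS: "smooth (SS i)" unfolding SS_def[abs_def] by (intro smooth_add smooth_diff sRR sR sif sf)

lemma integral_SS: "integral cell (\<lambda>x. \<bar>SS i (t, x)\<bar>) \<le> 4 * K * ((real CARD('d))\<^sup>2 / lam) + cE * Ed + (3 * B * K + K) * (cQ / om)
    + (cQ / om + K / om * (cD * N / MM * Ed))"
proof -
  let ?I = "integral cell :: (real^'d \<Rightarrow> real) \<Rightarrow> real"
  let ?V = "\<lambda>x. \<Sum>l\<in>UNIV. \<bar>VV l (t, x)\<bar>"
  have "?I (\<lambda>x. \<bar>SS i (t, x)\<bar>) \<le> ?I (\<lambda>x. 4 * K * ?V x + cE * EE (t, x) + (3 * B * K + K) * \<bar>Qc (t, x)\<bar> + \<bar>Dx i Qc (t, x)\<bar>)"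
    unfolding cE_def
    by (rule integral_cell_le[OF _ _ abs_SS[OF t]]) (intro continuous_intros conts slice_cont[OF sSS])+
  also have "\<dots> = 4 * K * ?I ?V + cE * ?I (\<lambda>x. EE (t, x)) + (3 * B * K + K) * ?I (\<lambda>x. \<bar>Qc (t, x)\<bar>) + ?I (\<lambda>x. \<bar>Dx i Qc (t, x)\<bar>)"
    by (subst integral_add, (intro integrable_cell continuous_intros conts)+)+ simp
  also have "\<dots> \<le> 4 * K * ((real CARD('d))\<^sup>2 / lam) + cE * Ed + (3 * B * K + K) * (cQ / om) + (cQ / om + K / om * (cD * N / MM * Ed))"
    by (intro add_mono mult_left_mono integral_sum_VV integral_EE_Ed integral_Qc integral_Dx_Qc) (use K0 cE0 AB in auto)
  finally show ?thesis .
qed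

lemma EE_powr: "1 \<le> r \<Longrightarrow> EE z powr r \<le> EE z"
  using powr_mono'[of 1 r "EE z"] EE_pos[of z] EE_le_1[of z] by simp

text \<open>Powers of \<open>EE\<close> with exponent at least 1 are bounded by \<open>EE\<close>
  itself, so all these L^r estimates use the same integral \<open>Ed\<close>.\<close>

lemma integral_powr_EE:
  assumes r: "1 \<le> r" and F: "continuous_on UNIV (\<lambda>x. F (t, x))" and c: "0 \<le> c" and b: "\<And>x. x \<in> cell \<Longrightarrow> \<bar>F (t, x)\<bar> \<le> c * EE (t, x)"
  shows "integral cell (\<lambda>x. \<bar>F (t, x)\<bar> powr r) \<le> c powr r * Ed"
proof -
  have "integral cell (\<lambda>x. \<bar>F (t, x)\<bar> powr r) \<le> integral cell (\<lambda>x. c powr r * EE (t, x))"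
  proof (rule integral_cell_le)
    fix x :: "real^'d" assume x: "x \<in> cell"
    have "\<bar>F (t, x)\<bar> powr r \<le> (c * EE (t, x)) powr r" using r b[OF x] by (intro powr_mono2) auto
    also have "\<dots> = c powr r * EE (t, x) powr r" using c EE_pos[of "(t, x)"] by (simp add: powr_mult)
    also have "\<dots> \<le> c powr r * EE (t, x)" by (intro mult_left_mono EE_powr r) auto
    finally show "\<bar>F (t, x)\<bar> powr r \<le> c powr r * EE (t, x)" .
  qed (use r in \<open>auto intro!: continuous_intros conts F continuous_on_powr'\<close>)
  also have "\<dots> \<le> c powr r * Ed" by (simp add: mult_left_mono integral_EE_Ed)
  finally show ?thesis .
qed

text \<open>Interpolation between L^1 and L^infinity: \<open>r - 1\<close> powers are estimated by
  the supremum and the remaining one is integrated.\<close>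

lemma integral_Qc_powr:
  assumes r: "1 < r"
  shows "integral cell (\<lambda>x. \<bar>Qc (t, x)\<bar> powr r) \<le> (cQ / om / MM) powr (r - 1) * (cQ / om)"
proof -
  have "integral cell (\<lambda>x. \<bar>Qc (t, x)\<bar> powr r) \<le> integral cell (\<lambda>x. (cQ / om / MM) powr (r - 1) * \<bar>Qc (t, x)\<bar>)"
  proof (rule integral_cell_le)
    fix x :: "real^'d" assume x: "x \<in> cell"
    have "\<bar>Qc (t, x)\<bar> powr r = \<bar>Qc (t, x)\<bar> powr (r - 1) * \<bar>Qc (t, x)\<bar>"
      using powr_add[of "\<bar>Qc (t, x)\<bar>" "r - 1" 1] by (cases "Qc (t, x) = 0") auto
    also have "\<dots> \<le> (cQ / om / MM) powr (r - 1) * \<bar>Qc (t, x)\<bar>"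
      using r sup_Qc[OF x] by (intro mult_right_mono powr_mono2) auto
    finally show "\<bar>Qc (t, x)\<bar> powr r \<le> (cQ / om / MM) powr (r - 1) * \<bar>Qc (t, x)\<bar>" .
  qed (use r in \<open>auto intro!: continuous_intros conts continuous_on_powr'\<close>)
  also have "\<dots> = (cQ / om / MM) powr (r - 1) * integral cell (\<lambda>x. \<bar>Qc (t, x)\<bar>)" by simp
  also have "\<dots> \<le> (cQ / om / MM) powr (r - 1) * (cQ / om)" by (intro mult_left_mono integral_Qc) auto
  finally show ?thesis .
qed

text \<open>The Gaussian has the small period \<open>1 / lam\<close>, so the integral of slow times
  fast is nearly the product of the integrals, and the amplitude enters through the integral of
  \<open>h\<close> instead of a supremum. The smooth majorant \<open>h\<close> stands in for |s|^r
  because the oscillation argument uses a derivative bound.\<close>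

lemma integral_main:
  assumes r: "1 \<le> r" and s: "continuous_on UNIV (\<lambda>x. s (t, x))" and h: "smooth h" "per_at 1 t h"
    and c: "0 \<le> c" "0 \<le> D" and sh: "\<And>x. x \<in> cell \<Longrightarrow> \<bar>s (t, x)\<bar> powr r \<le> c * h (t, x)"
    and bh: "\<And>i x. x \<in> cell \<Longrightarrow> \<bar>Dx i h (t, x)\<bar> \<le> K" and h0: "\<And>x. x \<in> cell \<Longrightarrow> 0 \<le> h (t, x)"
  shows "integral cell (\<lambda>x. \<bar>D * (s (t, x) * (phi (t, x) * sn (t, x)))\<bar> powr r)
     \<le> D powr r * c * (pi / \<mu>) ^ CARD('d) * (integral cell (\<lambda>x. h (t, x)) + (real CARD('d))\<^sup>2 / lam * K)"
proof -
  have ch: "continuous_on UNIV (\<lambda>x. h (t, x))" by (rule slice_cont[OF h(1)])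
  have "integral cell (\<lambda>x. \<bar>D * (s (t, x) * (phi (t, x) * sn (t, x)))\<bar> powr r)
     \<le> integral cell (\<lambda>x. D powr r * c * (h (t, x) * gauss (r * \<mu>\<^sup>2) (t, x)))"
  proof (rule integral_cell_le)
    fix x :: "real^'d" assume x: "x \<in> cell"
    let ?z = "(t, x)"
    have ph: "phi ?z powr r = gauss (r * \<mu>\<^sup>2) ?z"
      by (simp add: phi_def gauss_def powr_def)
    have "\<bar>D * (s ?z * (phi ?z * sn ?z))\<bar> powr r = D powr r * (\<bar>s ?z\<bar> powr r * (phi ?z powr r * \<bar>sn ?z\<bar> powr r))"
      using c phi_pos[of ?z] by (simp add: abs_mult powr_mult)
    also have "\<dots> \<le> D powr r * ((c * h ?z) * (phi ?z powr r * 1))"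
      using abs_sn[of ?z] r c h0[OF x] sh[OF x] powr_mono2[of r "\<bar>sn ?z\<bar>" 1] by (intro mult_mono mult_left_mono) auto
    finally show "\<bar>D * (s ?z * (phi ?z * sn ?z))\<bar> powr r \<le> D powr r * c * (h ?z * gauss (r * \<mu>\<^sup>2) ?z)"
      by (simp add: ph mult_ac)
  qed (use r in \<open>auto intro!: continuous_intros conts s ch continuous_on_powr'\<close>)
  also have "\<dots> = D powr r * c * integral cell (\<lambda>x. h (t, x) * gauss (r * \<mu>\<^sup>2) (t, x))" by simp
  also have "\<dots> \<le> D powr r * c * ((pi / \<mu>) ^ CARD('d) * (integral cell (\<lambda>x. h (t, x)) + (real CARD('d))\<^sup>2 / lam * K))"
  proof (intro mult_left_mono)
    have h_int: "0 \<le> integral cell (\<lambda>x. h (t, x))" by (rule integral_nonneg[OF integrable_cell[OF ch] h0])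
    have "integral cell (\<lambda>x. gauss (r * \<mu>\<^sup>2) (t, x)) \<le> (pi / sqrt r / \<mu>) ^ CARD('d)"
      using r by (intro integral_gauss_le) auto
    also have "\<dots> \<le> (pi / \<mu>) ^ CARD('d)"
      using r mu by (intro power_mono divide_right_mono) (auto simp: divide_le_eq mult_le_cancel_left1)
    finally have g: "integral cell (\<lambda>x. gauss (r * \<mu>\<^sup>2) (t, x)) \<le> (pi / \<mu>) ^ CARD('d)" .
    have "integral cell (\<lambda>x. h (t, x) * gauss (r * \<mu>\<^sup>2) (t, x))
       \<le> integral cell (\<lambda>x. gauss (r * \<mu>\<^sup>2) (t, x)) * (integral cell (\<lambda>x. h (t, x)) + (real CARD('d))\<^sup>2 * (1 / lam) * K)"
      using rho gauss_pos by (intro integral_mult_oscillating_le smooth_gauss per_lam per1 h bh) (auto simp: less_imp_le)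
    also have "\<dots> \<le> (pi / \<mu>) ^ CARD('d) * (integral cell (\<lambda>x. h (t, x)) + (real CARD('d))\<^sup>2 * (1 / lam) * K)"
      using g h_int K0 lam by (intro mult_right_mono) auto
    finally show "integral cell (\<lambda>x. h (t, x) * gauss (r * \<mu>\<^sup>2) (t, x)) \<le> (pi / \<mu>) ^ CARD('d) * (integral cell (\<lambda>x. h (t, x)) + (real CARD('d))\<^sup>2 / lam * K)"
      by simp
  qed (use c in auto)
  finally show ?thesis by (simp add: mult.assoc)
qed

lemma integral_th_powr:
  assumes r: "1 < r" and h: "smooth h" "per_at 1 t h" and c: "0 \<le> c"
    and sh: "\<And>x. x \<in> cell \<Longrightarrow> \<bar>a (t, x)\<bar> powr r \<le> c * h (t, x)"
    and bh: "\<And>i x. x \<in> cell \<Longrightarrow> \<bar>Dx i h (t, x)\<bar> \<le> K" and h0: "\<And>x. x \<in> cell \<Longrightarrow> 0 \<le> h (t, x)"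
  shows "integral cell (\<lambda>x. \<bar>th (t, x)\<bar> powr r) \<le> 3 powr r * (
      A powr r * c * (pi / \<mu>) ^ CARD('d) * (integral cell (\<lambda>x. h (t, x)) + (real CARD('d))\<^sup>2 / lam * K)
      + (2 * A * K * (\<mu> / N)) powr r * Ed + (cQ / om / MM) powr (r - 1) * (cQ / om))"
proof -
  let ?I = "integral cell :: (real^'d \<Rightarrow> real) \<Rightarrow> real"
  let ?m = "\<lambda>z. A * (a z * (phi z * sn z))"
  have cp: "continuous_on UNIV (\<lambda>x. \<bar>F x\<bar> powr r)" if "continuous_on UNIV F" for F :: "real^'d \<Rightarrow> real"
    using that r by (intro continuous_on_abs_powr) auto
  have c2: "continuous_on UNIV (\<lambda>x. th1 (t, x) - ?m (t, x))" "continuous_on UNIV (\<lambda>x. ?m (t, x))" by (intro continuous_intros conts)+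
  have "?I (\<lambda>x. \<bar>th (t, x)\<bar> powr r) \<le> ?I (\<lambda>x. 3 powr r * (\<bar>?m (t, x)\<bar> powr r + \<bar>th1 (t, x) - ?m (t, x)\<bar> powr r + \<bar>Qc (t, x)\<bar> powr r))"
  proof (rule integral_cell_le)
    fix x :: "real^'d"
    have "\<bar>th (t, x)\<bar> powr r \<le> (\<bar>?m (t, x)\<bar> + \<bar>th1 (t, x) - ?m (t, x)\<bar> + \<bar>Qc (t, x)\<bar>) powr r"
      using r by (intro powr_mono2) (auto simp: th_def)
    also have "\<dots> \<le> 3 powr r * (\<bar>?m (t, x)\<bar> powr r + \<bar>th1 (t, x) - ?m (t, x)\<bar> powr r + \<bar>Qc (t, x)\<bar> powr r)"
      using r by (intro powr_add_le3) auto
    finally show "\<bar>th (t, x)\<bar> powr r \<le> 3 powr r * (\<bar>?m (t, x)\<bar> powr r + \<bar>th1 (t, x) - ?m (t, x)\<bar> powr r + \<bar>Qc (t, x)\<bar> powr r)" .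
  qed (intro cp continuous_intros conts c2)+
  also have "\<dots> = 3 powr r * (?I (\<lambda>x. \<bar>?m (t, x)\<bar> powr r) + ?I (\<lambda>x. \<bar>th1 (t, x) - ?m (t, x)\<bar> powr r) + ?I (\<lambda>x. \<bar>Qc (t, x)\<bar> powr r))"
    by (simp, subst integral_add, (intro integrable_cell cp continuous_intros conts)+, subst integral_add, (intro integrable_cell cp continuous_intros conts)+) simp
  also have "\<dots> \<le> 3 powr r * (
      A powr r * c * (pi / \<mu>) ^ CARD('d) * (?I (\<lambda>x. h (t, x)) + (real CARD('d))\<^sup>2 / lam * K)
      + (2 * A * K * (\<mu> / N)) powr r * Ed + (cQ / om / MM) powr (r - 1) * (cQ / om))"
  proof (intro mult_left_mono add_mono)
    show "?I (\<lambda>x. \<bar>?m (t, x)\<bar> powr r) \<le> A powr r * c * (pi / \<mu>) ^ CARD('d) * (?I (\<lambda>x. h (t, x)) + (real CARD('d))\<^sup>2 / lam * K)"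
      by (rule integral_main) (use r h c AB sh bh h0 conts in auto)
    show "?I (\<lambda>x. \<bar>th1 (t, x) - ?m (t, x)\<bar> powr r) \<le> (2 * A * K * (\<mu> / N)) powr r * Ed"
      by (rule integral_powr_EE[where F="\<lambda>z. th1 z - ?m z"])
         (use r AB K0 mu N1 c2(1) th1_main[OF t] in \<open>auto simp: mult_ac\<close>)
    show "?I (\<lambda>x. \<bar>Qc (t, x)\<bar> powr r) \<le> (cQ / om / MM) powr (r - 1) * (cQ / om)" by (rule integral_Qc_powr[OF r])
  qed auto
  finally show ?thesis .
qed

text \<open>Coordinate \<open>j\<close> carries the leading part. Coordinate \<open>k\<close> is a
  \<open>j\<close>-derivative of the stream function, which misses the oscillation and is smaller by
  \<open>\<mu> / N\<close>; the remaining coordinates are zero.\<close>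

lemma integral_ww_powr:
  assumes r: "1 < r" and h: "smooth h" "per_at 1 t h" and c: "0 \<le> c"
    and sh: "\<And>x. x \<in> cell \<Longrightarrow> \<bar>b (t, x)\<bar> powr r \<le> c * h (t, x)"
    and bh: "\<And>i x. x \<in> cell \<Longrightarrow> \<bar>Dx i h (t, x)\<bar> \<le> K" and h0: "\<And>x. x \<in> cell \<Longrightarrow> 0 \<le> h (t, x)"
  shows "integral cell (\<lambda>x. \<bar>ww i (t, x)\<bar> powr r) \<le> 2 powr r * (
      B powr r * c * (pi / \<mu>) ^ CARD('d) * (integral cell (\<lambda>x. h (t, x)) + (real CARD('d))\<^sup>2 / lam * K)
      + (2 * B * K * (\<mu> / N)) powr r * Ed)"
proof -
  let ?I = "integral cell :: (real^'d \<Rightarrow> real) \<Rightarrow> real"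
  let ?m = "\<lambda>z. B * (b z * (phi z * sn z))"
  have cp: "continuous_on UNIV (\<lambda>x. \<bar>F x\<bar> powr r)" if "continuous_on UNIV F" for F :: "real^'d \<Rightarrow> real"
    using that r by (intro continuous_on_abs_powr) auto
  have c2: "continuous_on UNIV (\<lambda>x. ww j (t, x) - ?m (t, x))" "continuous_on UNIV (\<lambda>x. ?m (t, x))" by (intro continuous_intros conts)+
  have main: "?I (\<lambda>x. \<bar>?m (t, x)\<bar> powr r) \<le> B powr r * c * (pi / \<mu>) ^ CARD('d) * (?I (\<lambda>x. h (t, x)) + (real CARD('d))\<^sup>2 / lam * K)"
    by (rule integral_main) (use r h c AB sh bh h0 conts in auto)
  have main0: "0 \<le> ?I (\<lambda>x. \<bar>?m (t, x)\<bar> powr r)"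
    by (rule integral_nonneg) (auto intro!: integrable_cell cp c2)
  have b0: "0 \<le> 2 * B * K * (\<mu> / N)" using AB K0 mu N1 by simp
  show ?thesis
  proof (cases "i = j")
    case True
    have "?I (\<lambda>x. \<bar>ww i (t, x)\<bar> powr r) \<le> ?I (\<lambda>x. 2 powr r * (\<bar>?m (t, x)\<bar> powr r + \<bar>ww j (t, x) - ?m (t, x)\<bar> powr r))"
    proof (rule integral_cell_le)
      fix x :: "real^'d"
      have "\<bar>ww i (t, x)\<bar> powr r \<le> (\<bar>?m (t, x)\<bar> + \<bar>ww j (t, x) - ?m (t, x)\<bar>) powr r"
        using r True by (intro powr_mono2) auto
      also have "\<dots> \<le> 2 powr r * (\<bar>?m (t, x)\<bar> powr r + \<bar>ww j (t, x) - ?m (t, x)\<bar> powr r)"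
        using r by (intro powr_add_le2) auto
      finally show "\<bar>ww i (t, x)\<bar> powr r \<le> 2 powr r * (\<bar>?m (t, x)\<bar> powr r + \<bar>ww j (t, x) - ?m (t, x)\<bar> powr r)" .
    qed (intro cp continuous_intros conts c2)+
    also have "\<dots> = 2 powr r * (?I (\<lambda>x. \<bar>?m (t, x)\<bar> powr r) + ?I (\<lambda>x. \<bar>ww j (t, x) - ?m (t, x)\<bar> powr r))"
      by (simp, subst integral_add, (intro integrable_cell cp continuous_intros conts)+) simp
    also have "\<dots> \<le> 2 powr r * (B powr r * c * (pi / \<mu>) ^ CARD('d) * (?I (\<lambda>x. h (t, x)) + (real CARD('d))\<^sup>2 / lam * K)
      + (2 * B * K * (\<mu> / N)) powr r * Ed)"
    proof (intro mult_left_mono add_mono main)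
      show "?I (\<lambda>x. \<bar>ww j (t, x) - ?m (t, x)\<bar> powr r) \<le> (2 * B * K * (\<mu> / N)) powr r * Ed"
        by (rule integral_powr_EE[where F="\<lambda>z. ww j z - ?m z"])
           (use r b0 c2(1) ww_main[OF t] in \<open>auto simp: mult_ac\<close>)
    qed auto
    finally show ?thesis .
  next
    case False
    have "?I (\<lambda>x. \<bar>ww i (t, x)\<bar> powr r) \<le> 1 * ((2 * B * K * (\<mu> / N)) powr r * Ed)"
      unfolding mult_1
      by (rule integral_powr_EE) (use r b0 conts ww_ne[OF t _ False] in \<open>auto simp: mult_ac\<close>)
    also have "\<dots> \<le> 2 powr r * ((2 * B * K * (\<mu> / N)) powr r * Ed)"
      using r Ed0 by (intro mult_right_mono) (auto simp: ge_one_powr_ge_zero)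
    also have "\<dots> \<le> 2 powr r * (B powr r * c * (pi / \<mu>) ^ CARD('d) * (?I (\<lambda>x. h (t, x)) + (real CARD('d))\<^sup>2 / lam * K)
      + (2 * B * K * (\<mu> / N)) powr r * Ed)"
      using main main0 by (intro mult_left_mono) auto
    finally show ?thesis .
  qed
qed

text \<open>In L^pt the gain will come from the concentration alone, so a bound by the supremum of
  the slow amplitude is enough.\<close>

lemma integral_ww_small: assumes r: "1 \<le> r" shows "integral cell (\<lambda>x. \<bar>ww i (t, x)\<bar> powr r) \<le> (3 * B * K) powr r * Ed"
  by (rule integral_powr_EE) (use r AB K0 conts abs_ww[OF t] in \<open>auto simp: mult_ac\<close>)

lemma integral_Dx_ww_small: assumes r: "1 \<le> r" shows "integral cell (\<lambda>x. \<bar>Dx l (ww i) (t, x)\<bar> powr r) \<le> (B * C1 * K * N) powr r * Ed"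
proof -
  have "0 \<le> C1" using lam by (simp add: C1_def)
  then show ?thesis
    by (intro integral_powr_EE) (use r AB K0 N1 conts abs_Dx_ww[OF t] in \<open>auto simp: mult_ac\<close>)
qed

end

end

subsection \<open>Choice of parameters\<close>

text \<open>Polynomial order with a real exponent, negative ones included, as bookkeeping for
  sequences indexed by the frequency. Index 0 is excluded, where a power of \<open>n\<close> carries
  no information.\<close>

definition pO :: "real \<Rightarrow> (nat \<Rightarrow> real) \<Rightarrow> bool" where
  "pO r f \<longleftrightarrow> (\<exists>C\<ge>0. \<forall>n\<ge>1. \<bar>f n\<bar> \<le> C * real n powr r)"

lemma pO_const: "pO 0 (\<lambda>n. c)"
  unfolding pO_def by (rule exI[of _ "\<bar>c\<bar>"]) auto

lemma pO_npowr: "pO r (\<lambda>n. real n powr r)"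
  unfolding pO_def by (rule exI[of _ 1]) auto

lemma pO_mono: "pO r g \<Longrightarrow> (\<And>n. n \<ge> 1 \<Longrightarrow> \<bar>f n\<bar> \<le> \<bar>g n\<bar>) \<Longrightarrow> pO r f"
  unfolding pO_def by (meson order_trans)

lemma pO_mult: assumes "pO r f" "pO s g" shows "pO (r + s) (\<lambda>n. f n * g n)"
proof -
  obtain C D where C: "C \<ge> 0" "\<And>n. n \<ge> 1 \<Longrightarrow> \<bar>f n\<bar> \<le> C * real n powr r" and D: "D \<ge> 0" "\<And>n. n \<ge> 1 \<Longrightarrow> \<bar>g n\<bar> \<le> D * real n powr s"
    using assms by (auto simp: pO_def)
  have "\<bar>f n * g n\<bar> \<le> C * D * real n powr (r + s)" if "n \<ge> 1" for n
  proof -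
    have "\<bar>f n * g n\<bar> \<le> (C * real n powr r) * (D * real n powr s)"
      unfolding abs_mult using C D that by (intro mult_mono) auto
    then show ?thesis using that by (simp add: powr_add mult_ac)
  qed
  then show ?thesis unfolding pO_def using C D by (intro exI[of _ "C * D"]) auto
qed

lemma pO_divide: "pO r f \<Longrightarrow> pO s (\<lambda>n. inverse (g n)) \<Longrightarrow> pO (r + s) (\<lambda>n. f n / g n)"
  unfolding divide_inverse by (rule pO_mult)

lemma pO_powr: assumes "pO r f" "\<And>n. 0 \<le> f n" "0 \<le> q" shows "pO (q * r) (\<lambda>n. f n powr q)"
proof -
  obtain C where C: "C \<ge> 0" "\<And>n. n \<ge> 1 \<Longrightarrow> \<bar>f n\<bar> \<le> C * real n powr r" using assms by (auto simp: pO_def)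
  have "\<bar>f n powr q\<bar> \<le> C powr q * real n powr (q * r)" if "n \<ge> 1" for n
  proof -
    have "f n powr q \<le> (C * real n powr r) powr q" using C(2)[OF that] assms by (intro powr_mono2) auto
    then show ?thesis using C by (simp add: powr_mult powr_powr mult.commute)
  qed
  then show ?thesis unfolding pO_def by (intro exI[of _ "C powr q"]) auto
qed

lemma pO_lim: assumes "pO r f" "r < 0" shows "f \<longlonglongrightarrow> 0"
proof -
  obtain C where C: "C \<ge> 0" "\<And>n. n \<ge> 1 \<Longrightarrow> \<bar>f n\<bar> \<le> C * real n powr r" using assms by (auto simp: pO_def)
  have "(\<lambda>n. real n powr r) \<longlonglongrightarrow> 0"
    using assms(2) by (intro tendsto_neg_powr filterlim_real_sequentially)
  then have "(\<lambda>n. C * real n powr r) \<longlonglongrightarrow> 0" using tendsto_mult_right_zero by blast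
  then show ?thesis
    by (rule Lim_null_comparison[rotated]) (use C(2) in \<open>auto simp: eventually_sequentially\<close>)
qed

text \<open>With e = d/pt - d/p' the requirements read \<sigma> > p'/d and \<sigma> > 1/e. The first
  bound is below 1 because p' < d; the second because 1/p' = 1 - 1/p turns the inequality for
  \<open>p\<close> and \<open>pt\<close> into e > 1. The midpoint between the larger bound and 1 is
  taken.\<close>

lemma scale_exponents:
  fixes p p' pt d :: real
  assumes p: "1 < p" and pt: "1 < pt" and d: "0 < d" and p': "p' = p / (p - 1)" and pd: "p' < d" and pp: "1 / p + 1 / pt > 1 + 1 / d"
  obtains \<sigma> where "0 < \<sigma>" "\<sigma> < 1" "\<sigma> * d / p' > 1" "\<sigma> * d / pt - \<sigma> * d / p' > 1"
proof -
  have p'0: "0 < p'" using p p' by simp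
  have ip: "1 / p' = 1 - 1 / p" using p by (simp add: p' diff_divide_distrib)
  define e where "e = d / pt - d / p'"
  have "1 / pt - 1 / p' > 1 / d" using pp ip by linarith
  then have "d * (1 / pt - 1 / p') > d * (1 / d)" using d by (intro mult_strict_left_mono) auto
  then have e1: "e > 1" using d by (simp add: e_def right_diff_distrib)
  define m where "m = max (p' / d) (1 / e)"
  define \<sigma> where "\<sigma> = (1 + m) / 2"
  have m: "m < 1" "0 < m" "p' / d \<le> m" "1 / e \<le> m" using pd d e1 p'0 by (auto simp: m_def less_max_iff_disj)
  then have "m < \<sigma>" "0 < \<sigma>" "\<sigma> < 1" by (auto simp: \<sigma>_def)
  then have s: "0 < \<sigma>" "\<sigma> < 1" "\<sigma> > p' / d" "\<sigma> > 1 / e" using m by linarith+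
  have "\<sigma> * d / p' > 1" using s(3) d p'0 by (simp add: field_simps)
  moreover have "\<sigma> * e > 1" using s(4) e1 by (simp add: field_simps)
  ultimately show ?thesis using that[of \<sigma>] s by (simp add: e_def right_diff_distrib)
qed

text \<open>Every quantity is bounded by sums of powers of \<open>n\<close>, so exponents are
  compared. With \<beta> = \<sigma> d/p' the conditions that arise are \<beta> > 1, \<beta> + 1 <
  \<sigma> d/pt, \<sigma> < 1 and \<beta> < \<tau> < \<beta> + 1 - \<sigma>; the given \<tau> is the
  midpoint of the last window.\<close>

lemma eventually_small:
  fixes p p' pt d :: real and K C1 cQ cD c\<^sub>0 \<sigma> \<tau> :: real and D :: nat
  assumes p: "1 < p" and pt: "1 < pt" and p': "p' = p / (p - 1)" and d: "d = real D" "0 < d"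
    and s: "0 < \<sigma>" "\<sigma> < 1" "\<sigma> * d / p' > 1" "\<sigma> * d / pt - \<sigma> * d / p' > 1"
    and tau: "\<tau> = \<sigma> * d / p' + (1 - \<sigma>) / 2"
    and nn: "0 \<le> K" "0 \<le> C1" "0 \<le> cQ" "0 \<le> cD" and c0: "0 < c\<^sub>0"
    and mu: "\<And>n. mu n = real n powr \<sigma>" and om: "\<And>n. om n = real n powr \<tau>"
    and MM: "\<And>n. n \<ge> 1 \<Longrightarrow> (c\<^sub>0 / mu n) ^ D \<le> MM n" "\<And>n. 0 \<le> MM n"
    and A: "\<And>n. A n = mu n powr (d / p)" and B: "\<And>n. B n = 1 / (A n * MM n)" and Ed: "\<And>n. Ed n = (pi * sqrt 2 / mu n) ^ D"
    and e: "0 < e"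
  shows "\<forall>\<^sub>F n in sequentially. (2 * A n * K * (mu n / real n)) powr p * Ed n \<le> e
     \<and> (cQ / om n / MM n) powr (p - 1) * (cQ / om n) \<le> e
     \<and> (2 * B n * K * (mu n / real n)) powr p' * Ed n \<le> e
     \<and> (3 * B n * K) powr pt * Ed n \<le> e \<and> (B n * C1 * K * real n) powr pt * Ed n \<le> e
     \<and> (12 * A n * B n * K\<^sup>2 * (mu n / real n) + 3 * A n * K * (om n * mu n / real n) + A n * C1 * K * real n + 3 * A n * K\<^sup>2 + 3 * B n * K\<^sup>2) * Ed n
        + (3 * B n * K + K) * (cQ / om n) + (cQ / om n + K / om n * (cD * real n / MM n * Ed n)) \<le> e"
proof -
  \<comment> \<open>These are the orders of \<open>A\<close>, of \<open>B\<close> and of the inverse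
    of \<open>MM\<close>; the order of \<open>Ed\<close> is minus the last one.\<close>
  define \<alpha> \<beta> \<gamma> where "\<alpha> = \<sigma> * d / p" and "\<beta> = \<sigma> * d / p'" and "\<gamma> = \<sigma> * d"
  have p'1: "1 < p'" using p p' by (simp add: less_divide_eq)
  have ab: "\<alpha> + \<beta> = \<gamma>" unfolding \<alpha>_def \<beta>_def \<gamma>_def p' using p by (simp add: field_simps)
  have pa: "p * \<alpha> = \<gamma>" using p by (simp add: \<alpha>_def \<gamma>_def)
  have pb: "p' * \<beta> = \<gamma>" using p'1 by (simp add: \<beta>_def \<gamma>_def)
  have tau': "\<tau> = \<beta> + (1 - \<sigma>) / 2" using tau by (simp add: \<beta>_def)
  have s1: "\<beta> > 1" "\<gamma> / pt - \<beta> > 1" using s by (auto simp: \<beta>_def \<gamma>_def)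
  have a0: "0 < \<alpha>" "0 < \<gamma>" using s d p by (auto simp: \<alpha>_def \<gamma>_def)
  have oA: "pO \<alpha> A"
    by (rule pO_mono[OF pO_npowr]) (simp add: A mu powr_powr \<alpha>_def)
  have oiA: "pO (- \<alpha>) (\<lambda>n. inverse (A n))"
    by (rule pO_mono[OF pO_npowr]) (simp add: A mu powr_powr \<alpha>_def powr_minus)
  have omu: "pO (\<sigma> - 1) (\<lambda>n. mu n / real n)"
    by (rule pO_mono[OF pO_npowr]) (simp add: mu powr_diff)
  have on: "pO 1 (\<lambda>n. real n)" by (rule pO_mono[OF pO_npowr]) simp
  have oiom: "pO (- \<tau>) (\<lambda>n. inverse (om n))"
    by (rule pO_mono[OF pO_npowr]) (simp add: om powr_minus)
  have oom: "pO (\<tau> + (\<sigma> - 1)) (\<lambda>n. om n * mu n / real n)"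
    using pO_mult[OF pO_npowr[of \<tau>] omu] by (simp add: om)
  have oEd: "pO (- \<gamma>) Ed"
  proof (rule pO_mono)
    show "pO (- \<gamma>) (\<lambda>n. (pi * sqrt 2) ^ D * real n powr (- \<gamma>))"
      using pO_mult[OF pO_const pO_npowr[of "- \<gamma>"], of "(pi * sqrt 2) ^ D"] by simp
    fix n :: nat assume n: "n \<ge> 1"
    have "mu n ^ D = real n powr \<gamma>" using n by (simp add: mu \<gamma>_def d powr_powr flip: powr_realpow)
    then show "\<bar>Ed n\<bar> \<le> \<bar>(pi * sqrt 2) ^ D * real n powr - \<gamma>\<bar>"
      by (simp add: Ed power_divide powr_minus inverse_eq_divide)
  qed
  have oMM: "pO \<gamma> (\<lambda>n. inverse (MM n))"
  proof (rule pO_mono)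
    show "pO \<gamma> (\<lambda>n. (1 / c\<^sub>0 ^ D) * real n powr \<gamma>)"
      using pO_mult[OF pO_const pO_npowr[of \<gamma>], of "1 / c\<^sub>0 ^ D"] by simp
    fix n :: nat assume n: "n \<ge> 1"
    have m: "mu n ^ D = real n powr \<gamma>" using n by (simp add: mu \<gamma>_def d powr_powr flip: powr_realpow)
    have m0: "0 < mu n" using n by (simp add: mu)
    have "0 < (c\<^sub>0 / mu n) ^ D" using m0 c0 by simp
    then have "inverse (MM n) \<le> inverse ((c\<^sub>0 / mu n) ^ D)" "0 < MM n" using MM(1)[OF n] by (auto intro: le_imp_inverse_le)
    then show "\<bar>inverse (MM n)\<bar> \<le> \<bar>(1 / c\<^sub>0 ^ D) * real n powr \<gamma>\<bar>"
      using c0 by (simp add: power_divide m)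
  qed
  have oB: "pO \<beta> B"
  proof -
    have "pO (- \<alpha> + \<gamma>) (\<lambda>n. inverse (A n) * inverse (MM n))" by (rule pO_mult[OF oiA oMM])
    moreover have "- \<alpha> + \<gamma> = \<beta>" using ab by simp
    moreover have "B = (\<lambda>n. inverse (A n) * inverse (MM n))" by (simp add: fun_eq_iff B divide_inverse)
    ultimately show ?thesis by metis
  qed
  have A0: "0 \<le> A n" for n by (simp add: A)
  have B0: "0 \<le> B n" for n using A0[of n] MM(2)[of n] by (simp add: B)
  have mu0: "0 \<le> mu n" and om0: "0 \<le> om n" for n by (simp_all add: mu om)
  have l1: "(\<lambda>n. (2 * A n * K * (mu n / real n)) powr p * Ed n) \<longlonglongrightarrow> 0"
  proof (rule pO_lim)
    show "pO (p * (0 + \<alpha> + 0 + (\<sigma> - 1)) + - \<gamma>) (\<lambda>n. (2 * A n * K * (mu n / real n)) powr p * Ed n)"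
      by (intro pO_mult oEd pO_powr pO_const oA omu) (use nn A0 mu0 p in auto)
    have "p * (\<sigma> - 1) < 0" using p s by (intro mult_pos_neg) auto
    then show "p * (0 + \<alpha> + 0 + (\<sigma> - 1)) + - \<gamma> < 0" using pa by (simp add: distrib_left)
  qed
  have l2: "(\<lambda>n. (cQ / om n / MM n) powr (p - 1) * (cQ / om n)) \<longlonglongrightarrow> 0"
  proof (rule pO_lim)
    show "pO ((p - 1) * (0 + - \<tau> + \<gamma>) + (0 + - \<tau>)) (\<lambda>n. (cQ / om n / MM n) powr (p - 1) * (cQ / om n))"
      by (intro pO_mult pO_powr pO_divide pO_const oiom oMM) (use nn om0 MM(2) p in auto)
    \<comment> \<open>By \<alpha> + \<beta> = \<gamma> = p \<alpha> the exponent collapses to p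
      (\<beta> - \<tau>): smallness of the corrector in L^p is the lower limit for the
      speed.\<close>
    have "(p - 1) * (0 + - \<tau> + \<gamma>) + (0 + - \<tau>) = p * (\<gamma> - \<tau>) - \<gamma>" by (simp add: algebra_simps)
    also have "\<dots> = p * (\<beta> - \<tau>)" using ab pa by (simp add: algebra_simps flip: ab)
    also have "\<dots> < 0" using p s tau' by (intro mult_pos_neg) auto
    finally show "(p - 1) * (0 + - \<tau> + \<gamma>) + (0 + - \<tau>) < 0" .
  qed
  have l3: "(\<lambda>n. (2 * B n * K * (mu n / real n)) powr p' * Ed n) \<longlonglongrightarrow> 0"
  proof (rule pO_lim)
    show "pO (p' * (0 + \<beta> + 0 + (\<sigma> - 1)) + - \<gamma>) (\<lambda>n. (2 * B n * K * (mu n / real n)) powr p' * Ed n)"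
      by (intro pO_mult oEd pO_powr pO_const oB omu) (use nn B0 mu0 p'1 in auto)
    have "p' * (\<sigma> - 1) < 0" using p'1 s by (intro mult_pos_neg) auto
    then show "p' * (0 + \<beta> + 0 + (\<sigma> - 1)) + - \<gamma> < 0" using pb by (simp add: distrib_left)
  qed
  have l4: "(\<lambda>n. (3 * B n * K) powr pt * Ed n) \<longlonglongrightarrow> 0"
  proof (rule pO_lim)
    show "pO (pt * (0 + \<beta> + 0) + - \<gamma>) (\<lambda>n. (3 * B n * K) powr pt * Ed n)"
      by (intro pO_mult oEd pO_powr pO_const oB) (use nn B0 pt in auto)
    have "pt * (0 + \<beta> + 0) + - \<gamma> = pt * (\<beta> - \<gamma> / pt)" using pt by (simp add: algebra_simps)
    also have "\<dots> < 0" using pt s1 by (intro mult_pos_neg) auto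
    finally show "pt * (0 + \<beta> + 0) + - \<gamma> < 0" .
  qed
  have l5: "(\<lambda>n. (B n * C1 * K * real n) powr pt * Ed n) \<longlonglongrightarrow> 0"
  proof (rule pO_lim)
    show "pO (pt * (\<beta> + 0 + 0 + 1) + - \<gamma>) (\<lambda>n. (B n * C1 * K * real n) powr pt * Ed n)"
      by (intro pO_mult oEd pO_powr pO_const oB on) (use nn B0 pt in auto)
    have "pt * (\<beta> + 0 + 0 + 1) + - \<gamma> = pt * (\<beta> + 1 - \<gamma> / pt)" using pt by (simp add: algebra_simps)
    also have "\<dots> < 0" using pt s1 by (intro mult_pos_neg) auto
    finally show "pt * (\<beta> + 0 + 0 + 1) + - \<gamma> < 0" .
  qed
  have m1: "(\<lambda>n. 12 * A n * B n * K\<^sup>2 * (mu n / real n) * Ed n) \<longlonglongrightarrow> 0"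
  proof (rule pO_lim)
    show "pO (0 + \<alpha> + \<beta> + 0 + (\<sigma> - 1) + - \<gamma>) (\<lambda>n. 12 * A n * B n * K\<^sup>2 * (mu n / real n) * Ed n)"
      by (intro pO_mult oEd pO_const oA oB omu)
  qed (use ab s in auto)
  \<comment> \<open>Here the exponent is \<tau> - \<beta> - (1 - \<sigma>), the upper limit for the
    speed.\<close>
  have m2: "(\<lambda>n. 3 * A n * K * (om n * mu n / real n) * Ed n) \<longlonglongrightarrow> 0"
  proof (rule pO_lim)
    show "pO (0 + \<alpha> + 0 + (\<tau> + (\<sigma> - 1)) + - \<gamma>) (\<lambda>n. 3 * A n * K * (om n * mu n / real n) * Ed n)"
      by (intro pO_mult oEd pO_const oA oom)
  qed (use ab s tau' in argo)
  \<comment> \<open>The diffusion of the density has exponent 1 - \<beta>.\<close>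
  have m3: "(\<lambda>n. A n * C1 * K * real n * Ed n) \<longlonglongrightarrow> 0"
  proof (rule pO_lim)
    show "pO (\<alpha> + 0 + 0 + 1 + - \<gamma>) (\<lambda>n. A n * C1 * K * real n * Ed n)"
      by (intro pO_mult oEd pO_const oA on)
  qed (use ab s1 in auto)
  have m4: "(\<lambda>n. 3 * A n * K\<^sup>2 * Ed n) \<longlonglongrightarrow> 0"
  proof (rule pO_lim)
    show "pO (0 + \<alpha> + 0 + - \<gamma>) (\<lambda>n. 3 * A n * K\<^sup>2 * Ed n)" by (intro pO_mult oEd pO_const oA)
  qed (use ab s1 in auto)
  have m5: "(\<lambda>n. 3 * B n * K\<^sup>2 * Ed n) \<longlonglongrightarrow> 0"
  proof (rule pO_lim)
    show "pO (0 + \<beta> + 0 + - \<gamma>) (\<lambda>n. 3 * B n * K\<^sup>2 * Ed n)" by (intro pO_mult oEd pO_const oB)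
  qed (use ab a0 in auto)
  have m6: "(\<lambda>n. 3 * B n * K * (cQ / om n)) \<longlonglongrightarrow> 0"
  proof (rule pO_lim)
    show "pO (0 + \<beta> + 0 + (0 + - \<tau>)) (\<lambda>n. 3 * B n * K * (cQ / om n))" by (intro pO_mult pO_divide pO_const oB oiom)
  qed (use tau' s in auto)
  have m7: "(\<lambda>n. c / om n) \<longlonglongrightarrow> 0" for c
  proof (rule pO_lim)
    show "pO (0 + - \<tau>) (\<lambda>n. c / om n)" by (intro pO_divide pO_const oiom)
  qed (use tau' s s1 in auto)
  have m8: "(\<lambda>n. K / om n * (cD * real n / MM n * Ed n)) \<longlonglongrightarrow> 0"
  proof (rule pO_lim)
    show "pO ((0 + - \<tau>) + (0 + 1 + \<gamma> + - \<gamma>)) (\<lambda>n. K / om n * (cD * real n / MM n * Ed n))"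
      by (intro pO_mult pO_divide pO_const oiom on oMM oEd)
  qed (use tau' s s1 in argo)
  have l6: "(\<lambda>n. (12 * A n * B n * K\<^sup>2 * (mu n / real n) + 3 * A n * K * (om n * mu n / real n) + A n * C1 * K * real n + 3 * A n * K\<^sup>2 + 3 * B n * K\<^sup>2) * Ed n
        + (3 * B n * K + K) * (cQ / om n) + (cQ / om n + K / om n * (cD * real n / MM n * Ed n))) \<longlonglongrightarrow> 0"
  proof -
    have "(\<lambda>n. (12 * A n * B n * K\<^sup>2 * (mu n / real n) * Ed n + 3 * A n * K * (om n * mu n / real n) * Ed n + A n * C1 * K * real n * Ed n + 3 * A n * K\<^sup>2 * Ed n + 3 * B n * K\<^sup>2 * Ed n)
        + (3 * B n * K * (cQ / om n) + K * cQ / om n) + (cQ / om n + K / om n * (cD * real n / MM n * Ed n))) \<longlonglongrightarrow> (0 + 0 + 0 + 0 + 0) + (0 + 0) + (0 + 0)"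
      by (intro tendsto_add m1 m2 m3 m4 m5 m6 m7 m8)
    moreover have "(12 * A n * B n * K\<^sup>2 * (mu n / real n) * Ed n + 3 * A n * K * (om n * mu n / real n) * Ed n + A n * C1 * K * real n * Ed n + 3 * A n * K\<^sup>2 * Ed n + 3 * B n * K\<^sup>2 * Ed n)
        + (3 * B n * K * (cQ / om n) + K * cQ / om n) = (12 * A n * B n * K\<^sup>2 * (mu n / real n) + 3 * A n * K * (om n * mu n / real n) + A n * C1 * K * real n + 3 * A n * K\<^sup>2 + 3 * B n * K\<^sup>2) * Ed n
        + (3 * B n * K + K) * (cQ / om n)" for n by (simp only: distrib_right times_divide_eq_right add_divide_distrib)
    ultimately show ?thesis by (simp only: add_0)
  qed
  have ev: "\<forall>\<^sub>F n in sequentially. F n \<le> e" if "F \<longlonglongrightarrow> 0" for F :: "nat \<Rightarrow> real"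
    using order_tendstoD(2)[OF that e] by eventually_elim simp
  show ?thesis by (intro eventually_conj ev l1 l2 l3 l4 l5 l6)
qed

section \<open>Bounds of slow functions and regularised amplitudes\<close>

lemma bounded_on_slab:
  fixes F :: "real \<times> (real^'d) \<Rightarrow> real"
  assumes "smooth F"
  shows "\<exists>C\<ge>0. \<forall>t\<in>{0..T}. \<forall>x\<in>cell. \<bar>F (t, x)\<bar> \<le> C"
proof -
  have "compact ({0..T} \<times> (cell :: (real^'d) set))" by (intro compact_Times) (auto simp: cell_def)
  then have "compact (F ` ({0..T} \<times> cell))" by (rule compact_continuous_image[OF smooth_continuous_on[OF assms]])
  then obtain C where "\<And>y. y \<in> F ` ({0..T} \<times> cell) \<Longrightarrow> norm y \<le> C"
    using compact_imp_bounded bounded_iff by metis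
  then show ?thesis by (intro exI[of _ "max C 0"]) force
qed

lemma bounded_on_slab_finite:
  fixes S :: "(real \<times> (real^'d) \<Rightarrow> real) set"
  assumes "finite S" "\<And>F. F \<in> S \<Longrightarrow> smooth F"
  shows "\<exists>C\<ge>0. \<forall>F\<in>S. \<forall>t\<in>{0..T}. \<forall>x\<in>cell. \<bar>F (t, x)\<bar> \<le> C"
  using assms
proof (induction S)
  case (insert F S)
  obtain C where C: "C \<ge> 0" "\<forall>F\<in>S. \<forall>t\<in>{0..T}. \<forall>x\<in>cell. \<bar>F (t, x)\<bar> \<le> C" using insert by auto
  obtain D where D: "D \<ge> 0" "\<forall>t\<in>{0..T}. \<forall>x\<in>cell. \<bar>F (t, x)\<bar> \<le> D" using bounded_on_slab[of F T] insert by auto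
  show ?case using C D by (intro exI[of _ "max C D"]) (auto simp: le_max_iff_disj)
qed auto

text \<open>A regularised absolute value. For positive \<open>\<kappa>\<close> it is bounded away
  from zero, so all its real powers are smooth; the square root is written as a \<open>powr\<close>
  to fall under \<open>smooth_powr\<close>.\<close>

definition amp :: "real \<Rightarrow> (real \<times> (real^'d) \<Rightarrow> real) \<Rightarrow> real \<times> (real^'d) \<Rightarrow> real" where
  "amp \<kappa> g z = ((g z)\<^sup>2 + \<kappa>\<^sup>2) powr (1 / 2)"

context
  fixes \<kappa> :: real and g :: "real \<times> (real^'d) \<Rightarrow> real"
  assumes kap: "0 < \<kappa>" and g: "smooth g"
begin

lemma amp_sqrt: "amp \<kappa> g z = sqrt ((g z)\<^sup>2 + \<kappa>\<^sup>2)" by (simp add: amp_def powr_half_sqrt)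

lemma amp_pos: "0 < amp \<kappa> g z"
proof -
  have "0 < (g z)\<^sup>2 + \<kappa>\<^sup>2" using kap by (intro add_nonneg_pos) auto
  then show ?thesis unfolding amp_sqrt by simp
qed

lemma amp_sq: "(amp \<kappa> g z)\<^sup>2 = (g z)\<^sup>2 + \<kappa>\<^sup>2" unfolding amp_sqrt by simp

lemma amp_ge: "\<bar>g z\<bar> \<le> amp \<kappa> g z" unfolding amp_sqrt by (rule real_le_rsqrt) simp

lemma amp_le: "amp \<kappa> g z \<le> \<bar>g z\<bar> + \<kappa>"
  unfolding amp_sqrt using kap by (intro real_le_lsqrt) (auto simp: power2_sum)

lemma smooth_amp: "smooth (amp \<kappa> g)"
proof -
  have "0 < (g z)\<^sup>2 + \<kappa>\<^sup>2" for z using kap by (intro add_nonneg_pos) auto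
  then show ?thesis unfolding amp_def[abs_def] by (intro smooth_powr smooth_intros g)
qed

lemma smooth_amp_powr: "smooth (\<lambda>z. amp \<kappa> g z powr r)"
  by (rule smooth_powr[OF smooth_amp amp_pos])

text \<open>By |g| \<le> \<open>amp\<close> the powers of \<open>g\<close> can be absorbed. The
  expression inside is a regular substitute for |g|^(1/q) that keeps \<open>n\<close> factors of
  \<open>g\<close>, and hence a zero wherever \<open>g\<close> vanishes.\<close>

lemma amp_powr_abs:
  assumes r: "0 < q"
  shows "(\<bar>g z\<bar> ^ n * amp \<kappa> g z powr (1 / q - real n)) powr q \<le> amp \<kappa> g z"
proof -
  have "\<bar>g z\<bar> ^ n \<le> amp \<kappa> g z ^ n" using amp_ge by (intro power_mono) auto
  then have "\<bar>g z\<bar> ^ n * amp \<kappa> g z powr (1 / q - real n) \<le> amp \<kappa> g z powr real n * amp \<kappa> g z powr (1 / q - real n)"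
    using amp_pos[of z] by (intro mult_right_mono) (auto simp: powr_realpow)
  also have "\<dots> = amp \<kappa> g z powr (1 / q)" by (simp flip: powr_add)
  finally have "(\<bar>g z\<bar> ^ n * amp \<kappa> g z powr (1 / q - real n)) powr q \<le> (amp \<kappa> g z powr (1 / q)) powr q"
    using r by (intro powr_mono2) auto
  also have "\<dots> = amp \<kappa> g z" using r amp_pos[of z] by (simp add: powr_powr)
  finally show ?thesis .
qed

text \<open>With y the value of \<open>g\<close>, the difference is y \<kappa>^2 (2 y^2 +
  \<kappa>^2) / (y^2 + \<kappa>^2)^2, and 2 |y| \<kappa> \<le> y^2 + \<kappa>^2 bounds it by
  \<kappa>.\<close>

lemma amp_residual: "\<bar>g z - (g z) ^ 5 * amp \<kappa> g z powr (- 4)\<bar> \<le> \<kappa>"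
proof -
  let ?h = "amp \<kappa> g z"
  have h4: "?h powr (- 4) = 1 / ((g z)\<^sup>2 + \<kappa>\<^sup>2)\<^sup>2"
  proof -
    have "?h powr (- 4) = 1 / ?h powr (real 4)" by (simp add: powr_minus divide_inverse)
    also have "?h powr (real 4) = ?h ^ 4" by (rule powr_realpow[OF amp_pos])
    also have "?h ^ 4 = (?h\<^sup>2)\<^sup>2" by simp
    finally show ?thesis by (simp add: amp_sq)
  qed
  define y where "y = g z"
  have D: "y\<^sup>2 + \<kappa>\<^sup>2 > 0" using kap by (intro add_nonneg_pos) auto
  have "y - y ^ 5 * (1 / (y\<^sup>2 + \<kappa>\<^sup>2)\<^sup>2) = y * \<kappa>\<^sup>2 * (2 * y\<^sup>2 + \<kappa>\<^sup>2) / (y\<^sup>2 + \<kappa>\<^sup>2)\<^sup>2"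
  proof -
    have 1: "y * (y\<^sup>2 + \<kappa>\<^sup>2)\<^sup>2 - y ^ 5 = y * \<kappa>\<^sup>2 * (2 * y\<^sup>2 + \<kappa>\<^sup>2)"
      by (simp add: power2_eq_square eval_nat_numeral algebra_simps)
    have "y - y ^ 5 * (1 / W) = (y * W - y ^ 5) / W" if "W > 0" for W using that by (simp add: diff_divide_distrib)
    from this[of "(y\<^sup>2 + \<kappa>\<^sup>2)\<^sup>2"] show ?thesis using D kap unfolding 1 by simp
  qed
  then have "\<bar>y - y ^ 5 * (1 / (y\<^sup>2 + \<kappa>\<^sup>2)\<^sup>2)\<bar> = \<bar>y\<bar> * \<kappa>\<^sup>2 * (2 * y\<^sup>2 + \<kappa>\<^sup>2) / (y\<^sup>2 + \<kappa>\<^sup>2)\<^sup>2"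
    by (simp add: abs_mult)
  also have "\<dots> \<le> \<kappa>"
  proof -
    have "2 * (\<bar>y\<bar> * \<kappa>) \<le> y\<^sup>2 + \<kappa>\<^sup>2" using zero_le_power2[of "\<bar>y\<bar> - \<kappa>"] by (simp add: power2_diff)
    then have "(2 * (\<bar>y\<bar> * \<kappa>)) * (y\<^sup>2 + \<kappa>\<^sup>2) \<le> (y\<^sup>2 + \<kappa>\<^sup>2) * (y\<^sup>2 + \<kappa>\<^sup>2)" using D by (intro mult_right_mono) auto
    moreover have "(\<bar>y\<bar> * \<kappa>) * (2 * y\<^sup>2 + \<kappa>\<^sup>2) \<le> (\<bar>y\<bar> * \<kappa>) * (2 * (y\<^sup>2 + \<kappa>\<^sup>2))" using kap by (intro mult_left_mono) auto
    moreover have "(\<bar>y\<bar> * \<kappa>) * (2 * (y\<^sup>2 + \<kappa>\<^sup>2)) = (2 * (\<bar>y\<bar> * \<kappa>)) * (y\<^sup>2 + \<kappa>\<^sup>2)" by simp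
    ultimately have "(\<bar>y\<bar> * \<kappa>) * (2 * y\<^sup>2 + \<kappa>\<^sup>2) \<le> (y\<^sup>2 + \<kappa>\<^sup>2) * (y\<^sup>2 + \<kappa>\<^sup>2)" by linarith
    then have "(\<bar>y\<bar> * \<kappa>) * (2 * y\<^sup>2 + \<kappa>\<^sup>2) \<le> (y\<^sup>2 + \<kappa>\<^sup>2)\<^sup>2" by (simp only: power2_eq_square)
    then have "\<kappa> * ((\<bar>y\<bar> * \<kappa>) * (2 * y\<^sup>2 + \<kappa>\<^sup>2)) \<le> \<kappa> * (y\<^sup>2 + \<kappa>\<^sup>2)\<^sup>2" using kap by (intro mult_left_mono) auto
    then have "\<bar>y\<bar> * \<kappa>\<^sup>2 * (2 * y\<^sup>2 + \<kappa>\<^sup>2) \<le> \<kappa> * (y\<^sup>2 + \<kappa>\<^sup>2)\<^sup>2" by (simp add: power2_eq_square mult_ac)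
    then show ?thesis using D by (simp add: divide_le_eq)
  qed
  finally show ?thesis by (simp add: h4 y_def)
qed

text \<open>A zero of order two survives one differentiation; the application is to the time
  direction.\<close>

lemma ddir_power_vanish:
  assumes "smooth s" "g z = 0"
  shows "ddir v (\<lambda>z. c * ((g z) ^ Suc (Suc n) * s z)) z = 0"
proof -
  have "(\<lambda>z. c * ((g z) ^ Suc (Suc n) * s z)) = (\<lambda>z. g z * (g z * (c * ((g z) ^ n * s z))))" by (simp add: fun_eq_iff)
  moreover have "smooth (\<lambda>z. c * ((g z) ^ n * s z))" by (intro smooth_intros g assms)
  ultimately show ?thesis by (simp add: ddir_mult smooth_mult g assms)
qed

end

section \<open>Specification and construction of one perturbation step\<close>

definition step_bound :: "real \<Rightarrow> real \<Rightarrow> real \<Rightarrow> real \<Rightarrow> real \<Rightarrow> real \<Rightarrow> real \<Rightarrow> (real \<times> (real^'d) \<Rightarrow> real) \<Rightarrow> ('d \<Rightarrow> real \<times> (real^'d) \<Rightarrow> real) \<Rightarrow> bool" where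
  "step_bound T p pt M\<^sub>1 M\<^sub>2 \<delta> t \<zeta> w \<longleftrightarrow>
     integral cell (\<lambda>x. \<bar>\<zeta> (t, x)\<bar> powr p) \<le> M\<^sub>1 \<and>
     (\<forall>i. integral cell (\<lambda>x. \<bar>w i (t, x)\<bar> powr (hconj p)) \<le> M\<^sub>2) \<and>
     (\<forall>i. integral cell (\<lambda>x. \<bar>w i (t, x)\<bar> powr pt) \<le> \<delta>) \<and>
     (\<forall>i l. integral cell (\<lambda>x. \<bar>Dx l (w i) (t, x)\<bar> powr pt) \<le> \<delta>)"

text \<open>\<open>M\<^sub>1\<close> and \<open>M\<^sub>2\<close> will be proportional to the size
  of the defect, while \<open>\<delta>\<close> is freely small. By the last clause nothing changes
  at times with zero defect, and the new defect vanishes there too, which makes the clause stable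
  under iteration.\<close>

definition is_step :: "real \<Rightarrow> real \<Rightarrow> real \<Rightarrow> (real \<times> (real^'d) \<Rightarrow> real) \<Rightarrow> ('d \<Rightarrow> real \<times> (real^'d) \<Rightarrow> real) \<Rightarrow> ('d \<Rightarrow> real \<times> (real^'d) \<Rightarrow> real) \<Rightarrow> real \<Rightarrow> real \<Rightarrow> real
    \<Rightarrow> (real \<times> (real^'d) \<Rightarrow> real) \<Rightarrow> ('d \<Rightarrow> real \<times> (real^'d) \<Rightarrow> real) \<Rightarrow> ('d \<Rightarrow> real \<times> (real^'d) \<Rightarrow> real) \<Rightarrow> bool" where
  "is_step T p pt \<theta> u R M\<^sub>1 M\<^sub>2 \<delta> \<zeta> w R' \<longleftrightarrow>
     smooth \<zeta> \<and> (\<forall>i. smooth (w i)) \<and> solves T (\<lambda>z. \<theta> z + \<zeta> z) (\<lambda>i z. u i z + w i z) R' \<and>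
     (\<forall>t\<in>{0..T}. step_bound T p pt M\<^sub>1 M\<^sub>2 \<delta> t \<zeta> w) \<and>
     (\<forall>t\<in>{0..T}. (\<forall>x i. R i (t, x) = 0) \<longrightarrow> (\<forall>x i. \<zeta> (t, x) = 0 \<and> w i (t, x) = 0 \<and> R' i (t, x) = 0))"

text \<open>Named to fix the order of quantifiers: \<open>M\<close> precedes the solution, the
  defect and above all \<open>\<eta>\<close>, so that \<open>\<eta>\<close> can later be chosen
  against it.\<close>

definition substep_const :: "real \<Rightarrow> real \<Rightarrow> 'd::finite \<Rightarrow> real \<Rightarrow> bool" where
  "substep_const p pt j M \<longleftrightarrow> (\<forall>T \<theta> u (R :: 'd \<Rightarrow> real \<times> (real^'d) \<Rightarrow> real) \<eta> G \<delta>. 0 < T \<longrightarrow> solves T \<theta> u R \<longrightarrow> 0 < \<eta> \<longrightarrow> 0 < G \<longrightarrow> 0 < \<delta> \<longrightarrow>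
      (\<forall>t\<in>{0..T}. integral cell (\<lambda>x. \<bar>R j (t, x)\<bar>) \<le> G) \<longrightarrow>
      (\<exists>\<zeta> w R'. is_step T p pt \<theta> u R (M * \<eta> powr p * G) (M * \<eta> powr (- hconj p) * G) \<delta> \<zeta> w R' \<and>
        (\<forall>t\<in>{0..T}. \<forall>i. integral cell (\<lambda>x. \<bar>R' i (t, x) - (if i = j then 0 else R i (t, x))\<bar>) \<le> \<delta>)))"

text \<open>The parameters are chosen in the order \<open>\<kappa>\<close>, the bound
  \<open>K\<close> for the slow functions, the frequency \<open>lam\<close>, and finally the
  oscillation \<open>n\<close>, each in terms of the earlier ones.\<close>

lemma substep:
  fixes p pt :: real
  assumes p: "1 < p" and pt: "1 < pt" and pp: "1 / p + 1 / pt > 1 + 1 / real CARD('d)" and pd: "hconj p < real CARD('d)"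
    and jk: "j \<noteq> (k :: 'd::finite)"
  shows "\<exists>M>0. substep_const p pt j M"
proof -
  define p' where "p' = p / (p - 1)"
  define D where "D = CARD('d)"
  have hc: "hconj p = p'" by (simp add: hconj_def p'_def)
  have d1: "1 \<le> real D" using card_gt_0_iff[of "UNIV :: 'd set"] by (simp add: D_def Suc_leI)
  have p'1: "1 < p'" using p by (simp add: p'_def less_divide_eq)
  have ipp: "1 / p + 1 / p' = 1" using p by (simp add: p'_def field_simps)
  obtain \<sigma> where s: "0 < \<sigma>" "\<sigma> < 1" "\<sigma> * real D / p' > 1" "\<sigma> * real D / pt - \<sigma> * real D / p' > 1"
    using scale_exponents[OF p pt _ p'_def _ , of "real D"] pp pd d1 unfolding hc D_def by (metis less_le_trans zero_less_one)
  define \<tau> where "\<tau> = \<sigma> * real D / p' + (1 - \<sigma>) / 2"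
  define c0 where "c0 = exp (- 2 * pi\<^sup>2) / 4"
  have c0: "0 < c0" by (simp add: c0_def)
  \<comment> \<open>The 3 in front of \<open>pi ^ D\<close> is that of \<open>hG\<close> below; the
    added 2 and 1 pay for the lower-order terms, each of which is made at most as large as the main
    scale.\<close>
  define M where "M = 3 powr p * (3 * pi ^ D + 2) + 2 powr p' * (3 * ((1 / c0 ^ D) powr p' * pi ^ D) + 1)"
  have M1: "3 powr p * (3 * pi ^ D + 2) \<le> M" "2 powr p' * (3 * ((1 / c0 ^ D) powr p' * pi ^ D) + 1) \<le> M"
    using c0 by (auto simp: M_def)
  have "0 < 3 powr p * (3 * pi ^ D + 2)" by (intro mult_pos_pos add_nonneg_pos) auto
  then have M0: "0 < M" using M1 by linarith
  show ?thesis
    unfolding substep_const_def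
  proof (intro exI[of _ M] conjI M0 allI impI)
    fix T \<eta> G \<delta> :: real and \<theta> and u R :: "'d \<Rightarrow> real \<times> (real^'d) \<Rightarrow> real"
    assume T: "0 < T" and sol: "solves T \<theta> u R" and eta: "0 < \<eta>" and G: "0 < G" and del: "0 < \<delta>"
      and RG: "\<forall>t\<in>{0..T}. integral cell (\<lambda>x. \<bar>R j (t, x)\<bar>) \<le> G"
    define g where "g = R j"
    have sg: "smooth g" using sol by (simp add: solves_def g_def)
    have pg: "per_at 1 t g" if "t \<in> {0..T}" for t using sol that by (simp add: solves_def g_def)
    \<comment> \<open>\<open>G\<close> keeps the integral of \<open>h\<close> below 2 G, and
      \<open>\<delta> / 2\<close> bounds the share of the residual \<open>g - f\<close> in the new
      defect.\<close>
    define \<kappa> where "\<kappa> = min G (\<delta> / 2)"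
    have kap: "0 < \<kappa>" "\<kappa> \<le> G" "\<kappa> \<le> \<delta> / 2" using G del by (auto simp: \<kappa>_def)
    define h where "h = amp \<kappa> g"
    \<comment> \<open>The factors of g make the amplitudes and their first time derivatives vanish together with the defect,
      while g ^ 5 / h ^ 4 still differs from g by at most a multiple of \<open>\<kappa>\<close>.\<close>
    define a where "a z = (- \<eta>) * (g z ^ 3 * h z powr (1 / p - 3))" for z
    define b where "b z = (1 / \<eta>) * (g z ^ 2 * h z powr (1 / p' - 2))" for z
    define f where "f z = 1 * (g z ^ 5 * h z powr (- 4))" for z
    note shp = smooth_amp_powr[OF kap(1) sg, folded h_def]
    have sh: "smooth h" unfolding h_def by (rule smooth_amp[OF kap(1) sg])
    have sa: "smooth a" and sb: "smooth b" and sf: "smooth f"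
      unfolding a_def[abs_def] b_def[abs_def] f_def[abs_def] by (intro smooth_mult smooth_const smooth_power sg shp)+
    have hpos: "0 < h z" for z unfolding h_def by (rule amp_pos[OF kap(1) sg])
    have ab: "a z * b z = - f z" for z
    proof -
      have "a z * b z = - (g z ^ 5 * (h z powr (1 / p - 3) * h z powr (1 / p' - 2)))"
        using eta by (simp add: a_def b_def eval_nat_numeral mult_ac)
      also have "h z powr (1 / p - 3) * h z powr (1 / p' - 2) = h z powr (- 4)"
      proof -
        have "1 / p - 3 + (1 / p' - 2) = - 4" using ipp by simp
        then show ?thesis by (simp only: powr_add[symmetric])
      qed
      finally show ?thesis by (simp add: f_def)
    qed
    have a_h: "\<bar>a z\<bar> powr p \<le> \<eta> powr p * h z" for z
    proof -
      have "\<bar>a z\<bar> = \<eta> * (\<bar>g z\<bar> ^ 3 * h z powr (1 / p - real 3))" using eta by (simp add: a_def abs_mult power_abs)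
      then have "\<bar>a z\<bar> powr p = \<eta> powr p * (\<bar>g z\<bar> ^ 3 * h z powr (1 / p - real 3)) powr p" using eta by (simp add: powr_mult)
      then show ?thesis using mult_left_mono[OF amp_powr_abs[OF kap(1) sg, of p z 3], of "\<eta> powr p"] p by (simp add: h_def)
    qed
    have b_h: "\<bar>b z\<bar> powr p' \<le> \<eta> powr (- p') * h z" for z
    proof -
      have "\<bar>b z\<bar> = (1 / \<eta>) * (\<bar>g z\<bar> ^ 2 * h z powr (1 / p' - real 2))" using eta by (simp add: b_def abs_mult power_abs)
      then have "\<bar>b z\<bar> powr p' = (1 / \<eta>) powr p' * (\<bar>g z\<bar> ^ 2 * h z powr (1 / p' - real 2)) powr p'" using eta by (simp add: powr_mult powr_divide)
      also have "(1 / \<eta>) powr p' = \<eta> powr (- p')" using eta by (simp add: powr_divide powr_minus inverse_eq_divide)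
      finally show ?thesis using mult_left_mono[OF amp_powr_abs[OF kap(1) sg, of p' z 2], of "\<eta> powr (- p')"] p'1 by (simp add: h_def)
    qed
    have per: "per_at 1 t h" "per_at 1 t a" "per_at 1 t b" "per_at 1 t f" if "t \<in> {0..T}" for t
      using pg[OF that] by (simp_all add: per_at_def h_def amp_def a_def b_def f_def)
    let ?S = "{a, b, f, \<theta>, Dt a, Dt f} \<union> range u \<union> range (\<lambda>i. Dx i a) \<union> range (\<lambda>i. Dx i b) \<union> range (\<lambda>i. Dx i f) \<union> range (\<lambda>i. Dx i h)
      \<union> range (\<lambda>(l, i). Dx l (Dx i a)) \<union> range (\<lambda>(l, i). Dx l (Dx i b)) \<union> range (\<lambda>(l, i). Dx l (Dx i f))"
    have "\<exists>K\<ge>0. \<forall>F\<in>?S. \<forall>t\<in>{0..T}. \<forall>x\<in>cell. \<bar>F (t, x)\<bar> \<le> K"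
    proof (rule bounded_on_slab_finite)
      fix F assume "F \<in> ?S"
      then show "smooth F" using sol by (auto simp: solves_def smooth_ddir sa sb sf sh)
    qed auto
    then obtain K where K0: "0 \<le> K" and K: "\<And>F t x. F \<in> ?S \<Longrightarrow> t \<in> {0..T} \<Longrightarrow> x \<in> cell \<Longrightarrow> \<bar>F (t, x)\<bar> \<le> K" by blast
    have K2: "\<bar>Dx l (Dx i a) (t, x)\<bar> \<le> K" "\<bar>Dx l (Dx i b) (t, x)\<bar> \<le> K" "\<bar>Dx l (Dx i f) (t, x)\<bar> \<le> K"
      if "t \<in> {0..T}" "x \<in> cell" for l i t x
      by (rule K[OF _ that], force)+
    have K1: "\<bar>a (t, x)\<bar> \<le> K" "\<bar>b (t, x)\<bar> \<le> K" "\<bar>f (t, x)\<bar> \<le> K" "\<bar>\<theta> (t, x)\<bar> \<le> K" "\<bar>u i (t, x)\<bar> \<le> K" "\<bar>Dt a (t, x)\<bar> \<le> K" "\<bar>Dt f (t, x)\<bar> \<le> K"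
       "\<bar>Dx i a (t, x)\<bar> \<le> K" "\<bar>Dx i b (t, x)\<bar> \<le> K" "\<bar>Dx i f (t, x)\<bar> \<le> K" "\<bar>Dx i h (t, x)\<bar> \<le> K"
      if "t \<in> {0..T}" "x \<in> cell" for i t x
      by (rule K[OF _ that], simp)+
    \<comment> \<open>The first size condition makes the oscillation error in the amplitude
      estimates at most \<open>G\<close>, the second one limits the contribution of
      \<open>VV\<close> to a quarter of \<open>\<delta>\<close>.\<close>
    obtain L :: nat where L: "1 \<le> L" "(real D)\<^sup>2 * K / real L \<le> G" "4 * K * ((real D)\<^sup>2 / real L) \<le> \<delta> / 4"
    proof -
      obtain L :: nat where "max 1 (max ((real D)\<^sup>2 * K / G) (16 * (K * (real D)\<^sup>2) / \<delta>)) \<le> real L" using real_arch_simple by blast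
      then have "1 \<le> L" "(real D)\<^sup>2 * K / G \<le> real L" "16 * (K * (real D)\<^sup>2) / \<delta> \<le> real L" by auto
      then show ?thesis using G del by (intro that[of L]) (auto simp: field_simps)
    qed
    define lam where "lam = real L"
    define C1 where "C1 = 5 + 9 * pi * lam"
    define cD where "cD = 8 * pi * (real D)\<^sup>2 + 8 * pi * lam"
    define cQ where "cQ = K * ((real D)\<^sup>2 + 2)"
    define mu where "mu n = real n powr \<sigma>" for n :: nat
    define om where "om n = real n powr \<tau>" for n :: nat
    \<comment> \<open>For \<open>n \<ge> 1\<close> this is the constant of the blob; the maximum
      covers \<open>n = 0\<close>, as \<open>eventually_small\<close> asks for nonnegativity at
      every index.\<close>
    define MM where "MM n = max 0 (gint (2 * (mu n)\<^sup>2) ^ (D - 1) * gsint (2 * (mu n)\<^sup>2) (real n))" for n :: nat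
    \<comment> \<open>Normalised so that \<open>A n powr p\<close> cancels the factor mu^(-D) of the
      blob integral.\<close>
    define A where "A n = mu n powr (real D / p)" for n
    define B where "B n = 1 / (A n * MM n)" for n
    define Ed where "Ed n = (pi * sqrt 2 / mu n) ^ D" for n
    have tau1: "0 < \<tau>" unfolding \<tau>_def using s by (intro add_pos_pos) auto
    have mu1: "1 \<le> mu n" "mu n \<le> real n" "1 \<le> om n" if "1 \<le> n" for n
      using that s tau1 powr_mono[of \<sigma> 1 "real n"] by (auto simp: mu_def om_def ge_one_powr_ge_zero)
    have bl: "blob j k lam (real n) (om n) (mu n)" if "1 \<le> n" for n
      using jk L mu1[OF that] by unfold_locales (auto simp: lam_def)
    have MMb: "blob.MM TYPE('d) (real n) (mu n) = MM n" "(c0 / mu n) ^ D \<le> MM n" "0 < MM n" if "1 \<le> n" for n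
    proof -
      interpret b: blob j k lam "real n" "om n" "mu n" by (rule bl[OF that])
      show 1: "blob.MM TYPE('d) (real n) (mu n) = MM n" using b.MM_pos by (simp add: MM_def b.MM_def D_def)
      show "(c0 / mu n) ^ D \<le> MM n" using b.MM_ge 1 by (simp add: c0_def D_def)
      show "0 < MM n" using b.MM_pos 1 by simp
    qed
    \<comment> \<open>A quarter of \<open>\<delta>\<close> for the defect, and the two main scales
      for the terms that must fit into the slack of \<open>M\<close>.\<close>
    define e where "e = min (\<delta> / 4) (min (\<eta> powr p * G) (\<eta> powr (- p') * G))"
    have e0: "0 < e" using del eta G by (simp add: e_def)
    have "\<forall>\<^sub>F n in sequentially. (2 * A n * K * (mu n / real n)) powr p * Ed n \<le> e
     \<and> (cQ / om n / MM n) powr (p - 1) * (cQ / om n) \<le> e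
     \<and> (2 * B n * K * (mu n / real n)) powr p' * Ed n \<le> e
     \<and> (3 * B n * K) powr pt * Ed n \<le> e \<and> (B n * C1 * K * real n) powr pt * Ed n \<le> e
     \<and> (12 * A n * B n * K\<^sup>2 * (mu n / real n) + 3 * A n * K * (om n * mu n / real n) + A n * C1 * K * real n + 3 * A n * K\<^sup>2 + 3 * B n * K\<^sup>2) * Ed n
        + (3 * B n * K + K) * (cQ / om n) + (cQ / om n + K / om n * (cD * real n / MM n * Ed n)) \<le> e"
      by (rule eventually_small[where D=D and d="real D" and \<sigma>=\<sigma> and \<tau>=\<tau> and c\<^sub>0=c0, OF p pt p'_def refl])
         (use d1 s K0 c0 MMb e0 in \<open>auto simp: \<tau>_def C1_def cQ_def cD_def lam_def mu_def om_def A_def B_def Ed_def MM_def\<close>)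
    then obtain n where n: "1 \<le> n" and n1: "(2 * A n * K * (mu n / real n)) powr p * Ed n \<le> e"
     and n2: "(cQ / om n / MM n) powr (p - 1) * (cQ / om n) \<le> e"
     and n3: "(2 * B n * K * (mu n / real n)) powr p' * Ed n \<le> e"
     and n4: "(3 * B n * K) powr pt * Ed n \<le> e" and n5: "(B n * C1 * K * real n) powr pt * Ed n \<le> e"
     and n6: "(12 * A n * B n * K\<^sup>2 * (mu n / real n) + 3 * A n * K * (om n * mu n / real n) + A n * C1 * K * real n + 3 * A n * K\<^sup>2 + 3 * B n * K\<^sup>2) * Ed n
        + (3 * B n * K + K) * (cQ / om n) + (cQ / om n + K / om n * (cD * real n / MM n * Ed n)) \<le> e"
      by (metis (no_types, lifting) eventually_sequentially max.cobounded1 max.cobounded2)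
    have mun: "1 \<le> mu n" by (rule mu1[OF n])
    have An: "0 < A n" using mun by (simp add: A_def)
    have Bn: "0 < B n" using An MMb(3)[OF n] by (simp add: B_def)
    interpret E: estimates j k lam "real n" "om n" "mu n" "A n" "B n" T a b f \<theta> u R K
    proof (intro estimates.intro perturbation.intro bl[OF n] perturbation_axioms.intro estimates_axioms.intro)
      show "A n * B n * blob.MM TYPE('d) (real n) (mu n) = 1" using An MMb[OF n] by (simp add: B_def)
    qed (use sa sb sf sol per T mu1[OF n] An Bn ab K1 K2 in \<open>(simp; fail)+\<close>)
    show "\<exists>\<zeta> w R'. is_step T p pt \<theta> u R (M * \<eta> powr p * G) (M * \<eta> powr (- hconj p) * G) \<delta> \<zeta> w R' \<and>
        (\<forall>t\<in>{0..T}. \<forall>i. integral cell (\<lambda>x. \<bar>R' i (t, x) - (if i = j then 0 else R i (t, x))\<bar>) \<le> \<delta>)"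
      unfolding is_step_def
    proof (rule exI[of _ E.th], rule exI[of _ E.ww], rule exI[of _ E.RR], intro conjI allI ballI impI)
      show "smooth E.th" "smooth (E.ww i)" for i by (rule E.sth E.sww)+
      show "solves T (\<lambda>z. \<theta> z + E.th z) (\<lambda>i z. u i z + E.ww i z) E.RR" by (rule E.new_solves[OF T])
      fix t assume t: "t \<in> {0..T}"
      note csts = E.Ed_def E.cQ_def E.cD_def E.C1_def E.cE_def MMb(1)[OF n] D_def[symmetric] C1_def[symmetric] cD_def[symmetric] cQ_def[symmetric] Ed_def[symmetric]
      have h0: "0 \<le> h z" for z using hpos[of z] by simp
      have cR: "continuous_on UNIV (\<lambda>x. R i (t, x))" for i using sol by (auto simp: solves_def intro: slice_cont)
      have ch: "continuous_on UNIV (\<lambda>x. h (t, x))" by (rule slice_cont[OF sh])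
      have "integral cell (\<lambda>x. h (t, x)) \<le> integral cell (\<lambda>x. \<bar>R j (t, x)\<bar> + \<kappa>)"
        using amp_le[OF kap(1) sg] by (intro integral_cell_le continuous_intros cR ch) (auto simp: h_def g_def)
      also have "\<dots> = integral cell (\<lambda>x. \<bar>R j (t, x)\<bar>) + \<kappa>"
        by (subst integral_add) (auto intro!: integrable_cell continuous_intros cR)
      finally have "integral cell (\<lambda>x. h (t, x)) \<le> 2 * G" using RG t kap by fastforce
      then have hG: "integral cell (\<lambda>x. h (t, x)) + (real D)\<^sup>2 / lam * K \<le> 3 * G" using L(2) by (simp add: lam_def)
      have hG0: "0 \<le> integral cell (\<lambda>x. h (t, x)) + (real D)\<^sup>2 / lam * K"
        using K0 by (intro add_nonneg_nonneg integral_nonneg integrable_cell ch h0) (auto simp: lam_def)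
      have mD: "0 < mu n ^ D" using mun by simp
      show "step_bound T p pt (M * \<eta> powr p * G) (M * \<eta> powr (- hconj p) * G) \<delta> t E.th E.ww"
        unfolding step_bound_def hc
      proof (intro conjI allI)
        have AD: "A n powr p = mu n ^ D" using p mun by (simp add: A_def powr_powr powr_realpow)
        have "integral cell (\<lambda>x. \<bar>E.th (t, x)\<bar> powr p) \<le> 3 powr p * (
            A n powr p * \<eta> powr p * (pi / mu n) ^ D * (integral cell (\<lambda>x. h (t, x)) + (real D)\<^sup>2 / lam * K)
            + (2 * A n * K * (mu n / real n)) powr p * Ed n + (cQ / om n / MM n) powr (p - 1) * (cQ / om n))"
          using E.integral_th_powr[OF t p sh per(1)[OF t], of "\<eta> powr p", OF _ a_h] K1(11)[OF t] h0 unfolding csts by simp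
        also have "A n powr p * \<eta> powr p * (pi / mu n) ^ D = \<eta> powr p * pi ^ D" unfolding AD using mun by (simp add: power_divide)
        also have "3 powr p * (\<eta> powr p * pi ^ D * (integral cell (\<lambda>x. h (t, x)) + (real D)\<^sup>2 / lam * K)
            + (2 * A n * K * (mu n / real n)) powr p * Ed n + (cQ / om n / MM n) powr (p - 1) * (cQ / om n))
           \<le> 3 powr p * (\<eta> powr p * pi ^ D * (3 * G) + \<eta> powr p * G + \<eta> powr p * G)"
          using n1 n2 hG by (intro mult_left_mono add_mono) (auto simp: e_def)
        also have "\<dots> = (3 powr p * (3 * pi ^ D + 2)) * (\<eta> powr p * G)" by (simp add: algebra_simps)
        also have "\<dots> \<le> M * (\<eta> powr p * G)" using M1(1) G by (intro mult_right_mono) auto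
        finally show "integral cell (\<lambda>x. \<bar>E.th (t, x)\<bar> powr p) \<le> M * \<eta> powr p * G" by simp
        fix i
        \<comment> \<open>The lower bound on \<open>MM\<close> and 1 - 1/p = 1/p' make
          \<open>B n\<close> at most a constant times mu^(D/p'); its power p' then cancels the mean
          of the blob.\<close>
        have BD: "B n powr p' * (pi / mu n) ^ D \<le> (1 / c0 ^ D) powr p' * pi ^ D"
        proof -
          have "B n \<le> 1 / (A n * (c0 / mu n) ^ D)"
            unfolding B_def using MMb[OF n] An c0 mun by (intro divide_left_mono mult_left_mono mult_pos_pos) auto
          also have "\<dots> = (1 / c0 ^ D) * (mu n ^ D / A n)" using mD by (simp add: power_divide)
          also have "mu n ^ D / A n = mu n powr (real D / p')"
          proof -
            have "real D - real D / p = real D * (1 - 1 / p)" by (simp add: algebra_simps)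
            also have "1 - 1 / p = 1 / p'" using ipp by simp
            finally have "real D / p' = real D - real D / p" by simp
            then show ?thesis using mun by (simp add: A_def powr_diff powr_realpow)
          qed
          finally have "B n powr p' \<le> ((1 / c0 ^ D) * mu n powr (real D / p')) powr p'"
            using Bn p'1 by (intro powr_mono2) auto
          also have "\<dots> = (1 / c0 ^ D) powr p' * mu n ^ D"
            using c0 p'1 mun by (simp add: powr_mult powr_divide powr_powr powr_realpow)
          finally have "B n powr p' * (pi / mu n) ^ D \<le> ((1 / c0 ^ D) powr p' * mu n ^ D) * (pi / mu n) ^ D"
            using mun by (intro mult_right_mono) auto
          also have "\<dots> = (1 / c0 ^ D) powr p' * pi ^ D" using mun by (simp add: power_divide)
          finally show ?thesis .
        qed
        have "integral cell (\<lambda>x. \<bar>E.ww i (t, x)\<bar> powr p') \<le> 2 powr p' * (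
            B n powr p' * \<eta> powr (- p') * (pi / mu n) ^ D * (integral cell (\<lambda>x. h (t, x)) + (real D)\<^sup>2 / lam * K)
            + (2 * B n * K * (mu n / real n)) powr p' * Ed n)"
          using E.integral_ww_powr[OF t p'1 sh per(1)[OF t], of "\<eta> powr (- p')" i, OF _ b_h] K1(11)[OF t] h0 unfolding csts by simp
        also have "B n powr p' * \<eta> powr (- p') * (pi / mu n) ^ D = \<eta> powr (- p') * (B n powr p' * (pi / mu n) ^ D)" by simp
        also have "2 powr p' * (\<eta> powr (- p') * (B n powr p' * (pi / mu n) ^ D) * (integral cell (\<lambda>x. h (t, x)) + (real D)\<^sup>2 / lam * K)
            + (2 * B n * K * (mu n / real n)) powr p' * Ed n)
           \<le> 2 powr p' * (\<eta> powr (- p') * ((1 / c0 ^ D) powr p' * pi ^ D) * (3 * G) + \<eta> powr (- p') * G)"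
          using n3 hG hG0 BD by (intro mult_left_mono add_mono mult_mono[OF mult_left_mono]) (auto simp: e_def)
        also have "\<dots> = (2 powr p' * (3 * ((1 / c0 ^ D) powr p' * pi ^ D) + 1)) * (\<eta> powr (- p') * G)" by (simp add: algebra_simps)
        also have "\<dots> \<le> M * (\<eta> powr (- p') * G)" using M1(2) G by (intro mult_right_mono) auto
        finally show "integral cell (\<lambda>x. \<bar>E.ww i (t, x)\<bar> powr p') \<le> M * \<eta> powr (- p') * G" by simp
        have ed: "e \<le> \<delta>" using del by (simp add: e_def min_def)
        show "integral cell (\<lambda>x. \<bar>E.ww i (t, x)\<bar> powr pt) \<le> \<delta>"
          using E.integral_ww_small[OF t, of pt i] pt n4 ed unfolding csts by simp
        show "integral cell (\<lambda>x. \<bar>Dx l (E.ww i) (t, x)\<bar> powr pt) \<le> \<delta>" for l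
          using E.integral_Dx_ww_small[OF t, of pt l i] pt n5 ed unfolding csts by simp
      qed
      fix i
      have e4: "e \<le> \<delta> / 4" by (simp add: e_def)
      have SS: "integral cell (\<lambda>x. \<bar>E.SS i (t, x)\<bar>) \<le> \<delta> / 2"
        using E.integral_SS[OF t, of i] n6 L(3) e4 unfolding csts lam_def[symmetric] by linarith
      show "integral cell (\<lambda>x. \<bar>E.RR i (t, x) - (if i = j then 0 else R i (t, x))\<bar>) \<le> \<delta>"
      proof (cases "i = j")
        case True
        have "integral cell (\<lambda>x. \<bar>E.RR i (t, x)\<bar>) \<le> integral cell (\<lambda>x. \<bar>E.SS i (t, x)\<bar> + \<kappa>)"
        proof (rule integral_cell_le)
          fix x
          have "E.RR i (t, x) = E.SS i (t, x) + (g (t, x) - f (t, x))" using True by (simp add: E.SS_def g_def)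
          then show "\<bar>E.RR i (t, x)\<bar> \<le> \<bar>E.SS i (t, x)\<bar> + \<kappa>"
            using amp_residual[OF kap(1) sg, of "(t, x)"] by (simp add: f_def h_def)
        qed (intro continuous_intros slice_cont E.sRR E.sSS[OF t])+
        also have "\<dots> = integral cell (\<lambda>x. \<bar>E.SS i (t, x)\<bar>) + \<kappa>"
          by (subst integral_add) (auto intro!: integrable_cell continuous_intros slice_cont[OF E.sSS[OF t]])
        finally show ?thesis using SS kap True by simp
      next
        case False
        then have "(\<lambda>x. \<bar>E.RR i (t, x) - (if i = j then 0 else R i (t, x))\<bar>) = (\<lambda>x. \<bar>E.SS i (t, x)\<bar>)" by (simp add: E.SS_def)
        then show ?thesis using SS del by simp
      qed
    next
      fix t x i assume t: "t \<in> {0..T}" and z: "\<forall>x i. R i (t, x) = 0"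
      have g0: "g (t, x) = 0" for x using z by (simp add: g_def)
      have 1: "a (t, x) = 0" "b (t, x) = 0" "f (t, x) = 0" for x by (simp_all add: a_def b_def f_def g0)
      \<comment> \<open>The arguments 1 and 3 are the powers of \<open>g\<close> beyond the double
        zero: \<open>a\<close> contains the third and \<open>f\<close> the fifth power.\<close>
      have 2: "Dt a (t, x) = 0" "Dt f (t, x) = 0" for x
        using ddir_power_vanish[OF kap(1) sg shp g0, of et "- \<eta>" 1] ddir_power_vanish[OF kap(1) sg shp g0, of et 1 3]
        by (simp_all add: a_def[abs_def] f_def[abs_def] numeral_eq_Suc)
      show "E.th (t, x) = 0" "E.ww i (t, x) = 0" "E.RR i (t, x) = 0"
        by (rule E.vanish[where i=i]; simp add: 1 2 z)+
    qed
  qed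
qed

subsection \<open>The iteration\<close>

lemma integral_abs_powr_add:
  fixes F G :: "real^'d \<Rightarrow> real"
  assumes "continuous_on UNIV F" "continuous_on UNIV G" "0 < r"
    and "integral cell (\<lambda>x. \<bar>F x\<bar> powr r) \<le> a" "integral cell (\<lambda>x. \<bar>G x\<bar> powr r) \<le> b"
  shows "integral cell (\<lambda>x. \<bar>F x + G x\<bar> powr r) \<le> 2 powr r * (a + b)"
proof -
  have cp: "continuous_on UNIV (\<lambda>x. \<bar>F x\<bar> powr r)" "continuous_on UNIV (\<lambda>x. \<bar>G x\<bar> powr r)" "continuous_on UNIV (\<lambda>x. \<bar>F x + G x\<bar> powr r)"
    using assms by (auto intro!: continuous_on_abs_powr continuous_on_add)
  have "integral cell (\<lambda>x. \<bar>F x + G x\<bar> powr r) \<le> integral cell (\<lambda>x. 2 powr r * (\<bar>F x\<bar> powr r + \<bar>G x\<bar> powr r))"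
  proof (rule integral_cell_le)
    fix x
    have "\<bar>F x + G x\<bar> powr r \<le> (\<bar>F x\<bar> + \<bar>G x\<bar>) powr r" using assms by (intro powr_mono2) auto
    also have "\<dots> \<le> 2 powr r * (\<bar>F x\<bar> powr r + \<bar>G x\<bar> powr r)" using assms by (intro powr_add_le2) auto
    finally show "\<bar>F x + G x\<bar> powr r \<le> 2 powr r * (\<bar>F x\<bar> powr r + \<bar>G x\<bar> powr r)" .
  qed (intro cp continuous_intros)+
  also have "\<dots> = 2 powr r * (integral cell (\<lambda>x. \<bar>F x\<bar> powr r) + integral cell (\<lambda>x. \<bar>G x\<bar> powr r))"
    by (simp, subst integral_add) (auto intro!: integrable_cell cp)
  also have "\<dots> \<le> 2 powr r * (a + b)" using assms by (intro mult_left_mono) auto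
  finally show ?thesis .
qed

lemma integral_abs_diff_le:
  fixes F G :: "real^'d \<Rightarrow> real"
  assumes "continuous_on UNIV F" "continuous_on UNIV G"
    and "integral cell (\<lambda>x. \<bar>F x - G x\<bar>) \<le> a" "integral cell (\<lambda>x. \<bar>G x\<bar>) \<le> b"
  shows "integral cell (\<lambda>x. \<bar>F x\<bar>) \<le> a + b"
proof -
  have "integral cell (\<lambda>x. \<bar>F x\<bar>) \<le> integral cell (\<lambda>x. \<bar>F x - G x\<bar> + \<bar>G x\<bar>)"
    by (rule integral_cell_le) (auto intro!: continuous_intros assms)
  also have "\<dots> = integral cell (\<lambda>x. \<bar>F x - G x\<bar>) + integral cell (\<lambda>x. \<bar>G x\<bar>)"
    by (rule integral_add) (auto intro!: integrable_cell continuous_intros assms)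
  finally show ?thesis using assms by linarith
qed

lemma step_bound_add:
  assumes 1: "step_bound T p pt a b c t \<zeta>1 w1" and 2: "step_bound T p pt a' b' c' t \<zeta>2 w2" and p: "1 < p" "1 < pt"
    and s: "smooth \<zeta>1" "smooth \<zeta>2" "\<And>i. smooth (w1 i)" "\<And>i. smooth (w2 i)"
  shows "step_bound T p pt (2 powr p * (a + a')) (2 powr (hconj p) * (b + b')) (2 powr pt * (c + c')) t (\<lambda>z. \<zeta>1 z + \<zeta>2 z) (\<lambda>i z. w1 i z + w2 i z)"
proof -
  have "0 < hconj p" using p by (simp add: hconj_def)
  then show ?thesis using 1 2 p s unfolding step_bound_def
    by (auto intro!: integral_abs_powr_add slice_cont smooth_ddir simp: ddir_add)
qed

lemma step_bound_mono:
  "step_bound T p pt a b c t \<zeta> w \<Longrightarrow> a \<le> a' \<Longrightarrow> b \<le> b' \<Longrightarrow> c \<le> c' \<Longrightarrow> step_bound T p pt a' b' c' t \<zeta> w"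
  unfolding step_bound_def by (meson order_trans)

text \<open>\<open>J\<close> is the set of coordinates already treated. The others may deteriorate
  by \<open>\<delta>\<close>, because a step for one coordinate leaves small errors in all of
  them.\<close>

definition partial_const :: "real \<Rightarrow> real \<Rightarrow> 'd::finite set \<Rightarrow> real \<Rightarrow> bool" where
  "partial_const p pt J M \<longleftrightarrow> (\<forall>T \<theta> u (R :: 'd \<Rightarrow> real \<times> (real^'d) \<Rightarrow> real) \<eta> G \<delta>. 0 < T \<longrightarrow> solves T \<theta> u R \<longrightarrow> 0 < \<eta> \<longrightarrow> 0 < G \<longrightarrow> 0 < \<delta> \<longrightarrow>
      (\<forall>t\<in>{0..T}. \<forall>i. integral cell (\<lambda>x. \<bar>R i (t, x)\<bar>) \<le> G) \<longrightarrow>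
      (\<exists>\<zeta> w R'. is_step T p pt \<theta> u R (M * \<eta> powr p * G) (M * \<eta> powr (- hconj p) * G) \<delta> \<zeta> w R' \<and>
        (\<forall>t\<in>{0..T}. \<forall>i. integral cell (\<lambda>x. \<bar>R' i (t, x)\<bar>) \<le> (if i \<in> J then \<delta> else G + \<delta>))))"

lemma partial_step:
  fixes p pt :: real and J :: "'d::finite set"
  assumes p: "1 < p" and pt: "1 < pt" and pp: "1 / p + 1 / pt > 1 + 1 / real CARD('d)" and pd: "hconj p < real CARD('d)"
    and d2: "2 \<le> CARD('d)"
  shows "\<exists>M>0. partial_const p pt J M"
  using finite[of J]
proof (induction J rule: finite_induct)
  case empty
  have "partial_const p pt ({} :: 'd set) 1"
    unfolding partial_const_def
  proof (intro allI impI)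
    fix T \<eta> G \<delta> :: real and \<theta> and u R :: "'d \<Rightarrow> real \<times> (real^'d) \<Rightarrow> real"
    assume *: "0 < T" "solves T \<theta> u R" "0 < \<eta>" "0 < G" "0 < \<delta>" "\<forall>t\<in>{0..T}. \<forall>i. integral cell (\<lambda>x. \<bar>R i (t, x)\<bar>) \<le> G"
    have "integral cell (\<lambda>x. \<bar>R i (t, x)\<bar>) \<le> G + \<delta>" if "t \<in> {0..T}" for t i using *(5) *(6)[rule_format, OF that, of i] by simp
    with * show "\<exists>\<zeta> w R'. is_step T p pt \<theta> u R (1 * \<eta> powr p * G) (1 * \<eta> powr (- hconj p) * G) \<delta> \<zeta> w R' \<and>
        (\<forall>t\<in>{0..T}. \<forall>i. integral cell (\<lambda>x. \<bar>R' i (t, x)\<bar>) \<le> (if i \<in> {} then \<delta> else G + \<delta>))"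
      by (intro exI[where x="\<lambda>z. 0"] exI[where x="\<lambda>i z. 0"] exI[where x=R]) (auto simp: step_bound_def is_step_def)
  qed
  then show ?case using zero_less_one by blast
next
  case (insert j J)
  obtain M1 where M1: "0 < M1" and H1: "partial_const p pt J M1" using insert.IH by blast
  have "\<exists>k. j \<noteq> k"
  proof (rule ccontr)
    assume "\<nexists>k. j \<noteq> k"
    then have "UNIV = {j}" by auto
    then have "CARD('d) = card {j}" by metis
    then show False using d2 by simp
  qed
  then obtain k where jk: "j \<noteq> k" by blast
  obtain M2 where M2: "0 < M2" and H2: "substep_const p pt j M2" using substep[OF p pt pp pd jk] by blast
  \<comment> \<open>The second step starts from a defect of size at most
    \<open>G + \<delta>'\<close>, hence 2 G, which is the 2 before \<open>M2\<close>; the powers of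
    2 come from adding two perturbations.\<close>
  define M where "M = (2 powr p + 2 powr (hconj p)) * (M1 + 2 * M2)"
  have M0: "0 < M" using M1 M2 by (auto simp: M_def intro!: mult_pos_pos add_pos_pos)
  have "partial_const p pt (insert j J) M"
    unfolding partial_const_def
  proof (intro allI impI)
    fix T \<eta> G \<delta> :: real and \<theta> and u R :: "'d \<Rightarrow> real \<times> (real^'d) \<Rightarrow> real"
    assume T: "0 < T" and sol: "solves T \<theta> u R" and eta: "0 < \<eta>" and G: "0 < G" and del: "0 < \<delta>"
      and RG: "\<forall>t\<in>{0..T}. \<forall>i. integral cell (\<lambda>x. \<bar>R i (t, x)\<bar>) \<le> G"
    \<comment> \<open>\<open>G\<close> yields the bound 2 G for the intermediate defect,
      \<open>\<delta> / 2\<close> lets two errors add up, and the last entry compensates the factor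
      \<open>2 powr pt\<close> of \<open>step_bound_add\<close>.\<close>
    define \<delta>' where "\<delta>' = min G (min (\<delta> / 2) (\<delta> / (2 * 2 powr pt)))"
    have d': "0 < \<delta>'" "\<delta>' \<le> G" "\<delta>' \<le> \<delta> / 2" "\<delta>' \<le> \<delta> / (2 * 2 powr pt)" using G del by (auto simp: \<delta>'_def)
    obtain \<zeta>1 w1 R1 where st1: "is_step T p pt \<theta> u R (M1 * \<eta> powr p * G) (M1 * \<eta> powr (- hconj p) * G) \<delta>' \<zeta>1 w1 R1"
      and r1: "\<And>t i. t \<in> {0..T} \<Longrightarrow> integral cell (\<lambda>x. \<bar>R1 i (t, x)\<bar>) \<le> (if i \<in> J then \<delta>' else G + \<delta>')"
      using H1[unfolded partial_const_def, rule_format, OF T sol eta G d'(1)] RG by blast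
    have s1: "smooth \<zeta>1" "\<And>i. smooth (w1 i)" and sol1: "solves T (\<lambda>z. \<theta> z + \<zeta>1 z) (\<lambda>i z. u i z + w1 i z) R1"
      and b1: "\<And>t. t \<in> {0..T} \<Longrightarrow> step_bound T p pt (M1 * \<eta> powr p * G) (M1 * \<eta> powr (- hconj p) * G) \<delta>' t \<zeta>1 w1"
      and v1: "\<And>t x i. t \<in> {0..T} \<Longrightarrow> (\<forall>x i. R i (t, x) = 0) \<Longrightarrow> \<zeta>1 (t, x) = 0 \<and> w1 i (t, x) = 0 \<and> R1 i (t, x) = 0"
      using st1 unfolding is_step_def by blast+
    have "integral cell (\<lambda>x. \<bar>R1 j (t, x)\<bar>) \<le> 2 * G" if "t \<in> {0..T}" for t using r1[OF that, of j] insert.hyps d'(2) by simp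
    then obtain \<zeta>2 w2 R2 where st2: "is_step T p pt (\<lambda>z. \<theta> z + \<zeta>1 z) (\<lambda>i z. u i z + w1 i z) R1 (M2 * \<eta> powr p * (2 * G)) (M2 * \<eta> powr (- hconj p) * (2 * G)) \<delta>' \<zeta>2 w2 R2"
      and r2: "\<And>t i. t \<in> {0..T} \<Longrightarrow> integral cell (\<lambda>x. \<bar>R2 i (t, x) - (if i = j then 0 else R1 i (t, x))\<bar>) \<le> \<delta>'"
      using H2[unfolded substep_const_def, rule_format, OF T sol1 eta mult_pos_pos[OF zero_less_numeral G] d'(1)] by blast
    have s2: "smooth \<zeta>2" "\<And>i. smooth (w2 i)" and sol2: "solves T (\<lambda>z. \<theta> z + \<zeta>1 z + \<zeta>2 z) (\<lambda>i z. u i z + w1 i z + w2 i z) R2"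
      and b2: "\<And>t. t \<in> {0..T} \<Longrightarrow> step_bound T p pt (M2 * \<eta> powr p * (2 * G)) (M2 * \<eta> powr (- hconj p) * (2 * G)) \<delta>' t \<zeta>2 w2"
      and v2: "\<And>t x i. t \<in> {0..T} \<Longrightarrow> (\<forall>x i. R1 i (t, x) = 0) \<Longrightarrow> \<zeta>2 (t, x) = 0 \<and> w2 i (t, x) = 0 \<and> R2 i (t, x) = 0"
      using st2 unfolding is_step_def by blast+
    show "\<exists>\<zeta> w R'. is_step T p pt \<theta> u R (M * \<eta> powr p * G) (M * \<eta> powr (- hconj p) * G) \<delta> \<zeta> w R' \<and>
        (\<forall>t\<in>{0..T}. \<forall>i. integral cell (\<lambda>x. \<bar>R' i (t, x)\<bar>) \<le> (if i \<in> insert j J then \<delta> else G + \<delta>))"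
      unfolding is_step_def
    proof (rule exI[of _ "\<lambda>z. \<zeta>1 z + \<zeta>2 z"], rule exI[of _ "\<lambda>i z. w1 i z + w2 i z"], rule exI[of _ R2], intro conjI allI ballI impI)
      show "smooth (\<lambda>z. \<zeta>1 z + \<zeta>2 z)" "smooth (\<lambda>z. w1 i z + w2 i z)" for i by (intro smooth_add s1 s2)+
      show "solves T (\<lambda>z. \<theta> z + (\<zeta>1 z + \<zeta>2 z)) (\<lambda>i z. u i z + (w1 i z + w2 i z)) R2" using sol2 by (simp add: add.assoc)
      fix t assume t: "t \<in> {0..T}"
      show "step_bound T p pt (M * \<eta> powr p * G) (M * \<eta> powr (- hconj p) * G) \<delta> t (\<lambda>z. \<zeta>1 z + \<zeta>2 z) (\<lambda>i z. w1 i z + w2 i z)"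
      proof (rule step_bound_mono[OF step_bound_add[OF b1[OF t] b2[OF t] p pt s1(1) s2(1) s1(2) s2(2)]])
        have m: "2 powr p * (M1 + 2 * M2) \<le> M" "2 powr (hconj p) * (M1 + 2 * M2) \<le> M"
          using M1 M2 by (auto simp: M_def)
        show "2 powr p * (M1 * \<eta> powr p * G + M2 * \<eta> powr p * (2 * G)) \<le> M * \<eta> powr p * G"
          using mult_right_mono[OF m(1), of "\<eta> powr p * G"] G by (simp add: algebra_simps)
        show "2 powr (hconj p) * (M1 * \<eta> powr (- hconj p) * G + M2 * \<eta> powr (- hconj p) * (2 * G)) \<le> M * \<eta> powr (- hconj p) * G"
          using mult_right_mono[OF m(2), of "\<eta> powr (- hconj p) * G"] G by (simp add: algebra_simps)
        have "2 powr pt * (2 * \<delta>') \<le> 2 powr pt * (2 * (\<delta> / (2 * 2 powr pt)))" using d' by (intro mult_left_mono) auto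
        then show "2 powr pt * (\<delta>' + \<delta>') \<le> \<delta>" by simp
      qed
      fix i
      have c: "continuous_on UNIV (\<lambda>x. R2 i (t, x))" "continuous_on UNIV (\<lambda>x. R1 i (t, x))"
        using sol1 sol2 by (auto simp: solves_def intro: slice_cont)
      show "integral cell (\<lambda>x. \<bar>R2 i (t, x)\<bar>) \<le> (if i \<in> insert j J then \<delta> else G + \<delta>)"
      proof (cases "i = j")
        case True
        then show ?thesis using r2[OF t, of i] d' del by auto
      next
        case False
        then have "integral cell (\<lambda>x. \<bar>R2 i (t, x)\<bar>) \<le> \<delta>' + (if i \<in> J then \<delta>' else G + \<delta>')"
          using r2[OF t, of i] r1[OF t, of i] by (intro integral_abs_diff_le[OF c]) auto
        then show ?thesis using False d' by (auto split: if_splits)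
      qed
    next
      fix t x i assume t: "t \<in> {0..T}" and z: "\<forall>x i. R i (t, x) = 0"
      note v1' = v1[OF t z]
      then have "\<forall>x i. R1 i (t, x) = 0" by blast
      from v2[OF t this] v1' show "\<zeta>1 (t, x) + \<zeta>2 (t, x) = 0" "w1 i (t, x) + w2 i (t, x) = 0" "R2 i (t, x) = 0" by auto
    qed
  qed
  then show ?case using M0 by blast
qed

text \<open>\<open>G n\<close> measures the defect at stage \<open>n\<close>. The increment to the
  next stage is of the size of \<open>G n\<close> in L^p and L^p', whereas in L^pt, together with
  its gradient, it is bounded by the freely prescribed \<open>G (Suc n)\<close>.\<close>

definition iteration :: "real \<Rightarrow> real \<Rightarrow> real \<Rightarrow> real \<Rightarrow> real \<Rightarrow> (nat \<Rightarrow> real) \<Rightarrow> (nat \<Rightarrow> real \<times> (real^'d) \<Rightarrow> real) \<Rightarrow> (nat \<Rightarrow> 'd \<Rightarrow> real \<times> (real^'d) \<Rightarrow> real)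
    \<Rightarrow> (nat \<Rightarrow> 'd \<Rightarrow> real \<times> (real^'d) \<Rightarrow> real) \<Rightarrow> bool" where
  "iteration T p pt P\<^sub>1 P\<^sub>2 G \<Theta> U R \<longleftrightarrow> (\<forall>n. solves T (\<Theta> n) (U n) (R n) \<and>
     (\<forall>t\<in>{0..T}. (\<forall>i. integral cell (\<lambda>x. \<bar>R n i (t, x)\<bar>) \<le> G n) \<and>
        step_bound T p pt (P\<^sub>1 * G n) (P\<^sub>2 * G n) (G (Suc n)) t (\<lambda>z. \<Theta> (Suc n) z - \<Theta> n z) (\<lambda>i z. U (Suc n) i z - U n i z) \<and>
        ((\<forall>x i. R 0 i (t, x) = 0) \<longrightarrow> (\<forall>x i. \<Theta> n (t, x) = \<Theta> 0 (t, x) \<and> U n i (t, x) = U 0 i (t, x)))))"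

lemma iterate:
  fixes p pt :: real
  assumes p: "1 < p" and pt: "1 < pt" and pp: "1 / p + 1 / pt > 1 + 1 / real CARD('d::finite)" and pd: "hconj p < real CARD('d)"
    and d2: "2 \<le> CARD('d)"
  shows "\<exists>M>0. \<forall>T \<theta> u (R :: 'd \<Rightarrow> real \<times> (real^'d) \<Rightarrow> real) \<eta> G. 0 < T \<longrightarrow> solves T \<theta> u R \<longrightarrow> 0 < \<eta> \<longrightarrow> (\<forall>n. 0 < G n) \<longrightarrow>
      (\<forall>t\<in>{0..T}. \<forall>i. integral cell (\<lambda>x. \<bar>R i (t, x)\<bar>) \<le> G 0) \<longrightarrow>
      (\<exists>\<Theta> U RR. \<Theta> 0 = \<theta> \<and> U 0 = u \<and> RR 0 = R \<and> iteration T p pt (M * \<eta> powr p) (M * \<eta> powr (- hconj p)) G \<Theta> U RR)"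
proof -
  obtain M where M0: "0 < M" and H: "partial_const p pt (UNIV :: 'd set) M" using partial_step[OF p pt pp pd d2, of UNIV] by blast
  show ?thesis
  proof (intro exI[of _ M] conjI allI impI M0)
    fix T \<eta> :: real and G :: "nat \<Rightarrow> real" and \<theta> and u R :: "'d \<Rightarrow> real \<times> (real^'d) \<Rightarrow> real"
    assume T: "0 < T" and sol: "solves T \<theta> u R" and eta: "0 < \<eta>" and G: "\<forall>n. 0 < G n"
      and RG: "\<forall>t\<in>{0..T}. \<forall>i. integral cell (\<lambda>x. \<bar>R i (t, x)\<bar>) \<le> G 0"
    \<comment> \<open>The clause for \<open>n = 0\<close> pins the start of the sequence to the
      given solution within the dependent choice.\<close>
    define P where "P n s \<longleftrightarrow> (case s of (\<theta>', u', R') \<Rightarrow> solves T \<theta>' u' R' \<and> (\<forall>t\<in>{0..T}. \<forall>i. integral cell (\<lambda>x. \<bar>R' i (t, x)\<bar>) \<le> G n)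
       \<and> (n = 0 \<longrightarrow> \<theta>' = \<theta> \<and> u' = u \<and> R' = R))" for n :: nat and s :: "(real \<times> (real^'d) \<Rightarrow> real) \<times> ('d \<Rightarrow> real \<times> (real^'d) \<Rightarrow> real) \<times> ('d \<Rightarrow> real \<times> (real^'d) \<Rightarrow> real)"
    define Q where "Q n s s' \<longleftrightarrow> (case s of (\<theta>1, u1, R1) \<Rightarrow> case s' of (\<theta>2, u2, R2) \<Rightarrow>
        \<forall>t\<in>{0..T}. step_bound T p pt (M * \<eta> powr p * G n) (M * \<eta> powr (- hconj p) * G n) (G (Suc n)) t (\<lambda>z. \<theta>2 z - \<theta>1 z) (\<lambda>i z. u2 i z - u1 i z) \<and>
          ((\<forall>x i. R1 i (t, x) = 0) \<longrightarrow> (\<forall>x i. \<theta>2 (t, x) = \<theta>1 (t, x) \<and> u2 i (t, x) = u1 i (t, x) \<and> R2 i (t, x) = 0)))"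
       for n :: nat and s s' :: "(real \<times> (real^'d) \<Rightarrow> real) \<times> ('d \<Rightarrow> real \<times> (real^'d) \<Rightarrow> real) \<times> ('d \<Rightarrow> real \<times> (real^'d) \<Rightarrow> real)"
    have "\<exists>S. \<forall>n. P n (S n) \<and> Q n (S n) (S (Suc n))"
    proof (rule dependent_nat_choice)
      show "\<exists>s. P 0 s" using sol RG by (intro exI[of _ "(\<theta>, u, R)"]) (simp add: P_def)
      fix s n assume Ps: "P n s"
      obtain \<theta>1 u1 R1 where s: "s = (\<theta>1, u1, R1)" by (cases s) auto
      have 1: "solves T \<theta>1 u1 R1" "\<forall>t\<in>{0..T}. \<forall>i. integral cell (\<lambda>x. \<bar>R1 i (t, x)\<bar>) \<le> G n" using Ps by (auto simp: P_def s)
      obtain \<zeta> w R' where st: "is_step T p pt \<theta>1 u1 R1 (M * \<eta> powr p * G n) (M * \<eta> powr (- hconj p) * G n) (G (Suc n)) \<zeta> w R'"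
        and r: "\<forall>t\<in>{0..T}. \<forall>i. integral cell (\<lambda>x. \<bar>R' i (t, x)\<bar>) \<le> (if i \<in> UNIV then G (Suc n) else G n + G (Suc n))"
        using H[unfolded partial_const_def, rule_format, OF T 1(1) eta G[rule_format, of n] G[rule_format, of "Suc n"]] 1(2) by blast
      then show "\<exists>s'. P (Suc n) s' \<and> Q n s s'"
        by (intro exI[of _ "(\<lambda>z. \<theta>1 z + \<zeta> z, \<lambda>i z. u1 i z + w i z, R')"]) (simp add: P_def Q_def s is_step_def)
    qed
    then obtain S where S: "\<And>n. P n (S n)" "\<And>n. Q n (S n) (S (Suc n))" by blast
    define \<Theta> where "\<Theta> n = fst (S n)" for n
    define U where "U n = fst (snd (S n))" for n
    define RR where "RR n = snd (snd (S n))" for n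
    have SS: "S n = (\<Theta> n, U n, RR n)" for n by (simp add: \<Theta>_def U_def RR_def)
    have PP: "solves T (\<Theta> n) (U n) (RR n)" "\<And>t i. t \<in> {0..T} \<Longrightarrow> integral cell (\<lambda>x. \<bar>RR n i (t, x)\<bar>) \<le> G n" for n
      using S(1)[of n] by (auto simp: P_def SS)
    have init: "\<Theta> 0 = \<theta>" "U 0 = u" "RR 0 = R" using S(1)[of 0] by (auto simp: P_def SS)
    have QQ: "\<And>t. t \<in> {0..T} \<Longrightarrow> step_bound T p pt (M * \<eta> powr p * G n) (M * \<eta> powr (- hconj p) * G n) (G (Suc n)) t (\<lambda>z. \<Theta> (Suc n) z - \<Theta> n z) (\<lambda>i z. U (Suc n) i z - U n i z)"
      "\<And>t x i. t \<in> {0..T} \<Longrightarrow> (\<forall>x i. RR n i (t, x) = 0) \<Longrightarrow> \<Theta> (Suc n) (t, x) = \<Theta> n (t, x) \<and> U (Suc n) i (t, x) = U n i (t, x) \<and> RR (Suc n) i (t, x) = 0" for n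
      using S(2)[of n] by (auto simp: Q_def SS)
    have van: "(\<forall>x i. \<Theta> n (t, x) = \<Theta> 0 (t, x) \<and> U n i (t, x) = U 0 i (t, x) \<and> RR n i (t, x) = 0)"
      if t: "t \<in> {0..T}" and z: "\<forall>x i. RR 0 i (t, x) = 0" for n t
    proof (induction n)
      case (Suc n)
      then have "\<forall>x i. RR n i (t, x) = 0" by blast
      from QQ(2)[OF t this] Suc show ?case by simp
    qed (use z in simp)
    show "\<exists>\<Theta> U RR. \<Theta> 0 = \<theta> \<and> U 0 = u \<and> RR 0 = R \<and> iteration T p pt (M * \<eta> powr p) (M * \<eta> powr (- hconj p)) G \<Theta> U RR"
      by (rule exI[of _ \<Theta>], rule exI[of _ U], rule exI[of _ RR]) (use init PP QQ(1) van in \<open>auto simp: iteration_def\<close>)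
  qed
qed

subsection \<open>Limits of rapidly converging sequences in Lebesgue spaces\<close>

text \<open>The numbers 1/2^(k+1) sum to at most one, so the total increment obeys the bound that
  each single weighted increment obeys.\<close>

lemma rapid_sequence:
  fixes a :: "nat \<Rightarrow> 'b::euclidean_space"
  assumes r: "0 < r" and S: "\<And>k. k \<ge> n \<Longrightarrow> (2 ^ Suc k * norm (a (Suc k) - a k)) powr r \<le> S"
  shows "convergent a" "norm (lim a - a n) powr r \<le> S"
proof -
  have S0: "0 \<le> S" using S[of n] by (meson order_trans order_refl powr_ge_zero)
  define B where "B = S powr (1 / r)"
  have step: "norm (a (Suc k) - a k) \<le> B / 2 ^ Suc k" if "k \<ge> n" for k
  proof -
    have "2 ^ Suc k * norm (a (Suc k) - a k) = ((2 ^ Suc k * norm (a (Suc k) - a k)) powr r) powr (1 / r)"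
      using r by (simp add: powr_powr)
    also have "\<dots> \<le> B" unfolding B_def using r S[OF that] by (intro powr_mono2) auto
    finally show ?thesis by (simp add: field_simps)
  qed
  have B0: "0 \<le> B" by (simp add: B_def)
  have bd: "norm (a (n + m) - a n) \<le> B * (1 / 2 ^ n - 1 / 2 ^ (n + m))" for m
  proof (induction m)
    case (Suc m)
    have "norm (a (n + Suc m) - a n) \<le> norm (a (Suc (n + m)) - a (n + m)) + norm (a (n + m) - a n)"
      using norm_triangle_ineq[of "a (Suc (n + m)) - a (n + m)" "a (n + m) - a n"] by simp
    also have "\<dots> \<le> B / 2 ^ Suc (n + m) + B * (1 / 2 ^ n - 1 / 2 ^ (n + m))" using Suc step[of "n + m"] by simp
    also have "\<dots> = B * (1 / 2 ^ n - 1 / 2 ^ (n + Suc m))" by (simp add: algebra_simps)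
    finally show ?case .
  qed simp
  have "summable (\<lambda>k. a (Suc (k + n)) - a (k + n))"
  proof (rule summable_comparison_test')
    show "summable (\<lambda>k. B * (1 / 2) ^ k)" by (intro summable_mult summable_geometric) simp
    fix k
    have "norm (a (Suc (k + n)) - a (k + n)) \<le> B / 2 ^ Suc (k + n)" by (rule step) simp
    also have "\<dots> \<le> B / 2 ^ k" using B0 by (intro divide_left_mono power_increasing) auto
    finally show "norm (a (Suc (k + n)) - a (k + n)) \<le> B * (1 / 2) ^ k" by (simp add: power_divide)
  qed
  then have "convergent (\<lambda>m. \<Sum>k<m. a (Suc (k + n)) - a (k + n))" by (simp add: summable_iff_convergent)
  then have "convergent (\<lambda>m. (\<Sum>k<m. a (Suc (k + n)) - a (k + n)) + a n)" by (intro convergent_add convergent_const)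
  moreover have "(\<Sum>k<m. a (Suc (k + n)) - a (k + n)) + a n = a (m + n)" for m
    using sum_lessThan_telescope[of "\<lambda>k. a (k + n)" m] by simp
  ultimately have "convergent (\<lambda>m. a (m + n))" by simp
  then show "convergent a" by (simp add: convergent_ignore_initial_segment)
  then have "a \<longlonglongrightarrow> lim a" by (simp add: convergent_LIMSEQ_iff)
  then have l: "(\<lambda>m. norm (a (m + n) - a n)) \<longlonglongrightarrow> norm (lim a - a n)"
    by (intro tendsto_intros LIMSEQ_ignore_initial_segment)
  have "norm (a (m + n) - a n) \<le> B" for m
  proof -
    have "B * (1 / 2 ^ n - 1 / 2 ^ (n + m)) \<le> B * 1"
    proof (intro mult_left_mono B0)
      have "1 / 2 ^ n \<le> (1::real)" by (simp add: divide_le_eq)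
      moreover have "0 \<le> 1 / (2::real) ^ (n + m)" by simp
      ultimately show "1 / 2 ^ n - 1 / 2 ^ (n + m) \<le> (1::real)" by linarith
    qed
    then show ?thesis using bd[of m] by (simp add: add.commute)
  qed
  then have "norm (lim a - a n) \<le> B" by (intro tendsto_upperbound[OF l]) auto
  then have "norm (lim a - a n) powr r \<le> B powr r" using r by (intro powr_mono2) auto
  then show "norm (lim a - a n) powr r \<le> S" using r S0 by (simp add: B_def powr_powr)
qed

lemma cont_norm_powr:
  fixes F :: "'a::topological_space \<Rightarrow> 'b::real_normed_vector"
  shows "0 < r \<Longrightarrow> continuous_on S F \<Longrightarrow> continuous_on S (\<lambda>x. norm (F x) powr r)"
  by (rule continuous_on_powr') (auto intro!: continuous_intros)

lemma cont_measurable: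
  fixes F :: "real^'d \<Rightarrow> 'b::euclidean_space"
  shows "continuous_on UNIV F \<Longrightarrow> F \<in> borel_measurable (lebesgue_on cell)"
  using tint_eq_integral(2)[of F] continuous_on_subset[of UNIV F cell] by auto

text \<open>The limit is taken pointwise by \<open>lim\<close>, so its definition is independent of
  the exponent \<open>r\<close>. The distance to stage \<open>n\<close> is dominated by the series
  of weighted increments from \<open>n\<close> on, whose integral is at most the tail of
  \<open>e\<close>.\<close>

lemma rapid_limit:
  fixes F :: "nat \<Rightarrow> real^'d \<Rightarrow> 'b::euclidean_space" and e :: "nat \<Rightarrow> real"
  assumes r: "0 < r" and cont: "\<And>n. continuous_on UNIV (F n)"
    and b: "\<And>n. (2 ^ Suc n) powr r * integral cell (\<lambda>x. norm (F (Suc n) x - F n x) powr r) \<le> e n" and e: "summable e"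
  defines "L \<equiv> \<lambda>x. lim (\<lambda>n. F n x)"
  shows "L \<in> borel_measurable (lebesgue_on cell)"
    "integrable (lebesgue_on cell) (\<lambda>x. norm (L x - F n x) powr r)"
    "tint (\<lambda>x. norm (L x - F n x) powr r) \<le> (\<Sum>k. e (k + n))"
proof -
  let ?M = "lebesgue_on (cell :: (real^'d) set)"
  define f where "f k x = (2 ^ Suc k * norm (F (Suc k) x - F k x)) powr r" for k x
  have f0: "0 \<le> f k x" for k x by (simp add: f_def)
  have f_eq: "f k x = (2 ^ Suc k) powr r * norm (F (Suc k) x - F k x) powr r" for k x
    by (simp add: f_def powr_mult)
  have cf: "continuous_on UNIV (f k)" for k
    unfolding f_eq[abs_def] by (intro continuous_intros cont_norm_powr r cont)
  have mF [measurable]: "F k \<in> borel_measurable ?M" for k by (rule cont_measurable[OF cont])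
  have mf [measurable]: "f k \<in> borel_measurable ?M" for k by (rule cont_measurable[OF cf])
  show mL: "L \<in> borel_measurable ?M" unfolding L_def by measurable
  have If: "(\<integral>\<^sup>+ x. ennreal (f k x) \<partial>?M) \<le> ennreal (e k)" for k
  proof -
    have cs: "continuous_on cell (f k)" using cf continuous_on_subset by blast
    have "(\<integral>\<^sup>+ x. ennreal (f k x) \<partial>?M) = ennreal (tint (f k))"
      unfolding tint_def by (rule nn_integral_eq_integral[OF tint_eq_integral(2)[OF cs]]) (simp add: f0)
    also have "tint (f k) = (2 ^ Suc k) powr r * integral cell (\<lambda>x. norm (F (Suc k) x - F k x) powr r)"
      unfolding tint_eq_integral(1)[OF cs] by (simp add: f_eq[abs_def])
    finally show ?thesis using b[of k] by (simp add: ennreal_leI)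
  qed
  have e0: "0 \<le> e k" for k
  proof -
    have "0 \<le> integral cell (\<lambda>x. norm (F (Suc k) x - F k x) powr r)"
      by (rule integral_nonneg) (auto intro!: integrable_cell cont_norm_powr r continuous_intros cont)
    then have "0 \<le> (2 ^ Suc k) powr r * integral cell (\<lambda>x. norm (F (Suc k) x - F k x) powr r)" by simp
    then show ?thesis using b[of k] by linarith
  qed
  have en: "summable (\<lambda>k. e (k + n))" for n using e by (simp add: summable_iff_shift)
  have tail: "(\<integral>\<^sup>+ x. (\<Sum>k. ennreal (f (k + n) x)) \<partial>?M) \<le> ennreal (\<Sum>k. e (k + n))" for n
  proof -
    have "(\<integral>\<^sup>+ x. (\<Sum>k. ennreal (f (k + n) x)) \<partial>?M) = (\<Sum>k. \<integral>\<^sup>+ x. ennreal (f (k + n) x) \<partial>?M)"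
      by (rule nn_integral_suminf) measurable
    also have "\<dots> \<le> (\<Sum>k. ennreal (e (k + n)))" by (intro suminf_le If) auto
    also have "\<dots> = ennreal (\<Sum>k. e (k + n))" by (intro suminf_ennreal2 e0 en)
    finally show ?thesis .
  qed
  \<comment> \<open>Valid at every point: where the series diverges the right-hand side is infinite,
    and elsewhere \<open>rapid_sequence\<close> applies with its sum as bound.\<close>
  have le: "ennreal (norm (L x - F n x) powr r) \<le> (\<Sum>k. ennreal (f (k + n) x))" for n x
  proof (cases "(\<Sum>k. ennreal (f (k + n) x)) = \<infinity>")
    case False
    then obtain S where S: "0 \<le> S" "(\<Sum>k. ennreal (f (k + n) x)) = ennreal S" by (cases "\<Sum>k. ennreal (f (k + n) x)") auto
    have "(2 ^ Suc k * norm (F (Suc k) x - F k x)) powr r \<le> S" if "k \<ge> n" for k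
    proof -
      have "ennreal (f ((k - n) + n) x) \<le> (\<Sum>k. ennreal (f (k + n) x))"
        using sum_le_suminf[of "\<lambda>k. ennreal (f (k + n) x)" "{k - n}"] by simp
      then show ?thesis using that S by (simp add: f_def ennreal_le_iff)
    qed
    from rapid_sequence(2)[OF r this] show ?thesis unfolding S(2) L_def using S(1) by (simp add: ennreal_leI)
  qed simp
  have fin: "(\<integral>\<^sup>+ x. ennreal (norm (L x - F n x) powr r) \<partial>?M) \<le> ennreal (\<Sum>k. e (k + n))"
    by (rule order_trans[OF nn_integral_mono[OF le] tail])
  have mm: "(\<lambda>x. norm (L x - F n x) powr r) \<in> borel_measurable ?M" using mL by measurable
  show int: "integrable ?M (\<lambda>x. norm (L x - F n x) powr r)"
  proof (rule integrableI_bounded[OF mm])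
    show "(\<integral>\<^sup>+ x. ennreal (norm (norm (L x - F n x) powr r)) \<partial>?M) < \<infinity>"
      using fin by (simp add: le_less_trans)
  qed
  have "ennreal (tint (\<lambda>x. norm (L x - F n x) powr r)) = (\<integral>\<^sup>+ x. ennreal (norm (L x - F n x) powr r) \<partial>?M)"
    unfolding tint_def by (rule nn_integral_eq_integral[OF int, symmetric]) simp
  then show "tint (\<lambda>x. norm (L x - F n x) powr r) \<le> (\<Sum>k. e (k + n))"
    using fin ennreal_le_iff[OF suminf_nonneg[OF en[of n] e0]] by metis
qed

lemma norm_powr_sum3:
  fixes x y w :: "'b::real_normed_vector" assumes "0 < r"
  shows "norm (x + y + w) powr r \<le> 3 powr r * (norm x powr r + norm y powr r + norm w powr r)"
proof -
  have "norm (x + y + w) powr r \<le> (norm x + norm y + norm w) powr r"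
    using assms norm_triangle_le[of "x + y" w] norm_triangle_ineq[of x y] by (intro powr_mono2) (auto intro: norm_add_rule_thm order_trans[OF norm_triangle_ineq])
  also have "\<dots> \<le> 3 powr r * (norm x powr r + norm y powr r + norm w powr r)" using assms by (intro powr_add_le3) auto
  finally show ?thesis .
qed

lemma Lp_mem_of_diff:
  fixes f g :: "real^'d \<Rightarrow> 'b::euclidean_space"
  assumes r: "0 < r" and f: "f \<in> borel_measurable (lebesgue_on cell)" and g: "continuous_on UNIV g"
    and int: "integrable (lebesgue_on cell) (\<lambda>x. norm (f x - g x) powr r)"
  shows "Lp_mem r f"
    "tint (\<lambda>x. norm (f x) powr r) \<le> 3 powr r * (tint (\<lambda>x. norm (f x - g x) powr r) + integral cell (\<lambda>x. norm (g x) powr r))"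
proof -
  let ?M = "lebesgue_on (cell :: (real^'d) set)"
  have cg: "continuous_on cell (\<lambda>x. norm (g x) powr r)"
    by (rule continuous_on_subset[OF cont_norm_powr[OF r g]]) simp
  note g' = tint_eq_integral[OF cg]
  have I: "integrable ?M (\<lambda>x. 3 powr r * (norm (f x - g x) powr r + norm (g x) powr r))"
    by (intro integrable_mult_right Bochner_Integration.integrable_add int g')
  have le: "norm (f x) powr r \<le> 3 powr r * (norm (f x - g x) powr r + norm (g x) powr r)" for x
    using norm_powr_sum3[OF r, of "f x - g x" "g x" 0] r by simp
  have mf: "(\<lambda>x. norm (f x) powr r) \<in> borel_measurable ?M" using f by measurable
  have If: "integrable ?M (\<lambda>x. norm (f x) powr r)"
    by (rule Bochner_Integration.integrable_bound[OF I mf]) (use le in auto)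
  then show "Lp_mem r f" using f by (simp add: Lp_mem_def)
  have "tint (\<lambda>x. norm (f x) powr r) \<le> tint (\<lambda>x. 3 powr r * (norm (f x - g x) powr r + norm (g x) powr r))"
    unfolding tint_def by (rule integral_mono[OF If I]) (rule le)
  also have "\<dots> = 3 powr r * (tint (\<lambda>x. norm (f x - g x) powr r) + tint (\<lambda>x. norm (g x) powr r))"
    unfolding tint_def using int g'(2) by simp
  finally show "tint (\<lambda>x. norm (f x) powr r) \<le> 3 powr r * (tint (\<lambda>x. norm (f x - g x) powr r) + integral cell (\<lambda>x. norm (g x) powr r))"
    by (simp add: g')
qed

text \<open>The distance of the limit to a stage is small uniformly in time, and each fixed stage is
  continuous in time; the difference at two times is split accordingly into three parts.\<close>

lemma C_Lp_limit:
  fixes F :: "nat \<Rightarrow> real \<times> (real^'d) \<Rightarrow> 'b::euclidean_space" and e :: "nat \<Rightarrow> real"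
  assumes r: "0 < r" and cont: "\<And>n. continuous_on UNIV (F n)"
    and b: "\<And>n t. t \<in> {0..T} \<Longrightarrow> (2 ^ Suc n) powr r * integral cell (\<lambda>x. norm (F (Suc n) (t, x) - F n (t, x)) powr r) \<le> e n" and e: "summable e"
  defines "L \<equiv> \<lambda>t x. lim (\<lambda>n. F n (t, x))"
  shows "C_Lp T r L"
proof -
  let ?M = "lebesgue_on (cell :: (real^'d) set)"
  have cs: "continuous_on UNIV (\<lambda>x. F n (t, x))" for n t
    by (rule continuous_on_compose2[OF cont]) (auto intro!: continuous_intros)
  have rl: "L t \<in> borel_measurable ?M" "integrable ?M (\<lambda>x. norm (L t x - F n (t, x)) powr r)"
    "tint (\<lambda>x. norm (L t x - F n (t, x)) powr r) \<le> (\<Sum>k. e (k + n))" if "t \<in> {0..T}" for t n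
    unfolding L_def using rapid_limit[OF r cs b[OF that] e] by auto
  show ?thesis
    unfolding C_Lp_def
  proof (intro conjI ballI)
    fix t assume t: "t \<in> {0..T}"
    show "Lp_mem r (L t)" by (rule Lp_mem_of_diff(1)[OF r rl(1)[OF t] cs rl(2)[OF t]])
  next
    fix t assume t: "t \<in> {0..T}"
    have D: "0 \<le> tint (\<lambda>x. norm (L s x - L t x) powr r) \<and> tint (\<lambda>x. norm (L s x - L t x) powr r)
        \<le> 3 powr r * (2 * (\<Sum>k. e (k + n)) + integral cell (\<lambda>x. norm (F n (s, x) - F n (t, x)) powr r))" if s: "s \<in> {0..T}" for s n
    proof -
      have c2: "continuous_on cell (\<lambda>x. norm (F n (s, x) - F n (t, x)) powr r)"
        by (rule continuous_on_subset[OF cont_norm_powr[OF r continuous_on_diff[OF cs cs]]]) simp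
      note c2' = tint_eq_integral[OF c2]
      let ?B = "\<lambda>x. 3 powr r * (norm (L s x - F n (s, x)) powr r + norm (F n (s, x) - F n (t, x)) powr r + norm (L t x - F n (t, x)) powr r)"
      have I: "integrable ?M ?B"
        by (intro integrable_mult_right Bochner_Integration.integrable_add rl(2) s t c2')
      have le: "norm (L s x - L t x) powr r \<le> ?B x" for x
        using norm_powr_sum3[OF r, of "L s x - F n (s, x)" "F n (s, x) - F n (t, x)" "F n (t, x) - L t x"] by (simp add: norm_minus_commute)
      have m: "(\<lambda>x. norm (L s x - L t x) powr r) \<in> borel_measurable ?M" using rl(1)[OF s] rl(1)[OF t] by measurable
      have J: "integrable ?M (\<lambda>x. norm (L s x - L t x) powr r)"
        by (rule Bochner_Integration.integrable_bound[OF I m]) (use le in auto)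
      have "tint (\<lambda>x. norm (L s x - L t x) powr r) \<le> tint ?B" unfolding tint_def by (rule integral_mono[OF J I]) (rule le)
      also have "\<dots> = 3 powr r * (tint (\<lambda>x. norm (L s x - F n (s, x)) powr r) + tint (\<lambda>x. norm (F n (s, x) - F n (t, x)) powr r) + tint (\<lambda>x. norm (L t x - F n (t, x)) powr r))"
        unfolding tint_def using rl(2)[OF s] rl(2)[OF t] c2'(2) by simp
      also have "\<dots> \<le> 3 powr r * (2 * (\<Sum>k. e (k + n)) + integral cell (\<lambda>x. norm (F n (s, x) - F n (t, x)) powr r))"
        using rl(3)[OF s, of n] rl(3)[OF t, of n] c2'(1) by (intro mult_left_mono) auto
      finally show ?thesis unfolding tint_def by (auto intro!: Bochner_Integration.integral_nonneg)
    qed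
    have "((\<lambda>s. tint (\<lambda>x. norm (L s x - L t x) powr r)) \<longlongrightarrow> 0) (at t within {0..T})"
    proof (rule tendstoI)
      fix \<epsilon> :: real assume eps: "0 < \<epsilon>"
      \<comment> \<open>Two tails and one time increment, each below \<open>\<epsilon>'\<close>,
        stay under \<open>4 * \<epsilon>'\<close>.\<close>
      define \<epsilon>' where "\<epsilon>' = \<epsilon> / (4 * 3 powr r)"
      have eps': "0 < \<epsilon>'" using eps by (simp add: \<epsilon>'_def)
      have "(\<lambda>n. \<Sum>k. e (k + n)) \<longlonglongrightarrow> 0" by (rule suminf_exist_split2[OF e])
      then obtain n where n: "(\<Sum>k. e (k + n)) < \<epsilon>'"
        using order_tendstoD(2)[OF _ eps'] by (metis (no_types, lifting) eventually_sequentially order_refl)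
      have "continuous_on UNIV (\<lambda>s. integral (cbox 0 One) (\<lambda>x. norm (F n (s, x) - F n (t, x)) powr r))"
        by (rule integral_continuous_on_param)
           (auto simp: split_beta intro!: cont_norm_powr r continuous_intros continuous_on_compose2[OF cont])
      then have "((\<lambda>s. integral cell (\<lambda>x. norm (F n (s, x) - F n (t, x)) powr r)) \<longlongrightarrow> integral cell (\<lambda>x. norm (F n (t, x) - F n (t, x)) powr r)) (at t within {0..T})"
        unfolding cell_def by (meson continuous_on_def continuous_on_subset subset_UNIV t)
      then have "((\<lambda>s. integral cell (\<lambda>x. norm (F n (s, x) - F n (t, x)) powr r)) \<longlongrightarrow> 0) (at t within {0..T})" using r by simp
      then have "\<forall>\<^sub>F s in at t within {0..T}. integral cell (\<lambda>x. norm (F n (s, x) - F n (t, x)) powr r) < \<epsilon>'"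
        by (rule order_tendstoD(2)[OF _ eps'])
      moreover have "\<forall>\<^sub>F s in at t within {0..T}. s \<in> {0..T}" by (simp add: eventually_at_filter)
      ultimately show "\<forall>\<^sub>F s in at t within {0..T}. dist (tint (\<lambda>x. norm (L s x - L t x) powr r)) 0 < \<epsilon>"
      proof eventually_elim
        case (elim s)
        have "3 powr r * (2 * (\<Sum>k. e (k + n)) + integral cell (\<lambda>x. norm (F n (s, x) - F n (t, x)) powr r)) < 3 powr r * (4 * \<epsilon>')"
          using elim n eps' by (intro mult_strict_left_mono) auto
        also have "\<dots> = \<epsilon>" by (simp add: \<epsilon>'_def)
        finally show ?case using D[OF elim(2), of n] by (simp add: dist_real_def)
      qed
    qed
    then show "((\<lambda>s. Lp_norm r (\<lambda>x. L s x - L t x)) \<longlongrightarrow> 0) (at t within {0..T})"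
      unfolding Lp_norm_def
      by (rule tendsto_zero_powrI[where b="1 / r"])
         (use r D in \<open>auto simp: eventually_at_filter\<close>)
  qed
qed

subsection \<open>Passing to the limit in products\<close>

lemma hconj_props: assumes "1 < p" shows "1 < hconj p" "1 / p + 1 / hconj p = 1"
  using assms by (auto simp: hconj_def less_divide_eq field_simps)

context
  fixes p :: real assumes p: "1 < p"
begin

text \<open>Young's inequality after moving a factor \<open>l\<close> from one side to the other. A
  large or a small \<open>l\<close> makes either coefficient as small as desired, which takes the
  role of Hoelder's inequality when products pass to the limit.\<close>

lemma young_scaled:
  fixes x y l :: real assumes l: "0 < l"
  shows "\<bar>x * y\<bar> \<le> l powr p * \<bar>x\<bar> powr p + l powr (- hconj p) * \<bar>y\<bar> powr (hconj p)"
proof -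
  note q = hconj_props[OF p]
  have "\<bar>x * y\<bar> = (l * \<bar>x\<bar>) * (\<bar>y\<bar> / l)" using l by (simp add: abs_mult)
  also have "\<dots> \<le> (l * \<bar>x\<bar>) powr p / p + (\<bar>y\<bar> / l) powr (hconj p) / hconj p"
    using l by (intro Youngs_inequality p q) auto
  also have "\<dots> \<le> (l * \<bar>x\<bar>) powr p + (\<bar>y\<bar> / l) powr (hconj p)"
    using p q by (intro add_mono) (auto simp: divide_le_eq mult_le_cancel_left1)
  also have "(l * \<bar>x\<bar>) powr p = l powr p * \<bar>x\<bar> powr p" using l by (simp add: powr_mult)
  also have "(\<bar>y\<bar> / l) powr (hconj p) = l powr (- hconj p) * \<bar>y\<bar> powr (hconj p)"
    using l by (simp add: powr_divide powr_minus inverse_eq_divide)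
  finally show ?thesis .
qed

lemma young_integral:
  fixes x y :: "real^'d \<Rightarrow> real"
  assumes x: "Lp_mem p x" and y: "Lp_mem (hconj p) y"
  shows "integrable (lebesgue_on cell) (\<lambda>s. x s * y s)"
    "0 < l \<Longrightarrow> \<bar>tint (\<lambda>s. x s * y s)\<bar> \<le> l powr p * tint (\<lambda>s. norm (x s) powr p) + l powr (- hconj p) * tint (\<lambda>s. norm (y s) powr (hconj p))"
proof -
  let ?M = "lebesgue_on (cell :: (real^'d) set)"
  have m: "(\<lambda>s. x s * y s) \<in> borel_measurable ?M" using x y by (auto simp: Lp_mem_def)
  have Ix: "integrable ?M (\<lambda>s. norm (x s) powr p)" and Iy: "integrable ?M (\<lambda>s. norm (y s) powr (hconj p))" using x y by (auto simp: Lp_mem_def)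
  have I: "integrable ?M (\<lambda>s. l powr p * norm (x s) powr p + l powr (- hconj p) * norm (y s) powr (hconj p))" for l
    by (intro Bochner_Integration.integrable_add integrable_mult_right Ix Iy)
  show J: "integrable ?M (\<lambda>s. x s * y s)"
    by (rule Bochner_Integration.integrable_bound[OF I[of 1] m]) (use young_scaled[of 1] in auto)
  assume l: "0 < l"
  have "\<bar>tint (\<lambda>s. x s * y s)\<bar> \<le> tint (\<lambda>s. \<bar>x s * y s\<bar>)" unfolding tint_def using integral_norm_bound[of ?M "\<lambda>s. x s * y s"] by simp
  also have "\<dots> \<le> tint (\<lambda>s. l powr p * norm (x s) powr p + l powr (- hconj p) * norm (y s) powr (hconj p))"
    unfolding tint_def using young_scaled[OF l] by (intro integral_mono I integrable_abs J) auto
  also have "\<dots> = l powr p * tint (\<lambda>s. norm (x s) powr p) + l powr (- hconj p) * tint (\<lambda>s. norm (y s) powr (hconj p))"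
    unfolding tint_def using Ix Iy by simp
  finally show "\<bar>tint (\<lambda>s. x s * y s)\<bar> \<le> l powr p * tint (\<lambda>s. norm (x s) powr p) + l powr (- hconj p) * tint (\<lambda>s. norm (y s) powr (hconj p))" .
qed

lemma Lp_mem_diff:
  fixes f g :: "real^'d \<Rightarrow> 'b::euclidean_space"
  assumes r: "0 < r" and f: "Lp_mem r f" and g: "Lp_mem r g"
  shows "Lp_mem r (\<lambda>x. f x - g x)"
proof -
  let ?M = "lebesgue_on (cell :: (real^'d) set)"
  have mf: "f \<in> borel_measurable ?M" "g \<in> borel_measurable ?M" and I: "integrable ?M (\<lambda>x. norm (f x) powr r)" "integrable ?M (\<lambda>x. norm (g x) powr r)"
    using f g by (auto simp: Lp_mem_def)
  have I2: "integrable ?M (\<lambda>x. 3 powr r * (norm (f x) powr r + norm (g x) powr r))"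
    by (intro integrable_mult_right Bochner_Integration.integrable_add I)
  have "(\<lambda>x. norm (f x - g x) powr r) \<in> borel_measurable ?M" using mf by measurable
  then have "integrable ?M (\<lambda>x. norm (f x - g x) powr r)"
    by (rule Bochner_Integration.integrable_bound[OF I2]) (use norm_powr_sum3[OF r, of "f _" "- g _" 0] r in auto)
  then show ?thesis using mf by (auto simp: Lp_mem_def)
qed

text \<open>The difference of products has three parts, two of which contain a fixed factor bounded
  by \<open>C\<close>. Young's inequality with a large \<open>l\<close>, and with
  \<open>1 / l\<close> in the second part, makes the fixed factors contribute less than half of
  \<open>\<epsilon>\<close>; then \<open>n\<close> is chosen for that \<open>l\<close>. Uniformity
  in \<open>t\<close> prepares the integration in time.\<close>

lemma uniform_limit_product:
  fixes X :: "nat \<Rightarrow> real \<Rightarrow> real^'d \<Rightarrow> real" and Y :: "nat \<Rightarrow> real \<Rightarrow> real^'d \<Rightarrow> real"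
  assumes mX: "\<And>n t. t \<in> I \<Longrightarrow> Lp_mem p (X n t)" and mY: "\<And>n t. t \<in> I \<Longrightarrow> Lp_mem (hconj p) (Y n t)"
    and mX': "\<And>t. t \<in> I \<Longrightarrow> Lp_mem p (X' t)" and mY': "\<And>t. t \<in> I \<Longrightarrow> Lp_mem (hconj p) (Y' t)"
    and bX: "\<And>n t. t \<in> I \<Longrightarrow> tint (\<lambda>x. norm (X n t x - X' t x) powr p) \<le> \<alpha> n"
    and bY: "\<And>n t. t \<in> I \<Longrightarrow> tint (\<lambda>x. norm (Y n t x - Y' t x) powr (hconj p)) \<le> \<beta> n"
    and a: "\<alpha> \<longlonglongrightarrow> 0" and b: "\<beta> \<longlonglongrightarrow> 0"
    and cX: "\<And>t. t \<in> I \<Longrightarrow> tint (\<lambda>x. norm (X' t x) powr p) \<le> C" and cY: "\<And>t. t \<in> I \<Longrightarrow> tint (\<lambda>x. norm (Y' t x) powr (hconj p)) \<le> C"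
  shows "uniform_limit I (\<lambda>n t. tint (\<lambda>x. X n t x * Y n t x)) (\<lambda>t. tint (\<lambda>x. X' t x * Y' t x)) sequentially"
proof (rule uniform_limitI)
  fix \<epsilon> :: real assume eps: "0 < \<epsilon>"
  note q = hconj_props[OF p]
  define q where "q = hconj p"
  have q1: "1 < q" using q by (simp add: q_def)
  have "((\<lambda>l. l powr (- q) * C + l powr (- p) * C) \<longlongrightarrow> 0 * C + 0 * C) at_top"
    using p q1 by (intro tendsto_add tendsto_mult tendsto_const tendsto_neg_powr filterlim_ident) auto
  then have "\<forall>\<^sub>F l in at_top. l powr (- q) * C + l powr (- p) * C < \<epsilon> / 2"
    using eps by (intro order_tendstoD(2)[where y=0]) auto
  then have "\<forall>\<^sub>F l in at_top. l powr (- q) * C + l powr (- p) * C < \<epsilon> / 2 \<and> l > (0::real)"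
    by (intro eventually_conj eventually_gt_at_top)
  then obtain l :: real where l: "l powr (- q) * C + l powr (- p) * C < \<epsilon> / 2" "l > 0"
    by (metis (no_types, lifting) eventually_at_top_linorder order_refl)
  have "(\<lambda>n. l powr p * \<alpha> n + l powr q * \<beta> n + (\<alpha> n + \<beta> n)) \<longlonglongrightarrow> l powr p * 0 + l powr q * 0 + (0 + 0)"
    by (intro tendsto_add tendsto_mult tendsto_const a b)
  then have "\<forall>\<^sub>F n in sequentially. l powr p * \<alpha> n + l powr q * \<beta> n + (\<alpha> n + \<beta> n) < \<epsilon> / 2"
    using eps by (intro order_tendstoD(2)[where y=0]) auto
  then show "\<forall>\<^sub>F n in sequentially. \<forall>t\<in>I. dist (tint (\<lambda>x. X n t x * Y n t x)) (tint (\<lambda>x. X' t x * Y' t x)) < \<epsilon>"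
  proof eventually_elim
    case (elim n)
    show ?case
    proof
      fix t assume t: "t \<in> I"
      have dX: "Lp_mem p (\<lambda>x. X n t x - X' t x)" and dY: "Lp_mem (hconj p) (\<lambda>x. Y n t x - Y' t x)"
        using p q1 by (auto intro!: Lp_mem_diff mX mX' mY mY' t simp: q_def)
      note I1 = young_integral[OF dX mY'[OF t]] and I2 = young_integral[OF mX'[OF t] dY] and I3 = young_integral[OF dX dY]
         and I4 = young_integral(1)[OF mX[OF t] mY[OF t], of n n] and I5 = young_integral(1)[OF mX'[OF t] mY'[OF t]]
      have "tint (\<lambda>x. X n t x * Y n t x) - tint (\<lambda>x. X' t x * Y' t x) = tint (\<lambda>x. X n t x * Y n t x - X' t x * Y' t x)"
        unfolding tint_def using I4 I5 by simp
      also have "(\<lambda>x. X n t x * Y n t x - X' t x * Y' t x) = (\<lambda>x. (X n t x - X' t x) * Y' t x + X' t x * (Y n t x - Y' t x) + (X n t x - X' t x) * (Y n t x - Y' t x))"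
        by (simp add: fun_eq_iff algebra_simps)
      also have "tint \<dots> = tint (\<lambda>x. (X n t x - X' t x) * Y' t x) + tint (\<lambda>x. X' t x * (Y n t x - Y' t x)) + tint (\<lambda>x. (X n t x - X' t x) * (Y n t x - Y' t x))"
        unfolding tint_def using I1(1) I2(1) I3(1) by (simp add: Bochner_Integration.integral_add Bochner_Integration.integrable_add del: left_diff_distrib right_diff_distrib)
      finally have eq: "tint (\<lambda>x. X n t x * Y n t x) - tint (\<lambda>x. X' t x * Y' t x) = tint (\<lambda>x. (X n t x - X' t x) * Y' t x) + tint (\<lambda>x. X' t x * (Y n t x - Y' t x)) + tint (\<lambda>x. (X n t x - X' t x) * (Y n t x - Y' t x))" .
      have 1: "\<bar>tint (\<lambda>x. (X n t x - X' t x) * Y' t x)\<bar> \<le> l powr p * \<alpha> n + l powr (- q) * C"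
        by (rule order_trans[OF I1(2)[OF l(2), folded q_def]]) (intro add_mono mult_left_mono bX cY[folded q_def] t powr_ge_zero)
      have il: "0 < 1 / l" using l by simp
      have 2: "\<bar>tint (\<lambda>x. X' t x * (Y n t x - Y' t x))\<bar> \<le> (1 / l) powr p * C + (1 / l) powr (- q) * \<beta> n"
        by (rule order_trans[OF I2(2)[OF il, folded q_def]]) (intro add_mono mult_left_mono bY[folded q_def] cX t powr_ge_zero)
      have pw: "(1 / l) powr p = l powr (- p)" "(1 / l) powr (- q) = l powr q" using l by (simp_all add: powr_divide powr_minus inverse_eq_divide)
      have 3: "\<bar>tint (\<lambda>x. (X n t x - X' t x) * (Y n t x - Y' t x))\<bar> \<le> 1 powr p * \<alpha> n + 1 powr (- hconj p) * \<beta> n"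
        by (rule order_trans[OF I3(2)[OF zero_less_one]]) (intro add_mono mult_left_mono bX bY t powr_ge_zero)
      show "dist (tint (\<lambda>x. X n t x * Y n t x)) (tint (\<lambda>x. X' t x * Y' t x)) < \<epsilon>"
        unfolding dist_real_def eq using 1 2[unfolded pw] 3 elim l(1) by simp
    qed
  qed
qed

end

lemma Lp_mem_cont:
  fixes f :: "real^'d \<Rightarrow> 'b::euclidean_space"
  shows "0 < r \<Longrightarrow> continuous_on UNIV f \<Longrightarrow> Lp_mem r f"
  unfolding Lp_mem_def using cont_measurable[of f] tint_eq_integral(2)[of "\<lambda>x. norm (f x) powr r"]
    continuous_on_subset[OF cont_norm_powr[of r UNIV f], of cell] by auto

subsection \<open>The weak formulation for smooth approximate solutions\<close>

lemma ddir_snd: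
  fixes f :: "real^'d \<Rightarrow> real"
  assumes "smooth f"
  shows "((\<lambda>z :: real \<times> (real^'d). f (snd z)) has_derivative (\<lambda>v. ddir (snd v) f (snd z))) (at z)"
  by (rule has_derivative_compose[OF _ smooth_has_derivative[OF assms]]) (auto intro!: derivative_eq_intros)

text \<open>Test functions, extended constantly in time, become space-time functions, so that the
  calculus with \<open>Dx\<close> covers them.\<close>

lemma smooth_snd:
  fixes f :: "real^'d \<Rightarrow> real"
  assumes "smooth f"
  shows "smooth (\<lambda>z :: real \<times> (real^'d). f (snd z))"
proof -
  have "smooth f \<Longrightarrow> Ck n (\<lambda>z :: real \<times> (real^'d). f (snd z))" for n and f :: "real^'d \<Rightarrow> real"
  proof (induction n arbitrary: f)
    case 0
    then show ?case by (auto intro!: smooth_cont_compose[of f] continuous_intros)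
  next
    case (Suc n)
    have "Ck n (\<lambda>z :: real \<times> (real^'d). ddir (snd b) f (snd z))" if "b \<in> Basis" for b :: "real \<times> (real^'d)"
    \<comment> \<open>The basis vector in the time direction has zero spatial part, and the
      derivative along it vanishes.\<close>
    proof (cases "snd b = 0")
      case True
      have "ddir 0 f x = 0" for x using ddir_scaleR[OF Suc.prems, of 0 0 x] by simp
      then show ?thesis using True by simp
    next
      case False
      then have "snd b \<in> Basis" using that by (auto simp: Basis_prod_def)
      then show ?thesis by (intro Suc.IH smooth_ddir Suc.prems)
    qed
    then show ?case by (rule Ck_SucI[OF ddir_snd[OF Suc.prems]])
  qed
  then show ?thesis using assms by (auto simp: smooth_def)
qed

lemma pd_eq_ddir: "pd f i = ddir (axis i 1) f" for f :: "real^'d \<Rightarrow> real"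
  by (simp add: fun_eq_iff pd_def ddir_def)

text \<open>The equation is tested at a fixed time and every space derivative is moved to
  \<open>\<phi>\<close>: once for the transport term and the defect, twice for the diffusion. The
  defect then enters undifferentiated.\<close>

lemma solves_weak_rate:
  fixes \<phi> :: "real^'d \<Rightarrow> real"
  assumes sol: "solves T \<theta> u R" and t: "t \<in> {0..T}" and phi: "test_fun \<phi>"
  shows "integral cell (\<lambda>x. Dt \<theta> (t, x) * \<phi> x)
     = integral cell (\<lambda>x. \<theta> (t, x) * (\<Sum>i\<in>UNIV. u i (t, x) * pd \<phi> i x)) + integral cell (\<lambda>x. \<theta> (t, x) * (lap \<phi> x - \<phi> x / 2))
       - (\<Sum>i\<in>UNIV. integral cell (\<lambda>x. R i (t, x) * pd \<phi> i x))"
    "(\<Sum>i\<in>UNIV. integral cell (\<lambda>x. u i (t, x) * pd \<phi> i x)) = 0"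
proof -
  let ?I = "integral cell :: (real^'d \<Rightarrow> real) \<Rightarrow> real"
  define g where "g z = \<phi> (snd z)" for z :: "real \<times> (real^'d)"
  have sphi: "smooth \<phi>" and pphi: "periodic \<phi>" using phi by (auto simp: test_fun_def)
  have sg: "smooth g" unfolding g_def[abs_def] by (rule smooth_snd[OF sphi])
  have pg: "per_at 1 t g" using pphi by (simp add: per_at_def g_def periodic_def)
  have Dg: "Dx i g (t, x) = pd \<phi> i x" for i x
    unfolding g_def[abs_def] using ddir_eqI[OF ddir_snd[OF sphi]] by (simp add: pd_eq_ddir)
  have DDg: "Dx i (Dx i g) (t, x) = pd (pd \<phi> i) i x" for i x
  proof -
    have "Dx i g = (\<lambda>z. ddir (axis i 1) \<phi> (snd z))"
      unfolding g_def[abs_def] using ddir_eqI[OF ddir_snd[OF sphi]] by (simp add: fun_eq_iff)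
    then show ?thesis using ddir_eqI[OF ddir_snd[OF smooth_ddir[OF sphi, of "axis i 1"]]] by (simp add: pd_eq_ddir)
  qed
  have s: "smooth \<theta>" "smooth (u i)" "smooth (R i)" and pr: "per_at 1 t \<theta>" "per_at 1 t (u i)" "per_at 1 t (R i)" for i
    using sol t by (auto simp: solves_def)
  have suth: "smooth (\<lambda>z. u i z * \<theta> z)" "per_at 1 t (\<lambda>z. u i z * \<theta> z)" for i using s pr by (auto intro: smooth_mult simp: per_at_def)
  have eq: "Dt \<theta> (t, x) = - (\<Sum>i\<in>UNIV. Dx i (\<lambda>z. u i z * \<theta> z) (t, x)) - \<theta> (t, x) / 2 + (\<Sum>i\<in>UNIV. Dx i (Dx i \<theta>) (t, x)) + (\<Sum>i\<in>UNIV. Dx i (R i) (t, x))" for x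
    using sol t by (auto simp: solves_def algebra_simps)
  have du: "(\<Sum>i\<in>UNIV. Dx i (u i) (t, x)) = 0" for x using sol t by (auto simp: solves_def)
  have cg: "continuous_on UNIV (\<lambda>x. g (t, x))" "continuous_on UNIV (\<lambda>x. \<theta> (t, x))" "continuous_on UNIV (\<lambda>x. Dx i (\<lambda>z. u i z * \<theta> z) (t, x))"
    "continuous_on UNIV (\<lambda>x. Dx i (Dx i \<theta>) (t, x))" "continuous_on UNIV (\<lambda>x. Dx i (R i) (t, x))" "continuous_on UNIV (\<lambda>x. Dx i (u i) (t, x))"
    "continuous_on UNIV (\<lambda>x. u i (t, x))" "continuous_on UNIV (\<lambda>x. pd \<phi> i x)" "continuous_on UNIV (\<lambda>x. pd (pd \<phi> i) i x)" for i
    unfolding Dg[symmetric] DDg[symmetric] by (intro slice_cont smooth_ddir sg s suth ex_Basis)+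
  have "?I (\<lambda>x. Dt \<theta> (t, x) * \<phi> x) = ?I (\<lambda>x. (\<Sum>i\<in>UNIV. - (g (t, x) * Dx i (\<lambda>z. u i z * \<theta> z) (t, x)) + g (t, x) * Dx i (Dx i \<theta>) (t, x) + g (t, x) * Dx i (R i) (t, x)) - \<theta> (t, x) * \<phi> x / 2)"
  proof -
    have S: "(\<Sum>i\<in>UNIV. - (y * a i) + y * b i + y * c i) = y * (- (\<Sum>i\<in>UNIV. a i) + (\<Sum>i\<in>UNIV. b i) + (\<Sum>i\<in>UNIV. c i))" for y :: real and a b c :: "'d \<Rightarrow> real"
      by (simp add: sum.distrib sum_negf sum_subtractf sum_distrib_left distrib_left right_diff_distrib)
    show ?thesis unfolding eq g_def S by (simp add: algebra_simps)
  qed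
  also have "\<dots> = ?I (\<lambda>x. \<Sum>i\<in>UNIV. - (g (t, x) * Dx i (\<lambda>z. u i z * \<theta> z) (t, x)) + g (t, x) * Dx i (Dx i \<theta>) (t, x) + g (t, x) * Dx i (R i) (t, x)) - ?I (\<lambda>x. \<theta> (t, x) * \<phi> x / 2)"
    using cg(1) unfolding g_def by (intro Henstock_Kurzweil_Integration.integral_diff integrable_cell continuous_intros cg) auto
  also have "?I (\<lambda>x. \<Sum>i\<in>UNIV. - (g (t, x) * Dx i (\<lambda>z. u i z * \<theta> z) (t, x)) + g (t, x) * Dx i (Dx i \<theta>) (t, x) + g (t, x) * Dx i (R i) (t, x))
     = (\<Sum>i\<in>UNIV. - ?I (\<lambda>x. g (t, x) * Dx i (\<lambda>z. u i z * \<theta> z) (t, x)) + ?I (\<lambda>x. g (t, x) * Dx i (Dx i \<theta>) (t, x)) + ?I (\<lambda>x. g (t, x) * Dx i (R i) (t, x)))"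
    apply (subst Henstock_Kurzweil_Integration.integral_sum)
      apply simp
     apply (intro integrable_cell continuous_intros cg)
    apply (rule sum.cong[OF refl])
    apply (subst Henstock_Kurzweil_Integration.integral_add, (intro integrable_cell continuous_intros cg)+)+
    apply simp
    done
  also have "\<dots> = (\<Sum>i\<in>UNIV. ?I (\<lambda>x. pd \<phi> i x * (u i (t, x) * \<theta> (t, x))) + ?I (\<lambda>x. pd (pd \<phi> i) i x * \<theta> (t, x)) - ?I (\<lambda>x. pd \<phi> i x * R i (t, x)))"
  proof (rule sum.cong[OF refl])
    fix i
    have 1: "?I (\<lambda>x. g (t, x) * Dx i (\<lambda>z. u i z * \<theta> z) (t, x)) = - ?I (\<lambda>x. pd \<phi> i x * (u i (t, x) * \<theta> (t, x)))"
      using integral_by_parts[OF sg pg suth, of i] by (simp add: Dg)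
    have 2: "?I (\<lambda>x. g (t, x) * Dx i (R i) (t, x)) = - ?I (\<lambda>x. pd \<phi> i x * R i (t, x))"
      using integral_by_parts[OF sg pg s(3) pr(3), of i] by (simp add: Dg)
    have 3: "?I (\<lambda>x. g (t, x) * Dx i (Dx i \<theta>) (t, x)) = - ?I (\<lambda>x. Dx i g (t, x) * Dx i \<theta> (t, x))"
      by (rule integral_by_parts[OF sg pg]) (auto intro: smooth_ddir s per_at_ddir pr)
    have 4: "?I (\<lambda>x. Dx i g (t, x) * Dx i \<theta> (t, x)) = - ?I (\<lambda>x. Dx i (Dx i g) (t, x) * \<theta> (t, x))"
      by (rule integral_by_parts) (auto intro: smooth_ddir s sg per_at_ddir pr pg)
    show "- ?I (\<lambda>x. g (t, x) * Dx i (\<lambda>z. u i z * \<theta> z) (t, x)) + ?I (\<lambda>x. g (t, x) * Dx i (Dx i \<theta>) (t, x)) + ?I (\<lambda>x. g (t, x) * Dx i (R i) (t, x))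
      = ?I (\<lambda>x. pd \<phi> i x * (u i (t, x) * \<theta> (t, x))) + ?I (\<lambda>x. pd (pd \<phi> i) i x * \<theta> (t, x)) - ?I (\<lambda>x. pd \<phi> i x * R i (t, x))"
      unfolding 1 2 3 4 DDg by simp
  qed
  also have "\<dots> = (\<Sum>i\<in>UNIV. ?I (\<lambda>x. pd \<phi> i x * (u i (t, x) * \<theta> (t, x)))) + (\<Sum>i\<in>UNIV. ?I (\<lambda>x. pd (pd \<phi> i) i x * \<theta> (t, x))) - (\<Sum>i\<in>UNIV. ?I (\<lambda>x. pd \<phi> i x * R i (t, x)))"
    by (simp add: sum.distrib sum_subtractf)
  also have "(\<Sum>i\<in>UNIV. ?I (\<lambda>x. pd \<phi> i x * (u i (t, x) * \<theta> (t, x)))) = ?I (\<lambda>x. \<Sum>i\<in>UNIV. pd \<phi> i x * (u i (t, x) * \<theta> (t, x)))"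
    by (rule Henstock_Kurzweil_Integration.integral_sum[symmetric]) (auto intro!: integrable_cell continuous_intros cg)
  also have "(\<Sum>i\<in>UNIV. ?I (\<lambda>x. pd (pd \<phi> i) i x * \<theta> (t, x))) = ?I (\<lambda>x. \<Sum>i\<in>UNIV. pd (pd \<phi> i) i x * \<theta> (t, x))"
    by (rule Henstock_Kurzweil_Integration.integral_sum[symmetric]) (auto intro!: integrable_cell continuous_intros cg)
  also have "?I (\<lambda>x. \<Sum>i\<in>UNIV. pd (pd \<phi> i) i x * \<theta> (t, x)) = ?I (\<lambda>x. \<theta> (t, x) * (lap \<phi> x - \<phi> x / 2)) + ?I (\<lambda>x. \<theta> (t, x) * \<phi> x / 2)"
  proof -
    have c: "continuous_on UNIV (\<lambda>x. lap \<phi> x)" unfolding lap_def by (intro continuous_intros cg)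
    have c': "continuous_on UNIV \<phi>" by (rule smooth_continuous_on[OF sphi])
    have "?I (\<lambda>x. \<theta> (t, x) * (lap \<phi> x - \<phi> x / 2)) + ?I (\<lambda>x. \<theta> (t, x) * \<phi> x / 2) = ?I (\<lambda>x. \<theta> (t, x) * (lap \<phi> x - \<phi> x / 2) + \<theta> (t, x) * \<phi> x / 2)"
      by (rule Henstock_Kurzweil_Integration.integral_add[symmetric]) (auto intro!: integrable_cell continuous_intros cg c c')
    also have "(\<lambda>x. \<theta> (t, x) * (lap \<phi> x - \<phi> x / 2) + \<theta> (t, x) * \<phi> x / 2) = (\<lambda>x. \<Sum>i\<in>UNIV. pd (pd \<phi> i) i x * \<theta> (t, x))"
      by (simp add: fun_eq_iff lap_def algebra_simps sum_distrib_left)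
    finally show ?thesis by simp
  qed
  finally show "?I (\<lambda>x. Dt \<theta> (t, x) * \<phi> x) = ?I (\<lambda>x. \<theta> (t, x) * (\<Sum>i\<in>UNIV. u i (t, x) * pd \<phi> i x)) + ?I (\<lambda>x. \<theta> (t, x) * (lap \<phi> x - \<phi> x / 2))
       - (\<Sum>i\<in>UNIV. ?I (\<lambda>x. R i (t, x) * pd \<phi> i x))"
    by (simp add: sum_distrib_left mult_ac)
  have "(\<Sum>i\<in>UNIV. ?I (\<lambda>x. u i (t, x) * pd \<phi> i x)) = (\<Sum>i\<in>UNIV. - ?I (\<lambda>x. g (t, x) * Dx i (u i) (t, x)))"
    using integral_by_parts[OF sg pg s(2) pr(2)] by (intro sum.cong) (auto simp: Dg mult.commute)
  also have "\<dots> = - ?I (\<lambda>x. \<Sum>i\<in>UNIV. g (t, x) * Dx i (u i) (t, x))"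
    by (subst Henstock_Kurzweil_Integration.integral_sum) (auto intro!: integrable_cell continuous_intros cg simp: sum_negf)
  also have "\<dots> = 0" by (simp add: du flip: sum_distrib_left)
  finally show "(\<Sum>i\<in>UNIV. ?I (\<lambda>x. u i (t, x) * pd \<phi> i x)) = 0" .
qed

lemma integral_time_derivative:
  fixes \<theta> :: "real \<times> (real^'d) \<Rightarrow> real" and \<phi> :: "real^'d \<Rightarrow> real"
  assumes s: "smooth \<theta>" and phi: "continuous_on UNIV \<phi>"
  shows "((\<lambda>t. integral cell (\<lambda>x. \<theta> (t, x) * \<phi> x)) has_real_derivative integral cell (\<lambda>x. Dt \<theta> (t, x) * \<phi> x)) (at t within S)"
    "continuous_on UNIV (\<lambda>t. integral cell (\<lambda>x. Dt \<theta> (t, x) * \<phi> x))"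
proof -
  have cphi: "continuous_on A (\<lambda>z. \<phi> (snd z))" for A :: "(real \<times> (real^'d)) set"
    by (rule continuous_on_compose2[OF phi]) (auto intro!: continuous_intros)
  have c: "continuous_on A (\<lambda>z. F (fst z, snd z))" if "smooth F" for A and F :: "real \<times> (real^'d) \<Rightarrow> real"
    using smooth_continuous_on[OF that] by simp
  have d: "((\<lambda>r. \<theta> (r, y)) has_real_derivative Dt \<theta> (r, y)) (at r within S)" for r y S
  proof -
    have "((\<lambda>r. \<theta> ((0, y) + r *\<^sub>R et)) has_real_derivative Dt \<theta> ((0, y) + r *\<^sub>R et)) (at r within S)"
      by (rule seg_has_field_derivative[OF s])
    then show ?thesis by simp
  qed
  have "((\<lambda>t. integral (cbox 0 One) (\<lambda>x. \<theta> (t, x) * \<phi> x)) has_real_derivative integral (cbox 0 One) (\<lambda>x. Dt \<theta> (t, x) * \<phi> x)) (at t within UNIV)"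
  proof (rule leibniz_rule_field_derivative)
    show "((\<lambda>t. \<theta> (t, x) * \<phi> x) has_real_derivative Dt \<theta> (t, x) * \<phi> x) (at t within UNIV)" for t x
      using DERIV_cmult_right[OF d[of x t UNIV], of "\<phi> x"] by simp
    show "(\<lambda>x. \<theta> (t, x) * \<phi> x) integrable_on cbox 0 One" for t
      using integrable_cell[OF continuous_on_mult[OF slice_cont[OF s] phi]] by (simp add: cell_def)
    show "continuous_on (UNIV \<times> cbox 0 One) (\<lambda>(t, x). Dt \<theta> (t, x) * \<phi> x)"
      unfolding split_beta by (intro continuous_on_mult c smooth_ddir s et_Basis cphi)
  qed auto
  then show "((\<lambda>t. integral cell (\<lambda>x. \<theta> (t, x) * \<phi> x)) has_real_derivative integral cell (\<lambda>x. Dt \<theta> (t, x) * \<phi> x)) (at t within S)"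
    unfolding cell_def by (rule has_field_derivative_subset) simp
  have "continuous_on UNIV (\<lambda>t. integral (cbox 0 One) (\<lambda>x. Dt \<theta> (t, x) * \<phi> x))"
    by (rule integral_continuous_on_param) (unfold split_beta, intro continuous_on_mult c smooth_ddir s et_Basis cphi)
  then show "continuous_on UNIV (\<lambda>t. integral cell (\<lambda>x. Dt \<theta> (t, x) * \<phi> x))" by (simp add: cell_def)
qed

lemma sum_powr_le:
  fixes a :: "'i \<Rightarrow> real"
  assumes A: "finite A" and a: "\<And>i. i \<in> A \<Longrightarrow> 0 \<le> a i" and r: "0 < r"
  shows "(\<Sum>i\<in>A. a i) powr r \<le> real (card A) powr r * (\<Sum>i\<in>A. a i powr r)"
proof (cases "A = {}")
  case False
  define m where "m = Max (a ` A)"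
  have m: "m \<in> a ` A" unfolding m_def using A False by (intro Max_in) auto
  then obtain i where i: "i \<in> A" "m = a i" by auto
  have "(\<Sum>i\<in>A. a i) \<le> (\<Sum>i\<in>A. m)" by (intro sum_mono) (auto simp: m_def A)
  then have "(\<Sum>i\<in>A. a i) powr r \<le> (real (card A) * m) powr r" using r a by (intro powr_mono2) (auto intro: sum_nonneg)
  also have "\<dots> = real (card A) powr r * m powr r" using a i by (simp add: powr_mult)
  also have "m powr r \<le> (\<Sum>i\<in>A. a i powr r)" unfolding i(2) using A i(1) by (intro member_le_sum) auto
  finally show ?thesis by (simp add: mult_left_mono)
qed simp

lemma integral_norm_powr_le:
  fixes F :: "real^'d \<Rightarrow> 'b::euclidean_space" and f :: "'i \<Rightarrow> real^'d \<Rightarrow> real"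
  assumes A: "finite A" and le: "\<And>x. norm (F x) \<le> (\<Sum>i\<in>A. \<bar>f i x\<bar>)" and r: "0 < r"
    and c: "continuous_on UNIV F" "\<And>i. i \<in> A \<Longrightarrow> continuous_on UNIV (f i)" and b: "\<And>i. i \<in> A \<Longrightarrow> integral cell (\<lambda>x. \<bar>f i x\<bar> powr r) \<le> C"
  shows "integral cell (\<lambda>x. norm (F x) powr r) \<le> real (card A) powr r * (real (card A) * C)"
proof -
  have "integral cell (\<lambda>x. norm (F x) powr r) \<le> integral cell (\<lambda>x. real (card A) powr r * (\<Sum>i\<in>A. \<bar>f i x\<bar> powr r))"
  proof (rule integral_cell_le)
    fix x
    have "norm (F x) powr r \<le> (\<Sum>i\<in>A. \<bar>f i x\<bar>) powr r" using r le by (intro powr_mono2) auto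
    also have "\<dots> \<le> real (card A) powr r * (\<Sum>i\<in>A. \<bar>f i x\<bar> powr r)" by (rule sum_powr_le[OF A _ r]) auto
    finally show "norm (F x) powr r \<le> real (card A) powr r * (\<Sum>i\<in>A. \<bar>f i x\<bar> powr r)" .
  qed (intro cont_norm_powr continuous_intros continuous_on_abs_powr c r; assumption?)+
  also have "\<dots> = real (card A) powr r * (\<Sum>i\<in>A. integral cell (\<lambda>x. \<bar>f i x\<bar> powr r))"
    by (simp, subst Henstock_Kurzweil_Integration.integral_sum) (auto intro!: A integrable_cell continuous_on_abs_powr c r)
  also have "\<dots> \<le> real (card A) powr r * (\<Sum>i\<in>A. C)" by (intro mult_left_mono sum_mono b) auto
  finally show ?thesis by simp
qed

lemma Lp_dominated:
  fixes f :: "real^'d \<Rightarrow> 'b::euclidean_space" and g :: "real^'d \<Rightarrow> 'c::euclidean_space"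
  assumes f: "Lp_mem r f" and r: "0 < r" and g: "g \<in> borel_measurable (lebesgue_on cell)" and S: "0 \<le> S"
    and le: "\<And>x. x \<in> cell \<Longrightarrow> norm (g x) \<le> S * norm (f x)"
  shows "Lp_mem r g" "tint (\<lambda>x. norm (g x) powr r) \<le> S powr r * tint (\<lambda>x. norm (f x) powr r)"
proof -
  let ?M = "lebesgue_on (cell :: (real^'d) set)"
  have I: "integrable ?M (\<lambda>x. S powr r * norm (f x) powr r)" using f by (auto simp: Lp_mem_def)
  have le': "norm (g x) powr r \<le> S powr r * norm (f x) powr r" if "x \<in> space ?M" for x
  proof -
    have "norm (g x) powr r \<le> (S * norm (f x)) powr r" using r le that by (intro powr_mono2) auto
    then show ?thesis using S by (simp add: powr_mult)
  qed
  have m: "(\<lambda>x. norm (g x) powr r) \<in> borel_measurable ?M" using g by measurable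
  have J: "integrable ?M (\<lambda>x. norm (g x) powr r)"
    by (rule Bochner_Integration.integrable_bound[OF I m]) (use le' in \<open>auto intro!: AE_I2\<close>)
  then show "Lp_mem r g" using g by (simp add: Lp_mem_def)
  have "tint (\<lambda>x. norm (g x) powr r) \<le> tint (\<lambda>x. S powr r * norm (f x) powr r)"
    unfolding tint_def by (rule integral_mono[OF J I le'])
  then show "tint (\<lambda>x. norm (g x) powr r) \<le> S powr r * tint (\<lambda>x. norm (f x) powr r)" by (simp add: tint_def)
qed

text \<open>The weights are those of \<open>rapid_sequence\<close>. The exponent is a parameter so
  that one sequence can be rapid with several exponents at once.\<close>

definition rapid :: "real \<Rightarrow> real \<Rightarrow> (nat \<Rightarrow> real) \<Rightarrow> (nat \<Rightarrow> real \<times> (real^'d) \<Rightarrow> 'b::euclidean_space) \<Rightarrow> bool" where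
  "rapid T r e F \<longleftrightarrow> 0 < r \<and> summable e \<and> (\<forall>n. continuous_on UNIV (F n)) \<and>
     (\<forall>n. \<forall>t\<in>{0..T}. (2 ^ Suc n) powr r * integral cell (\<lambda>x. norm (F (Suc n) (t, x) - F n (t, x)) powr r) \<le> e n)"

lemma rapidD:
  fixes F :: "nat \<Rightarrow> real \<times> (real^'d) \<Rightarrow> 'b::euclidean_space"
  assumes F: "rapid T r e F"
  defines "L \<equiv> \<lambda>t x. lim (\<lambda>n. F n (t, x))"
  shows "C_Lp T r L" "t \<in> {0..T} \<Longrightarrow> Lp_mem r (L t)" "Lp_mem r (\<lambda>x. F n (t, x))"
    "t \<in> {0..T} \<Longrightarrow> tint (\<lambda>x. norm (F n (t, x) - L t x) powr r) \<le> (\<Sum>k. e (k + n))"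
    "t \<in> {0..T} \<Longrightarrow> L t \<in> borel_measurable (lebesgue_on cell)"
    "(\<lambda>n. \<Sum>k. e (k + n)) \<longlonglongrightarrow> 0"
    "\<exists>C\<ge>0. \<forall>t\<in>{0..T}. tint (\<lambda>x. norm (L t x) powr r) \<le> C"
proof -
  have r: "0 < r" and e: "summable e" and cont: "\<And>n. continuous_on UNIV (F n)"
    and b: "\<And>n t. t \<in> {0..T} \<Longrightarrow> (2 ^ Suc n) powr r * integral cell (\<lambda>x. norm (F (Suc n) (t, x) - F n (t, x)) powr r) \<le> e n"
    using F by (auto simp: rapid_def)
  have cs: "continuous_on UNIV (\<lambda>x. F n (t, x))" for n t
    by (rule continuous_on_compose2[OF cont]) (auto intro!: continuous_intros)
  show C: "C_Lp T r L" unfolding L_def by (rule C_Lp_limit[OF r cont b e])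
  show mem: "t \<in> {0..T} \<Longrightarrow> Lp_mem r (L t)" for t using C by (simp add: C_Lp_def)
  show "Lp_mem r (\<lambda>x. F n (t, x))" by (rule Lp_mem_cont[OF r cs])
  show d: "tint (\<lambda>x. norm (F n (t, x) - L t x) powr r) \<le> (\<Sum>k. e (k + n))" if "t \<in> {0..T}" for t n
    using rapid_limit(3)[OF r cs b[OF that] e, of n] by (simp add: L_def norm_minus_commute)
  show "t \<in> {0..T} \<Longrightarrow> L t \<in> borel_measurable (lebesgue_on cell)" using mem by (simp add: Lp_mem_def)
  show "(\<lambda>n. \<Sum>k. e (k + n)) \<longlonglongrightarrow> 0" by (rule suminf_exist_split2[OF e])
  have "compact ({0..T} \<times> (cell :: (real^'d) set))" by (intro compact_Times) (auto simp: cell_def)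
  then have "compact (F 0 ` ({0..T} \<times> cell))"
    by (rule compact_continuous_image[rotated]) (rule continuous_on_subset[OF cont], simp)
  then obtain C where "\<And>y. y \<in> F 0 ` ({0..T} \<times> cell) \<Longrightarrow> norm y \<le> C" using compact_imp_bounded bounded_iff by metis
  then have C0: "norm (F 0 (t, x)) \<le> C" if "t \<in> {0..T}" "x \<in> cell" for t x using that by blast
  have "tint (\<lambda>x. norm (L t x) powr r) \<le> 3 powr r * ((\<Sum>k. e (k + 0)) + \<bar>C\<bar> powr r)" if t: "t \<in> {0..T}" for t
  proof -
    have "integral cell (\<lambda>x. norm (F 0 (t, x)) powr r) \<le> integral (cell :: (real^'d) set) (\<lambda>x. \<bar>C\<bar> powr r)"
      using r by (intro integral_cell_le cont_norm_powr cs continuous_intros powr_mono2) (auto intro: order_trans[OF C0[OF t] abs_ge_self])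
    moreover have "tint (\<lambda>x. norm (L t x - F 0 (t, x)) powr r) \<le> (\<Sum>k. e (k + 0))" using d[OF t, of 0] by (simp add: norm_minus_commute)
    ultimately have "3 powr r * (tint (\<lambda>x. norm (L t x - F 0 (t, x)) powr r) + integral cell (\<lambda>x. norm (F 0 (t, x)) powr r))
       \<le> 3 powr r * ((\<Sum>k. e (k + 0)) + \<bar>C\<bar> powr r)" by (intro mult_left_mono) auto
    moreover have "tint (\<lambda>x. norm (L t x) powr r) \<le> 3 powr r * (tint (\<lambda>x. norm (L t x - F 0 (t, x)) powr r) + integral cell (\<lambda>x. norm (F 0 (t, x)) powr r))"
      unfolding L_def using Lp_mem_of_diff(2)[OF r rapid_limit(1)[OF r cs b[OF t] e] cs rapid_limit(2)[OF r cs b[OF t] e], of 0] by simp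
    ultimately show ?thesis by linarith
  qed
  then show "\<exists>C\<ge>0. \<forall>t\<in>{0..T}. tint (\<lambda>x. norm (L t x) powr r) \<le> C"
    by (intro exI[of _ "max 0 (3 powr r * ((\<Sum>k. e (k + 0)) + \<bar>C\<bar> powr r))"]) (auto simp: le_max_iff_disj)
qed

text \<open>The test field is attached to the second factor; being bounded on the cell, it only
  multiplies the rate of convergence by a constant.\<close>

lemma uniform_limit_rapid:
  fixes F :: "nat \<Rightarrow> real \<times> (real^'d) \<Rightarrow> real" and H :: "nat \<Rightarrow> real \<times> (real^'d) \<Rightarrow> 'b::euclidean_space" and \<psi> :: "real^'d \<Rightarrow> 'b"
  assumes p: "1 < p" and F: "rapid T p e F" and H: "rapid T (hconj p) e' H" and psi: "continuous_on UNIV \<psi>"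
  shows "uniform_limit {0..T} (\<lambda>n t. tint (\<lambda>x. F n (t, x) * (H n (t, x) \<bullet> \<psi> x)))
     (\<lambda>t. tint (\<lambda>x. lim (\<lambda>n. F n (t, x)) * (lim (\<lambda>n. H n (t, x)) \<bullet> \<psi> x))) sequentially"
    "t \<in> {0..T} \<Longrightarrow> integrable (lebesgue_on cell) (\<lambda>x. lim (\<lambda>n. F n (t, x)) * (lim (\<lambda>n. H n (t, x)) \<bullet> \<psi> x))"
proof -
  define L where "L t x = lim (\<lambda>n. F n (t, x))" for t x
  define K where "K t x = lim (\<lambda>n. H n (t, x))" for t x
  note rF = rapidD[OF F, folded L_def] and rH = rapidD[OF H, folded K_def]
  let ?q = "hconj p"
  have q: "0 < ?q" using hconj_props[OF p] by simp
  have "compact (\<psi> ` cell)" by (intro compact_continuous_image continuous_on_subset[OF psi]) (auto simp: cell_def)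
  then obtain S0 where "\<And>y. y \<in> \<psi> ` cell \<Longrightarrow> norm y \<le> S0" using compact_imp_bounded bounded_iff by metis
  then have S0: "norm (\<psi> x) \<le> max 0 S0" if "x \<in> cell" for x using that by (simp add: le_max_iff_disj)
  define S where "S = max 0 S0"
  have S: "0 \<le> S" "\<And>x. x \<in> cell \<Longrightarrow> norm (\<psi> x) \<le> S" using S0 by (auto simp: S_def)
  have ib: "norm (v \<bullet> \<psi> x) \<le> S * norm v" if "x \<in> cell" for v x
    using Cauchy_Schwarz_ineq2[of v "\<psi> x"] mult_right_mono[OF S(2)[OF that], of "norm v"] by (simp add: mult.commute)
  have mpsi: "\<psi> \<in> borel_measurable (lebesgue_on cell)" by (rule cont_measurable[OF psi])
  have mm: "(\<lambda>x. v x \<bullet> \<psi> x) \<in> borel_measurable (lebesgue_on cell)" if "Lp_mem ?q v" for v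
    using that mpsi by (auto simp: Lp_mem_def)
  note dom = Lp_dominated[OF _ q mm S(1) ib]
  obtain C1 where C1: "\<And>t. t \<in> {0..T} \<Longrightarrow> tint (\<lambda>x. norm (L t x) powr p) \<le> C1" using rF(7) by blast
  obtain C2 where C2: "0 \<le> C2" "\<And>t. t \<in> {0..T} \<Longrightarrow> tint (\<lambda>x. norm (K t x) powr ?q) \<le> C2" using rH(7) by blast
  have "uniform_limit {0..T} (\<lambda>n t. tint (\<lambda>x. F n (t, x) * (H n (t, x) \<bullet> \<psi> x))) (\<lambda>t. tint (\<lambda>x. L t x * (K t x \<bullet> \<psi> x))) sequentially"
  proof (rule uniform_limit_product[OF p, where \<alpha>="\<lambda>n. \<Sum>k. e (k + n)" and \<beta>="\<lambda>n. S powr ?q * (\<Sum>k. e' (k + n))" and C="max C1 (S powr ?q * C2)"])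
    fix n t assume t: "t \<in> {0..T}"
    show "Lp_mem p (\<lambda>x. F n (t, x))" by (rule rF)
    show "Lp_mem ?q (\<lambda>x. H n (t, x) \<bullet> \<psi> x)" by (rule dom(1)) (rule rH)+
    show "tint (\<lambda>x. norm (F n (t, x) - L t x) powr p) \<le> (\<Sum>k. e (k + n))" by (rule rF(4)[OF t])
    have m: "Lp_mem ?q (\<lambda>x. H n (t, x) - K t x)" by (intro Lp_mem_diff[OF p] q rH t)
    have "tint (\<lambda>x. norm ((H n (t, x) - K t x) \<bullet> \<psi> x) powr ?q) \<le> S powr ?q * tint (\<lambda>x. norm (H n (t, x) - K t x) powr ?q)"
      by (rule dom(2)[OF m m])
    also have "\<dots> \<le> S powr ?q * (\<Sum>k. e' (k + n))" by (intro mult_left_mono rH(4)[OF t]) auto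
    finally show "tint (\<lambda>x. norm (H n (t, x) \<bullet> \<psi> x - K t x \<bullet> \<psi> x) powr ?q) \<le> S powr ?q * (\<Sum>k. e' (k + n))"
      by (simp add: inner_diff_left)
  next
    fix t assume t: "t \<in> {0..T}"
    show "Lp_mem p (L t)" by (rule rF(2)[OF t])
    note m = rH(2)[OF t]
    show "Lp_mem ?q (\<lambda>x. K t x \<bullet> \<psi> x)" by (rule dom(1)[OF m m])
    show "tint (\<lambda>x. norm (L t x) powr p) \<le> max C1 (S powr ?q * C2)" using C1[OF t] by simp
    have "tint (\<lambda>x. norm (K t x \<bullet> \<psi> x) powr ?q) \<le> S powr ?q * tint (\<lambda>x. norm (K t x) powr ?q)" by (rule dom(2)[OF m m])
    also have "\<dots> \<le> S powr ?q * C2" by (intro mult_left_mono C2 t) auto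
    finally show "tint (\<lambda>x. norm (K t x \<bullet> \<psi> x) powr ?q) \<le> max C1 (S powr ?q * C2)" by simp
  next
    show "(\<lambda>n. \<Sum>k. e (k + n)) \<longlonglongrightarrow> 0" by (rule rF(6))
    show "(\<lambda>n. S powr ?q * (\<Sum>k. e' (k + n))) \<longlonglongrightarrow> 0" using tendsto_mult_right_zero[OF rH(6)] by simp
  qed
  then show "uniform_limit {0..T} (\<lambda>n t. tint (\<lambda>x. F n (t, x) * (H n (t, x) \<bullet> \<psi> x)))
     (\<lambda>t. tint (\<lambda>x. lim (\<lambda>n. F n (t, x)) * (lim (\<lambda>n. H n (t, x)) \<bullet> \<psi> x))) sequentially"
    by (simp add: L_def K_def)
  show "integrable (lebesgue_on cell) (\<lambda>x. lim (\<lambda>n. F n (t, x)) * (lim (\<lambda>n. H n (t, x)) \<bullet> \<psi> x))" if t: "t \<in> {0..T}"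
    using young_integral(1)[OF p rF(2)[OF t] dom(1)[OF rH(2)[OF t] rH(2)[OF t]]] by (simp add: L_def K_def)
qed

lemma rapid_const: "0 < r \<Longrightarrow> rapid T r (\<lambda>n. 0) (\<lambda>n (z :: real \<times> (real^'d)). 1 :: real)"
  by (simp add: rapid_def)

lemma hconj_hconj: "1 < p \<Longrightarrow> hconj (hconj p) = p"
  by (simp add: hconj_def field_simps)

text \<open>The linear case is the bilinear one with the constant 1 as first factor, taken in the
  conjugate exponent; conjugation is an involution, so \<open>H\<close> keeps its exponent
  \<open>p\<close>.\<close>

lemma uniform_limit_rapid_single:
  fixes H :: "nat \<Rightarrow> real \<times> (real^'d) \<Rightarrow> 'b::euclidean_space" and \<psi> :: "real^'d \<Rightarrow> 'b"
  assumes p: "1 < p" and H: "rapid T p e' H" and psi: "continuous_on UNIV \<psi>"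
  shows "uniform_limit {0..T} (\<lambda>n t. tint (\<lambda>x. H n (t, x) \<bullet> \<psi> x)) (\<lambda>t. tint (\<lambda>x. lim (\<lambda>n. H n (t, x)) \<bullet> \<psi> x)) sequentially"
    "t \<in> {0..T} \<Longrightarrow> integrable (lebesgue_on cell) (\<lambda>x. lim (\<lambda>n. H n (t, x)) \<bullet> \<psi> x)"
proof -
  have q: "1 < hconj p" using hconj_props[OF p] by simp
  have H': "rapid T (hconj (hconj p)) e' H" using H hconj_hconj[OF p] by simp
  have l: "lim (\<lambda>n. 1::real) = 1" by (rule limI) simp
  note * = uniform_limit_rapid[OF q rapid_const H' psi]
  show "uniform_limit {0..T} (\<lambda>n t. tint (\<lambda>x. H n (t, x) \<bullet> \<psi> x)) (\<lambda>t. tint (\<lambda>x. lim (\<lambda>n. H n (t, x)) \<bullet> \<psi> x)) sequentially"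
    using *(1) q by (simp add: l)
  show "t \<in> {0..T} \<Longrightarrow> integrable (lebesgue_on cell) (\<lambda>x. lim (\<lambda>n. H n (t, x)) \<bullet> \<psi> x)"
    using *(2) q by (simp add: l)
qed

subsection \<open>The limit of the iteration\<close>

lemma norm_matrix_le: "norm (M :: real^'d^'d) \<le> (\<Sum>(i, l)\<in>UNIV \<times> UNIV. \<bar>M $ i $ l\<bar>)"
proof -
  have "norm M \<le> (\<Sum>i\<in>UNIV. norm (M $ i))" by (simp add: norm_vec_def L2_set_le_sum)
  also have "\<dots> \<le> (\<Sum>i\<in>UNIV. \<Sum>l\<in>UNIV. \<bar>M $ i $ l\<bar>)" by (intro sum_mono norm_le_l1_cart)
  finally show ?thesis by (simp add: sum.cartesian_product)
qed

text \<open>The four sequences of bounds combine the weights of rapid convergence with the constants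
  that arise when components are assembled into vectors and matrices. Those for \<open>pt\<close>
  refer to \<open>G (Suc n)\<close>, as in \<open>iteration\<close>.\<close>

locale converging_iteration =
  fixes T p pt P\<^sub>1 P\<^sub>2 :: real and G :: "nat \<Rightarrow> real" and \<Theta> :: "nat \<Rightarrow> real \<times> (real^'d) \<Rightarrow> real"
    and U RR :: "nat \<Rightarrow> 'd \<Rightarrow> real \<times> (real^'d) \<Rightarrow> real" and e\<^sub>1 e\<^sub>2 e\<^sub>3 e\<^sub>4 :: "nat \<Rightarrow> real"
  assumes T: "0 < T" and p: "1 < p" and pt: "1 < pt" and it: "iteration T p pt P\<^sub>1 P\<^sub>2 G \<Theta> U RR"
    and e1: "\<And>n. (2 ^ Suc n) powr p * (P\<^sub>1 * G n) \<le> e\<^sub>1 n" "summable e\<^sub>1"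
    and e2: "\<And>n. (2 ^ Suc n) powr (hconj p) * (real CARD('d) powr (hconj p) * (real CARD('d) * (P\<^sub>2 * G n))) \<le> e\<^sub>2 n" "summable e\<^sub>2"
    and e3: "\<And>n. (2 ^ Suc n) powr pt * (real CARD('d) powr pt * (real CARD('d) * G (Suc n))) \<le> e\<^sub>3 n" "summable e\<^sub>3"
    and e4: "\<And>n. (2 ^ Suc n) powr pt * (real (CARD('d) * CARD('d)) powr pt * (real (CARD('d) * CARD('d)) * G (Suc n))) \<le> e\<^sub>4 n" "summable e\<^sub>4"
    and G0: "G \<longlonglongrightarrow> 0"
begin

definition Uv :: "nat \<Rightarrow> real \<times> (real^'d) \<Rightarrow> real^'d" where "Uv n z = (\<chi> i. U n i z)"
definition DU :: "nat \<Rightarrow> real \<times> (real^'d) \<Rightarrow> real^'d^'d" where "DU n z = (\<chi> i l. Dx l (U n i) z)"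
definition lim\<theta> :: "real \<Rightarrow> real^'d \<Rightarrow> real" where "lim\<theta> t x = lim (\<lambda>n. \<Theta> n (t, x))"
definition limu :: "real \<Rightarrow> real^'d \<Rightarrow> real^'d" where "limu t x = lim (\<lambda>n. Uv n (t, x))"
definition limDu :: "real \<Rightarrow> real^'d \<Rightarrow> real^'d^'d" where "limDu t x = lim (\<lambda>n. DU n (t, x))"

lemma sol: "solves T (\<Theta> n) (U n) (RR n)" and RG: "t \<in> {0..T} \<Longrightarrow> integral cell (\<lambda>x. \<bar>RR n i (t, x)\<bar>) \<le> G n"
  and sb: "t \<in> {0..T} \<Longrightarrow> step_bound T p pt (P\<^sub>1 * G n) (P\<^sub>2 * G n) (G (Suc n)) t (\<lambda>z. \<Theta> (Suc n) z - \<Theta> n z) (\<lambda>i z. U (Suc n) i z - U n i z)"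
  and van: "t \<in> {0..T} \<Longrightarrow> (\<forall>x i. RR 0 i (t, x) = 0) \<Longrightarrow> \<Theta> n (t, x) = \<Theta> 0 (t, x) \<and> U n i (t, x) = U 0 i (t, x)"
  using it[unfolded iteration_def, rule_format, of n] by blast+

lemma s\<Theta>: "smooth (\<Theta> n)" and sU: "smooth (U n i)" and sR: "smooth (RR n i)" using sol[of n] by (auto simp: solves_def)

lemma cUv: "continuous_on S (Uv n)" unfolding Uv_def[abs_def] by (intro continuous_intros smooth_continuous_on sU)
lemma cDU: "continuous_on S (DU n)" unfolding DU_def[abs_def] by (intro continuous_intros smooth_continuous_on smooth_ddir sU ex_Basis)

lemma rapid_\<Theta>: "rapid T p e\<^sub>1 \<Theta>"
  unfolding rapid_def
proof (intro conjI allI ballI)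
  fix n t assume t: "t \<in> {0..T}"
  have "integral cell (\<lambda>x. norm (\<Theta> (Suc n) (t, x) - \<Theta> n (t, x)) powr p) \<le> P\<^sub>1 * G n" using sb[OF t, of n] by (simp add: step_bound_def)
  then have "(2 ^ Suc n) powr p * integral cell (\<lambda>x. norm (\<Theta> (Suc n) (t, x) - \<Theta> n (t, x)) powr p) \<le> (2 ^ Suc n) powr p * (P\<^sub>1 * G n)"
    by (intro mult_left_mono) auto
  then show "(2 ^ Suc n) powr p * integral cell (\<lambda>x. norm (\<Theta> (Suc n) (t, x) - \<Theta> n (t, x)) powr p) \<le> e\<^sub>1 n" using e1(1)[of n] by linarith
qed (use p e1 s\<Theta> in \<open>auto intro: smooth_continuous_on\<close>)

text \<open>Used with two exponents for the same sequence. As \<open>limu\<close> is a pointwise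
  limit, the limits in L^p' and in L^pt agree by definition.\<close>

lemma rapid_Uv_gen:
  assumes r: "0 < r" and b: "\<And>n t i. t \<in> {0..T} \<Longrightarrow> integral cell (\<lambda>x. \<bar>U (Suc n) i (t, x) - U n i (t, x)\<bar> powr r) \<le> C n"
    and e: "\<And>n. (2 ^ Suc n) powr r * (real CARD('d) powr r * (real CARD('d) * C n)) \<le> e n" "summable e"
  shows "rapid T r e Uv"
  unfolding rapid_def
proof (intro conjI allI ballI)
  fix n t assume t: "t \<in> {0..T}"
  have cs: "continuous_on UNIV (\<lambda>x. Uv n (t, x))" for n by (rule continuous_on_compose2[OF cUv[of UNIV]]) (auto intro!: continuous_intros)
  have "integral cell (\<lambda>x. norm (Uv (Suc n) (t, x) - Uv n (t, x)) powr r) \<le> real (card (UNIV :: 'd set)) powr r * (real (card (UNIV :: 'd set)) * C n)"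
  proof (rule integral_norm_powr_le[where f="\<lambda>i x. U (Suc n) i (t, x) - U n i (t, x)"])
    show "norm (Uv (Suc n) (t, x) - Uv n (t, x)) \<le> (\<Sum>i\<in>UNIV. \<bar>U (Suc n) i (t, x) - U n i (t, x)\<bar>)" for x
      using norm_le_l1_cart[of "Uv (Suc n) (t, x) - Uv n (t, x)"] by (simp add: Uv_def)
  qed (use r b t in \<open>auto intro!: continuous_on_diff cs slice_cont[OF sU]\<close>)
  then have "(2 ^ Suc n) powr r * integral cell (\<lambda>x. norm (Uv (Suc n) (t, x) - Uv n (t, x)) powr r)
     \<le> (2 ^ Suc n) powr r * (real CARD('d) powr r * (real CARD('d) * C n))" by (intro mult_left_mono) auto
  then show "(2 ^ Suc n) powr r * integral cell (\<lambda>x. norm (Uv (Suc n) (t, x) - Uv n (t, x)) powr r) \<le> e n" using e(1)[of n] by linarith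
qed (use r e cUv in auto)

lemma rapid_Uv: "rapid T (hconj p) e\<^sub>2 Uv"
  by (rule rapid_Uv_gen[where C="\<lambda>n. P\<^sub>2 * G n"]) (use hconj_props(1)[OF p] sb e2 in \<open>auto simp: step_bound_def\<close>)

lemma rapid_Uv_pt: "rapid T pt e\<^sub>3 Uv"
  by (rule rapid_Uv_gen[where C="\<lambda>n. G (Suc n)"]) (use pt sb e3 in \<open>auto simp: step_bound_def\<close>)

lemma rapid_DU: "rapid T pt e\<^sub>4 DU"
  unfolding rapid_def
proof (intro conjI allI ballI)
  fix n t assume t: "t \<in> {0..T}"
  have cs: "continuous_on UNIV (\<lambda>x. DU n (t, x))" for n by (rule continuous_on_compose2[OF cDU[of UNIV]]) (auto intro!: continuous_intros)
  have D: "Dx l (\<lambda>z. U (Suc n) i z - U n i z) (t, x) = Dx l (U (Suc n) i) (t, x) - Dx l (U n i) (t, x)" for l i x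
    by (rule ddir_diff[OF sU sU])
  have "integral cell (\<lambda>x. norm (DU (Suc n) (t, x) - DU n (t, x)) powr pt)
     \<le> real (card (UNIV \<times> UNIV :: ('d \<times> 'd) set)) powr pt * (real (card (UNIV \<times> UNIV :: ('d \<times> 'd) set)) * G (Suc n))"
  proof (rule integral_norm_powr_le[where f="\<lambda>(i, l) x. Dx l (U (Suc n) i) (t, x) - Dx l (U n i) (t, x)"])
    show "norm (DU (Suc n) (t, x) - DU n (t, x)) \<le> (\<Sum>il\<in>UNIV \<times> UNIV. \<bar>(case il of (i, l) \<Rightarrow> \<lambda>x. Dx l (U (Suc n) i) (t, x) - Dx l (U n i) (t, x)) x\<bar>)" for x
      using norm_matrix_le[of "DU (Suc n) (t, x) - DU n (t, x)"] by (simp add: DU_def case_prod_beta)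
    fix il :: "'d \<times> 'd"
    obtain i l where il: "il = (i, l)" by force
    show "continuous_on UNIV ((\<lambda>(i, l) x. Dx l (U (Suc n) i) (t, x) - Dx l (U n i) (t, x)) il)"
      by (simp add: il) (intro continuous_intros slice_cont smooth_ddir sU ex_Basis)
    show "integral cell (\<lambda>x. \<bar>(case il of (i, l) \<Rightarrow> \<lambda>x. Dx l (U (Suc n) i) (t, x) - Dx l (U n i) (t, x)) x\<bar> powr pt) \<le> G (Suc n)"
      using sb[OF t, of n] by (simp add: step_bound_def D il)
  qed (use pt in \<open>auto intro!: continuous_on_diff cs\<close>)
  then have "(2 ^ Suc n) powr pt * integral cell (\<lambda>x. norm (DU (Suc n) (t, x) - DU n (t, x)) powr pt)
     \<le> (2 ^ Suc n) powr pt * (real (CARD('d) * CARD('d)) powr pt * (real (CARD('d) * CARD('d)) * G (Suc n)))"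
    by (intro mult_left_mono) (auto simp: card_cartesian_product)
  then show "(2 ^ Suc n) powr pt * integral cell (\<lambda>x. norm (DU (Suc n) (t, x) - DU n (t, x)) powr pt) \<le> e\<^sub>4 n" using e4(1)[of n] by linarith
qed (use pt e4 cDU in auto)

text \<open>The sequences at a point and at its translate coincide term by term, so
  \<open>lim\<close> returns the same value even where they diverge.\<close>

lemma lim_periodic: assumes t: "t \<in> {0..T}" shows "periodic (lim\<theta> t)" "periodic (limu t)"
proof -
  have "per_at 1 t (\<Theta> n)" "per_at 1 t (U n i)" for n i using sol[of n] t by (auto simp: solves_def)
  then show "periodic (lim\<theta> t)" "periodic (limu t)" by (simp_all add: periodic_def per_at_def lim\<theta>_def limu_def Uv_def)
qed

lemma lim_C: "C_Lp T p lim\<theta>" "C_Lp T (hconj p) limu"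
  using rapidD(1)[OF rapid_\<Theta>] rapidD(1)[OF rapid_Uv] by (simp_all add: lim\<theta>_def[abs_def] limu_def[abs_def])

lemma tint_slice: "continuous_on UNIV f \<Longrightarrow> tint f = integral cell f" for f :: "real^'d \<Rightarrow> real"
  using tint_eq_integral(1)[of f] continuous_on_subset by blast

lemma at_point: "uniform_limit {0..T} f g sequentially \<Longrightarrow> t \<in> {0..T} \<Longrightarrow> (\<lambda>n. f n t) \<longlonglongrightarrow> g t" for f :: "nat \<Rightarrow> real \<Rightarrow> real"
  by (rule tendsto_uniform_limitI)

text \<open>Integration by parts holds at each stage and both sides converge. The axis vectors in
  the pairings select component \<open>i\<close> of the velocity and entry \<open>(i, l)\<close> of
  its gradient.\<close>

lemma lim_weak_pd: assumes t: "t \<in> {0..T}" shows "weak_pd l (\<lambda>x. limu t x $ i) (\<lambda>x. limDu t x $ i $ l)"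
  unfolding weak_pd_def
proof (intro allI impI)
  fix \<phi> :: "real^'d \<Rightarrow> real" assume phi: "test_fun \<phi>"
  have sphi: "smooth \<phi>" and pphi: "periodic \<phi>" using phi by (auto simp: test_fun_def)
  have cphi: "continuous_on UNIV \<phi>" "continuous_on UNIV (pd \<phi> l)"
    unfolding pd_eq_ddir by (intro smooth_continuous_on smooth_ddir sphi; simp)+
  have 1: "(\<lambda>n. tint (\<lambda>x. Uv n (t, x) \<bullet> (pd \<phi> l x *\<^sub>R axis i 1))) \<longlonglongrightarrow> tint (\<lambda>x. limu t x \<bullet> (pd \<phi> l x *\<^sub>R axis i 1))"
    using at_point[OF uniform_limit_rapid_single(1)[OF pt rapid_Uv_pt continuous_on_scaleR[OF cphi(2) continuous_on_const]] t]
    by (simp add: limu_def)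
  have 2: "(\<lambda>n. tint (\<lambda>x. DU n (t, x) \<bullet> (\<phi> x *\<^sub>R axis i (axis l 1)))) \<longlonglongrightarrow> tint (\<lambda>x. limDu t x \<bullet> (\<phi> x *\<^sub>R axis i (axis l 1)))"
    using at_point[OF uniform_limit_rapid_single(1)[OF pt rapid_DU continuous_on_scaleR[OF cphi(1) continuous_on_const]] t]
    by (simp add: limDu_def)
  have "tint (\<lambda>x. Uv n (t, x) \<bullet> (pd \<phi> l x *\<^sub>R axis i 1)) = - tint (\<lambda>x. DU n (t, x) \<bullet> (\<phi> x *\<^sub>R axis i (axis l 1)))" for n
  proof -
    define g where "g z = \<phi> (snd z)" for z :: "real \<times> (real^'d)"
    have sg: "smooth g" unfolding g_def[abs_def] by (rule smooth_snd[OF sphi])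
    have pg: "per_at 1 t g" using pphi by (simp add: per_at_def g_def periodic_def)
    have Dg: "Dx l g (t, x) = pd \<phi> l x" for x
      unfolding g_def[abs_def] using ddir_eqI[OF ddir_snd[OF sphi]] by (simp add: pd_eq_ddir)
    have pU: "per_at 1 t (U n i)" using sol[of n] t by (auto simp: solves_def)
    have "integral cell (\<lambda>x. U n i (t, x) * pd \<phi> l x) = - integral cell (\<lambda>x. Dx l (U n i) (t, x) * \<phi> x)"
      using integral_by_parts[OF sU pU sg pg, of l] by (simp add: Dg g_def)
    moreover have "tint (\<lambda>x. U n i (t, x) * pd \<phi> l x) = integral cell (\<lambda>x. U n i (t, x) * pd \<phi> l x)"
      "tint (\<lambda>x. Dx l (U n i) (t, x) * \<phi> x) = integral cell (\<lambda>x. Dx l (U n i) (t, x) * \<phi> x)"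
      by (intro tint_slice continuous_intros cphi slice_cont smooth_ddir sU ex_Basis)+
    ultimately show ?thesis by (simp add: Uv_def DU_def inner_axis mult.commute)
  qed
  with tendsto_minus[OF 2] have "(\<lambda>n. tint (\<lambda>x. Uv n (t, x) \<bullet> (pd \<phi> l x *\<^sub>R axis i 1))) \<longlonglongrightarrow> - tint (\<lambda>x. limDu t x \<bullet> (\<phi> x *\<^sub>R axis i (axis l 1)))" by simp
  from LIMSEQ_unique[OF 1 this] show "tint (\<lambda>x. limu t x $ i * pd \<phi> l x) = - tint (\<lambda>x. limDu t x $ i $ l * \<phi> x)"
    by (simp add: inner_axis mult.commute)
qed

lemma lim_C_W1p: "C_W1p T pt limu"
  unfolding C_W1p_def
proof (intro exI[of _ limDu] conjI ballI allI)
  show "C_Lp T pt limu" "C_Lp T pt limDu"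
    using rapidD(1)[OF rapid_Uv_pt] rapidD(1)[OF rapid_DU] by (simp_all add: limu_def[abs_def] limDu_def[abs_def])
qed (rule lim_weak_pd)

text \<open>\<open>AA n\<close> is the rate of change of the tested density at stage
  \<open>n\<close>, and by the equation it is the tested right-hand side plus a defect term. It
  converges uniformly in time, which allows passing to the limit under the time integral.\<close>

lemma lim_weak_solution: "weak_solution T lim\<theta> limu"
  unfolding weak_solution_def
proof (intro allI impI ballI conjI)
  fix \<phi> :: "real^'d \<Rightarrow> real" and t assume phi: "test_fun \<phi>" and t: "t \<in> {0..T}"
  have sphi: "smooth \<phi>" using phi by (auto simp: test_fun_def)
  have cpd: "continuous_on UNIV (pd \<phi> i)" "continuous_on UNIV (pd (pd \<phi> i) i)" for i
    unfolding pd_eq_ddir by (intro smooth_continuous_on smooth_ddir sphi; simp)+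
  have cphi: "continuous_on UNIV \<phi>" by (rule smooth_continuous_on[OF sphi])
  have cgrad: "continuous_on UNIV (grad \<phi>)" unfolding grad_def[abs_def] by (intro continuous_intros cpd)
  define \<psi> where "\<psi> x = lap \<phi> x - \<phi> x / 2" for x
  have cpsi: "continuous_on UNIV \<psi>" unfolding \<psi>_def[abs_def] lap_def[abs_def] by (intro continuous_intros cpd cphi) auto
  have ug: "Uv n z \<bullet> grad \<phi> x = (\<Sum>i\<in>UNIV. U n i z * pd \<phi> i x)" for n z x
    by (simp add: inner_vec_def Uv_def grad_def)
  have cug: "continuous_on UNIV (\<lambda>x. Uv n (s, x) \<bullet> grad \<phi> x)" for n s
    unfolding ug by (intro continuous_intros slice_cont sU cpd)

  have "(\<lambda>n. tint (\<lambda>x. Uv n (t, x) \<bullet> grad \<phi> x)) \<longlonglongrightarrow> tint (\<lambda>x. limu t x \<bullet> grad \<phi> x)"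
    using at_point[OF uniform_limit_rapid_single(1)[OF pt rapid_Uv_pt cgrad] t] by (simp add: limu_def)
  moreover have "tint (\<lambda>x. Uv n (t, x) \<bullet> grad \<phi> x) = 0" for n
  proof -
    have "tint (\<lambda>x. Uv n (t, x) \<bullet> grad \<phi> x) = integral cell (\<lambda>x. \<Sum>i\<in>UNIV. U n i (t, x) * pd \<phi> i x)"
      unfolding tint_slice[OF cug] by (simp add: ug)
    also have "\<dots> = (\<Sum>i\<in>UNIV. integral cell (\<lambda>x. U n i (t, x) * pd \<phi> i x))"
      by (rule Henstock_Kurzweil_Integration.integral_sum) (auto intro!: integrable_cell continuous_intros slice_cont sU cpd)
    finally show ?thesis using solves_weak_rate(2)[OF sol t phi] by simp
  qed
  ultimately show "tint (\<lambda>x. limu t x \<bullet> grad \<phi> x) = 0" using LIMSEQ_unique tendsto_const by (metis (no_types, lifting) ext)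

  define A where "A s = tint (\<lambda>x. lim\<theta> s x * (limu s x \<bullet> grad \<phi> x)) + tint (\<lambda>x. lim\<theta> s x \<bullet> \<psi> x)" for s
  define AA where "AA n s = integral cell (\<lambda>x. Dt (\<Theta> n) (s, x) * \<phi> x)" for n s
  have ul1: "uniform_limit {0..T} (\<lambda>n s. tint (\<lambda>x. \<Theta> n (s, x) * (Uv n (s, x) \<bullet> grad \<phi> x))) (\<lambda>s. tint (\<lambda>x. lim\<theta> s x * (limu s x \<bullet> grad \<phi> x))) sequentially"
    using uniform_limit_rapid(1)[OF p rapid_\<Theta> rapid_Uv cgrad] by (simp add: lim\<theta>_def limu_def)
  have ul2: "uniform_limit {0..T} (\<lambda>n s. tint (\<lambda>x. \<Theta> n (s, x) \<bullet> \<psi> x)) (\<lambda>s. tint (\<lambda>x. lim\<theta> s x \<bullet> \<psi> x)) sequentially"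
    using uniform_limit_rapid_single(1)[OF p rapid_\<Theta> cpsi] by (simp add: lim\<theta>_def)
  \<comment> \<open>The L^1 size \<open>G n\<close> of the defect is paired with the bounded
    gradient of the test function.\<close>
  have ul3: "uniform_limit {0..T} (\<lambda>n s. \<Sum>i\<in>UNIV. integral cell (\<lambda>x. RR n i (s, x) * pd \<phi> i x)) (\<lambda>s. 0) sequentially"
  proof (rule uniform_limitI)
    fix \<epsilon> :: real assume eps: "0 < \<epsilon>"
    have "\<exists>C\<ge>0. \<forall>x\<in>cell. norm (grad \<phi> x) \<le> C"
    proof -
      have "compact (grad \<phi> ` cell)" by (intro compact_continuous_image continuous_on_subset[OF cgrad]) (auto simp: cell_def)
      then obtain C where "\<And>y. y \<in> grad \<phi> ` cell \<Longrightarrow> norm y \<le> C" using compact_imp_bounded bounded_iff by metis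
      then show ?thesis by (intro exI[of _ "max 0 C"]) (auto simp: le_max_iff_disj)
    qed
    then obtain C where C: "0 \<le> C" "\<And>x. x \<in> cell \<Longrightarrow> norm (grad \<phi> x) \<le> C" by blast
    have C': "\<bar>pd \<phi> i x\<bar> \<le> C" if "x \<in> cell" for i x
      using C(2)[OF that] component_le_norm_cart[of "grad \<phi> x" i] by (simp add: grad_def)
    have "(\<lambda>n. real CARD('d) * (G n * C)) \<longlonglongrightarrow> real CARD('d) * (0 * C)" by (intro tendsto_intros G0)
    then have "\<forall>\<^sub>F n in sequentially. real CARD('d) * (G n * C) < \<epsilon>" using eps by (intro order_tendstoD(2)[where y=0]) auto
    then show "\<forall>\<^sub>F n in sequentially. \<forall>s\<in>{0..T}. dist (\<Sum>i\<in>UNIV. integral cell (\<lambda>x. RR n i (s, x) * pd \<phi> i x)) 0 < \<epsilon>"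
    proof eventually_elim
      case (elim n)
      show ?case
      proof
        fix s assume s: "s \<in> {0..T}"
        have "\<bar>integral cell (\<lambda>x. RR n i (s, x) * pd \<phi> i x)\<bar> \<le> G n * C" for i
        proof -
          have "norm (integral cell (\<lambda>x. RR n i (s, x) * pd \<phi> i x)) \<le> integral cell (\<lambda>x. \<bar>RR n i (s, x)\<bar> * C)"
            using C' by (intro Henstock_Kurzweil_Integration.integral_norm_bound_integral integrable_cell continuous_intros slice_cont sR cpd)
              (auto simp: abs_mult intro!: mult_left_mono)
          also have "\<dots> = integral cell (\<lambda>x. \<bar>RR n i (s, x)\<bar>) * C" by simp
          also have "\<dots> \<le> G n * C" using RG[OF s] C by (intro mult_right_mono) auto
          finally show ?thesis by simp
        qed
        then have "\<bar>\<Sum>i\<in>UNIV. integral cell (\<lambda>x. RR n i (s, x) * pd \<phi> i x)\<bar> \<le> (\<Sum>i\<in>(UNIV::'d set). G n * C)"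
          by (intro order_trans[OF sum_abs] sum_mono)
        then show "dist (\<Sum>i\<in>UNIV. integral cell (\<lambda>x. RR n i (s, x) * pd \<phi> i x)) 0 < \<epsilon>" using elim by (simp add: dist_real_def)
      qed
    qed
  qed
  have AAeq: "AA n s = tint (\<lambda>x. \<Theta> n (s, x) * (Uv n (s, x) \<bullet> grad \<phi> x)) + tint (\<lambda>x. \<Theta> n (s, x) \<bullet> \<psi> x) - (\<Sum>i\<in>UNIV. integral cell (\<lambda>x. RR n i (s, x) * pd \<phi> i x))"
    if "s \<in> {0..T}" for n s
  proof -
    have "tint (\<lambda>x. \<Theta> n (s, x) * (Uv n (s, x) \<bullet> grad \<phi> x)) = integral cell (\<lambda>x. \<Theta> n (s, x) * (\<Sum>i\<in>UNIV. U n i (s, x) * pd \<phi> i x))"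
      unfolding ug by (intro tint_slice continuous_intros slice_cont s\<Theta> sU cpd)
    moreover have "tint (\<lambda>x. \<Theta> n (s, x) \<bullet> \<psi> x) = integral cell (\<lambda>x. \<Theta> n (s, x) * (lap \<phi> x - \<phi> x / 2))"
      unfolding \<psi>_def[symmetric] inner_real_def by (intro tint_slice continuous_intros slice_cont s\<Theta> cpsi)
    ultimately show ?thesis unfolding AA_def using solves_weak_rate(1)[OF sol that phi] by simp
  qed
  have "uniform_limit {0..T} (\<lambda>n s. tint (\<lambda>x. \<Theta> n (s, x) * (Uv n (s, x) \<bullet> grad \<phi> x)) + tint (\<lambda>x. \<Theta> n (s, x) \<bullet> \<psi> x) - (\<Sum>i\<in>UNIV. integral cell (\<lambda>x. RR n i (s, x) * pd \<phi> i x))) (\<lambda>s. A s - 0) sequentially"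
    unfolding A_def by (intro uniform_limit_intros ul1 ul2 ul3)
  then have ul: "uniform_limit {0..T} AA A sequentially"
    by (rule uniform_limit_cong'[THEN iffD1, rotated 2]) (auto simp: AAeq)
  have cAA: "continuous_on S (AA n)" for n S
    unfolding AA_def[abs_def] using integral_time_derivative(2)[OF s\<Theta> cphi] continuous_on_subset by blast
  have ult: "uniform_limit (cbox 0 t) AA A sequentially" by (rule uniform_limit_on_subset[OF ul]) (use t in auto)
  obtain I J where I: "\<And>n. (AA n has_integral I n) (cbox 0 t)" and J: "(A has_integral J) (cbox 0 t)" and IJ: "I \<longlonglongrightarrow> J"
    using uniform_limit_integral_cbox[OF ult cAA] by (metis trivial_limit_sequentially)
  have F: "(AA n has_integral integral cell (\<lambda>x. \<Theta> n (t, x) * \<phi> x) - integral cell (\<lambda>x. \<Theta> n (0, x) * \<phi> x)) {0..t}" for n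
    using t unfolding AA_def
    by (intro fundamental_theorem_of_calculus) (auto simp: has_real_derivative_iff_has_vector_derivative[symmetric] intro!: integral_time_derivative(1)[OF s\<Theta> cphi])
  have In: "I n = integral cell (\<lambda>x. \<Theta> n (t, x) * \<phi> x) - integral cell (\<lambda>x. \<Theta> n (0, x) * \<phi> x)" for n
    using has_integral_unique[OF I[of n]] F[of n] by simp
  have lim1: "(\<lambda>n. integral cell (\<lambda>x. \<Theta> n (s, x) * \<phi> x)) \<longlonglongrightarrow> tint (\<lambda>x. lim\<theta> s x * \<phi> x)" if s: "s \<in> {0..T}" for s
  proof -
    have "(\<lambda>n. tint (\<lambda>x. \<Theta> n (s, x) * \<phi> x)) \<longlonglongrightarrow> tint (\<lambda>x. lim\<theta> s x * \<phi> x)"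
      using at_point[OF uniform_limit_rapid_single(1)[OF p rapid_\<Theta> cphi] s] by (simp add: lim\<theta>_def)
    moreover have "tint (\<lambda>x. \<Theta> n (s, x) * \<phi> x) = integral cell (\<lambda>x. \<Theta> n (s, x) * \<phi> x)" for n
      by (intro tint_slice continuous_intros slice_cont s\<Theta> cphi)
    ultimately show ?thesis by simp
  qed
  have "I \<longlonglongrightarrow> tint (\<lambda>x. lim\<theta> t x * \<phi> x) - tint (\<lambda>x. lim\<theta> 0 x * \<phi> x)"
    unfolding In[abs_def] by (intro tendsto_diff lim1 t) (use T in auto)
  then have Jeq: "J = tint (\<lambda>x. lim\<theta> t x * \<phi> x) - tint (\<lambda>x. lim\<theta> 0 x * \<phi> x)" using IJ LIMSEQ_unique by blast
  have Aeq: "tint (\<lambda>x. lim\<theta> s x * (limu s x \<bullet> grad \<phi> x) - lim\<theta> s x * \<phi> x / 2 + lim\<theta> s x * lap \<phi> x) = A s" if s: "s \<in> {0..T}" for s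
  proof -
    have 1: "integrable (lebesgue_on cell) (\<lambda>x. lim\<theta> s x * (limu s x \<bullet> grad \<phi> x))"
      using uniform_limit_rapid(2)[OF p rapid_\<Theta> rapid_Uv cgrad s] by (simp add: lim\<theta>_def limu_def)
    have 2: "integrable (lebesgue_on cell) (\<lambda>x. lim\<theta> s x \<bullet> \<psi> x)"
      using uniform_limit_rapid_single(2)[OF p rapid_\<Theta> cpsi s] by (simp add: lim\<theta>_def)
    have "A s = tint (\<lambda>x. lim\<theta> s x * (limu s x \<bullet> grad \<phi> x) + lim\<theta> s x \<bullet> \<psi> x)"
      unfolding A_def tint_def by (rule Bochner_Integration.integral_add[OF 1 2, symmetric])
    then show ?thesis by (simp add: \<psi>_def algebra_simps)
  qed
  have cA: "continuous_on {0..t} A"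
    using uniform_limit_theorem[OF _ ult] cAA by (auto simp: always_eventually)
  have "integral\<^sup>L (lebesgue_on {0..t}) (\<lambda>s. tint (\<lambda>x. lim\<theta> s x * (limu s x \<bullet> grad \<phi> x) - lim\<theta> s x * \<phi> x / 2 + lim\<theta> s x * lap \<phi> x))
     = integral\<^sup>L (lebesgue_on {0..t}) A"
    by (rule Bochner_Integration.integral_cong) (use t Aeq in auto)
  also have "\<dots> = integral {0..t} A"
    by (rule lebesgue_integral_eq_integral[OF continuous_imp_integrable_real[OF cA]]) simp
  also have "\<dots> = J" using J by (auto dest: integral_unique)
  finally show "tint (\<lambda>x. lim\<theta> t x * \<phi> x) - tint (\<lambda>x. lim\<theta> 0 x * \<phi> x) =
      integral\<^sup>L (lebesgue_on {0..t}) (\<lambda>s. tint (\<lambda>x. lim\<theta> s x * (limu s x \<bullet> grad \<phi> x) - lim\<theta> s x * \<phi> x / 2 + lim\<theta> s x * lap \<phi> x))"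
    using Jeq by simp
qed

text \<open>At such a time every stage equals the first one, so the sequences under
  \<open>lim\<close> are constant.\<close>

lemma lim_fixed:
  assumes t: "t \<in> {0..T}" and z: "\<forall>x i. RR 0 i (t, x) = 0"
  shows "lim\<theta> t x = \<Theta> 0 (t, x)" "limu t x = Uv 0 (t, x)"
proof -
  have "(\<lambda>n. \<Theta> n (t, x)) = (\<lambda>n. \<Theta> 0 (t, x))" "(\<lambda>n. Uv n (t, x)) = (\<lambda>n. Uv 0 (t, x))"
    using van[OF t z] by (auto simp: Uv_def fun_eq_iff vec_eq_iff)
  then show "lim\<theta> t x = \<Theta> 0 (t, x)" "limu t x = Uv 0 (t, x)"
    by (simp_all only: lim\<theta>_def limu_def limI[OF tendsto_const])
qed

lemma lim_close:
  assumes t: "t \<in> {0..T}"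
  shows "tint (\<lambda>x. norm (lim\<theta> t x - \<Theta> 0 (t, x)) powr p) \<le> (\<Sum>k. e\<^sub>1 k)"
    "tint (\<lambda>x. norm (limu t x - Uv 0 (t, x)) powr (hconj p)) \<le> (\<Sum>k. e\<^sub>2 k)"
  using rapidD(4)[OF rapid_\<Theta> t, of 0] rapidD(4)[OF rapid_Uv t, of 0]
  by (simp_all add: lim\<theta>_def limu_def norm_minus_commute abs_minus_commute)

end

subsection \<open>The initial defect and the theorem\<close>

lemma smooth_component:
  fixes f :: "'a::euclidean_space \<Rightarrow> real^'d"
  assumes "smooth f"
  shows "smooth (\<lambda>z. f z $ i)"
proof -
  have "Ck n f \<Longrightarrow> Ck n (\<lambda>z. f z $ i)" for n and f :: "'a \<Rightarrow> real^'d"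
  proof (induction n arbitrary: f)
    case 0
    then show ?case by (auto intro!: continuous_intros)
  next
    case (Suc n)
    have "(f has_derivative frechet_derivative f (at z)) (at z)" for z
      using Suc.prems frechet_derivative_works[of f "at z"] by (auto simp: differentiable_on_def)
    then have "((\<lambda>z. f z $ i) has_derivative (\<lambda>v. frechet_derivative f (at z) v $ i)) (at z)" for z
      by (rule bounded_linear.has_derivative[OF bounded_linear_vec_nth])
    then show ?case by (rule Ck_SucI) (use Suc in auto)
  qed
  then show ?thesis using assms by (auto simp: smooth_def)
qed

text \<open>\<open>divg\<close> differentiates a vector field as a whole, while the construction
  differentiates scalar components; this matches the two.\<close>

lemma divg_slice:
  fixes c :: "'d \<Rightarrow> real \<times> (real^'d) \<Rightarrow> real"
  assumes "\<And>i. smooth (c i)"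
  shows "divg (\<lambda>y. \<chi> i. c i (t, y)) x = (\<Sum>i\<in>UNIV. Dx i (c i) (t, x))"
proof -
  have "((\<lambda>y. \<chi> i. c i (t, y)) has_derivative (\<lambda>h. \<chi> i. ddir (0, h) (c i) (t, x))) (at x)"
    by (rule has_derivative_componentwise_within[THEN iffD2])
       (auto simp: Basis_vec_def inner_axis intro!: slice_has_derivative assms)
  then have "frechet_derivative (\<lambda>y. \<chi> i. c i (t, y)) (at x) = (\<lambda>h. \<chi> i. ddir (0, h) (c i) (t, x))"
    by (rule frechet_derivative_at[symmetric])
  then show ?thesis by (simp add: divg_def pd_def)
qed

lemma pd_slice: "smooth f \<Longrightarrow> pd (\<lambda>x. f (t, x)) i = (\<lambda>x. Dx i f (t, x))" for f :: "real \<times> (real^'d) \<Rightarrow> real"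
  by (simp add: fun_eq_iff pd_eq_ddir ddir_slice)

lemma lap_slice: "smooth f \<Longrightarrow> lap (\<lambda>x. f (t, x)) x = (\<Sum>i\<in>UNIV. Dx i (Dx i f) (t, x))" for f :: "real \<times> (real^'d) \<Rightarrow> real"
  by (simp add: lap_def pd_slice smooth_ddir)

lemma integral_cell_Dx:
  fixes f :: "real \<times> (real^'d) \<Rightarrow> real"
  assumes "smooth f" "per_at 1 t f"
  shows "integral cell (\<lambda>x. Dx i f (t, x)) = 0"
  using integral_by_parts[of "\<lambda>z. 1" t f i] assms by (simp add: per_at_def)

text \<open>The residual of the equation has mean zero: the time derivative and the damping inherit
  the zero mean of \<open>\<theta>\<close>, and the other terms are derivatives of periodic
  functions. The antidivergence with period 1 of the residual is then a defect, and it vanishes at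
  each time at which the residual vanishes everywhere.\<close>

lemma initial_defect:
  fixes \<theta> :: "real \<times> (real^'d) \<Rightarrow> real" and u :: "'d \<Rightarrow> real \<times> (real^'d) \<Rightarrow> real"
  assumes T: "0 < T" and s: "smooth \<theta>" "\<And>i. smooth (u i)" and per: "\<And>t. t \<in> {0..T} \<Longrightarrow> per_at 1 t \<theta>" "\<And>t i. t \<in> {0..T} \<Longrightarrow> per_at 1 t (u i)"
    and div: "\<And>t x. t \<in> {0..T} \<Longrightarrow> (\<Sum>i\<in>UNIV. Dx i (u i) (t, x)) = 0" and mean: "\<And>t. t \<in> {0..T} \<Longrightarrow> integral cell (\<lambda>x. \<theta> (t, x)) = 0"
  obtains R where "solves T \<theta> u R"
    "\<And>t x i. (\<forall>x. Dt \<theta> (t, x) + (\<Sum>i\<in>UNIV. Dx i (\<lambda>z. u i z * \<theta> z) (t, x)) + \<theta> (t, x) / 2 - (\<Sum>i\<in>UNIV. Dx i (Dx i \<theta>) (t, x)) = 0) \<Longrightarrow> R i (t, x) = 0"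
proof -
  define E where "E z = Dt \<theta> z + (\<Sum>i\<in>UNIV. Dx i (\<lambda>z. u i z * \<theta> z) z) + \<theta> z / 2 - (\<Sum>i\<in>UNIV. Dx i (Dx i \<theta>) z)" for z
  have sut: "smooth (\<lambda>z. u i z * \<theta> z)" for i by (intro smooth_mult s)
  have sE: "smooth E" unfolding E_def[abs_def] by (intro smooth_add smooth_diff smooth_sum smooth_divide smooth_ddir sut s et_Basis ex_Basis)
  have put: "per_at 1 t (\<lambda>z. u i z * \<theta> z)" if "t \<in> {0..T}" for t i using per that by (simp add: per_at_def)
  have pE: "per_at 1 t E" if t: "t \<in> {0..T}" for t
    using per_at_Dt[OF s(1) per(1) T t] per_at_ddir[OF sut put[OF t]] per(1)[OF t] per_at_ddir[OF smooth_ddir[OF s(1)] per_at_ddir[OF s(1) per(1)[OF t]]]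
    by (simp add: per_at_def E_def)
  have cE: "continuous_on UNIV (\<lambda>x. Dt \<theta> (t, x))" "continuous_on UNIV (\<lambda>x. Dx i (\<lambda>z. u i z * \<theta> z) (t, x))" "continuous_on UNIV (\<lambda>x. \<theta> (t, x))" "continuous_on UNIV (\<lambda>x. Dx i (Dx i \<theta>) (t, x))" for t i
    by (intro slice_cont smooth_ddir sut s et_Basis ex_Basis)+
  have mE: "integral cell (\<lambda>x. E (t, x)) = 0" if t: "t \<in> {0..T}" for t
  proof -
    have "((\<lambda>t. integral cell (\<lambda>x. \<theta> (t, x) * 1)) has_real_derivative integral cell (\<lambda>x. Dt \<theta> (t, x) * 1)) (at t within {0..T})"
      by (rule integral_time_derivative[OF s(1) continuous_on_const])
    then have "((\<lambda>t. 0) has_real_derivative integral cell (\<lambda>x. Dt \<theta> (t, x))) (at t within {0..T})"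
      by (rule has_field_derivative_transform_within[OF _ zero_less_one t, THEN DERIV_cong]) (auto simp: mean)
    moreover have "((\<lambda>t. 0) has_real_derivative 0) (at t within {0..T})" by simp
    moreover have "at t within {0..T} \<noteq> bot" using t T by (simp add: trivial_limit_within islimpt_Icc)
    ultimately have 1: "integral cell (\<lambda>x. Dt \<theta> (t, x)) = 0"
      using vector_derivative_unique_within unfolding has_real_derivative_iff_has_vector_derivative by blast
    have 2: "integral cell (\<lambda>x. Dx i (\<lambda>z. u i z * \<theta> z) (t, x)) = 0" "integral cell (\<lambda>x. Dx i (Dx i \<theta>) (t, x)) = 0" for i
      by (rule integral_cell_Dx[OF sut put[OF t]], rule integral_cell_Dx[OF smooth_ddir[OF s(1) ex_Basis] per_at_ddir[OF s(1) per(1)[OF t]]])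
    have i: "(\<lambda>x. Dt \<theta> (t, x)) integrable_on cell" "(\<lambda>x. \<Sum>i\<in>UNIV. Dx i (\<lambda>z. u i z * \<theta> z) (t, x)) integrable_on cell"
        "(\<lambda>x. \<theta> (t, x) / 2) integrable_on cell" "(\<lambda>x. \<Sum>i\<in>UNIV. Dx i (Dx i \<theta>) (t, x)) integrable_on cell"
      by (intro integrable_cell continuous_intros cE; simp)+
    have "integral cell (\<lambda>x. E (t, x)) = integral cell (\<lambda>x. Dt \<theta> (t, x)) + integral cell (\<lambda>x. \<Sum>i\<in>UNIV. Dx i (\<lambda>z. u i z * \<theta> z) (t, x))
        + integral cell (\<lambda>x. \<theta> (t, x) / 2) - integral cell (\<lambda>x. \<Sum>i\<in>UNIV. Dx i (Dx i \<theta>) (t, x))"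
      unfolding E_def by (simp add: Henstock_Kurzweil_Integration.integral_diff Henstock_Kurzweil_Integration.integral_add integrable_add i)
    also have "integral cell (\<lambda>x. \<Sum>i\<in>UNIV. Dx i (\<lambda>z. u i z * \<theta> z) (t, x)) = 0"
      by (subst Henstock_Kurzweil_Integration.integral_sum) (auto intro!: integrable_cell cE simp: 2)
    also have "integral cell (\<lambda>x. \<Sum>i\<in>UNIV. Dx i (Dx i \<theta>) (t, x)) = 0"
      by (subst Henstock_Kurzweil_Integration.integral_sum) (auto intro!: integrable_cell cE simp: 2)
    finally show ?thesis using mean[OF t] 1 by simp
  qed
  define R where "R = adiv 1 coords E"
  have "solves T \<theta> u R"
    unfolding solves_def
  proof (intro conjI allI ballI s per div)
    show "smooth (R i)" for i unfolding R_def by (rule smooth_adiv[OF sE])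
    fix t assume t: "t \<in> {0..T}"
    show "per_at 1 t (R i)" for i unfolding R_def by (rule per_at_adiv[OF pE[OF t]])
    fix x
    have "(\<Sum>i\<in>UNIV. Dx i (R i) (t, x)) = E (t, x)"
      unfolding R_def using div_adiv[OF _ sE pE[OF t], of coords x] avg_list_eq_integral[OF _ _ sE pE[OF t] pE[OF t] coords(1), of x] mE[OF t] by simp
    then show "Dt \<theta> (t, x) + (\<Sum>i\<in>UNIV. Dx i (\<lambda>z. u i z * \<theta> z) (t, x)) + \<theta> (t, x) / 2 - (\<Sum>i\<in>UNIV. Dx i (Dx i \<theta>) (t, x)) = (\<Sum>i\<in>UNIV. Dx i (R i) (t, x))"
      by (simp add: E_def)
  qed
  moreover have "R i (t, x) = 0" if "\<forall>x. Dt \<theta> (t, x) + (\<Sum>i\<in>UNIV. Dx i (\<lambda>z. u i z * \<theta> z) (t, x)) + \<theta> (t, x) / 2 - (\<Sum>i\<in>UNIV. Dx i (Dx i \<theta>) (t, x)) = 0" for t x i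
    unfolding R_def using that by (intro adiv_zero) (simp add: E_def)
  ultimately show ?thesis using that by blast
qed

text \<open>Dividing by \<open>(2 ^ Suc n) powr \<Lambda>\<close> cancels the weights of rapid
  convergence for every exponent up to \<open>\<Lambda>\<close> and leaves 2^(-n). Index 0 is
  separate, since there the given initial defect has to be dominated.\<close>

definition rates :: "real \<Rightarrow> real \<Rightarrow> nat \<Rightarrow> real" where
  "rates G\<^sub>0 \<Lambda> n = (if n = 0 then G\<^sub>0 else (1 / 2) ^ n / (2 ^ Suc n) powr \<Lambda>)"

context
  fixes G\<^sub>0 \<Lambda> r c :: real assumes G0: "0 < G\<^sub>0" and r: "0 < r" "r \<le> \<Lambda>" and c: "0 \<le> c"
begin

lemma rates_pos: "0 < rates G\<^sub>0 \<Lambda> n" using G0 by (simp add: rates_def)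

text \<open>The free index \<open>m\<close> serves both conventions in use: weight and rate at the
  same stage, or the rate one stage ahead of the weight.\<close>

lemma rates_scaled: assumes "m \<le> Suc n" shows "(2 ^ Suc m) powr r * (c * rates G\<^sub>0 \<Lambda> (Suc n)) \<le> c * (1 / 2) ^ Suc n"
proof -
  have "(2 ^ Suc m) powr r \<le> (2 ^ Suc (Suc n)) powr r" using r assms by (intro powr_mono2 power_increasing) auto
  also have "\<dots> \<le> (2 ^ Suc (Suc n)) powr \<Lambda>" by (rule powr_mono[OF r(2) one_le_power]) simp
  finally have le: "(2 ^ Suc m) powr r \<le> (2 ^ Suc (Suc n)) powr \<Lambda>" .
  have "(2 ^ Suc m) powr r * (c * rates G\<^sub>0 \<Lambda> (Suc n)) = c * (1 / 2) ^ Suc n * ((2 ^ Suc m) powr r / (2 ^ Suc (Suc n)) powr \<Lambda>)"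
    by (simp add: rates_def)
  also have "\<dots> \<le> c * (1 / 2) ^ Suc n * 1"
    using le c by (intro mult_left_mono) (auto simp: divide_le_eq)
  finally show ?thesis by simp
qed

lemma rates_summable:
  "summable (\<lambda>n. (2 ^ Suc n) powr r * (c * rates G\<^sub>0 \<Lambda> n))"
  "(\<Sum>n. (2 ^ Suc n) powr r * (c * rates G\<^sub>0 \<Lambda> n)) \<le> c * (2 powr r * G\<^sub>0 + 1)"
  "summable (\<lambda>n. (2 ^ Suc n) powr r * (c * rates G\<^sub>0 \<Lambda> (Suc n)))"
proof -
  have s: "(\<lambda>n. c * (1 / 2) ^ Suc n) sums c" using sums_mult[OF power_half_series, of c] by simp
  have nn: "0 \<le> (2 ^ Suc m) powr r * (c * rates G\<^sub>0 \<Lambda> n)" for m n using c rates_pos[of n] by simp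
  show "summable (\<lambda>n. (2 ^ Suc n) powr r * (c * rates G\<^sub>0 \<Lambda> (Suc n)))"
    by (rule summable_comparison_test'[OF sums_summable[OF s]]) (use nn rates_scaled in auto)
  note le = rates_scaled[OF order_refl]
  have S: "summable (\<lambda>n. (2 ^ Suc (Suc n)) powr r * (c * rates G\<^sub>0 \<Lambda> (Suc n)))"
    by (rule summable_comparison_test'[OF sums_summable[OF s]]) (use nn[of "Suc _"] le in auto)
  then show S': "summable (\<lambda>n. (2 ^ Suc n) powr r * (c * rates G\<^sub>0 \<Lambda> n))"
    using summable_Suc_iff[of "\<lambda>n. (2 ^ Suc n) powr r * (c * rates G\<^sub>0 \<Lambda> n)"] by simp
  \<comment> \<open>The head is the term with the initial defect, the only one that is not small;
    all others together are at most \<open>c\<close>.\<close>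
  have "(\<Sum>n. (2 ^ Suc n) powr r * (c * rates G\<^sub>0 \<Lambda> n)) = (\<Sum>n. (2 ^ Suc (Suc n)) powr r * (c * rates G\<^sub>0 \<Lambda> (Suc n))) + (2 ^ Suc 0) powr r * (c * rates G\<^sub>0 \<Lambda> 0)"
    using suminf_split_head[OF S'] by simp
  also have "(\<Sum>n. (2 ^ Suc (Suc n)) powr r * (c * rates G\<^sub>0 \<Lambda> (Suc n))) \<le> (\<Sum>n. c * (1 / 2) ^ Suc n)"
    by (rule suminf_le[OF le S sums_summable[OF s]])
  also have "\<dots> = c" by (rule sums_unique[OF s, symmetric])
  finally show "(\<Sum>n. (2 ^ Suc n) powr r * (c * rates G\<^sub>0 \<Lambda> n)) \<le> c * (2 powr r * G\<^sub>0 + 1)"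
    by (simp add: rates_def algebra_simps)
qed

lemma rates_lim: "rates G\<^sub>0 \<Lambda> \<longlonglongrightarrow> 0"
proof (rule Lim_null_comparison)
  show "(\<lambda>n. (1 / 2 :: real) ^ n) \<longlonglongrightarrow> 0" by (rule LIMSEQ_power_zero) simp
  have "norm (rates G\<^sub>0 \<Lambda> n) \<le> (1 / 2) ^ n" if "n \<ge> 1" for n
  proof -
    have "1 \<le> ((2::real) ^ Suc n) powr \<Lambda>" using r by (intro ge_one_powr_ge_zero one_le_power) auto
    then have "(1 / 2) ^ n / (2 ^ Suc n) powr \<Lambda> \<le> (1 / 2 :: real) ^ n / 1" by (intro divide_left_mono) auto
    then show ?thesis using that rates_pos[of n] by (simp add: rates_def)
  qed
  then show "\<forall>\<^sub>F n in sequentially. norm (rates G\<^sub>0 \<Lambda> n) \<le> (1 / 2) ^ n" by (auto simp: eventually_sequentially)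
qed

end

lemma Lp_norm_less:
  assumes r: "0 < r" and eps: "0 < \<epsilon>" and b: "tint (\<lambda>x. norm (f x) powr r) < \<epsilon> powr r"
  shows "Lp_norm r f < \<epsilon>"
proof -
  have "0 \<le> tint (\<lambda>x. norm (f x) powr r)" unfolding tint_def by (rule Bochner_Integration.integral_nonneg) simp
  then have "tint (\<lambda>x. norm (f x) powr r) powr (1 / r) < (\<epsilon> powr r) powr (1 / r)" using b r by (intro powr_less_mono2) auto
  then show ?thesis using r eps by (simp add: Lp_norm_def powr_powr)
qed

text \<open>\<open>\<eta>\<close> shifts size between the two unknowns: the bounds on all increments
  carry the factor \<open>\<eta> powr p\<close> or \<open>\<eta> powr (- hconj p)\<close>, while the
  rates depend on the data and the exponents. Hence the constants can precede
  \<open>\<eta>\<close>.\<close>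

lemma quantitative_solution:
  fixes \<theta>b :: "real \<Rightarrow> real^'d \<Rightarrow> real" and ub :: "real \<Rightarrow> real^'d \<Rightarrow> real^'d" and T p pt :: real
  assumes d3: "CARD('d) \<ge> 3" and T: "T > 0"
    and s\<theta>: "smooth (\<lambda>z. \<theta>b (fst z) (snd z))" and p\<theta>: "\<forall>t\<in>{0..T}. periodic (\<theta>b t)"
    and mean: "\<forall>t\<in>{0..T}. tint (\<theta>b t) = 0"
    and su: "smooth (\<lambda>z. ub (fst z) (snd z))" and pu: "\<forall>t\<in>{0..T}. periodic (ub t)"
    and div: "\<forall>t\<in>{0..T}. \<forall>x. divg (ub t) x = 0"
    and p: "p > 1" and pt: "pt > 1"
    and pp: "1 / p + 1 / pt > 1 + 1 / real CARD('d)" and pd: "hconj p < real CARD('d)"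
  shows "\<exists>C\<^sub>1>0. \<exists>C\<^sub>2>0. \<forall>\<eta>>0. \<exists>\<theta> u. good_pair T p pt \<theta>b ub \<theta> u \<and>
     (\<forall>t\<in>{0..T}. tint (\<lambda>x. norm (\<theta> t x - \<theta>b t x) powr p) \<le> C\<^sub>1 * \<eta> powr p \<and>
        tint (\<lambda>x. norm (u t x - ub t x) powr (hconj p)) \<le> C\<^sub>2 * \<eta> powr (- hconj p))"
proof -
  define \<theta>0 where "\<theta>0 z = \<theta>b (fst z) (snd z)" for z
  define u0 where "u0 i z = ub (fst z) (snd z) $ i" for i z
  have s0: "smooth \<theta>0" "smooth (u0 i)" for i
    using s\<theta> smooth_component[OF su] by (auto simp: \<theta>0_def[abs_def] u0_def[abs_def])
  have per0: "per_at 1 t \<theta>0" "per_at 1 t (u0 i)" if "t \<in> {0..T}" for t i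
    using p\<theta> pu that by (auto simp: per_at_def periodic_def \<theta>0_def u0_def)
  have ub_eq: "ub t = (\<lambda>y. \<chi> i. u0 i (t, y))" for t by (simp add: fun_eq_iff u0_def vec_eq_iff)
  have \<theta>b_eq: "\<theta>b t = (\<lambda>y. \<theta>0 (t, y))" for t by (simp add: \<theta>0_def)
  have div0: "(\<Sum>i\<in>UNIV. Dx i (u0 i) (t, x)) = 0" if "t \<in> {0..T}" for t x
    using div that divg_slice[of u0 t x, OF s0(2)] by (simp add: ub_eq[symmetric])
  have mean0: "integral cell (\<lambda>x. \<theta>0 (t, x)) = 0" if "t \<in> {0..T}" for t
    using mean that tint_eq_integral(1)[OF slice_cont[OF s0(1), of cell t]] by (simp add: \<theta>b_eq)
  obtain R0 where sol0: "solves T \<theta>0 u0 R0" and van0: "\<And>t x i. (\<forall>x. Dt \<theta>0 (t, x) + (\<Sum>i\<in>UNIV. Dx i (\<lambda>z. u0 i z * \<theta>0 z) (t, x)) + \<theta>0 (t, x) / 2 - (\<Sum>i\<in>UNIV. Dx i (Dx i \<theta>0) (t, x)) = 0) \<Longrightarrow> R0 i (t, x) = 0"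
    by (rule initial_defect[where u=u0 and \<theta>=\<theta>0, OF T s0 per0 div0 mean0]) (assumption+, rule that, assumption, blast)
  have R0E: "\<forall>x i. R0 i (t, x) = 0" if tE: "t \<in> Eset T \<theta>b ub" for t
  proof (intro allI van0)
    fix x
    have "((\<lambda>r. \<theta>0 ((0, x) + r *\<^sub>R et)) has_real_derivative Dt \<theta>0 ((0, x) + t *\<^sub>R et)) (at t)"
      by (rule seg_has_field_derivative[OF s0(1)])
    then have 1: "deriv (\<lambda>s. \<theta>b s x) t = Dt \<theta>0 (t, x)" by (simp add: DERIV_imp_deriv \<theta>0_def)
    have "(\<lambda>y. \<theta>b t y *\<^sub>R ub t y) = (\<lambda>y. \<chi> i. (\<lambda>z. u0 i z * \<theta>0 z) (t, y))"
      by (simp add: fun_eq_iff vec_eq_iff u0_def \<theta>0_def)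
    then have 2: "divg (\<lambda>y. \<theta>b t y *\<^sub>R ub t y) x = (\<Sum>i\<in>UNIV. Dx i (\<lambda>z. u0 i z * \<theta>0 z) (t, x))"
      using divg_slice[of "\<lambda>i z. u0 i z * \<theta>0 z" t x] by (simp add: smooth_mult s0)
    have 3: "lap (\<theta>b t) x = (\<Sum>i\<in>UNIV. Dx i (Dx i \<theta>0) (t, x))" unfolding \<theta>b_eq by (rule lap_slice[OF s0(1)])
    show "Dt \<theta>0 (t, x) + (\<Sum>i\<in>UNIV. Dx i (\<lambda>z. u0 i z * \<theta>0 z) (t, x)) + \<theta>0 (t, x) / 2 - (\<Sum>i\<in>UNIV. Dx i (Dx i \<theta>0) (t, x)) = 0"
      using tE unfolding Eset_def 1[symmetric] 2[symmetric] 3[symmetric] by (simp add: \<theta>0_def)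
  qed
  have "\<exists>C\<ge>0. \<forall>F\<in>range R0. \<forall>t\<in>{0..T}. \<forall>x\<in>cell. \<bar>F (t, x)\<bar> \<le> C"
    by (rule bounded_on_slab_finite) (use sol0 in \<open>auto simp: solves_def\<close>)
  then obtain C where C: "0 \<le> C" "\<And>t x i. t \<in> {0..T} \<Longrightarrow> x \<in> cell \<Longrightarrow> \<bar>R0 i (t, x)\<bar> \<le> C" by blast
  \<comment> \<open>The summand 1 makes the bound positive even if the initial defect is
    zero.\<close>
  define G0 where "G0 = C + 1"
  have G0: "0 < G0" using C by (simp add: G0_def)
  have RG0: "\<forall>t\<in>{0..T}. \<forall>i. integral cell (\<lambda>x. \<bar>R0 i (t, x)\<bar>) \<le> G0"
  proof (intro ballI allI)
    fix t i assume t: "t \<in> {0..T}"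
    have "integral cell (\<lambda>x. \<bar>R0 i (t, x)\<bar>) \<le> integral (cell :: (real^'d) set) (\<lambda>x. C)"
      using C(2)[OF t] sol0 by (intro integral_cell_le continuous_intros slice_cont) (auto simp: solves_def)
    then show "integral cell (\<lambda>x. \<bar>R0 i (t, x)\<bar>) \<le> G0" by (simp add: G0_def)
  qed
  obtain M where M: "0 < M" and H: "\<forall>T \<theta> u (R :: 'd \<Rightarrow> real \<times> (real^'d) \<Rightarrow> real) \<eta> G. 0 < T \<longrightarrow> solves T \<theta> u R \<longrightarrow> 0 < \<eta> \<longrightarrow> (\<forall>n. 0 < G n) \<longrightarrow>
      (\<forall>t\<in>{0..T}. \<forall>i. integral cell (\<lambda>x. \<bar>R i (t, x)\<bar>) \<le> G 0) \<longrightarrow>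
      (\<exists>\<Theta> U RR. \<Theta> 0 = \<theta> \<and> U 0 = u \<and> RR 0 = R \<and> iteration T p pt (M * \<eta> powr p) (M * \<eta> powr (- hconj p)) G \<Theta> U RR)"
    using iterate[OF p pt pp pd] d3 by auto
  define d where "d = real CARD('d)"
  have d0: "0 < d" using d3 by (simp add: d_def)
  define q where "q = hconj p"
  have q1: "1 < q" using hconj_props[OF p] by (simp add: q_def)
  \<comment> \<open>The largest exponent in use, so that one sequence of rates serves L^p, L^p' and
    W^(1,pt).\<close>
  define \<Lambda> where "\<Lambda> = max p (max q pt)"
  have Lam: "p \<le> \<Lambda>" "q \<le> \<Lambda>" "pt \<le> \<Lambda>" by (auto simp: \<Lambda>_def)
  define G where "G = rates G0 \<Lambda>"
  have p0: "0 < p" "0 < q" "0 < pt" using p q1 pt by auto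
  have Gpos: "0 < G n" for n unfolding G_def by (rule rates_pos[OF G0 p0(1) Lam(1), of 1]) simp
  have G00: "G 0 = G0" by (simp add: G_def rates_def)
  show ?thesis
  proof (rule exI[of _ "M * (2 powr p * G0 + 1)"], rule conjI, (use M G0 in \<open>simp add: add_pos_pos\<close>),
         rule exI[of _ "d powr q * (d * M) * (2 powr q * G0 + 1)"], rule conjI, (use M G0 d0 in \<open>simp add: add_pos_pos\<close>), intro allI impI)
    fix \<eta> :: real assume eta: "0 < \<eta>"
    obtain \<Theta> U RR where init: "\<Theta> 0 = \<theta>0" "U 0 = u0" "RR 0 = R0" and it: "iteration T p pt (M * \<eta> powr p) (M * \<eta> powr (- hconj p)) G \<Theta> U RR"
      using H[rule_format, OF T sol0 eta, of G] Gpos RG0 G00 by auto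
    define P1 where "P1 = M * \<eta> powr p"
    define P2 where "P2 = d powr q * (d * (M * \<eta> powr (- q)))"
    have P0: "0 \<le> P1" "0 \<le> P2" "0 \<le> d powr pt * d" "0 \<le> (d * d) powr pt * (d * d)" using M d0 by (auto simp: P1_def P2_def)
    note r1 = rates_summable[OF G0 p0(1) Lam(1) P0(1), folded G_def] and r2 = rates_summable[OF G0 p0(2) Lam(2) P0(2), folded G_def]
      and r3 = rates_summable[OF G0 p0(3) Lam(3) P0(3), folded G_def] and r4 = rates_summable[OF G0 p0(3) Lam(3) P0(4), folded G_def]
    interpret L: converging_iteration T p pt "M * \<eta> powr p" "M * \<eta> powr (- hconj p)" G \<Theta> U RR
      "\<lambda>n. (2 ^ Suc n) powr p * (P1 * G n)" "\<lambda>n. (2 ^ Suc n) powr q * (P2 * G n)"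
      "\<lambda>n. (2 ^ Suc n) powr pt * ((d powr pt * d) * G (Suc n))" "\<lambda>n. (2 ^ Suc n) powr pt * (((d * d) powr pt * (d * d)) * G (Suc n))"
    proof
      show "G \<longlonglongrightarrow> 0" unfolding G_def by (rule rates_lim[OF G0 p0(1) Lam(1) P0(1)])
    qed (use T p pt it r1 r2 r3 r4 in \<open>auto simp: P1_def P2_def d_def q_def mult_ac\<close>)
    have Uv0: "L.Uv 0 (t, x) = ub t x" and Th0: "\<Theta> 0 (t, x) = \<theta>b t x" for t x
      by (simp_all add: L.Uv_def init u0_def \<theta>0_def vec_eq_iff)
    have "good_pair T p pt \<theta>b ub L.lim\<theta> L.limu"
      unfolding good_pair_def
    proof (intro conjI ballI allI L.lim_periodic L.lim_C L.lim_C_W1p L.lim_weak_solution)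
      fix t x assume tE: "t \<in> Eset T \<theta>b ub"
      then have t: "t \<in> {0..T}" by (simp add: Eset_def)
      show "L.lim\<theta> t x = \<theta>b t x" "L.limu t x = ub t x"
        using L.lim_fixed[OF t, unfolded init, OF R0E[OF tE], of x] Uv0 Th0 by (auto simp: init)
    qed auto
    moreover have "tint (\<lambda>x. norm (L.lim\<theta> t x - \<theta>b t x) powr p) \<le> M * (2 powr p * G0 + 1) * \<eta> powr p \<and>
        tint (\<lambda>x. norm (L.limu t x - ub t x) powr (hconj p)) \<le> d powr q * (d * M) * (2 powr q * G0 + 1) * \<eta> powr (- hconj p)" if t: "t \<in> {0..T}" for t
      using L.lim_close[OF t] r1(2) r2(2) unfolding Uv0 Th0 by (simp add: P1_def P2_def q_def mult_ac)
    ultimately show "\<exists>\<theta> u. good_pair T p pt \<theta>b ub \<theta> u \<and>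
     (\<forall>t\<in>{0..T}. tint (\<lambda>x. norm (\<theta> t x - \<theta>b t x) powr p) \<le> M * (2 powr p * G0 + 1) * \<eta> powr p \<and>
        tint (\<lambda>x. norm (u t x - ub t x) powr (hconj p)) \<le> d powr q * (d * M) * (2 powr q * G0 + 1) * \<eta> powr (- hconj p))"
      by blast
  qed
qed

theorem theorem7p1:
  fixes \<theta>b :: "real \<Rightarrow> real^'d \<Rightarrow> real" and ub :: "real \<Rightarrow> real^'d \<Rightarrow> real^'d"
    and \<epsilon> T p pt :: real
  assumes "CARD('d) \<ge> 3" and "\<epsilon> > 0" and "T > 0"
    and "smooth (\<lambda>z. \<theta>b (fst z) (snd z))" and "\<forall>t\<in>{0..T}. periodic (\<theta>b t)"
    and "\<forall>t\<in>{0..T}. tint (\<theta>b t) = 0"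
    and "smooth (\<lambda>z. ub (fst z) (snd z))" and "\<forall>t\<in>{0..T}. periodic (ub t)"
    and "\<forall>t\<in>{0..T}. \<forall>x. divg (ub t) x = 0"
    and "p > 1" and "pt > 1"
    and "1 / p + 1 / pt > 1 + 1 / real CARD('d)"
    and "hconj p < real CARD('d)"
  shows "(\<exists>\<theta> u. good_pair T p pt \<theta>b ub \<theta> u \<and>
             (\<forall>t\<in>{0..T}. Lp_norm p (\<lambda>x. \<theta> t x - \<theta>b t x) < \<epsilon>))
       \<and> (\<exists>\<theta> u. good_pair T p pt \<theta>b ub \<theta> u \<and>
             (\<forall>t\<in>{0..T}. Lp_norm (hconj p) (\<lambda>x. u t x - ub t x) < \<epsilon>))"
proof -
  note p = \<open>p > 1\<close> and eps = \<open>\<epsilon> > 0\<close>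
  define q where "q = hconj p"
  have q1: "1 < q" using hconj_props[OF p] by (simp add: q_def)
  obtain C1 C2 where C: "0 < C1" "0 < C2" and H: "\<And>\<eta>. 0 < \<eta> \<Longrightarrow> \<exists>\<theta> u. good_pair T p pt \<theta>b ub \<theta> u \<and>
     (\<forall>t\<in>{0..T}. tint (\<lambda>x. norm (\<theta> t x - \<theta>b t x) powr p) \<le> C1 * \<eta> powr p \<and>
        tint (\<lambda>x. norm (u t x - ub t x) powr q) \<le> C2 * \<eta> powr (- q))"
    using quantitative_solution[OF assms(1,3-13)] unfolding q_def by blast
  \<comment> \<open>\<open>y1\<close> and \<open>y2\<close> are the targets for the powers of
    \<open>\<eta>\<close> in the two bounds; with them the distances are at most half of
    \<open>\<epsilon> powr p\<close> and of \<open>\<epsilon> powr q\<close>, hence strictly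
    below.\<close>
  define y1 where "y1 = \<epsilon> powr p / (2 * C1)"
  define y2 where "y2 = \<epsilon> powr q / (2 * C2)"
  have y: "0 < y1" "0 < y2" using eps C by (auto simp: y1_def y2_def)
  have "(y1 powr (1 / p)) powr p = y1" "(y2 powr (- 1 / q)) powr (- q) = y2" using y p q1 by (simp_all add: powr_powr)
  then have small: "C1 * (y1 powr (1 / p)) powr p < \<epsilon> powr p" "C2 * (y2 powr (- 1 / q)) powr (- q) < \<epsilon> powr q"
    using C eps by (simp_all add: y1_def y2_def)
  have "0 < y1 powr (1 / p)" "0 < y2 powr (- 1 / q)" using y by auto
  with H obtain \<theta> u \<theta>' u' where good: "good_pair T p pt \<theta>b ub \<theta> u" "good_pair T p pt \<theta>b ub \<theta>' u'"
    and le: "\<And>t. t \<in> {0..T} \<Longrightarrow> tint (\<lambda>x. norm (\<theta> t x - \<theta>b t x) powr p) \<le> C1 * (y1 powr (1 / p)) powr p"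
      "\<And>t. t \<in> {0..T} \<Longrightarrow> tint (\<lambda>x. norm (u' t x - ub t x) powr q) \<le> C2 * (y2 powr (- 1 / q)) powr (- q)"
    by meson
  have "Lp_norm p (\<lambda>x. \<theta> t x - \<theta>b t x) < \<epsilon>" "Lp_norm q (\<lambda>x. u' t x - ub t x) < \<epsilon>" if "t \<in> {0..T}" for t
    using le[OF that] small p q1 eps by (auto intro!: Lp_norm_less)
  then show ?thesis using good unfolding q_def by blast
qed

end
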